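(* Let $(\nu^N)_{N\ge1}$ be probability measures on $\chi_R$ and $\rho_0:\mathbb R_+\to[0,1]$ continuous with $\int_0^\infty\rho_0(v)dv<\infty$, such that for every $\delta>0$ and every $g\in C_b(\mathbb R_+)$ which is constant on $[K,\infty)$ for some $K>0$, $$\lim_{N\to\infty}\nu^N\Big[\Big|\int_0^\infty g\,d\pi^N_0-\int_0^\infty g(v)\rho_0(v)dv\Big|>\delta\Big]=0.$$ Then the linear problem $$\partial_t\omega=\partial_u^2\omega+\beta\partial_u\omega\ (u\ge0),\quad \omega(0,u)=\exp\Big\{\beta\int_u^\infty\rho_0(v)dv\Big\},\quad 2\partial_u\omega(t,0)+\beta\omega(t,0)=0,\quad \omega(t,\infty)=1,$$ with $\beta=\pi/\sqrt{12}$, has a unique bounded weak solution $\omega$, and for every $T>0$, $K>0$, $\delta>0$, $$\lim_{N\to\infty}\bar{\mathbb Q}^N_{\nu^N}\Big[\sup_{0\le t\le T,\,0\le u\le K}|\tilde\zeta^N(t,u)-\omega(t,u)|>\delta\Big]=0.$$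
   Context: $\chi_R=\{\eta\in\{0,1\}^{\mathbb N}:\sum_x\eta(x)<\infty\}$. For $f:\chi_R\to\mathbb R$, $\bar L_{\varepsilon,R}f(\eta)=\sum_{x\in\mathbb N}[\varepsilon c_+(x,\eta)+c_-(x,\eta)](f(\eta^{x,x+1})-f(\eta))+[\varepsilon1_{\{\eta(1)=0\}}+1_{\{\eta(1)=1\}}](f(\eta^1)-f(\eta))$, where $c_+(x,\eta)=1_{\{\eta(x)=1,\eta(x+1)=0\}}$, $c_-(x,\eta)=1_{\{\eta(x)=0,\eta(x+1)=1\}}$, $\eta^{x,x+1}$ exchanges the values at $x,x+1$, and $\eta^1$ flips the value at site $1$. $\varepsilon(N)\in(0,1)$ is defined by $E_{\mu_R^{\varepsilon(N)}}[n(q)]=N^2$, where $\mu^\varepsilon_R(q)=\varepsilon^{n(q)}/\prod_{k\ge1}(1+\varepsilon^k)$ on partitions $q$ into distinct positive parts with $n(q)=\sum q_i$. $\bar{\mathbb Q}^N_\nu$ is the law on $D(\mathbb R_+,\chi_R)$ of the Markov process $\eta^N_t$ with generator $N^2\bar L_{\varepsilon(N),R}$ and initial law $\nu$. $\pi^N_t=\frac1N\sum_{x\in\mathbb N}\eta^N_t(x)\delta_{x/N}$. With $\varepsilon=\varepsilon(N)$, $\tilde\zeta^N(t,u)=\exp\big[-(\log\varepsilon)\{\sum_{y=[Nu]+1}^\infty\eta^N_t(y)+1_{\{u\ge1/N\}}([Nu]+1-Nu)\eta^N_t([Nu])\}\big]$, $u\ge0$. A bounded weak solution is a bounded measurable $\omega$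 with the given initial datum such that for every $t>0$, $\lim_{u\to\infty}\omega(t,u)=1$ and $\int_0^\infty g(u)\omega(t,u)du=\int_0^\infty g(u)\omega(0,u)du+\int_0^t\int_0^\infty(g''(u)-\beta g'(u))\omega(s,u)du\,ds$ for every $g\in C^2$ with compact support in $[0,\infty)$ satisfying $2g'(0)-\beta g(0)=0$. *)

theory Defs
  imports "HOL-Probability.Probability"
begin

text \<open>Configurations in chi_R: finite sets of occupied sites, sites are 1,2,3,...\<close>
definition chiR :: "nat set set" where
  "chiR = {\<eta>. finite \<eta> \<and> 0 \<notin> \<eta>}"

text \<open>Partitions into distinct positive parts = finite sets of positive naturals.\<close>
definition nsize :: "nat set \<Rightarrow> nat" where
  "nsize q = (\<Sum>i\<in>q. i)"

definition Zpart :: "real \<Rightarrow> real" where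
  "Zpart \<epsilon> = prodinf (\<lambda>k. 1 + \<epsilon> ^ Suc k)"

definition muR :: "real \<Rightarrow> nat set \<Rightarrow> real" where
  "muR \<epsilon> q = \<epsilon> ^ nsize q / Zpart \<epsilon>"

definition epsN :: "nat \<Rightarrow> real" where
  "epsN N = (THE \<epsilon>. 0 < \<epsilon> \<and> \<epsilon> < 1 \<and>
      infsum (\<lambda>q. real (nsize q) * muR \<epsilon> q) chiR = (real N)^2)"

definition beta :: real where
  "beta = pi / sqrt 12"

definition swap :: "nat \<Rightarrow> nat set \<Rightarrow> nat set" where
  "swap x \<eta> = {y. if y = x then Suc x \<in> \<eta> else if y = Suc x then x \<in> \<eta> else y \<in> \<eta>}"

definition flip1 :: "nat set \<Rightarrow> nat set" where
  "flip1 \<eta> = (if 1 \<in> \<eta> then \<eta> - {1} else insert 1 \<eta>)"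

definition cplus :: "nat \<Rightarrow> nat set \<Rightarrow> real" where
  "cplus x \<eta> = (if x \<in> \<eta> \<and> Suc x \<notin> \<eta> then 1 else 0)"

definition cminus :: "nat \<Rightarrow> nat set \<Rightarrow> real" where
  "cminus x \<eta> = (if x \<notin> \<eta> \<and> Suc x \<in> \<eta> then 1 else 0)"

definition genR :: "real \<Rightarrow> (nat set \<Rightarrow> real) \<Rightarrow> nat set \<Rightarrow> real" where
  "genR \<epsilon> f \<eta> =
     infsum (\<lambda>x. (\<epsilon> * cplus x \<eta> + cminus x \<eta>) * (f (swap x \<eta>) - f \<eta>)) {1..}
     + (if 1 \<notin> \<eta> then \<epsilon> else 1) * (f (flip1 \<eta>) - f \<eta>)"

definition cadlag_discrete :: "(real \<Rightarrow> 'a) \<Rightarrow> bool" where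
  "cadlag_discrete p \<longleftrightarrow>
     (\<forall>t\<ge>0. \<exists>e>0. \<forall>s. t \<le> s \<and> s < t + e \<longrightarrow> p s = p t) \<and>
     (\<forall>t>0. \<exists>e>0. \<exists>y. \<forall>s. t - e < s \<and> s < t \<longrightarrow> p s = y)"

text \<open>X is a cadlag chi_R-valued process on the probability space M with initial law nu
  solving the martingale problem for the generator G (tested on finitely supported f),
  i.e. X is (a realisation of) the Markov process with generator G and initial law nu.\<close>
definition solves_MP :: "'w measure \<Rightarrow> (real \<Rightarrow> 'w \<Rightarrow> nat set)
      \<Rightarrow> ((nat set \<Rightarrow> real) \<Rightarrow> nat set \<Rightarrow> real) \<Rightarrow> nat set pmf \<Rightarrow> bool" where
  "solves_MP M X G \<nu> \<longleftrightarrow> prob_space M \<and>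
     (\<forall>t\<ge>0. X t \<in> measurable M (count_space UNIV)) \<and>
     (\<forall>t\<ge>0. \<forall>\<xi>\<in>space M. X t \<xi> \<in> chiR) \<and>
     (\<forall>\<xi>\<in>space M. cadlag_discrete (\<lambda>t. X t \<xi>)) \<and>
     (\<forall>A. measure M {\<xi>\<in>space M. X 0 \<xi> \<in> A} = measure_pmf.prob \<nu> A) \<and>
     (\<forall>f::nat set \<Rightarrow> real. finite {\<eta>. f \<eta> \<noteq> 0} \<longrightarrow>
        (let Mf = (\<lambda>t \<xi>. f (X t \<xi>) - f (X 0 \<xi>) - (LBINT s:{0..t}. G f (X s \<xi>))) in
          (\<forall>t\<ge>0. integrable M (Mf t)) \<and>
          (\<forall>s t. 0 \<le> s \<and> s \<le> t \<longrightarrow>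
             (\<forall>A\<in>sigma_sets (space M)
                   {{\<xi>\<in>space M. X r \<xi> \<in> B} | r B. 0 \<le> r \<and> r \<le> s}.
                integral\<^sup>L M (\<lambda>\<xi>. indicator A \<xi> * (Mf t \<xi> - Mf s \<xi>)) = 0))))"

definition emp :: "nat \<Rightarrow> nat set \<Rightarrow> (real \<Rightarrow> real) \<Rightarrow> real" where
  "emp N \<eta> g = (1 / real N) * (\<Sum>x\<in>\<eta>. g (real x / real N))"

definition zeta :: "nat \<Rightarrow> real \<Rightarrow> nat set \<Rightarrow> real \<Rightarrow> real" where
  "zeta N \<epsilon> \<eta> u = exp (- ln \<epsilon> *
     (real (card {y\<in>\<eta>. y \<ge> nat \<lfloor>real N * u\<rfloor> + 1})
      + (if u \<ge> 1 / real N
         then (of_int \<lfloor>real N * u\<rfloor> + 1 - real N * u) *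
              (if nat \<lfloor>real N * u\<rfloor> \<in> \<eta> then 1 else 0)
         else 0)))"

definition w0 :: "(real \<Rightarrow> real) \<Rightarrow> real \<Rightarrow> real" where
  "w0 \<rho>0 u = exp (beta * (LBINT v:{u..}. \<rho>0 v))"

definition test_fun :: "real \<Rightarrow> (real \<Rightarrow> real) \<Rightarrow> (real \<Rightarrow> real) \<Rightarrow> (real \<Rightarrow> real) \<Rightarrow> bool" where
  "test_fun \<beta> g g' g'' \<longleftrightarrow>
     (\<forall>x. (g has_real_derivative g' x) (at x)) \<and>
     (\<forall>x. (g' has_real_derivative g'' x) (at x)) \<and>
     continuous_on UNIV g'' \<and>
     (\<exists>K. \<forall>u\<ge>K. g u = 0) \<and>
     2 * g' 0 - \<beta> * g 0 = 0"

definition weak_sol :: "real \<Rightarrow> (real \<Rightarrow> real) \<Rightarrow> (real \<Rightarrow> real \<Rightarrow> real) \<Rightarrow> bool" where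
  "weak_sol \<beta> init \<omega> \<longleftrightarrow>
     set_borel_measurable borel ({0..} \<times> {0..}) (\<lambda>(t, u). \<omega> t u) \<and>
     (\<exists>C. \<forall>t\<ge>0. \<forall>u\<ge>0. \<bar>\<omega> t u\<bar> \<le> C) \<and>
     (\<forall>u\<ge>0. \<omega> 0 u = init u) \<and>
     (\<forall>t>0. ((\<lambda>u. \<omega> t u) \<longlongrightarrow> 1) at_top) \<and>
     (\<forall>g g' g''. test_fun \<beta> g g' g'' \<longrightarrow>
        (\<forall>t>0. (LBINT u:{0..}. g u * \<omega> t u) =
               (LBINT u:{0..}. g u * \<omega> 0 u)
               + (LBINT s:{0..t}. (LBINT u:{0..}. (g'' u - \<beta> * g' u) * \<omega> s u))))"

text \<open>Outer probability (coincides with the probability on measurable events).\<close>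
definition outer_prob :: "'w measure \<Rightarrow> 'w set \<Rightarrow> real" where
  "outer_prob M S = Inf {measure M A | A. A \<in> sets M \<and> S \<subseteq> A}"

end

theory Submission
  imports Defs "HOL-Real_Asymp.Real_Asymp"
begin

text \<open>
 The exponential of the height function turns the exclusion dynamics into a linear one: with
 \<open>hz eps eta x = eps powr (- card {y\<in>eta. x <= y})\<close> the generator acts on \<open>hz\<close> as a discrete
 Laplacian with drift, the boundary reservoir giving the Robin condition. Hence for every admissible
 test function the pairing with \<open>zeta\<close> satisfies the weak equation up to a martingale whose carre du
 champ is \<open>O(1/N)\<close>, and Doob's maximal inequality makes the error small uniformly in time. Positive test
 functions together with a Gronwall argument bound \<open>zeta\<close> a priori.

 The limit equation is treated by duality instead of compactness. After the factor \<open>exp (beta * u / 2)\<close>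
 is removed it becomes the heat equation with Neumann condition and killing rate \<open>beta\<^sup>2 / 4\<close>. Testing against
 iterated symmetric averages of an even bump gives an explicit stability estimate from finitely many test
 functions; it yields uniqueness of weak solutions and, applied to the difference of \<open>zeta\<close> and the solution,
 convergence. Existence comes from the Gaussian formula for the Neumann heat equation.
\<close>

section \<open>The asymptotics of epsN\<close>

text \<open>The martingale problem is granted only for finitely supported functions, while
  \<open>zeta\<close> grows exponentially in the number of particles and no moment of the initial
  law is controlled. Two truncations bridge the gap. A cutoff in \<open>nsize\<close>, which one
  move changes by at most one, extends the martingale property to bounded functions with bounded
  generator. And \<open>min Y b\<close> replaces the unbounded functional \<open>Y\<close>, with
  \<open>b\<close> so large that \<open>Y\<close> stays below \<open>b / 2\<close> with high
  probability, where the truncation is invisible. The argument for this needs a drift bounded by a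
  multiple of the functional itself; a signed test function g is therefore written as the difference
  of the positive functions g + h and h. The value of \<open>beta\<close> comes from
  \<open>mean_size (exp (- l))\<close> being asymptotic to pi^2 / (12 l^2): a mean size N^2 makes N
  l tend to pi / sqrt 12. The list of test functions in the stability estimate depends on the target
  and the accuracy but not on the solution, so only finitely many good events have to be
  intersected.\<close>

lemma chiR_UN: "chiR = (\<Union>n. Pow {1..n})"
proof
 show "chiR \<subseteq> (\<Union>n. Pow {1..n})"
 proof
  fix q assume q: "q \<in> chiR"
  hence "finite q" "0 \<notin> q" by (auto simp: chiR_def)
  hence "q \<subseteq> {1..Max q}"
   by (metis Max_ge atLeastAtMost_iff not_less_eq_eq One_nat_def subsetI le_0_eq)
  thus "q \<in> (\<Union>n. Pow {1..n})" by blast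
 qed
qed (auto simp: chiR_def intro: finite_subset)

text \<open>Subsets of {1..n+1} split according to whether they contain n+1, and adjoining n+1
  multiplies the weight by e^(n+1). This is Euler's product for distinct parts, cut at n.\<close>

lemma sum_Pow_weights:
 fixes e :: real
 shows "(\<Sum>q\<in>Pow {1..n}. e ^ nsize q) = (\<Prod>k=1..n. 1+e ^ k)"
proof (induction n)
 case 0
 thus ?case by (simp add: nsize_def)
next
 case (Suc n)
 have eq: "{1..Suc n} = insert (Suc n) {1..n}" by auto
 have ns: "nsize (insert (Suc n) q) = Suc n+nsize q" if "q \<in> Pow {1..n}" for q
  using that unfolding nsize_def by (subst sum.insert) (auto intro: finite_subset)
 have inj: "inj_on (insert (Suc n)) (Pow {1..n})"
  by (rule inj_onI) (metis Pow_iff Suc_n_not_le_n atLeastAtMost_iff insert_ident subsetD)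
 have "(\<Sum>q\<in>Pow {1..Suc n}. e ^ nsize q)
   = (\<Sum>q\<in>Pow {1..n}. e ^ nsize q)+(\<Sum>q\<in>insert (Suc n) ` Pow {1..n}. e ^ nsize q)"
  unfolding eq Pow_insert by (rule sum.union_disjoint) auto
 also have "(\<Sum>q\<in>insert (Suc n) ` Pow {1..n}. e ^ nsize q) = (\<Sum>q\<in>Pow {1..n}. e ^ Suc n * e ^ nsize q)"
  by (subst sum.reindex[OF inj]) (auto intro!: sum.cong simp: ns power_add)
 also have "... = e ^ Suc n*(\<Sum>q\<in>Pow {1..n}. e ^ nsize q)"
  by (simp add: sum_distrib_left)
 finally show ?case using Suc by (simp add: algebra_simps)
qed

lemma summable_index_power:
 fixes e :: real
 assumes "0 <= e" "e < 1"
 shows "summable (%n. real (Suc n) * e ^ Suc n)"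
 using geometric_deriv_sums[of e] assms summable_mult[of "%n. real (Suc n) * e ^ n" e]
 by (auto simp: sums_iff mult_ac)

text \<open>Nonnegative weights are summable once finite sums are bounded, and every finite family
  of partitions lies in some \<open>Pow {1..Suc n}\<close>, whose total weight is a partial product
  of \<open>Zpart\<close>.\<close>

lemma has_sum_partition_function:
 assumes e: "0 < e" "e < 1"
 shows "((%q. e ^ nsize q) has_sum Zpart e) chiR"
proof -
 let ?w = "%q. e ^ nsize q"
 let ?P = "%n. \<Prod>i\<le>n. 1+e ^ Suc i"
 have sm: "summable (%k. \<bar>e ^ Suc k\<bar>)"
  using e by (simp add: summable_mult summable_geometric)
 have "convergent_prod (%k. 1+e ^ Suc k)"
  by (rule summable_imp_convergent_prod_real[OF sm])
   (use e in \<open>smt (verit) zero_less_power\<close>)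
 hence lim: "?P \<longlonglongrightarrow> Zpart e"
  unfolding Zpart_def by (rule convergent_prod_LIMSEQ)
 have S: "sum ?w (Pow {1..Suc n}) = ?P n" for n
  unfolding sum_Pow_weights
  by (simp add: prod.atLeast_Suc_atMost_Suc_shift atLeast0AtMost del: prod.cl_ivl_Suc)
 have "incseq ?P"
 proof (rule incseq_SucI)
  fix n
  have "0 <= ?P n" by (intro prod_nonneg) (use e in auto)
  hence "?P n*1 <= ?P n*(1+e ^ Suc (Suc n))" using e by (intro mult_left_mono) auto
  thus "?P n <= ?P (Suc n)" by simp
 qed
 hence le: "?P n <= Zpart e" for n using lim by (rule incseq_le)
 have bdd: "bdd_above (sum ?w ` {F. F \<subseteq> chiR & finite F})"
 proof (rule bdd_aboveI2)
  fix F assume F: "F \<in> {F. F \<subseteq> chiR & finite F}"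
  hence fin: "finite (\<Union>F)" by (auto simp: chiR_def)
  obtain n where n: "ALL x:\<Union>F. x <= n" using fin finite_nat_set_iff_bounded_le by auto
  have "q \<in> Pow {1..Suc n}" if "q \<in> F" for q
  proof -
   have "0 \<notin> q" using F that by (auto simp: chiR_def)
   thus ?thesis using n that by (force simp: Suc_le_eq intro: gr0I)
  qed
  hence "F \<subseteq> Pow {1..Suc n}" by blast
  moreover have "finite (Pow {1..Suc n})" by blast
  ultimately have "sum ?w F <= sum ?w (Pow {1..Suc n})"
   using e by (intro sum_mono2) simp_all
  thus "sum ?w F <= Zpart e" using S[of n] le[of n] by linarith
 qed
 have "?w summable_on chiR"
  by (rule nonneg_bdd_above_summable_on[OF _ bdd]) (use e in simp)
 then obtain s where s: "(?w has_sum s) chiR" by (auto simp: summable_on_def)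
 \<comment> \<open>These power sets are cofinal among the finite subsets of \<open>chiR\<close>, so
   the unordered sum is the limit along them.\<close>
 have "filterlim (%n. Pow {1..Suc n}) (finite_subsets_at_top chiR) sequentially"
  unfolding filterlim_finite_subsets_at_top
 proof safe
  fix F assume F: "finite F" "F \<subseteq> chiR"
  hence fin: "finite (\<Union>F)" by (auto simp: chiR_def)
  obtain n where n: "ALL x:\<Union>F. x <= n" using fin finite_nat_set_iff_bounded_le by auto
  have "F \<subseteq> Pow {1..Suc m}" if "n <= m" for m
  proof
   fix q assume "q \<in> F"
   hence "0 \<notin> q" using F by (auto simp: chiR_def)
   thus "q \<in> Pow {1..Suc m}" using n \<open>q \<in> F\<close> that by (force simp: Suc_le_eq intro: gr0I)
  qed
  thus "\<forall>\<^sub>F y in sequentially. finite (Pow {1..Suc y}) & F \<subseteq> Pow {1..Suc y} & Pow {1..Suc y} \<subseteq> chiR"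
   by (auto simp: eventually_sequentially chiR_UN intro!: exI[of _ n])
 qed
 hence "(%n. sum ?w (Pow {1..Suc n})) \<longlonglongrightarrow> s"
  using s unfolding has_sum_def by (rule filterlim_compose[rotated])
 hence "?P \<longlonglongrightarrow> s" unfolding S .
 hence "s = Zpart e" using lim LIMSEQ_unique by blast
 with s show ?thesis by simp
qed

lemma Zpart_pos:
 assumes e: "0 < e" "e < 1"
 shows "0 < Zpart e"
proof -
 have "(\<Sum>q\<in>{{}}. e ^ nsize q) <= Zpart e"
  by (rule has_sum_mono2[OF has_sum_finite has_sum_partition_function[OF e]]) (use e in \<open>auto simp: chiR_def\<close>)
 thus ?thesis by (simp add: nsize_def)
qed

text \<open>Adjoining k is a bijection from partitions without k to those with k and multiplies the
  weight by e^k, so the two classes share \<open>Zpart e\<close> in the ratio 1 : e^k.\<close>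

lemma has_sum_partitions_with_part:
 assumes e: "0 < e" "e < 1" and k: "k >= 1"
 shows "((%q. e ^ nsize q) has_sum (Zpart e*(e ^ k/(1+e ^ k)))) {q\<in>chiR. k \<in> q}"
proof -
 let ?w = "%q. e ^ nsize q"
 let ?A = "{q\<in>chiR. k \<notin> q}" and ?B = "{q\<in>chiR. k \<in> q}"
 have "?w summable_on ?A"
  by (rule summable_on_subset[of _ chiR]) (use has_sum_partition_function[OF e] in \<open>auto simp: summable_on_def\<close>)
 then obtain a where a: "(?w has_sum a) ?A" by (auto simp: summable_on_def)
 have inj: "inj_on (insert k) ?A" by (auto simp: inj_on_def)
 have im: "insert k ` ?A = ?B"
 proof
  show "?B \<subseteq> insert k ` ?A"
  proof
   fix q assume "q \<in> ?B"
   thus "q \<in> insert k ` ?A"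
    by (intro image_eqI[of _ _ "q-{k}"]) (auto simp: chiR_def)
  qed
 qed (use k in \<open>auto simp: chiR_def\<close>)
 have "((%q. e ^ k * ?w q) has_sum (e ^ k * a)) ?A"
  by (rule has_sum_cmult_right[OF a])
 also have "?this \<longleftrightarrow> (?w \<circ> insert k has_sum (e ^ k * a)) ?A"
  by (rule has_sum_cong) (auto simp: nsize_def chiR_def power_add)
 also have "... \<longleftrightarrow> (?w has_sum (e ^ k * a)) ?B"
  using has_sum_reindex[OF inj, of ?w] im by simp
 finally have b: "(?w has_sum (e ^ k * a)) ?B" .
 have "(?w has_sum (a+e ^ k * a)) (?A \<union> ?B)"
  by (rule has_sum_Un_disjoint[OF a b]) auto
 moreover have "?A \<union> ?B = chiR" by auto
 ultimately have "a+e ^ k * a = Zpart e"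
  using has_sum_partition_function[OF e] has_sum_unique by metis
 moreover have "1+e ^ k > 0" using e by (simp add: add_pos_pos)
 moreover have "a*(1+e ^ k)*(e ^ k/(1+e ^ k)) = e ^ k * a" if "1+e ^ k > 0"
  using that by (simp del: distrib_left_numeral add: mult.commute)
 ultimately have "e ^ k * a = Zpart e*(e ^ k/(1+e ^ k))" by (simp add: distrib_left mult.commute)
 with b show ?thesis by simp
qed

text \<open>Under \<open>muR e\<close> the number k is a part with probability e^k / (1 + e^k); this
  is the resulting mean of \<open>nsize\<close>.\<close>

definition mean_size :: "real => real" where
 "mean_size e = (\<Sum>n. real (Suc n) * e ^ Suc n/(1+e ^ Suc n))"

lemma summable_mean_size:
 assumes e: "0 <= e" "e < 1"
 shows "summable (%n. real (Suc n) * e ^ Suc n/(1+e ^ Suc n))"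
proof (rule summable_comparison_test'[OF summable_index_power[OF e], of 0])
 fix n
 have "real (Suc n) * e ^ Suc n/(1+e ^ Suc n) <= real (Suc n) * e ^ Suc n/1"
  by (rule divide_left_mono) (use e in \<open>auto intro!: add_pos_nonneg\<close>)
 moreover have "real (Suc n) * e ^ Suc n/(1+e ^ Suc n) >= 0" using e by simp
 ultimately show "norm (real (Suc n) * e ^ Suc n/(1+e ^ Suc n)) <= real (Suc n) * e ^ Suc n"
  by (simp only: real_norm_def abs_of_nonneg div_by_1)
qed

text \<open>Write \<open>nsize q\<close> as the sum of its parts and exchange the sum over
  partitions with the sum over parts; all terms are nonnegative.\<close>

lemma infsum_nsize_muR:
 assumes e: "0 < e" "e < 1"
 shows "infsum (%q. real (nsize q) * muR e q) chiR = mean_size e"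
proof -
 let ?w = "%q. e ^ nsize q" and ?Z = "Zpart e"
 let ?f = "%(n, q). real (Suc n) * ?w q"
 let ?B = "%n. {q\<in>chiR. Suc n \<in> q}" and ?C = "%q. {n. Suc n \<in> q}"
 let ?g = "%n. real (Suc n)*(?Z*(e ^ Suc n/(1+e ^ Suc n)))"
 have in1: "((%q. ?f (n, q)) has_sum ?g n) (?B n)" for n
  using has_sum_cmult_right[OF has_sum_partitions_with_part[OF e, of "Suc n"], of "real (Suc n)"] by simp
 have "(%n. ?Z*(real (Suc n) * e ^ Suc n/(1+e ^ Suc n))) sums (?Z * mean_size e)"
  unfolding mean_size_def by (rule sums_mult[OF summable_sums[OF summable_mean_size]]) (use e in auto)
 hence "?g sums (?Z * mean_size e)" by (simp add: mult_ac)
 hence g: "(?g has_sum (?Z * mean_size e)) UNIV"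
  by (rule sums_nonneg_imp_has_sum) (use e Zpart_pos[OF e] in \<open>auto simp: less_imp_le\<close>)
 have "?f summable_on Sigma UNIV ?B"
  by (rule summable_on_SigmaI[OF in1]) (use g e in \<open>auto simp: summable_on_def\<close>)
 hence F: "(?f has_sum (?Z * mean_size e)) (Sigma UNIV ?B)"
  by (rule has_sum_SigmaI[OF in1 g])
 have bij: "bij_betw (%(q, n). (n, q)) (Sigma chiR ?C) (Sigma UNIV ?B)"
  by (rule bij_betwI[of _ _ _ "%(n, q). (q, n)"]) auto
 have F': "((%(q, n). real (Suc n) * ?w q) has_sum (?Z * mean_size e)) (Sigma chiR ?C)"
  using has_sum_reindex_bij_betw[OF bij, of ?f] F by (simp add: case_prod_unfold)
 have "((%q. real (nsize q) * ?w q) has_sum (?Z * mean_size e)) chiR"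
 proof (rule has_sum_SigmaD[OF F'])
  fix q assume q: "q \<in> chiR"
  have b: "bij_betw Suc (?C q) q"
   by (rule bij_betwI[of _ _ _ "%n. n-1"])
    (use q in \<open>auto simp: chiR_def, (metis Suc_pred neq0_conv One_nat_def)+\<close>)
  hence fin: "finite (?C q)" using q bij_betw_finite chiR_def by blast
  have "(\<Sum>n\<in>?C q. real (Suc n)) = (\<Sum>i\<in>q. real i)"
   by (rule sum.reindex_bij_betw[OF b])
  hence "(\<Sum>n\<in>?C q. real (Suc n) * ?w q) = real (nsize q) * ?w q"
   unfolding sum_distrib_right[symmetric] by (simp add: nsize_def del: of_nat_Suc)
  thus "((%n. case (q, n) of (q, n) => real (Suc n) * ?w q) has_sum (real (nsize q) * ?w q)) (?C q)"
   using has_sum_finite[OF fin, of "%n. real (Suc n) * ?w q"] by simp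
 qed
 hence "((%q. (real (nsize q) * ?w q)*(1/?Z)) has_sum (?Z * mean_size e*(1/?Z))) chiR"
  by (rule has_sum_cmult_left)
 hence "((%q. real (nsize q) * muR e q) has_sum mean_size e) chiR"
  using Zpart_pos[OF e] by (simp add: muR_def)
 thus ?thesis by (rule infsumI)
qed

lemma mean_size_strict_mono:
 assumes e: "0 <= e" "e < e'" "e' < 1"
 shows "mean_size e < mean_size e'"
proof -
 let ?a = "%e n. real (Suc n) * e ^ Suc n/(1+e ^ Suc n)"
 have lt: "?a e n < ?a e' n" for n
 proof -
  have p: "e ^ Suc n < e' ^ Suc n" by (rule power_strict_mono) (use e in auto)
  have p0: "0 <= e ^ Suc n" using e by simp
  have "e ^ Suc n/(1+e ^ Suc n) < e' ^ Suc n/(1+e' ^ Suc n)"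
   using p p0 by (simp add: field_simps del: power_Suc)
  hence "real (Suc n)*(e ^ Suc n/(1+e ^ Suc n)) < real (Suc n)*(e' ^ Suc n/(1+e' ^ Suc n))"
   by (rule mult_strict_left_mono) simp
  thus ?thesis by simp
 qed
 have s: "summable (?a e)" "summable (?a e')"
  by (rule summable_mean_size, use e in simp, use e in simp)+
 have "0 < (\<Sum>n. ?a e' n-?a e n)"
  by (rule suminf_pos[OF summable_diff[OF s(2,1)]]) (use lt in simp)
 also have "... = mean_size e'-mean_size e"
  unfolding mean_size_def by (rule suminf_diff[OF s(2,1), symmetric])
 finally show ?thesis by simp
qed

lemma continuous_on_mean_size:
 assumes r: "0 <= r" "r < 1"
 shows "continuous_on {0..r} mean_size"
proof -
 let ?a = "%n e. real (Suc n) * e ^ Suc n/(1+e ^ Suc n) :: real"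
 have nz: "1+x ^ n ~= 0" if "x >= 0" for x :: real and n
  using that by (smt (verit) zero_le_power)
 have "uniform_limit {0..r} (%n x. \<Sum>i<n. ?a i x) (%x. \<Sum>i. ?a i x) sequentially"
 proof (rule Weierstrass_m_test[OF _ summable_index_power[OF r]])
  fix n x assume x: "x \<in> {0..r}"
  have "?a n x <= real (Suc n) * x ^ Suc n/1"
   by (rule divide_left_mono) (use x in \<open>auto intro!: add_pos_nonneg\<close>)
  also have "... <= real (Suc n) * r ^ Suc n"
   using x by (auto intro!: mult_left_mono power_mono simp del: power_Suc)
  finally show "norm (?a n x) <= real (Suc n) * r ^ Suc n"
   using x by (simp del: power_Suc of_nat_Suc)
 qed
 thus ?thesis unfolding mean_size_def[abs_def]
  by (rule uniform_limit_theorem[rotated])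
   (use nz in \<open>auto intro!: always_eventually continuous_intros simp del: power_Suc\<close>)
qed

text \<open>The generating function of the divisor sum sigma, as a Lambert series that exhibits the
  singularity at e = 1.\<close>

definition square_sum :: "real => real" where
 "square_sum e = (\<Sum>n. e ^ Suc n/(1-e ^ Suc n)^2)"

lemma power_Suc_less_one':
 fixes e :: real
 assumes "0 <= e" "e < 1"
 shows "0 <= e ^ Suc n" "e ^ Suc n < 1"  "e ^ Suc n <= e"
proof -
 show "0 <= e ^ Suc n" using assms by simp
 have "e ^ n <= 1" using assms by (simp add: power_le_one)
 thus "e ^ Suc n <= e" using assms by (simp add: mult_left_le)
 thus "e ^ Suc n < 1" using assms by linarith
qed

text \<open>Both series are iterated sums of (k+1) e^((k+1)(j+1)): a geometric series in j for fixed
  k, and the derivative of one in k for fixed j.\<close>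

lemma lambert_sums:
 assumes e: "0 <= e" "e < 1"
 shows "(%n. real (Suc n) * e ^ Suc n/(1-e ^ Suc n)) sums square_sum e"
  and "summable (%n. e ^ Suc n/(1-e ^ Suc n)^2)"
proof -
 note p = power_Suc_less_one'[OF e]
 let ?f = "%(k, j). real (Suc k)*(e ^ Suc k) ^ Suc j"
 let ?g = "%n. real (Suc n) * e ^ Suc n/(1-e ^ Suc n)"
 let ?h = "%n. e ^ Suc n/(1-e ^ Suc n)^2"
 have in1: "((%j. ?f (k, j)) has_sum ?g k) UNIV" for k
 proof -
  have "(%j. real (Suc k) * e ^ Suc k*(e ^ Suc k) ^ j) sums (real (Suc k) * e ^ Suc k*(1/(1-e ^ Suc k)))"
   by (intro sums_mult geometric_sums) (use p[of k] in auto)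
  hence "(%j. ?f (k, j)) sums ?g k" by (simp add: mult_ac)
  thus ?thesis by (rule sums_nonneg_imp_has_sum) (use e in auto)
 qed
 have gs: "summable ?g"
 proof (rule summable_comparison_test'[of "%n. real (Suc n) * e ^ Suc n/(1-e)" 0])
  show "summable (%n. real (Suc n) * e ^ Suc n/(1-e))"
   by (rule summable_divide[OF summable_index_power[OF e]])
  fix n
  have "?g n <= real (Suc n) * e ^ Suc n/(1-e)"
   by (rule divide_left_mono) (use e p[of n] in auto)
  moreover have "?g n >= 0" using p[of n] e by simp
  ultimately show "norm (?g n) <= real (Suc n) * e ^ Suc n/(1-e)"
   by (simp only: real_norm_def abs_of_nonneg)
 qed
 have g: "(?g has_sum suminf ?g) UNIV"
  by (rule sums_nonneg_imp_has_sum[OF summable_sums[OF gs]]) (use p e in \<open>simp add: less_imp_le del: power_Suc\<close>)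
 have sm: "?f summable_on UNIV \<times> UNIV"
  by (rule summable_on_SigmaI[OF in1]) (use g e in \<open>auto simp: summable_on_def\<close>)
 have F: "(?f has_sum suminf ?g) (UNIV \<times> UNIV)"
  by (rule has_sum_SigmaI[OF in1 g sm])
 hence F': "((%(j, k). real (Suc k)*(e ^ Suc k) ^ Suc j) has_sum suminf ?g) (UNIV \<times> UNIV)"
  by (subst (asm) has_sum_swap) (simp add: case_prod_unfold)
 have in2: "((%k. case (j, k) of (j, k) => real (Suc k)*(e ^ Suc k) ^ Suc j) has_sum ?h j) UNIV" for j
 proof -
  have pw: "(e ^ Suc k) ^ Suc j = (e ^ Suc j) ^ k * e ^ Suc j" for k
   by (metis mult.commute power_Suc power_mult)
  have "(%k. e ^ Suc j*(real (Suc k)*(e ^ Suc j) ^ k)) sums (e ^ Suc j*(1/(1-e ^ Suc j)^2))"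
   by (intro sums_mult geometric_deriv_sums) (use p[of j] in auto)
  hence "(%k. real (Suc k)*(e ^ Suc k) ^ Suc j) sums ?h j"
   unfolding pw by (simp add: mult_ac)
  thus ?thesis using e by (intro sums_nonneg_imp_has_sum) auto
 qed
 have "(?h has_sum suminf ?g) UNIV"
  by (rule has_sum_SigmaD[OF F' in2])
 hence h: "?h sums suminf ?g" by (rule has_sum_imp_sums)
 thus "summable ?h" by (simp add: sums_iff)
 from h have "square_sum e = suminf ?g" unfolding square_sum_def by (simp add: sums_iff)
 thus "?g sums square_sum e" using gs by (simp add: summable_sums)
qed

text \<open>The identity \<open>x / (1 + x) = x / (1 - x) - 2 x\<^sup>2 / (1 - x\<^sup>2)\<close> avoids alternating sums.\<close>
lemma mean_size_square_sum:
 assumes e: "0 <= e" "e < 1"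
 shows "mean_size e = square_sum e-2 * square_sum (e^2)"
proof -
 have e2: "0 <= e^2" "e^2 < 1" using e by (auto simp: power_less_one_iff abs_square_less_1)
 have "(%n. real (Suc n) * e ^ Suc n/(1-e ^ Suc n)
   -2*(real (Suc n)*(e^2) ^ Suc n/(1-(e^2) ^ Suc n))) sums (square_sum e-2 * square_sum (e^2))"
  by (intro sums_diff sums_mult lambert_sums e e2)
 moreover have "real (Suc n) * e ^ Suc n/(1-e ^ Suc n)
   -2*(real (Suc n)*(e^2) ^ Suc n/(1-(e^2) ^ Suc n)) = real (Suc n) * e ^ Suc n/(1+e ^ Suc n)" for n
 proof -
  define x where "x = e ^ Suc n"
  have x: "0 <= x" "x < 1" using power_Suc_less_one'[OF e] by (auto simp: x_def)
  have x2: "(e^2) ^ Suc n = x * x" unfolding x_def by (metis power_commutes power_mult power2_eq_square mult.commute)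
  have "1-x * x = (1-x)*(1+x)" by (simp add: algebra_simps)
  hence "x/(1-x)-2*(x * x/(1-x * x)) = x/(1+x)"
   using x by (simp add: divide_simps) (simp add: algebra_simps)
  hence "real (Suc n)*(x/(1-x)-2*(x * x/(1-x * x))) = real (Suc n)*(x/(1+x))" by simp
  thus ?thesis unfolding x2 x_def[symmetric] right_diff_distrib
   by (simp only: times_divide_eq_right mult.left_commute[of 2])
 qed
 ultimately show ?thesis unfolding mean_size_def by (simp add: sums_iff)
qed

text \<open>This is y <= 2 sinh (y/2), squared. It dominates the terms in the limit e -> 1 and also
  gives the crude bound \<open>mean_size_le\<close>.\<close>

lemma exp_quotient_le_1:
 fixes y :: real
 assumes y: "y > 0"
 shows "y\<^sup>2 * exp (- y)/(1-exp (- y))\<^sup>2 <= 1"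
proof -
 have "(%h. exp h-exp (- h)-2 * h) 0 <= (%h. exp h-exp (- h)-2 * h) (y/2)"
 proof (rule DERIV_nonneg_imp_nondecreasing[where f = "%h. exp h-exp (- h)-2 * h"])
  fix x :: real
  have "2 <= exp x+exp (- x)"
  proof -
   have "0 <= (exp (x/2)-exp (- x/2))\<^sup>2" by simp
   also have "... = exp x+exp (- x)-2"
   proof -
    have "exp (x/2) * exp (- x/2) = (1::real)" by (simp add: exp_add[symmetric])
    moreover have "(exp (x/2))^2 = exp x" "(exp (- x/2))\<^sup>2 = exp (- x)"
     by (simp_all add: exp_double[symmetric])
    ultimately show ?thesis by (simp add: power2_diff)
   qed
   finally show ?thesis by simp
  qed
  thus "EX z. ((%h. exp h-exp (- h)-2 * h) has_real_derivative z) (at x) & 0 <= z"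
   by (intro exI[of _ "exp x+exp (- x)-2"]) (auto intro!: derivative_eq_intros)
 qed (use y in simp)
 hence "y <= exp (y/2)-exp (- (y/2))" by simp
 hence "y * exp (- (y/2)) <= (exp (y/2)-exp (- (y/2))) * exp (- (y/2))"
  by (rule mult_right_mono) simp
 also have "... = 1-exp (- y)" by (simp add: left_diff_distrib exp_add[symmetric])
 finally have "(y * exp (- (y/2)))\<^sup>2 <= (1-exp (- y))\<^sup>2"
  using y by (intro power_mono) auto
 also have "(y * exp (- (y/2)))\<^sup>2 = y\<^sup>2 * exp (- y)"
  by (simp add: power_mult_distrib exp_double[symmetric])
 finally show ?thesis using y by (simp add: divide_simps)
qed

text \<open>For e = exp (- l) the n-th term times l^2 is q (l n) / n^2, where q <= 1 and q -> 1 at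
  0; Tannery's theorem leaves the Basel series.\<close>

lemma square_sum_asymp:
 "((%l. l\<^sup>2 * square_sum (exp (- l))) \<longlongrightarrow> pi\<^sup>2/6) (at_right 0)"
proof -
 let ?q = "%y::real. y\<^sup>2 * exp (- y)/(1-exp (- y))\<^sup>2"
 let ?a = "%n l. ?q (l * real (Suc n))/(real (Suc n))^2"
 have q: "(?q \<longlongrightarrow> 1) (at_right 0)" by real_asymp
 have lim: "((%l. ?a n l) \<longlongrightarrow> 1/(real (Suc n))^2) (at_right 0)" for n
 proof -
  have "filterlim (%l::real. l * real (Suc n)) (at_right 0) (at_right 0)"
   by (auto simp: filterlim_at intro!: tendsto_eq_intros simp del: of_nat_Suc)
    (auto simp: eventually_at_filter)
  hence "((%l. ?q (l * real (Suc n))) \<longlongrightarrow> 1) (at_right 0)"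
   by (rule filterlim_compose[OF q])
  thus ?thesis by (intro tendsto_divide tendsto_const) auto
 qed
 have ev: "eventually (%l::real. l > 0) (at_right 0)" by (simp add: eventually_at_right_less)
 have bd: "eventually (%(n, l). norm (?a n l) <= 1/(real (n+1))^2) (at_top \<times>\<^sub>F at_right 0)"
 proof -
  have "\<forall>\<^sub>F x in (at_top :: nat filter) \<times>\<^sub>F at_right (0::real). snd x > 0"
   using ev eventually_prod2[of "at_top :: nat filter" "%y. y > 0" "at_right (0::real)"]
   by (simp add: case_prod_unfold)
  thus ?thesis
  proof (rule eventually_mono)
   fix x :: "nat \<times> real" assume x: "snd x > 0"
   have "?q (snd x * real (Suc (fst x))) <= 1" by (rule exp_quotient_le_1) (use x in simp)
   hence "?a (fst x) (snd x) <= 1/(real (Suc (fst x)))^2"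
    by (rule divide_right_mono) simp
   moreover have "?a (fst x) (snd x) >= 0" by simp
   ultimately show "case x of (n, l) => norm (?a n l) <= 1/(real (n+1))^2"
    by (simp add: case_prod_unfold del: of_nat_Suc)
  qed
 qed
 have "((%l. \<Sum>n. ?a n l) \<longlongrightarrow> (\<Sum>n. 1/(real (Suc n))^2)) (at_right 0)"
  using tannerys_theorem[OF lim bd] inverse_squares_sums by (simp add: sums_iff)
 also have "(\<Sum>n. 1/(real (Suc n))^2) = pi^2/6"
  using inverse_squares_sums by (simp add: sums_iff)
 finally have T: "((%l. \<Sum>n. ?a n l) \<longlongrightarrow> pi^2/6) (at_right 0)" .
 have "(\<Sum>n. ?a n l) = l\<^sup>2 * square_sum (exp (- l))" if l: "l > 0" for l
 proof -
  have "?a n l = l\<^sup>2*(exp (- l) ^ Suc n/(1-exp (- l) ^ Suc n)\<^sup>2)" for n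
  proof -
   have "exp (- l) ^ Suc n = exp (- (l * real (Suc n)))"
    by (subst exp_of_nat_mult[symmetric]) (simp add: mult.commute)
   thus ?thesis by (simp add: power_mult_distrib del: power_Suc of_nat_Suc)
  qed
  moreover have "(\<Sum>n. l\<^sup>2*(exp (- l) ^ Suc n/(1-exp (- l) ^ Suc n)\<^sup>2)) = l\<^sup>2 * square_sum (exp (- l))"
   unfolding square_sum_def by (rule suminf_mult[OF lambert_sums(2)]) (use l in auto)
  ultimately show ?thesis by presburger
 qed
 hence "eventually (%l. (\<Sum>n. ?a n l) = l\<^sup>2 * square_sum (exp (- l))) (at_right 0)"
  using ev by (rule eventually_mono[rotated])
 from Lim_transform_eventually[OF T this] show ?thesis .
qed

text \<open>The term with doubled argument takes away half of the limit, since 2 l^2 = (2 l)^2 /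
  2.\<close>

lemma mean_size_asymp:
 "((%l. l\<^sup>2 * mean_size (exp (- l))) \<longlongrightarrow> pi\<^sup>2/12) (at_right 0)"
proof -
 have ev: "eventually (%l::real. l > 0) (at_right 0)" by (simp add: eventually_at_right_less)
 have "filterlim (%l::real. 2 * l) (at_right 0) (at_right 0)"
  by (auto simp: filterlim_at intro!: tendsto_eq_intros) (auto simp: eventually_at_filter)
 hence "((%l. (2 * l)\<^sup>2 * square_sum (exp (- (2 * l)))) \<longlongrightarrow> pi\<^sup>2/6) (at_right 0)"
  by (rule filterlim_compose[OF square_sum_asymp])
 hence "((%l. l\<^sup>2 * square_sum (exp (- l))-1/2*((2 * l)\<^sup>2 * square_sum (exp (- (2 * l))))) \<longlongrightarrow>
   pi\<^sup>2/6-1/2*(pi\<^sup>2/6)) (at_right 0)"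
  by (intro tendsto_diff tendsto_mult tendsto_const square_sum_asymp)
 moreover have "l\<^sup>2 * square_sum (exp (- l))-1/2*((2 * l)\<^sup>2 * square_sum (exp (- (2 * l))))
   = l\<^sup>2 * mean_size (exp (- l))" if "l > 0" for l
 proof -
  have "(exp (- l))\<^sup>2 = exp (- (2 * l))" by (simp add: exp_double[symmetric])
  hence "mean_size (exp (- l)) = square_sum (exp (- l))-2 * square_sum (exp (- (2 * l)))"
   using mean_size_square_sum[of "exp (- l)"] that by simp
  thus ?thesis by (simp only:) (simp add: algebra_simps power2_eq_square)
 qed
 ultimately show ?thesis
  using ev by (elim Lim_transform_eventually[rotated, OF eventually_mono]) auto
qed

lemma mean_size_le:
 assumes l: "l > 0"
 shows "mean_size (exp (- l)) <= 1/l\<^sup>2"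
proof -
 let ?e = "exp (- l)"
 have e: "0 <= ?e" "?e < 1" using l by auto
 have "(%n. ?e*(real (Suc n) * ?e ^ n)) sums (?e*(1/(1-?e)^2))"
  by (intro sums_mult geometric_deriv_sums) (use e in auto)
 hence s: "(%n. real (Suc n) * ?e ^ Suc n) sums (?e/(1-?e)^2)" by (simp add: mult_ac)
 have "mean_size ?e <= (\<Sum>n. real (Suc n) * ?e ^ Suc n)"
  unfolding mean_size_def
 proof (rule suminf_le[OF _ summable_mean_size summable_index_power])
  fix n
  have "real (Suc n) * ?e ^ Suc n/(1+?e ^ Suc n) <= real (Suc n) * ?e ^ Suc n/1"
   by (rule divide_left_mono) (auto intro!: add_pos_nonneg)
  thus "real (Suc n) * ?e ^ Suc n/(1+?e ^ Suc n) <= real (Suc n) * ?e ^ Suc n" by simp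
 qed (use e in auto)
 also have "... = ?e/(1-?e)^2" using s by (simp add: sums_iff)
 also have "... <= 1/l^2" using exp_quotient_le_1[OF l] l by (simp add: field_simps)
 finally show ?thesis .
qed

text \<open>The description in \<open>epsN\<close> is proper: uniqueness by strict monotonicity,
  existence by the intermediate value theorem between exp (- 1), where the mean size is at most 1,
  and a point so close to 1 that it exceeds N^2.\<close>

lemma epsN_works:
 assumes N: "N >= 1"
 shows "0 < epsN N & epsN N < 1 & mean_size (epsN N) = (real N)^2"
proof -
 \<comment> \<open>pi > 3 gives pi^2 / 12 > 3/4; the smaller 1/2 is still above the 1/4 obtained
   below from N l <= 1/2.\<close>
 have c: "pi^2/12 > (1/2::real)"
  using mult_strict_mono[OF pi_gt3 pi_gt3] by (simp add: power2_eq_square)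
 have "\<forall>\<^sub>F l in at_right 0. l\<^sup>2 * mean_size (exp (- l)) > 1/2 & l < 1/(2 * real N) & (0::real) < l"
  using order_tendstoD(1)[OF mean_size_asymp c] N
  by (auto simp: eventually_conj_iff eventually_at_right_less intro!: eventually_at_rightI)
 then obtain l :: real where l: "l\<^sup>2 * mean_size (exp (- l)) > 1/2" "l < 1/(2 * real N)" "0 < l"
  using eventually_happens by (metis (mono_tags, lifting) trivial_limit_at_right_real)
 have "1/(2 * real N) <= 1" using N by simp
 hence l1: "l < 1" using l by linarith
 have "real N * l <= 1/2" using l N by (simp add: field_simps)
 hence "(real N * l)^2 <= (1/2)^2" using l by (intro power_mono) auto
 hence "l^2*(real N)^2 <= 1/4" unfolding power_mult_distrib by (simp add: mult.commute power2_eq_square)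
 hence "l\<^sup>2*(real N)\<^sup>2 <= l\<^sup>2 * mean_size (exp (- l))" using l by linarith
 hence up: "(real N)\<^sup>2 <= mean_size (exp (- l))"
  by (rule mult_left_le_imp_le) (use l in simp)
 have lo: "mean_size (exp (- 1)) <= (real N)\<^sup>2" using mean_size_le[of 1] N
  by (smt (verit) of_nat_1 of_nat_mono one_le_power power_one div_by_1)
 have "continuous_on {exp (- 1)..exp (- l)} mean_size"
  by (rule continuous_on_subset[OF continuous_on_mean_size[of "exp (- l)"]]) (use l in \<open>auto intro: order_trans[OF exp_ge_zero]\<close>)
 then obtain e where e: "exp (- 1) <= e" "e <= exp (- l)" "mean_size e = (real N)^2"
  using IVT'[of mean_size "exp (- 1)" "(real N)^2" "exp (- l)"] lo up l1 by auto
 have e01: "0 < e" "e < 1" using e l by (smt (verit) exp_gt_zero exp_less_one_iff)+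
 have "\<exists>!e. 0 < e & e < 1 & infsum (%q. real (nsize q) * muR e q) chiR = (real N)^2"
 proof (rule ex1I[of _ e])
  fix e' assume h: "0 < e' & e' < 1 & infsum (%q. real (nsize q) * muR e' q) chiR = (real N)^2"
  hence "mean_size e' = mean_size e" using e infsum_nsize_muR[of e'] by simp
  thus "e' = e" using mean_size_strict_mono[of e e'] mean_size_strict_mono[of e' e] h e01
   by (smt (verit))
 qed (use e e01 infsum_nsize_muR[OF e01] in auto)
 from theI'[OF this] show ?thesis unfolding epsN_def[symmetric]
  using infsum_nsize_muR by metis
qed

lemma epsN_lt_1: "N >= 1 ==> epsN N < 1" and epsN_pos: "N >= 1 ==> 0 < epsN N"
 using epsN_works by auto

text \<open>By the choice of \<open>epsN\<close>, (N l)^2 = l^2 * mean_size (exp (- l)) with l = -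
  ln (epsN N). The crude bound gives l <= 1/N, hence l -> 0, and the asymptotics apply.\<close>

lemma epsN_log_asymp: "(%N.-real N * ln (epsN N)) \<longlonglongrightarrow> beta"
proof -
 define l where "l N = - ln (epsN N)" for N
 have l: "l N > 0" "exp (- l N) = epsN N" "mean_size (exp (- l N)) = (real N)\<^sup>2" if "N >= 1" for N
  using epsN_works[OF that] by (auto simp: l_def)
 have le: "l N <= 1/real N" if N: "N >= 1" for N
 proof -
  have "(real N)^2 <= 1/(l N)^2" using mean_size_le[of "l N"] l[OF N] by simp
  hence "(real N * l N)^2 <= 1^2" using l[OF N] by (simp add: field_simps power_mult_distrib)
  hence "real N * l N <= 1" by (rule power2_le_imp_le) simp
  thus ?thesis using N by (simp add: field_simps)
 qed
 have "l \<longlonglongrightarrow> 0"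
  by (rule tendsto_sandwich[OF _ _ tendsto_const lim_1_over_n])
   (use le l in \<open>auto simp: eventually_sequentially less_imp_le intro!: exI[of _ 1]\<close>)
 moreover have "\<forall>\<^sub>F N in sequentially. 0 < l N"
  using l(1) by (auto simp: eventually_sequentially)
 ultimately have "filterlim l (at_right 0) sequentially"
  unfolding filterlim_at by (auto elim: eventually_mono)
 hence "(%N. (l N)\<^sup>2 * mean_size (exp (- l N))) \<longlonglongrightarrow> pi\<^sup>2/12"
  by (rule filterlim_compose[OF mean_size_asymp])
 hence "(%N. (real N * l N)^2) \<longlonglongrightarrow> pi^2/12"
  by (rule Lim_transform_eventually)
   (use l in \<open>auto simp: eventually_sequentially power_mult_distrib intro!: exI[of _ 1]\<close>)
 hence "(%N. sqrt ((real N * l N)^2)) \<longlonglongrightarrow> sqrt (pi^2/12)"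
  by (rule tendsto_real_sqrt)
 moreover have "sqrt (pi^2/12) = beta" by (simp add: beta_def real_sqrt_divide)
 ultimately have "(%N. sqrt ((real N * l N)^2)) \<longlonglongrightarrow> beta" by simp
 thus ?thesis
  by (rule Lim_transform_eventually)
   (use l(1) in \<open>auto simp: l_def eventually_sequentially abs_mult intro!: exI[of _ 1]\<close>, force)
qed

lemma epsN_asymp: "(%N. real N*(1-epsN N)) \<longlonglongrightarrow> beta"
proof -
 define l where "l N = - ln (epsN N)" for N
 have l: "l N > 0" "exp (- l N) = epsN N" if "N >= 1" for N
  using epsN_works[OF that] by (auto simp: l_def)
 have Nl: "(%N. real N * l N) \<longlonglongrightarrow> beta" using epsN_log_asymp by (simp add: l_def)
 have "(%N. real N * l N*(1/real N)) \<longlonglongrightarrow> beta*0"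
  by (intro tendsto_mult Nl lim_1_over_n)
 hence "(%N. real N * l N*(1/real N)) \<longlonglongrightarrow> 0" by simp
 hence "l \<longlonglongrightarrow> 0"
  by (rule Lim_transform_eventually) (auto simp: eventually_sequentially intro!: exI[of _ 1])
 moreover have "\<forall>\<^sub>F N in sequentially. 0 < l N"
  using l(1) by (auto simp: eventually_sequentially)
 ultimately have fl: "filterlim l (at_right 0) sequentially"
  unfolding filterlim_at by (auto elim: eventually_mono)
 have "((%y::real. (1-exp (- y))/y) \<longlongrightarrow> 1) (at_right 0)" by real_asymp
 from tendsto_mult[OF Nl filterlim_compose[OF this fl]]
 have "(%N. real N * l N*((1-exp (- l N))/l N)) \<longlonglongrightarrow> beta" by simp
 thus ?thesis
  by (rule Lim_transform_eventually)
   (use l in \<open>auto simp: eventually_sequentially intro!: exI[of _ 1]\<close>, use l in force)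
qed

section \<open>Elementary moves, and truncation in the partition size\<close>

definition move :: "nat => nat set => nat set" where
 "move x eta = (if x = 0 then flip1 eta else swap x eta)"

text \<open>Index 0 of \<open>move\<close> and \<open>rate\<close> is the reservoir acting on site
  1, index x >= 1 the bond between x and x+1; bulk and boundary of \<open>genR\<close> thus become
  one sum.\<close>

definition rate :: "real => nat => nat set => real" where
 "rate eps x eta = (if x = 0 then (if 1 \<notin> eta then eps else 1) else eps * cplus x eta+cminus x eta)"

lemma move_chiR:
 assumes "eta \<in> chiR"
 shows "move x eta \<in> chiR"
proof -
 have "swap x eta \<subseteq> eta \<union> {x, Suc x}" by (auto simp: swap_def split: if_splits)
 hence "finite (swap x eta)" using assms by (auto simp: chiR_def intro: finite_subset)
 thus ?thesis using assms
  by (auto simp: move_def chiR_def swap_def flip1_def split: if_splits)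
qed

lemma rate_bounds:
 assumes "0 <= eps" "eps <= 1"
 shows "0 <= rate eps x eta" "rate eps x eta <= 1"
 using assms by (auto simp: rate_def cplus_def cminus_def)

lemma rate_eq_0:
 assumes "eta \<subseteq> {..m}" "m < x"
 shows "rate eps x eta = 0"
 using assms by (auto simp: rate_def cplus_def cminus_def)

lemma chiR_bounded:
 assumes "eta \<in> chiR"
 obtains m where "eta \<subseteq> {..m}"
 using assms by (metis (mono_tags, lifting) atMost_iff chiR_def finite_nat_set_iff_bounded_le mem_Collect_eq subsetI)

text \<open>A bond beyond the highest particle has rate 0, so the infinite sum is finite, and the
  reservoir joins it as the term with index 0.\<close>

lemma genR_sum:
 assumes m: "eta \<subseteq> {..m}"
 shows "genR eps f eta = (\<Sum>x\<le>m. rate eps x eta*(f (move x eta)-f eta))"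
proof -
 let ?h = "%x. rate eps x eta*(f (move x eta)-f eta)"
 have "infsum (%x. (eps * cplus x eta+cminus x eta)*(f (swap x eta)-f eta)) {1..} = infsum ?h {1..m}"
 proof (rule infsum_cong_neutral)
  fix x assume "x \<in> {1..}-{1..m}"
  hence "rate eps x eta = 0" "x ~= 0" using rate_eq_0[OF m] by auto
  thus "(eps * cplus x eta+cminus x eta)*(f (swap x eta)-f eta) = 0" by (simp add: rate_def)
 qed (auto simp: rate_def move_def)
 also have "... = sum ?h {1..m}" by simp
 finally have "genR eps f eta = sum ?h {1..m}+?h 0" by (simp add: genR_def rate_def move_def)
 also have "... = sum ?h {0..m}" by (simp add: sum.atLeast_Suc_atMost)
 finally show ?thesis by (simp add: atMost_atLeast0)
qed

lemma swap_insert: "x \<in> eta ==> Suc x \<notin> eta ==> swap x eta = insert (Suc x) (eta-{x})"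
 and swap_remove: "x \<notin> eta ==> Suc x \<in> eta ==> swap x eta = insert x (eta-{Suc x})"
 by (auto simp: swap_def)

text \<open>A move shifts one particle by one site or creates or removes the part 1. A function that
  is Lipschitz in \<open>nsize\<close> therefore has small jumps, which is what the cutoff
  exploits.\<close>

lemma nsize_move:
 assumes "eta \<in> chiR" "rate eps x eta ~= 0"
 shows "\<bar>real (nsize (move x eta))-real (nsize eta)\<bar> <= 1"
proof -
 have fin: "finite eta" using assms by (simp add: chiR_def)
 have del: "nsize eta = y+nsize (eta-{y})" if "y \<in> eta" for y
  unfolding nsize_def using sum.remove[OF fin that] by simp
 have ins: "nsize (insert z (eta-{y})) = z+nsize (eta-{y})" if "z \<notin> eta" for y z
  unfolding nsize_def using that fin by (subst sum.insert) auto
 consider "x = 0" | "x ~= 0" "x \<in> eta" "Suc x \<notin> eta" | "x ~= 0" "x \<notin> eta" "Suc x \<in> eta"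
  using assms(2) by (auto simp: rate_def cplus_def cminus_def split: if_splits)
 thus ?thesis
 proof cases
  case 1
  thus ?thesis using del[of 1] fin
   by (cases "1 \<in> eta") (auto simp: move_def flip1_def nsize_def)
 next
  case 2
  thus ?thesis using del[of x] ins[of "Suc x" x] by (simp add: move_def swap_insert)
 next
  case 3
  thus ?thesis using del[of "Suc x"] ins[of x "Suc x"] by (simp add: move_def swap_remove)
 qed
qed

lemma card_le_nsize:
 assumes "eta \<in> chiR"
 shows "card eta <= nsize eta"
proof -
 have "card eta = (\<Sum>i\<in>eta. 1)" by simp
 also have "... <= nsize eta" unfolding nsize_def
  by (rule sum_mono) (use assms in \<open>metis (mono_tags, lifting) chiR_def mem_Collect_eq One_nat_def Suc_leI neq0_conv\<close>)
 finally show ?thesis .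
qed

text \<open>Every active bond has a particle at one of its ends, so the total rate is at most 1 + 2
  \<open>card eta\<close>.\<close>

lemma sum_rate_le:
 assumes eta: "eta \<in> chiR" and e: "0 <= eps" "eps <= 1"
 shows "(\<Sum>x\<le>m. rate eps x eta) <= 1+2 * real (nsize eta)"
proof -
 have fin: "finite eta" using eta by (simp add: chiR_def)
 have "(\<Sum>x\<le>m. rate eps x eta) <= (\<Sum>x\<le>m. of_bool (x = 0)+(of_bool (x \<in> eta) + of_bool (Suc x \<in> eta)))"
  by (rule sum_mono) (use e in \<open>auto simp: rate_def cplus_def cminus_def\<close>)
 also have "... = 1+(real (card {x. x <= m & x \<in> eta})+real (card {x. x <= m & Suc x \<in> eta}))"
  using card_1_singleton_iff[of "{x. x = 0 & x <= m}"]
  by (simp add: sum.distrib Int_def conj_commute set_eq_iff) blast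
 also have "card {x. x <= m & x \<in> eta} <= card eta" by (rule card_mono[OF fin]) auto
 also have "card {x. x <= m & Suc x \<in> eta} <= card eta"
  by (rule card_inj_on_le[OF _ _ fin, of Suc]) auto
 finally show ?thesis using card_le_nsize[OF eta] by simp
qed

definition cutoff :: "nat => nat set => real" where
 "cutoff R eta = max 0 (1-real (nsize eta)/real R)"

text \<open>The case distinction matters: \<open>nsize\<close> of an infinite set is 0, so
  \<open>cutoff\<close> alone would not vanish there and the support would be infinite.\<close>

definition trunc :: "(nat set => real) => nat => nat set => real" where
 "trunc F R eta = (if eta \<in> chiR then F eta * cutoff R eta else 0)"

lemma cutoff_bounds: "0 <= cutoff R eta" "cutoff R eta <= 1" by (auto simp: cutoff_def)

lemma finite_trunc_support:
 assumes "R >= 1"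
 shows "finite {eta. trunc F R eta ~= 0}"
proof (rule finite_subset)
 show "{eta. trunc F R eta ~= 0} \<subseteq> Pow {..R}"
 proof safe
  fix eta x assume h: "trunc F R eta ~= 0" "x \<in> eta"
  hence "finite eta" "cutoff R eta ~= 0" by (auto simp: trunc_def chiR_def split: if_splits)
  hence "nsize eta < R" using assms by (auto simp: cutoff_def field_simps max_def split: if_splits)
  moreover have "x <= nsize eta" unfolding nsize_def using h \<open>finite eta\<close> by (intro member_le_sum) auto
  ultimately show "x <= R" by simp
 qed
qed simp

text \<open>The discrete product rule leaves only jumps of the cutoff, each at most 1/R. The first
  bound yields the pointwise limit R -> infinity; the second is uniform in R and eta, as dominated
  convergence requires.\<close>

lemma genR_trunc_diff:
 assumes eta: "eta \<in> chiR" and e: "0 <= eps" "eps <= 1" and B: "!!eta. eta \<in> chiR ==> \<bar>F eta\<bar> <= B" and R: "R >= 1"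
 shows "\<bar>genR eps (trunc F R) eta-cutoff R eta * genR eps F eta\<bar> <= B*(1+2 * real (nsize eta))/real R"
  and "\<bar>genR eps (trunc F R) eta-cutoff R eta * genR eps F eta\<bar> <= 5 * B"
proof -
 obtain m where m: "eta \<subseteq> {..m}" using eta by (rule chiR_bounded)
 have B0: "0 <= B" using B[OF eta] by linarith
 have eq: "genR eps (trunc F R) eta-cutoff R eta * genR eps F eta
   = (\<Sum>x\<le>m. rate eps x eta*(F (move x eta)*(cutoff R (move x eta)-cutoff R eta)))"
  unfolding genR_sum[OF m] sum_distrib_left sum_subtractf[symmetric]
  by (rule sum.cong) (simp_all add: trunc_def eta move_chiR[OF eta] algebra_simps)
 have d: "rate eps x eta * \<bar>cutoff R (move x eta)-cutoff R eta\<bar> <= rate eps x eta*(1/real R)" for x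
 proof (cases "rate eps x eta = 0")
  case False
  have "\<bar>cutoff R (move x eta)-cutoff R eta\<bar> <= \<bar>real (nsize (move x eta))/real R-real (nsize eta)/real R\<bar>"
   unfolding cutoff_def by (auto simp: max_def)
  also have "... = \<bar>real (nsize (move x eta))-real (nsize eta)\<bar>/real R"
   using R by (simp add: diff_divide_distrib[symmetric])
  also have "... <= 1/real R" using nsize_move[OF eta False] by (rule divide_right_mono) simp
  finally show ?thesis by (rule mult_left_mono) (rule rate_bounds[OF e])
 qed simp
 have "\<bar>genR eps (trunc F R) eta-cutoff R eta * genR eps F eta\<bar>
   <= (\<Sum>x\<le>m. \<bar>rate eps x eta*(F (move x eta)*(cutoff R (move x eta)-cutoff R eta))\<bar>)"
  unfolding eq by (rule sum_abs)
 also have "... <= (\<Sum>x\<le>m. B*(rate eps x eta*(1/real R)))"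
 proof (rule sum_mono)
  fix x
  have "\<bar>rate eps x eta*(F (move x eta)*(cutoff R (move x eta)-cutoff R eta))\<bar>
    = \<bar>F (move x eta)\<bar>*(rate eps x eta * \<bar>cutoff R (move x eta)-cutoff R eta\<bar>)"
   using rate_bounds[OF e] by (simp add: abs_mult)
  also have "... <= B*(rate eps x eta*(1/real R))"
   by (rule mult_mono[OF B[OF move_chiR[OF eta]] d B0]) (use rate_bounds[OF e] in auto)
  finally show "\<bar>rate eps x eta*(F (move x eta)*(cutoff R (move x eta)-cutoff R eta))\<bar> <= B*(rate eps x eta*(1/real R))" .
 qed
 also have "... = B*(\<Sum>x\<le>m. rate eps x eta)/real R"
  by (simp add: sum_distrib_left sum_divide_distrib)
 also have "... <= B*(1+2 * real (nsize eta))/real R"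
  by (intro divide_right_mono mult_left_mono sum_rate_le eta e B0) auto
 finally show 1: "\<bar>genR eps (trunc F R) eta-cutoff R eta * genR eps F eta\<bar> <= B*(1+2 * real (nsize eta))/real R" .
 show "\<bar>genR eps (trunc F R) eta-cutoff R eta * genR eps F eta\<bar> <= 5 * B"
 \<comment> \<open>Up to R+1 the factor (1 + 2 nsize) / R is at most 5; beyond, both ends of every
   active move lie where the cutoff vanishes.\<close>
 proof (cases "nsize eta <= R+1")
  case True
  hence "B*(1+2 * real (nsize eta)) <= B*(5 * real R)" using R B0 by (intro mult_left_mono) auto
  hence "B*(1+2 * real (nsize eta))/real R <= 5 * B" using R by (simp add: field_simps)
  with 1 show ?thesis by linarith
 next
  case False
  have "rate eps x eta*(F (move x eta)*(cutoff R (move x eta)-cutoff R eta)) = 0" for x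
  proof (cases "rate eps x eta = 0")
   case r: False
   have "real (nsize (move x eta)) >= real R" "real (nsize eta) >= real R"
    using nsize_move[OF eta r] False by linarith+
   hence "cutoff R (move x eta) = 0" "cutoff R eta = 0" using R by (auto simp: cutoff_def field_simps)
   thus ?thesis by simp
  qed simp
  hence "genR eps (trunc F R) eta-cutoff R eta * genR eps F eta = 0" unfolding eq by (simp add: sum.neutral)
  thus ?thesis using B0 by simp
 qed
qed

lemma cutoff_tendsto: "(%R. cutoff (Suc R) eta) \<longlonglongrightarrow> 1"
proof -
 have "(%R. max 0 (1-real (nsize eta)*(1/real (Suc R)))) \<longlonglongrightarrow> max 0 (1-real (nsize eta)*0)"
  by (intro tendsto_max tendsto_diff tendsto_mult tendsto_const LIMSEQ_Suc[OF lim_1_over_n])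
 thus ?thesis by (simp add: cutoff_def)
qed

lemma genR_trunc_tendsto:
 assumes eta: "eta \<in> chiR" and e: "0 <= eps" "eps <= 1" and B: "!!eta. eta \<in> chiR ==> \<bar>F eta\<bar> <= B"
 shows "(%R. genR eps (trunc F (Suc R)) eta) \<longlonglongrightarrow> genR eps F eta"
proof -
 have "(%R. B*(1+2 * real (nsize eta))*(1/real (Suc R))) \<longlonglongrightarrow> B*(1+2 * real (nsize eta))*0"
  by (intro tendsto_mult tendsto_const LIMSEQ_Suc[OF lim_1_over_n])
 hence z: "(%R. B*(1+2 * real (nsize eta))/real (Suc R)) \<longlonglongrightarrow> 0" by simp
 have "(%R. genR eps (trunc F (Suc R)) eta-cutoff (Suc R) eta * genR eps F eta) \<longlonglongrightarrow> 0"
  by (rule tendsto_rabs_zero_cancel, rule tendsto_sandwich[OF _ _ tendsto_const z])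
   (auto intro!: always_eventually genR_trunc_diff[OF eta e B] simp del: of_nat_Suc)
 hence "(%R. (genR eps (trunc F (Suc R)) eta-cutoff (Suc R) eta * genR eps F eta)+cutoff (Suc R) eta * genR eps F eta)
   \<longlonglongrightarrow> 0+1 * genR eps F eta"
  by (intro tendsto_add tendsto_mult cutoff_tendsto tendsto_const)
 thus ?thesis by simp
qed

lemma genR_trunc_bound:
 assumes eta: "eta \<in> chiR" and e: "0 <= eps" "eps <= 1" and B: "!!eta. eta \<in> chiR ==> \<bar>F eta\<bar> <= B" and R: "R >= 1"
  and C: "\<bar>genR eps F eta\<bar> <= C"
 shows "\<bar>genR eps (trunc F R) eta\<bar> <= C+5 * B"
proof -
 have "\<bar>cutoff R eta * genR eps F eta\<bar> <= 1 * C"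
  unfolding abs_mult by (rule mult_mono) (use C cutoff_bounds[of R eta] in auto)
 thus ?thesis using genR_trunc_diff(2)[where F = F, OF eta e B R] by linarith
qed

text \<open>The carre du champ without the customary factor 1/2; in \<open>carre_sum\<close> it
  appears as the rate-weighted sum of squared jumps.\<close>

definition carre :: "real => (nat set => real) => nat set => real" where
 "carre eps f eta = genR eps (%eta. (f eta)^2) eta-2 * f eta * genR eps f eta"

lemma carre_sum:
 assumes m: "eta \<subseteq> {..m}"
 shows "carre eps f eta = (\<Sum>x\<le>m. rate eps x eta*(f (move x eta)-f eta)^2)"
 unfolding carre_def genR_sum[OF m] sum_distrib_left sum_subtractf[symmetric]
 by (rule sum.cong) (auto simp: power2_eq_square algebra_simps)

lemma set_integral_Icc_split:
 fixes f :: "real => real"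
 assumes f: "set_integrable lborel {a..c} f" and abc: "a <= b" "b <= c"
 shows "(LBINT x:{a..c}. f x) = (LBINT x:{a..b}. f x)+(LBINT x:{b..c}. f x)"
proof -
 have i: "set_integrable lborel {a..b} f" "set_integrable lborel {b..c} f"
  by (rule set_integrable_subset[OF f], use abc in auto)+
 have "(LBINT x:{a..b}. f x)+(LBINT x:{b..c}. f x)
   = (LINT x|lborel. indicator {a..b} x *\<^sub>R f x+indicator {b..c} x *\<^sub>R f x)"
  unfolding set_lebesgue_integral_def
  by (rule Bochner_Integration.integral_add[symmetric]) (use i in \<open>auto simp: set_integrable_def\<close>)
 also have "... = (LINT x|lborel. indicator {a..c} x *\<^sub>R f x)"
 proof (rule integral_cong_AE)
  have "AE x in lborel. x ~= b" by (rule AE_lborel_singleton)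
  thus "AE x in lborel. indicator {a..b} x *\<^sub>R f x+indicator {b..c} x *\<^sub>R f x = indicator {a..c} x *\<^sub>R f x"
   by eventually_elim (use abc in \<open>auto simp: indicator_def\<close>)
 qed (use i f in \<open>auto simp: set_integrable_def intro!: borel_measurable_add borel_measurable_integrable\<close>)
 finally show ?thesis by (simp add: set_lebesgue_integral_def)
qed

lemma integrable_indicator_Icc: "integrable lborel (indicator {a..b::real} :: real => real)"
 by (rule integrable_real_indicator) (auto simp: emeasure_lborel_Icc_eq)

lemma set_integral_Icc_abs_le:
 fixes f :: "real => real"
 assumes f: "set_integrable lborel {a..b} f" and K: "!!x. x \<in> {a..b} ==> \<bar>f x\<bar> <= K" and ab: "a <= b"
 shows "\<bar>LBINT x:{a..b}. f x\<bar> <= K*(b-a)"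
proof -
 have "norm (LBINT x:{a..b}. f x) <= (LBINT x:{a..b}. \<bar>f x\<bar>)"
  using integral_norm_bound[of lborel "%x. indicator {a..b} x *\<^sub>R f x"]
  by (simp add: set_lebesgue_integral_def abs_mult)
 also have "... <= (LBINT x:{a..b}. K)"
  by (rule set_integral_mono[OF set_integrable_abs[OF f]])
   (use K in \<open>auto simp: set_integrable_def integrable_indicator_Icc\<close>)
 also have "... = K*(b-a)" using ab by (simp add: set_lebesgue_integral_def)
 finally show ?thesis by simp
qed

lemma set_integrable_Icc_bounded:
 fixes f :: "real => real"
 assumes "f \<in> borel_measurable borel" "!!x. x \<in> {a..b} ==> \<bar>f x\<bar> <= K"
 shows "set_integrable lborel {a..b} f"
 unfolding set_integrable_def
 by (rule integrableI_bounded_set_indicator[where B = K]) (use assms in \<open>auto simp: emeasure_lborel_Icc_eq\<close>)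

section \<open>The martingale problem\<close>

text \<open>\<open>c\<close> is the acceleration of time, N^2 in the application.\<close>

locale exclusion_MP =
 fixes M :: "'w measure" and X :: "real => 'w => nat set" and c eps :: real and \<nu> :: "nat set pmf"
 assumes mp: "solves_MP M X (%f eta. c * genR eps f eta) \<nu>"
  and eps: "0 <= eps" "eps <= 1" and c_pos: "0 < c"
begin

abbreviation L :: "(nat set => real) => nat set => real" where
 "L f eta \<equiv> c * genR eps f eta"

lemma prob_space_M: "prob_space M"
 using mp by (simp add: solves_MP_def)

sublocale prob_space M by (rule prob_space_M)

lemma X_measurable: "t >= 0 ==> X t \<in> measurable M (count_space UNIV)"
 using mp by (simp add: solves_MP_def)

lemma X_chiR: "t >= 0 ==> xi \<in> space M ==> X t xi \<in> chiR"
 using mp by (simp add: solves_MP_def)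

lemma X_right_cont:
 assumes "t >= 0" "xi \<in> space M"
 shows "EX e>0. ALL s. t <= s & s < t+e --> X s xi = X t xi"
 using mp assms unfolding solves_MP_def cadlag_discrete_def by metis

definition filt :: "real => 'w measure" where
 "filt s = sigma (space M) {{xi\<in>space M. X r xi \<in> B} | r B. 0 <= r & r <= s}"

lemma space_filt [simp]: "space (filt s) = space M"
 by (simp add: filt_def space_measure_of_conv)

lemma sets_filt: "sets (filt s) = sigma_sets (space M) {{xi\<in>space M. X r xi \<in> B} | r B. 0 <= r & r <= s}"
 unfolding filt_def by (rule sets_measure_of) auto

lemma X_filt:
 assumes "0 <= r" "r <= s"
 shows "X r \<in> measurable (filt s) (count_space UNIV)"
proof (rule measurableI)
 fix A :: "nat set set"
 have "X r -` A \<inter> space (filt s) = {xi\<in>space M. X r xi \<in> A}" by auto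
 moreover have "... \<in> sets (filt s)" unfolding sets_filt using assms by (intro sigma_sets.Basic) auto
 ultimately show "X r -` A \<inter> space (filt s) \<in> sets (filt s)" by simp
qed auto

lemma sets_filt_subset: "sets (filt s) \<subseteq> sets M"
 unfolding sets_filt
proof (rule sets.sigma_sets_subset, safe)
 fix r B assume r: "0 <= r" "r <= s"
 have "{xi \<in> space M. X r xi \<in> B} = X r -` B \<inter> space M" by auto
 thus "{xi \<in> space M. X r xi \<in> B} \<in> sets M"
  using measurable_sets[OF X_measurable[OF r(1)], of B] by simp
qed

lemma subalgebra_filt: "subalgebra M (filt s)"
 using sets_filt_subset by (simp add: subalgebra_def)

lemma filt_mono: "s <= t ==> sets (filt s) \<subseteq> sets (filt t)"
 unfolding sets_filt
proof (rule sigma_sets_mono, rule subsetI, rule sigma_sets.Basic)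
 fix A assume "s <= t" "A \<in> {{xi \<in> space M. X r xi \<in> B} |r B. 0 <= r & r <= s}"
 thus "A \<in> {{xi \<in> space M. X r xi \<in> B} |r B. 0 <= r & r <= t}"
  using order_trans by blast
qed

lemma measurable_filt_M: "f \<in> borel_measurable (filt s) ==> f \<in> borel_measurable M"
 by (rule measurable_from_subalg[OF subalgebra_filt])

lemma measurable_filt_mono: "f \<in> borel_measurable (filt s) ==> s <= t ==> f \<in> borel_measurable (filt t)"
 using measurable_mono[of borel borel "filt s" "filt t"] filt_mono[of s t] by auto

lemma G_filt: "0 <= r ==> r <= s ==> (%xi. (G :: nat set => real) (X r xi)) \<in> borel_measurable (filt s)"
 using measurable_compose[OF X_filt, of r s G borel] by simp

text \<open>Clamping the time keeps it inside \<open>{0..s}\<close>, where the process is adapted.\<close>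
abbreviation Xc :: "real => real => 'w => nat set" where
 "Xc s r \<equiv> X (min s (max 0 r))"

text \<open>This is progressive measurability. Paths are constant for a while after each time, so
  evaluation at the next grid time to the right converges, and the clamp lets each approximant read
  only times up to s.\<close>

lemma joint_measurable:
 fixes G :: "nat set => real"
 assumes s: "0 <= s"
 shows "(%p. G (Xc s (snd p) (fst p))) \<in> borel_measurable (filt s \<Otimes>\<^sub>M borel)"
proof (rule borel_measurable_LIMSEQ_real)
 let ?k = "%n (p :: 'w \<times> real). \<lfloor>max 0 (snd p) * real (Suc n)\<rfloor>"
 let ?u = "%n p. G (Xc s ((real_of_int (?k n p)+1)/real (Suc n)) (fst p))"
 show "?u n \<in> borel_measurable (filt s \<Otimes>\<^sub>M borel)" for n
 proof (rule measurable_compose_countable[where g = "?k n" and f = "%k p. G (Xc s ((real_of_int k+1)/real (Suc n)) (fst p))"])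
  fix k :: int
  have "(%xi. G (Xc s ((real_of_int k+1)/real (Suc n)) xi)) \<in> borel_measurable (filt s)"
   by (rule G_filt) (use s in auto)
  thus "(%p. G (Xc s ((real_of_int k+1)/real (Suc n)) (fst p))) \<in> borel_measurable (filt s \<Otimes>\<^sub>M borel)"
   by (rule measurable_compose[OF measurable_fst])
  show "?k n \<in> measurable (filt s \<Otimes>\<^sub>M borel) (count_space UNIV)" by measurable
 qed
 fix p assume p: "p \<in> space (filt s \<Otimes>\<^sub>M (borel :: real measure))"
 define xi where "xi = fst p"
 define r where "r = max 0 (snd p)"
 have xi: "xi \<in> space M" using p by (auto simp: space_pair_measure xi_def)
 have r0: "0 <= r" by (simp add: r_def)
 \<comment> \<open>Strictly to the right of r and within 1/(n+1) of it, so the approximants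
   eventually equal the value at r.\<close>
 define q where "q n = (real_of_int \<lfloor>r * real (Suc n)\<rfloor>+1)/real (Suc n)" for n
 have q: "r < q n" "q n <= r+1/real (Suc n)" for n
 proof -
  have "r * real (Suc n) < real_of_int \<lfloor>r * real (Suc n)\<rfloor>+1" by linarith
  thus "r < q n" unfolding q_def by (simp only: pos_less_divide_eq[of "real (Suc n)"] of_nat_0_less_iff zero_less_Suc)
  have "real_of_int \<lfloor>r * real (Suc n)\<rfloor>+1 <= r * real (Suc n)+1" by linarith
  hence "q n <= (r * real (Suc n)+1)/real (Suc n)" unfolding q_def by (rule divide_right_mono) simp
  thus "q n <= r+1/real (Suc n)" by (simp add: add_divide_distrib)
 qed
 have "\<forall>\<^sub>F n in sequentially. Xc s (q n) xi = Xc s r xi"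
 proof (cases "r < s")
  case True
  obtain e where e: "e > 0" "ALL v. r <= v & v < r+e --> X v xi = X r xi"
   using X_right_cont[OF r0 xi] by blast
  have "\<forall>\<^sub>F n in sequentially. 1/real (Suc n) < min e (s-r)"
   by (rule order_tendstoD(2)[OF LIMSEQ_Suc[OF lim_1_over_n]]) (use e True in auto)
  thus ?thesis
  proof eventually_elim
   case (elim n)
   hence "0 <= q n" "q n <= s" using q[of n] r0 by (simp_all del: of_nat_Suc)
   hence "Xc s (q n) xi = X (q n) xi" by (simp add: min_def max_def)
   also have "... = X r xi" using e(2)[rule_format, of "q n"] q[of n] elim by simp
   finally show ?case using True r0 by (simp add: min_def max_def)
  qed
 next
  case False
  hence "min s (max 0 (q n)) = s" for n using q[of n] r0 by (simp add: min_def max_def)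
  moreover have "min s (max 0 r) = s" using False s by auto
  ultimately show ?thesis by simp
 qed
 hence "\<forall>\<^sub>F n in sequentially. G (Xc s (snd p) (fst p)) = ?u n p"
  by eventually_elim (simp add: q_def r_def xi_def)
 thus "(%n. ?u n p) \<longlonglongrightarrow> G (Xc s (snd p) (fst p))"
  by (rule Lim_transform_eventually[OF tendsto_const])
qed

lemma path_measurable:
 fixes G :: "nat set => real"
 assumes "0 <= s" "xi \<in> space M"
 shows "(%r. G (Xc s r xi)) \<in> borel_measurable borel"
proof -
 have "(%r. (xi, r)) \<in> measurable borel (filt s \<Otimes>\<^sub>M borel)"
  by (intro measurable_Pair) (use assms in auto)
 from measurable_compose[OF this joint_measurable[OF assms(1), of G]] show ?thesis by simp
qed

lemma Xc_eq: "0 <= r ==> r <= s ==> Xc s r = X r"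
 by (simp add: min_def max_def)

lemma path_integrable:
 fixes G :: "nat set => real"
 assumes st: "0 <= s" and xi: "xi \<in> space M" and K: "!!eta. eta \<in> chiR ==> \<bar>G eta\<bar> <= K"
 shows "set_integrable lborel {s..t} (%r. G (X r xi))"
proof (cases "s <= t")
 case True
 have "set_integrable lborel {s..t} (%r. G (Xc t r xi))"
  by (rule set_integrable_Icc_bounded[where K = K, OF path_measurable[OF _ xi]])
   (use True st xi in \<open>auto intro!: K X_chiR\<close>)
 also have "?this \<longleftrightarrow> ?thesis"
  by (rule set_integrable_cong) (use st in \<open>auto simp: Xc_eq\<close>)
 finally show ?thesis .
qed (simp add: set_integrable_def)

lemma path_integral_bound:
 fixes G :: "nat set => real"
 assumes "0 <= s" "s <= t" "xi \<in> space M" "!!eta. eta \<in> chiR ==> \<bar>G eta\<bar> <= K"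
 shows "\<bar>LBINT r:{s..t}. G (X r xi)\<bar> <= K*(t-s)"
 by (rule set_integral_Icc_abs_le[OF path_integrable]) (use assms in \<open>auto intro!: assms(4) X_chiR\<close>)

lemma path_integral_measurable:
 fixes G :: "nat set => real"
 assumes "0 <= s" "s <= t"
 shows "(%xi. LBINT r:{s..t}. G (X r xi)) \<in> borel_measurable (filt t)"
proof -
 have "(%p. indicator {s..t} (snd p) *\<^sub>R G (Xc t (snd p) (fst p))) \<in> borel_measurable (filt t \<Otimes>\<^sub>M borel)"
  by (intro borel_measurable_scaleR joint_measurable measurable_compose[OF measurable_snd]
    borel_measurable_indicator) (use assms in auto)
 hence "(%(xi, r). indicator {s..t} r *\<^sub>R G (Xc t r xi)) \<in> borel_measurable (filt t \<Otimes>\<^sub>M lborel)"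
  by (simp add: case_prod_unfold cong: measurable_cong_sets sets_pair_measure_cong)
 hence "(%xi. LINT r|lborel. indicator {s..t} r *\<^sub>R G (Xc t r xi)) \<in> borel_measurable (filt t)"
  by (rule lborel.borel_measurable_lebesgue_integral)
 also have "(%xi. LINT r|lborel. indicator {s..t} r *\<^sub>R G (Xc t r xi)) = (%xi. LBINT r:{s..t}. G (X r xi))"
  unfolding set_lebesgue_integral_def
  by (intro ext Bochner_Integration.integral_cong) (use assms in \<open>auto simp: Xc_eq indicator_def\<close>)
 finally show ?thesis .
qed

text \<open>Dynkin's martingale of f.\<close>

definition mart :: "(nat set => real) => real => 'w => real" where
 "mart f t xi = f (X t xi)-f (X 0 xi)-(LBINT s:{0..t}. L f (X s xi))"

lemma mart_measurable: "0 <= t ==> mart f t \<in> borel_measurable (filt t)"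
 unfolding mart_def[abs_def]
 by (intro borel_measurable_diff G_filt path_integral_measurable) auto

lemma mart_measurable_M: "0 <= t ==> mart f t \<in> borel_measurable M"
 by (rule measurable_filt_M[OF mart_measurable])

lemma mart_diff:
 assumes "0 <= s" "s <= t" "xi \<in> space M" "!!eta. eta \<in> chiR ==> \<bar>L f eta\<bar> <= C"
 shows "mart f t xi-mart f s xi = f (X t xi)-f (X s xi)-(LBINT r:{s..t}. L f (X r xi))"
 using set_integral_Icc_split[OF path_integrable[of 0 xi "L f" C t], of s] assms
 by (simp add: mart_def)

lemma mart_bound:
 assumes t: "0 <= t" "xi \<in> space M" and B: "!!eta. eta \<in> chiR ==> \<bar>f eta\<bar> <= B" and C: "!!eta. eta \<in> chiR ==> \<bar>L f eta\<bar> <= C"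
 shows "\<bar>mart f t xi\<bar> <= 2 * B+C * t"
proof -
 have "\<bar>LBINT r:{0..t}. L f (X r xi)\<bar> <= C*(t-0)"
  using t by (intro path_integral_bound C) auto
 thus ?thesis
  using B[OF X_chiR[OF t]] B[OF X_chiR[OF _ t(2), of 0]] unfolding mart_def by simp
qed

lemma mart_finite_support:
 assumes f: "finite {eta. f eta ~= 0}" and st: "0 <= s" "s <= t" and A: "A \<in> sets (filt s)"
 shows "(LINT xi|M. indicator A xi*(mart f t xi-mart f s xi)) = 0"
 using mp f st A unfolding solves_MP_def Let_def mart_def sets_filt by blast

text \<open>The truncations have finite support and generators bounded uniformly in n. Dominated
  convergence in time and then over the probability space carries the martingale identity over to
  F.\<close>

lemma mart_orth_indicator:
 assumes B: "!!eta. eta \<in> chiR ==> \<bar>F eta\<bar> <= B" and C: "!!eta. eta \<in> chiR ==> \<bar>L F eta\<bar> <= C"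
  and st: "0 <= s" "s <= t" and A: "A \<in> sets (filt s)"
 shows "(LINT xi|M. indicator A xi*(mart F t xi-mart F s xi)) = 0"
proof -
 let ?f = "%n. trunc F (Suc n)"
 have C': "\<bar>L (?f n) eta\<bar> <= C+c*(5 * B)" if "eta \<in> chiR" for n eta
 proof -
  have "\<bar>genR eps F eta\<bar> <= C/c" using C[OF that] c_pos by (simp add: field_simps abs_mult)
  hence "\<bar>genR eps (?f n) eta\<bar> <= C/c+5 * B"
   by (intro genR_trunc_bound[OF that eps B]) auto
  hence "c * \<bar>genR eps (?f n) eta\<bar> <= c*(C/c+5 * B)" using c_pos by (intro mult_left_mono) auto
  thus ?thesis using c_pos by (simp add: abs_mult distrib_left)
 qed
 have B': "\<bar>?f n eta\<bar> <= B" if "eta \<in> chiR" for n eta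
 proof -
  have "\<bar>F eta\<bar> * \<bar>cutoff (Suc n) eta\<bar> <= B*1"
   by (rule mult_mono) (use B[OF that] cutoff_bounds[of "Suc n" eta] in auto)
  thus ?thesis using that by (simp add: trunc_def abs_mult)
 qed
 have lim: "(%n. mart (?f n) u xi) \<longlonglongrightarrow> mart F u xi" if u: "0 <= u" and xi: "xi \<in> space M" for u xi
 proof -
  have f: "(%n. ?f n eta) \<longlonglongrightarrow> F eta" if "eta \<in> chiR" for eta
   using tendsto_mult[OF tendsto_const cutoff_tendsto, of "F eta" eta] that by (simp add: trunc_def)
  have "(%n. LBINT r:{0..u}. L (?f n) (X r xi)) \<longlonglongrightarrow> (LBINT r:{0..u}. L F (X r xi))"
   unfolding set_lebesgue_integral_def
  proof (rule integral_dominated_convergence[where w = "%r. indicator {0..u} r *\<^sub>R (C+c*(5 * B))"])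
   show "(%r. indicator {0..u} r *\<^sub>R L F (X r xi)) \<in> borel_measurable lborel"
    using path_integrable[of 0 xi "L F" C u] C xi by (simp add: set_integrable_def)
   show "(%r. indicator {0..u} r *\<^sub>R L (?f n) (X r xi)) \<in> borel_measurable lborel" for n
    using path_integrable[of 0 xi "L (?f n)" "C+c*(5 * B)" u] C' xi by (simp add: set_integrable_def)
   show "AE r in lborel. (%n. indicator {0..u} r *\<^sub>R L (?f n) (X r xi)) \<longlonglongrightarrow> indicator {0..u} r *\<^sub>R L F (X r xi)"
   proof (rule AE_I2)
    fix r
    show "(%n. indicator {0..u} r *\<^sub>R L (?f n) (X r xi)) \<longlonglongrightarrow> indicator {0..u} r *\<^sub>R L F (X r xi)"
     by (cases "r \<in> {0..u}")
      (auto intro!: tendsto_mult tendsto_const genR_trunc_tendsto[OF X_chiR eps B] xi)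
   qed
   show "AE r in lborel. norm (indicator {0..u} r *\<^sub>R L (?f n) (X r xi)) <= indicator {0..u} r *\<^sub>R (C+c*(5 * B))" for n
    using C'[OF X_chiR[OF _ xi], of _ n] by (auto simp: indicator_def)
  qed (auto intro!: integrable_mult_left integrable_indicator_Icc)
  thus ?thesis unfolding mart_def
   using u xi by (intro tendsto_diff f X_chiR) auto
 qed
 have bd: "\<bar>mart (?f n) u xi\<bar> <= 2 * B+(C+c*(5 * B)) * u" if "0 <= u" "xi \<in> space M" for u xi n
  by (rule mart_bound[OF that B' C'])
 have AM: "A \<in> sets M" using A sets_filt_subset by auto
 have "(%n. LINT xi|M. indicator A xi*(mart (?f n) t xi-mart (?f n) s xi))
   \<longlonglongrightarrow> (LINT xi|M. indicator A xi*(mart F t xi-mart F s xi))"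
 proof (rule integral_dominated_convergence[where w = "%_. (2 * B+(C+c*(5 * B)) * t)+(2 * B+(C+c*(5 * B)) * s)"])
  show "AE xi in M. norm (indicator A xi*(mart (?f n) t xi-mart (?f n) s xi))
    <= (2 * B+(C+c*(5 * B)) * t)+(2 * B+(C+c*(5 * B)) * s)" for n
  proof (rule AE_I2)
   fix xi assume xi: "xi \<in> space M"
   have "\<bar>mart (?f n) t xi-mart (?f n) s xi\<bar> <= (2 * B+(C+c*(5 * B)) * t)+(2 * B+(C+c*(5 * B)) * s)"
    using bd[of t xi n] bd[of s xi n] st xi by linarith
   thus "norm (indicator A xi*(mart (?f n) t xi-mart (?f n) s xi))
    <= (2 * B+(C+c*(5 * B)) * t)+(2 * B+(C+c*(5 * B)) * s)"
    by (cases "xi \<in> A") (auto intro: order_trans[OF abs_ge_zero])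
  qed
  show "AE xi in M. (%n. indicator A xi*(mart (?f n) t xi-mart (?f n) s xi))
    \<longlonglongrightarrow> indicator A xi*(mart F t xi-mart F s xi)"
   using st by (intro AE_I2 tendsto_mult tendsto_const tendsto_diff lim) auto
 qed (use AM st in \<open>auto intro!: borel_measurable_times borel_measurable_diff mart_measurable_M\<close>)
 moreover have "(LINT xi|M. indicator A xi*(mart (?f n) t xi-mart (?f n) s xi)) = 0" for n
  by (rule mart_finite_support[OF finite_trunc_support st A]) simp
 ultimately have "(%n. 0) \<longlonglongrightarrow> (LINT xi|M. indicator A xi*(mart F t xi-mart F s xi))"
  by simp
 thus ?thesis using LIMSEQ_unique tendsto_const by metis
qed

lemma integrable_bounded:
 fixes f :: "'w => real"
 assumes "f \<in> borel_measurable M" "!!xi. xi \<in> space M ==> \<bar>f xi\<bar> <= K"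
 shows "integrable M f"
 by (rule integrable_const_bound[where B = K]) (use assms in auto)

text \<open>The increment has conditional expectation 0 given \<open>filt s\<close>, which passes
  from indicators to bounded \<open>filt s\<close>-measurable factors.\<close>

lemma mart_orth:
 assumes B: "!!eta. eta \<in> chiR ==> \<bar>F eta\<bar> <= B" and C: "!!eta. eta \<in> chiR ==> \<bar>L F eta\<bar> <= C"
  and st: "0 <= s" "s <= t"
  and H: "H \<in> borel_measurable (filt s)" and b: "!!xi. xi \<in> space M ==> \<bar>H xi\<bar> <= b"
 shows "(LINT xi|M. H xi*(mart F t xi-mart F s xi)) = 0"
proof -
 let ?D = "%xi. mart F t xi-mart F s xi"
 interpret fs: finite_measure_subalgebra M "filt s"
  by unfold_locales (rule subalgebra_filt)
 have Dm: "?D \<in> borel_measurable M" using st by (intro borel_measurable_diff mart_measurable_M) auto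
 have Db: "\<bar>?D xi\<bar> <= (2 * B+C * t)+(2 * B+C * s)" if "xi \<in> space M" for xi
  using mart_bound[OF _ that B C, of t] mart_bound[OF _ that B C, of s] st by linarith
 have Di: "integrable M ?D" by (rule integrable_bounded[OF Dm Db])
 have HDi: "integrable M (%xi. H xi * ?D xi)"
 proof (rule integrable_bounded)
  fix xi assume "xi \<in> space M"
  thus "\<bar>H xi * ?D xi\<bar> <= b*((2 * B+C * t)+(2 * B+C * s))"
   unfolding abs_mult by (intro mult_mono b Db) (use b order_trans[OF abs_ge_zero] in auto)
 qed (use Dm measurable_filt_M[OF H] in auto)
 have "AE xi in M. real_cond_exp M (filt s) ?D xi = 0"
 proof (rule fs.real_cond_exp_charact)
  fix A assume A: "A \<in> sets (filt s)"
  show "(LINT xi:A|M. ?D xi) = (LINT xi:A|M. 0)"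
   using mart_orth_indicator[OF B C st A] by (simp add: set_lebesgue_integral_def)
 qed (use Di in auto)
 hence "(LINT xi|M. H xi * real_cond_exp M (filt s) ?D xi) = (LINT xi|M. 0)"
  by (intro integral_cong_AE) (use measurable_filt_M[OF H] in \<open>auto intro!: borel_measurable_times\<close>)
 thus ?thesis using fs.real_cond_exp_intg(2)[OF HDi H Dm] by simp
qed

end

section \<open>Second moments of the Dynkin martingale\<close>

context exclusion_MP
begin

text \<open>Expand (a - b)^2 = (a^2 - b^2) - 2 b (a - b) and use the martingales of F^2 and of F;
  both martingale parts have mean zero, the second also after multiplication by F (X s).\<close>

lemma increment_decomposition:
 assumes B: "!!eta. eta \<in> chiR ==> \<bar>F eta\<bar> <= B" and C: "!!eta. eta \<in> chiR ==> \<bar>L F eta\<bar> <= C"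
  and C2: "!!eta. eta \<in> chiR ==> \<bar>L (%eta. (F eta)^2) eta\<bar> <= C2"
  and st: "0 <= s" "s <= t"
 shows "(LINT xi|M. (F (X t xi)-F (X s xi))^2)
   = (LINT xi|M. (LBINT r:{s..t}. L (%eta. (F eta)^2) (X r xi))-2 * F (X s xi)*(LBINT r:{s..t}. L F (X r xi)))"
proof -
 let ?Q = "%eta. (F eta)^2"
 let ?I = "%G xi. LBINT r:{s..t}. L G (X r xi)"
 have t0: "0 <= t" using st by simp
 have Q: "\<bar>?Q eta\<bar> <= B^2" if "eta \<in> chiR" for eta
  using B[OF that] by (simp add: abs_le_square_iff[symmetric])
 have Im: "?I G \<in> borel_measurable M" for G
  by (rule measurable_filt_M[OF path_integral_measurable[OF st]])
 have Fm: "(%xi. G (X u xi)) \<in> borel_measurable M" if "0 <= u" for u and G :: "nat set => real"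
  by (rule measurable_filt_M[OF G_filt[OF that order_refl]])
 have o1: "(LINT xi|M. 1*(mart ?Q t xi-mart ?Q s xi)) = 0"
  by (rule mart_orth[OF Q C2 st, where b = 1]) auto
 have o2: "(LINT xi|M. F (X s xi)*(mart F t xi-mart F s xi)) = 0"
  by (rule mart_orth[OF B C st G_filt[OF st(1) order_refl], where b = B]) (use B X_chiR[OF st(1)] in auto)
 have b2: "\<bar>mart ?Q u xi\<bar> <= 2 * B^2+C2 * u" if "0 <= u" "xi \<in> space M" for u xi
  by (rule mart_bound[OF that Q C2])
 have b1: "\<bar>mart F u xi\<bar> <= 2 * B+C * u" if "0 <= u" "xi \<in> space M" for u xi
  by (rule mart_bound[OF that B C])
 have i1: "integrable M (%xi. 1*(mart ?Q t xi-mart ?Q s xi))"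
 proof (rule integrable_bounded[where K = "(2 * B^2+C2 * t)+(2 * B^2+C2 * s)"])
  fix xi assume xi: "xi \<in> space M"
  show "\<bar>1*(mart ?Q t xi-mart ?Q s xi)\<bar> <= (2 * B^2+C2 * t)+(2 * B^2+C2 * s)"
   using b2[OF t0 xi] b2[OF st(1) xi] unfolding mult_1 by linarith
 qed (use st t0 in \<open>auto intro!: mart_measurable_M borel_measurable_diff\<close>)
 have i2: "integrable M (%xi. F (X s xi)*(mart F t xi-mart F s xi))"
 proof (rule integrable_bounded[where K = "B*((2 * B+C * t)+(2 * B+C * s))"])
  fix xi assume xi: "xi \<in> space M"
  have "\<bar>mart F t xi-mart F s xi\<bar> <= (2 * B+C * t)+(2 * B+C * s)"
   using b1[OF t0 xi] b1[OF st(1) xi] by linarith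
  thus "\<bar>F (X s xi)*(mart F t xi-mart F s xi)\<bar> <= B*((2 * B+C * t)+(2 * B+C * s))"
   unfolding abs_mult by (intro mult_mono B X_chiR st xi) (use B[OF X_chiR[OF st(1) xi]] in auto)
 qed (use st t0 in \<open>auto intro!: mart_measurable_M borel_measurable_diff borel_measurable_times Fm\<close>)
 have iI: "integrable M (%xi. ?I ?Q xi-2 * F (X s xi) * ?I F xi)"
 proof (rule integrable_bounded[where K = "C2*(t-s)+2 * B*(C*(t-s))"])
  fix xi assume xi: "xi \<in> space M"
  have a: "\<bar>?I ?Q xi\<bar> <= C2*(t-s)" by (rule path_integral_bound[OF st xi C2])
  have "\<bar>?I F xi\<bar> <= C*(t-s)" by (rule path_integral_bound[OF st xi C])
  hence "\<bar>2 * F (X s xi)\<bar> * \<bar>?I F xi\<bar> <= (2 * B)*(C*(t-s))"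
   by (intro mult_mono) (use B[OF X_chiR[OF st(1) xi]] in auto)
  thus "\<bar>?I ?Q xi-2 * F (X s xi) * ?I F xi\<bar> <= C2*(t-s)+2 * B*(C*(t-s))"
   using a unfolding abs_mult[of "2 * F (X s xi)", symmetric] by linarith
 qed (intro Im Fm borel_measurable_diff borel_measurable_times borel_measurable_const st)
 have "(F (X t xi)-F (X s xi))^2 = 1*(mart ?Q t xi-mart ?Q s xi)
  -2*(F (X s xi)*(mart F t xi-mart F s xi))+(?I ?Q xi-2 * F (X s xi) * ?I F xi)" if "xi \<in> space M" for xi
 proof -
  have "mart ?Q t xi-mart ?Q s xi = ?Q (X t xi)-?Q (X s xi)-?I ?Q xi" by (rule mart_diff[OF st that C2])
  moreover have "mart F t xi-mart F s xi = F (X t xi)-F (X s xi)-?I F xi" by (rule mart_diff[OF st that C])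
  moreover have "(a-b)^2 = 1*(a^2-b^2-p)-2*(b*(a-b-q))+(p-2 * b * q)" for a b p q :: real
   by (simp add: power2_eq_square algebra_simps)
  ultimately show ?thesis by (simp only:)
 qed
 hence "(LINT xi|M. (F (X t xi)-F (X s xi))^2)
   = (LINT xi|M. 1*(mart ?Q t xi-mart ?Q s xi)
  -2*(F (X s xi)*(mart F t xi-mart F s xi))+(?I ?Q xi-2 * F (X s xi) * ?I F xi))"
  by (intro Bochner_Integration.integral_cong) auto
 also have "... = (LINT xi|M. 1*(mart ?Q t xi-mart ?Q s xi))
  -2*(LINT xi|M. F (X s xi)*(mart F t xi-mart F s xi))+(LINT xi|M. ?I ?Q xi-2 * F (X s xi) * ?I F xi)"
  using i1 i2 iI by (subst Bochner_Integration.integral_add, simp, simp, subst Bochner_Integration.integral_diff) auto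
 finally show ?thesis using o1 o2 by simp
qed

lemma square_bounds:
 assumes B: "!!eta. eta \<in> chiR ==> \<bar>F eta\<bar> <= B" and C: "!!eta. eta \<in> chiR ==> \<bar>L F eta\<bar> <= C"
  and g: "!!eta. eta \<in> chiR ==> c * carre eps F eta <= gm" and eta: "eta \<in> chiR"
 shows "\<bar>L (%eta. (F eta)^2) eta\<bar> <= gm+2 * B * C"
proof -
 obtain m where m: "eta \<subseteq> {..m}" using eta by (rule chiR_bounded)
 have "carre eps F eta >= 0" unfolding carre_sum[OF m]
  by (intro sum_nonneg mult_nonneg_nonneg rate_bounds eps) auto
 hence g0: "c * carre eps F eta >= 0" using c_pos by simp
 have "L (%eta. (F eta)^2) eta = c * carre eps F eta+2 * F eta * L F eta"
  by (simp add: carre_def algebra_simps)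
 moreover have "\<bar>2 * F eta * L F eta\<bar> <= 2 * B * C"
  unfolding abs_mult[of "2 * F eta"] by (rule mult_mono) (use B[OF eta] C[OF eta] in auto)
 ultimately show ?thesis using g[OF eta] g0 by linarith
qed

text \<open>Linear in t - s, but with a constant that is not small; it serves only to control the
  quadratic remainder in \<open>increment_square\<close>.\<close>

lemma increment_square_crude:
 assumes B: "!!eta. eta \<in> chiR ==> \<bar>F eta\<bar> <= B" and C: "!!eta. eta \<in> chiR ==> \<bar>L F eta\<bar> <= C"
  and g: "!!eta. eta \<in> chiR ==> c * carre eps F eta <= gm"
  and st: "0 <= s" "s <= t"
 shows "(LINT xi|M. (F (X t xi)-F (X s xi))^2) <= (gm+4 * B * C)*(t-s)"
proof -
 have C2: "!!eta. eta \<in> chiR ==> \<bar>L (%eta. (F eta)^2) eta\<bar> <= gm+2 * B * C"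
  by (rule square_bounds[OF B C g])
 have "(LINT xi|M. (LBINT r:{s..t}. L (%eta. (F eta)^2) (X r xi))-2 * F (X s xi)*(LBINT r:{s..t}. L F (X r xi)))
   <= (LINT xi|M. (gm+4 * B * C)*(t-s))"
 proof (rule Bochner_Integration.integral_mono')
  fix xi assume xi: "xi \<in> space M"
  have a: "\<bar>LBINT r:{s..t}. L (%eta. (F eta)^2) (X r xi)\<bar> <= (gm+2 * B * C)*(t-s)"
   by (rule path_integral_bound[OF st xi C2])
  have "\<bar>LBINT r:{s..t}. L F (X r xi)\<bar> <= C*(t-s)" by (rule path_integral_bound[OF st xi C])
  hence "\<bar>2 * F (X s xi)\<bar> * \<bar>LBINT r:{s..t}. L F (X r xi)\<bar> <= (2 * B)*(C*(t-s))"
   by (intro mult_mono) (use B[OF X_chiR[OF st(1) xi]] in auto)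
  hence "- (2 * F (X s xi)*(LBINT r:{s..t}. L F (X r xi))) <= (2 * B)*(C*(t-s))"
   unfolding abs_mult[symmetric] by linarith
  thus "(LBINT r:{s..t}. L (%eta. (F eta)^2) (X r xi))-2 * F (X s xi)*(LBINT r:{s..t}. L F (X r xi))
   <= (gm+4 * B * C)*(t-s)"
  proof -
   have "(gm+4 * B * C)*(t-s) = (gm+2 * B * C)*(t-s)+2 * B*(C*(t-s))" by (simp add: algebra_simps)
   thus ?thesis using a \<open>- (2 * F (X s xi) * (LBINT r:{s..t}. L F (X r xi))) <= (2 * B) * (C * (t - s))\<close> by linarith
  qed
  have "0 <= B" "0 <= C" using B[OF X_chiR[OF st(1) xi]] C[OF X_chiR[OF st(1) xi]] by linarith+
  moreover have "0 <= gm+2 * B * C" using C2[OF X_chiR[OF st(1) xi]] by linarith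
  moreover have "0 <= 2 * B * C" using \<open>0 <= B\<close> \<open>0 <= C\<close> by simp
  ultimately have "0 <= gm+4 * B * C" by linarith
  thus "0 <= (gm+4 * B * C)*(t-s)" using st by simp
 qed simp
 moreover have "(LINT xi|M. (gm+4 * B * C)*(t-s)) = (gm+4 * B * C)*(t-s)" by (simp add: prob_space)
 ultimately show ?thesis using increment_decomposition[OF B C C2 st] by linarith
qed

lemma increment_square_integral:
 assumes B: "!!eta. eta \<in> chiR ==> \<bar>F eta\<bar> <= B" and C: "!!eta. eta \<in> chiR ==> \<bar>L F eta\<bar> <= C"
  and g: "!!eta. eta \<in> chiR ==> c * carre eps F eta <= gm"
  and st: "0 <= s" "s <= t"
 shows "integrable M (%xi. LBINT r:{s..t}. (F (X r xi)-F (X s xi))^2)" (is ?int)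
  and "(LINT xi|M. (LBINT r:{s..t}. (F (X r xi)-F (X s xi))^2)) <= (gm+4 * B * C)*(t-s)^2" (is ?le)
proof -
 interpret pair_sigma_finite M lborel ..
 let ?f = "%xi r. indicator {s..t} r *\<^sub>R (F (Xc t r xi)-F (X s xi))^2 :: real"
 have t0: "0 <= t" using st by simp
 have J: "(%p. F (Xc t (snd p) (fst p))) \<in> borel_measurable (M \<Otimes>\<^sub>M lborel)"
 proof (rule measurable_compose[OF _ joint_measurable[OF t0, of F], of "%p. p", simplified])
  show "(%p. p) \<in> M \<Otimes>\<^sub>M lborel \<rightarrow>\<^sub>M filt t \<Otimes>\<^sub>M borel"
  proof (rule measurable_pair)
   have "(%x. x) \<in> M \<rightarrow>\<^sub>M filt t"
    by (rule measurableI) (use sets_filt_subset sets.sets_into_space in \<open>auto simp: Int_absorb2\<close>)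
   thus "fst \<circ> (%p. p) \<in> M \<Otimes>\<^sub>M lborel \<rightarrow>\<^sub>M filt t"
    by (simp add: comp_def measurable_compose[OF measurable_fst])
   show "snd \<circ> (%p. p) \<in> M \<Otimes>\<^sub>M lborel \<rightarrow>\<^sub>M borel" by (simp add: comp_def)
  qed
 qed
 have Fs: "(%xi. F (X s xi)) \<in> borel_measurable M"
  by (rule measurable_filt_M[OF G_filt[OF st(1) order_refl]])
 have pm: "(%p. (F (Xc t (snd p) (fst p))-F (X s (fst p)))^2) \<in> borel_measurable (M \<Otimes>\<^sub>M lborel)"
  by (intro borel_measurable_power borel_measurable_diff J measurable_compose[OF measurable_fst Fs])
 have sq: "(F (X u xi)-F (X s xi))^2 <= (2 * B)^2" if "0 <= u" "xi \<in> space M" for u xi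
  using B[OF X_chiR[OF that]] B[OF X_chiR[OF st(1) that(2)]] by (intro abs_le_square_iff[THEN iffD1]) auto
 have "integrable (M \<Otimes>\<^sub>M lborel) (%p. indicator (space M \<times> {s..t}) p *\<^sub>R (F (Xc t (snd p) (fst p))-F (X s (fst p)))^2)"
 proof (rule integrableI_bounded_set_indicator[OF _ pm])
  show "emeasure (M \<Otimes>\<^sub>M lborel) (space M \<times> {s..t}) < \<infinity>"
   using emeasure_space_1 by (subst lborel.emeasure_pair_measure_Times) (auto simp: emeasure_lborel_Icc_eq)
  show "AE p in M \<Otimes>\<^sub>M lborel. p \<in> space M \<times> {s..t} --> norm ((F (Xc t (snd p) (fst p))-F (X s (fst p)))^2) <= (2 * B)^2"
  proof (rule AE_I2, rule impI)
   fix p :: "'w \<times> real" assume "p \<in> space M \<times> {s..t}"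
   thus "norm ((F (Xc t (snd p) (fst p))-F (X s (fst p)))^2) <= (2 * B)^2"
    using sq[of "min t (max 0 (snd p))" "fst p"] t0 by auto
  qed
 qed auto
 also have "?this \<longleftrightarrow> integrable (M \<Otimes>\<^sub>M lborel) (case_prod ?f)"
  by (rule Bochner_Integration.integrable_cong) (auto simp: indicator_def space_pair_measure)
 finally have int: "integrable (M \<Otimes>\<^sub>M lborel) (case_prod ?f)" .
 have eq: "(LBINT r:{s..t}. (F (X r xi)-F (X s xi))^2) = (LINT r|lborel. ?f xi r)" for xi
  unfolding set_lebesgue_integral_def
  by (intro Bochner_Integration.integral_cong) (use st in \<open>auto simp: Xc_eq indicator_def\<close>)
 show ?int unfolding eq using integrable_fst'[OF int] by simp
 have "(LINT xi|M. (LINT r|lborel. ?f xi r)) = (LINT r|lborel. (LINT xi|M. ?f xi r))"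
  by (rule Fubini_integral[OF int, symmetric])
 also have "... <= (LINT r|lborel. indicator {s..t} r*((gm+4 * B * C)*(t-s)))"
 proof (rule integral_mono)
  show "integrable lborel (%r. LINT xi|M. ?f xi r)" by (rule integrable_snd[OF int])
  show "integrable lborel (%r. indicator {s..t} r*((gm+4 * B * C)*(t-s)))"
   by (intro integrable_mult_left integrable_indicator_Icc)
  fix r
  show "(LINT xi|M. ?f xi r) <= indicator {s..t} r*((gm+4 * B * C)*(t-s))"
  proof (cases "r \<in> {s..t}")
   case True
   have nn: "0 <= gm+4 * B * C"
   proof -
    obtain xi where xi: "xi \<in> space M" using not_empty by blast
    have "0 <= B" "0 <= C" using B[OF X_chiR[OF st(1) xi]] C[OF X_chiR[OF st(1) xi]] by linarith+
    moreover have "\<bar>L (%eta. (F eta)^2) (X s xi)\<bar> <= gm+2 * B * C"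
     by (rule square_bounds[OF B C g]) (use X_chiR[OF st(1) xi] in auto)
    hence "0 <= gm+2 * B * C" by linarith
    moreover have "0 <= 2 * B * C" using \<open>0 <= B\<close> \<open>0 <= C\<close> by simp
    ultimately show ?thesis by linarith
   qed
   have "(LINT xi|M. ?f xi r) = (LINT xi|M. (F (X r xi)-F (X s xi))^2)" using True st by (simp add: Xc_eq)
   also have "... <= (gm+4 * B * C)*(r-s)"
    by (rule increment_square_crude[OF B C g]) (use True st in auto)
   also have "... <= (gm+4 * B * C)*(t-s)"
    using nn True by (intro mult_left_mono) auto
   finally show ?thesis using True by simp
  qed simp
 qed
 also have "... = (gm+4 * B * C)*(t-s)^2"
  using st by (simp add: power2_eq_square)
 finally show ?le unfolding eq .
qed

text \<open>Replacing F (X s) by F (X r) under the time integral produces the carre du champ plus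
  the cross term 2 (F (X r) - F (X s)) L F (X r). The cross term is split with weight dl; its second
  part is a squared increment, whose time integral is quadratic in t - s.\<close>

lemma increment_square:
 assumes B: "!!eta. eta \<in> chiR ==> \<bar>F eta\<bar> <= B" and C: "!!eta. eta \<in> chiR ==> \<bar>L F eta\<bar> <= C"
  and g: "!!eta. eta \<in> chiR ==> c * carre eps F eta <= gm"
  and st: "0 <= s" "s <= t" and d: "dl > 0"
 shows "(LINT xi|M. (F (X t xi)-F (X s xi))^2) <= (gm+dl)*(t-s)+C^2/dl*(gm+4 * B * C)*(t-s)^2"
proof -
 have C2: "!!eta. eta \<in> chiR ==> \<bar>L (%eta. (F eta)^2) eta\<bar> <= gm+2 * B * C"
  by (rule square_bounds[OF B C g])
 note SI = increment_square_integral[OF B C g st]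
 let ?J = "%xi. LBINT r:{s..t}. (F (X r xi)-F (X s xi))^2"
 let ?I = "%xi. (LBINT r:{s..t}. L (%eta. (F eta)^2) (X r xi))-2 * F (X s xi)*(LBINT r:{s..t}. L F (X r xi))"
 have pw: "?I xi <= (gm+dl)*(t-s)+C^2/dl * ?J xi" and I_bd: "\<bar>?I xi\<bar> <= (gm+2 * B * C+2 * B * C)*(t-s)"
  if xi: "xi \<in> space M" for xi
 proof -
  have i1: "set_integrable lborel {s..t} (%r. L (%eta. (F eta)^2) (X r xi))"
   by (rule path_integrable[OF st(1) xi C2])
  have i2: "set_integrable lborel {s..t} (%r. 2 * F (X s xi) * L F (X r xi))"
   by (intro set_integrable_mult_right path_integrable[OF st(1) xi C])
  have "\<bar>(F eta-F (X s xi))^2\<bar> <= (2 * B)^2" if "eta \<in> chiR" for eta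
   using B[OF that] B[OF X_chiR[OF st(1) xi]] unfolding abs_power2 by (intro abs_le_square_iff[THEN iffD1]) auto
  hence "set_integrable lborel {s..t} (%r. (F (X r xi)-F (X s xi))^2)"
   by (rule path_integrable[OF st(1) xi, of "%eta. (F eta-F (X s xi))^2"])
  hence i3: "set_integrable lborel {s..t} (%r. C^2/dl*(F (X r xi)-F (X s xi))^2)"
   by (rule set_integrable_mult_right)
  have ic: "set_integrable lborel {s..t} (%r. gm+dl)"
   unfolding set_integrable_def by (auto intro!: integrable_mult_left integrable_indicator_Icc)
  have eq: "?I xi = (LBINT r:{s..t}. L (%eta. (F eta)^2) (X r xi)-2 * F (X s xi) * L F (X r xi))"
   by (subst set_integral_diff(2)[OF i1 i2]) simp
  also have "... <= (LBINT r:{s..t}. (gm+dl)+C^2/dl*(F (X r xi)-F (X s xi))^2)"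
  proof (rule set_integral_mono[OF set_integral_diff(1)[OF i1 i2] set_integral_add(1)[OF ic i3]])
   fix r assume r: "r \<in> {s..t}"
   define x where "x = F (X r xi)-F (X s xi)"
   define y where "y = L F (X r xi)"
   have rc: "X r xi \<in> chiR" using X_chiR[OF _ xi] r st by auto
   have "L (%eta. (F eta)^2) (X r xi)-2 * F (X s xi) * L F (X r xi) = c * carre eps F (X r xi)+2*(x * y)"
    by (simp add: carre_def x_def y_def algebra_simps)
   \<comment> \<open>Young's inequality with weight dl; the square of y is then traded for C^2,
     leaving the squared increment x^2.\<close>
   also have "2*(x * y) <= dl+(x * y)^2/dl"
   proof -
    have "0 <= (x * y-dl)^2/dl" using d by simp
    also have "... = (x * y)^2/dl-2*(x * y)+dl" using d by (simp add: power2_diff field_simps power2_eq_square)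
    finally show ?thesis by simp
   qed
   also have "(x * y)^2/dl <= C^2/dl * x^2"
   proof -
    have "y^2 <= C^2" using C[OF rc] unfolding y_def by (intro abs_le_square_iff[THEN iffD1]) auto
    hence "y^2*(x^2/dl) <= C^2*(x^2/dl)" using d by (intro mult_right_mono) auto
    thus ?thesis by (simp add: power_mult_distrib mult_ac)
   qed
   finally show "L (%eta. (F eta)^2) (X r xi)-2 * F (X s xi) * L F (X r xi) <= (gm+dl)+C^2/dl*(F (X r xi)-F (X s xi))^2"
    using g[OF rc] by (simp add: x_def)
  qed
  also have "... = (gm+dl)*(t-s)+C^2/dl * ?J xi"
   using st by (subst set_integral_add(2)[OF ic i3]) (simp add: set_lebesgue_integral_def)
  finally show "?I xi <= (gm+dl)*(t-s)+C^2/dl * ?J xi" .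
  have a: "\<bar>LBINT r:{s..t}. L (%eta. (F eta)^2) (X r xi)\<bar> <= (gm+2 * B * C)*(t-s)"
   by (rule path_integral_bound[OF st xi C2])
  have "\<bar>LBINT r:{s..t}. L F (X r xi)\<bar> <= C*(t-s)" by (rule path_integral_bound[OF st xi C])
  hence "\<bar>2 * F (X s xi)\<bar> * \<bar>LBINT r:{s..t}. L F (X r xi)\<bar> <= (2 * B)*(C*(t-s))"
   by (intro mult_mono) (use B[OF X_chiR[OF st(1) xi]] in auto)
  hence "\<bar>2 * F (X s xi)*(LBINT r:{s..t}. L F (X r xi))\<bar> <= (2 * B)*(C*(t-s))"
   by (simp only: abs_mult)
  thus "\<bar>?I xi\<bar> <= (gm+2 * B * C+2 * B * C)*(t-s)" using a
   by (simp only: distrib_right mult.assoc)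
 qed
 have "integrable M ?I"
  by (rule integrable_bounded[OF _ I_bd])
   (intro borel_measurable_diff borel_measurable_times borel_measurable_const
    measurable_filt_M[OF path_integral_measurable[OF st]] measurable_filt_M[OF G_filt[OF st(1) order_refl]])
 hence "(LINT xi|M. ?I xi) <= (LINT xi|M. (gm+dl)*(t-s)+C^2/dl * ?J xi)"
  by (rule integral_mono) (use SI(1) pw in auto)
 also have "... = (gm+dl)*(t-s)+C^2/dl*(LINT xi|M. ?J xi)"
  using SI(1) by (subst Bochner_Integration.integral_add) (auto simp: prob_space)
 also have "C^2/dl*(LINT xi|M. ?J xi) <= C^2/dl*((gm+4 * B * C)*(t-s)^2)"
  by (rule mult_left_mono[OF SI(2)]) (use d in auto)
 finally show ?thesis using increment_decomposition[OF B C C2 st] unfolding mult.assoc[symmetric] by linarith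
qed

text \<open>Martingale increments are orthogonal to the past, so the second moment grows by that of
  the increment; the latter differs from the increment of F by a drift of order t - s.\<close>

lemma mart_increment_square:
 assumes B: "!!eta. eta \<in> chiR ==> \<bar>F eta\<bar> <= B" and C: "!!eta. eta \<in> chiR ==> \<bar>L F eta\<bar> <= C"
  and g: "!!eta. eta \<in> chiR ==> c * carre eps F eta <= gm"
  and st: "0 <= s" "s <= t" and d: "dl > 0"
 shows "(LINT xi|M. (mart F t xi)^2)-(LINT xi|M. (mart F s xi)^2)
   <= 2*(gm+dl)*(t-s)+(2*(C^2/dl*(gm+4 * B * C))+2 * C^2)*(t-s)^2"
proof -
 have t0: "0 <= t" using st by simp
 have b1: "\<bar>mart F u xi\<bar> <= 2 * B+C * u" if "0 <= u" "xi \<in> space M" for u xi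
  by (rule mart_bound[OF that B C])
 have i0: "integrable M (%xi. f xi * h xi)"
  if "f \<in> borel_measurable M" "h \<in> borel_measurable M"
   "!!xi. xi \<in> space M ==> \<bar>f xi\<bar> <= a" "!!xi. xi \<in> space M ==> \<bar>h xi\<bar> <= b" for f h :: "'w => real" and a b
 proof (rule integrable_bounded[where K = "a * b"])
  fix xi assume xi: "xi \<in> space M"
  show "\<bar>f xi * h xi\<bar> <= a * b" unfolding abs_mult
   by (rule mult_mono) (use that(3,4)[OF xi] in auto)
 qed (use that in auto)
 let ?D = "%xi. mart F t xi-mart F s xi"
 have Db: "\<bar>?D xi\<bar> <= (2 * B+C * t)+(2 * B+C * s)" if "xi \<in> space M" for xi
  using b1[OF t0 that] b1[OF st(1) that] by linarith
 have Dm: "?D \<in> borel_measurable M" using st t0 by (intro borel_measurable_diff mart_measurable_M) auto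
 have Fm: "(%xi. F (X u xi)) \<in> borel_measurable M" if "0 <= u" for u
  by (rule measurable_filt_M[OF G_filt[OF that order_refl]])
 have iD: "integrable M (%xi. ?D xi * ?D xi)" by (rule i0[OF Dm Dm Db Db])
 have iS: "integrable M (%xi. mart F s xi * mart F s xi)"
  by (rule i0[OF mart_measurable_M mart_measurable_M b1 b1]) (use st in auto)
 have iSD: "integrable M (%xi. mart F s xi * ?D xi)"
  by (rule i0[OF mart_measurable_M Dm b1 Db]) (use st in auto)
 have o: "(LINT xi|M. mart F s xi * ?D xi) = 0"
  by (rule mart_orth[OF B C st mart_measurable[OF st(1)] b1[OF st(1)]])
 have "(LINT xi|M. (mart F t xi)^2) = (LINT xi|M. (mart F s xi * mart F s xi+2*(mart F s xi * ?D xi))+?D xi * ?D xi)"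
  by (intro Bochner_Integration.integral_cong) (auto simp: power2_eq_square algebra_simps)
 also have "... = (LINT xi|M. mart F s xi * mart F s xi)+2*(LINT xi|M. mart F s xi * ?D xi)+(LINT xi|M. ?D xi * ?D xi)"
  using iS iSD iD by (subst Bochner_Integration.integral_add, simp, simp, subst Bochner_Integration.integral_add) auto
 finally have e: "(LINT xi|M. (mart F t xi)^2)-(LINT xi|M. (mart F s xi)^2) = (LINT xi|M. ?D xi * ?D xi)"
  using o by (simp add: power2_eq_square)
 have iF: "integrable M (%xi. (F (X t xi)-F (X s xi))^2)"
  unfolding power2_eq_square
 proof -
  have m: "(%xi. F (X t xi)-F (X s xi)) \<in> borel_measurable M" using t0 st by (intro borel_measurable_diff Fm)
  have b: "\<bar>F (X t xi)-F (X s xi)\<bar> <= 2 * B" if "xi \<in> space M" for xi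
   using B[OF X_chiR[OF t0 that]] B[OF X_chiR[OF st(1) that]] by linarith
  show "integrable M (%xi. (F (X t xi)-F (X s xi))*(F (X t xi)-F (X s xi)))"
   by (rule i0[OF m m b b])
 qed
 have "(LINT xi|M. ?D xi * ?D xi) <= (LINT xi|M. 2*(F (X t xi)-F (X s xi))^2+2*(C^2*(t-s)^2))"
 proof (rule integral_mono[OF iD])
  fix xi assume xi: "xi \<in> space M"
  define a where "a = F (X t xi)-F (X s xi)"
  define b where "b = (LBINT r:{s..t}. L F (X r xi))"
  have "\<bar>b\<bar> <= C*(t-s)" unfolding b_def by (rule path_integral_bound[OF st xi C])
  hence "b^2 <= (C*(t-s))^2" by (intro abs_le_square_iff[THEN iffD1]) auto
  have "(a-b)*(a-b) <= 2 * a^2+2 * b^2"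
   using zero_le_power2[of "a+b"] by (simp add: power2_eq_square algebra_simps)
  show "?D xi * ?D xi <= 2*(F (X t xi)-F (X s xi))^2+2*(C^2*(t-s)^2)"
  proof -
   have "?D xi = a-b" unfolding a_def b_def by (rule mart_diff[OF st xi C])
   with \<open>b\<^sup>2 <= (C * (t - s))\<^sup>2\<close> \<open>(a - b) * (a - b) <= 2 * a\<^sup>2 + 2 * b\<^sup>2\<close> show ?thesis
    unfolding a_def[symmetric] by (simp add: power_mult_distrib)
  qed
 qed (use iF in auto)
 also have "... = 2*(LINT xi|M. (F (X t xi)-F (X s xi))^2)+2*(C^2*(t-s)^2)"
  using iF by (subst Bochner_Integration.integral_add) (auto simp: prob_space)
 also have "... <= 2*((gm+dl)*(t-s)+C^2/dl*(gm+4 * B * C)*(t-s)^2)+2*(C^2*(t-s)^2)"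
  using increment_square[OF B C g st d] by simp
 finally show ?thesis unfolding e by (simp add: algebra_simps)
qed

text \<open>Over n equal pieces of {0..t} the quadratic remainders add up to O(1/n) and vanish in
  the limit. The factor 2 is the price of (a - b)^2 <= 2 a^2 + 2 b^2 in
  \<open>mart_increment_square\<close>.\<close>

lemma mart_second_moment:
 assumes B: "!!eta. eta \<in> chiR ==> \<bar>F eta\<bar> <= B" and C: "!!eta. eta \<in> chiR ==> \<bar>L F eta\<bar> <= C"
  and g: "!!eta. eta \<in> chiR ==> c * carre eps F eta <= gm" and t: "0 <= t"
 shows "(LINT xi|M. (mart F t xi)^2) <= 2 * gm * t"
proof (rule field_le_epsilon)
 fix e :: real assume e: "e > 0"
 \<comment> \<open>Makes 2 dl t at most e, with a denominator that is positive also at t =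
   0.\<close>
 define dl where "dl = e/(2*(t+1))"
 have d: "dl > 0" using e t by (simp add: dl_def)
 define K where "K = 2*(C^2/dl*(gm+4 * B * C))+2 * C^2"
 have step: "(LINT xi|M. (mart F (real i * h) xi)^2) <= real i*(2*(gm+dl) * h+K * h^2)" if h: "0 <= h" for i h
 proof (induction i)
  case 0
  have "(LINT xi|M. (mart F 0 xi)^2) = (LINT xi|M. 0)"
  proof (rule Bochner_Integration.integral_cong)
   fix xi assume "xi \<in> space M"
   hence "\<bar>LBINT r:{0..0}. L F (X r xi)\<bar> <= C*(0-0)" by (intro path_integral_bound C) auto
   thus "(mart F 0 xi)^2 = 0" by (simp add: mart_def)
  qed simp
  thus ?case by simp
 next
  case (Suc i)
  have "(LINT xi|M. (mart F (real (Suc i) * h) xi)^2)-(LINT xi|M. (mart F (real i * h) xi)^2)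
   <= 2*(gm+dl)*(real (Suc i) * h-real i * h)+K*(real (Suc i) * h-real i * h)^2"
   unfolding K_def by (rule mart_increment_square[OF B C g _ _ d]) (use h in \<open>auto intro!: mult_right_mono\<close>)
  moreover have "real (Suc i) * h-real i * h = h" by (simp add: distrib_right)
  ultimately have "(LINT xi|M. (mart F (real (Suc i) * h) xi)^2)-(LINT xi|M. (mart F (real i * h) xi)^2)
   <= 2*(gm+dl) * h+K * h^2" by (simp only:)
  hence "(LINT xi|M. (mart F (real (Suc i) * h) xi)^2) <= real i*(2*(gm+dl) * h+K * h^2)+(2*(gm+dl) * h+K * h^2)"
   using Suc by linarith
  moreover have "real (Suc i) * Y = real i * Y+Y" for Y by (simp add: distrib_right)
  ultimately show ?case by (simp only:)
 qed
 have le: "(LINT xi|M. (mart F t xi)^2) <= 2*(gm+dl) * t+K * t^2*(1/real n)" if "n >= 1" for n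
 proof -
  have "(LINT xi|M. (mart F (real n*(t/real n)) xi)^2) <= real n*(2*(gm+dl)*(t/real n)+K*(t/real n)^2)"
   by (rule step) (use t in auto)
  moreover have "real n*(2*(gm+dl)*(t/real n)+K*(t/real n)^2) = 2*(gm+dl) * t+K * t^2*(1/real n)"
   using that by (simp add: distrib_left power2_eq_square)
  moreover have "real n*(t/real n) = t" using that by simp
  ultimately show ?thesis by (simp only:)
 qed
 have lim: "(%n. 2*(gm+dl) * t+K * t^2*(1/real n)) \<longlonglongrightarrow> 2*(gm+dl) * t+K * t^2*0"
  by (intro tendsto_add tendsto_mult tendsto_const lim_1_over_n)
 have "(LINT xi|M. (mart F t xi)^2) <= 2*(gm+dl) * t+K * t^2*0"
  by (rule LIMSEQ_le_const[OF lim]) (use le in blast)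
 also have "... <= 2 * gm * t+e"
 proof -
  have "2 * dl * t = e*(t/(t+1))" using t unfolding dl_def by (simp add: divide_simps)
  also have "... <= e*1" using e t by (intro mult_left_mono) auto
  finally show ?thesis by (simp add: algebra_simps)
 qed
 finally show "(LINT xi|M. (mart F t xi)^2) <= 2 * gm * t+e" .
qed

lemma mart_first_moment:
 assumes B: "!!eta. eta \<in> chiR ==> \<bar>F eta\<bar> <= B" and C: "!!eta. eta \<in> chiR ==> \<bar>L F eta\<bar> <= C"
  and g: "!!eta. eta \<in> chiR ==> c * carre eps F eta <= gm" and t: "0 <= t"
 shows "(LINT xi|M. \<bar>mart F t xi\<bar>) <= sqrt (2 * gm * t)"
proof -
 have b1: "\<bar>mart F t xi\<bar> <= 2 * B+C * t" if "xi \<in> space M" for xi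
  by (rule mart_bound[OF t that B C])
 have i: "integrable M (%xi. \<bar>mart F t xi\<bar>)" "integrable M (%xi. (\<bar>mart F t xi\<bar>)^2)"
 proof -
  show "integrable M (%xi. \<bar>mart F t xi\<bar>)"
   by (rule integrable_bounded[where K = "2 * B+C * t"])
    (use b1 t in \<open>auto intro!: mart_measurable_M borel_measurable_abs\<close>)
  show "integrable M (%xi. (\<bar>mart F t xi\<bar>)^2)"
  proof (rule integrable_bounded[where K = "(2 * B+C * t)^2"])
   fix xi assume "xi \<in> space M"
   from power_mono[OF b1[OF this], of 2] show "\<bar>\<bar>mart F t xi\<bar>^2\<bar> <= (2 * B+C * t)^2" by simp
  qed (use t in \<open>intro borel_measurable_power borel_measurable_abs mart_measurable_M\<close>)
 qed
 have "(LINT xi|M. \<bar>mart F t xi\<bar>)^2 <= (LINT xi|M. (\<bar>mart F t xi\<bar>)^2)"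
  using variance_eq[OF i] variance_positive[of "%xi. \<bar>mart F t xi\<bar>"] by linarith
 also have "... <= 2 * gm * t" using mart_second_moment[OF B C g t] by simp
 finally show ?thesis by (rule real_le_rsqrt)
qed

end

section \<open>Maximal inequality in continuous time\<close>

lemma dyadic_approx:
 fixes t T d :: real
 assumes t: "0 <= t" "t < T" and d: "0 < d"
 shows "EX k i. t <= real i*(T/2 ^ k) & real i*(T/2 ^ k) < t+d & i <= 2 ^ k"
proof -
 have T: "T > 0" using t by simp
 define d' where "d' = min d (T-t)"
 have d': "d' > 0" using d t by (simp add: d'_def)
 obtain k where k: "(1/2) ^ k < d'/T"
  using real_arch_pow_inv[of "d'/T" "1/2"] d' T by auto
 define q :: real where "q = T/2 ^ k"
 have q: "q > 0" using T by (simp add: q_def)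
 have "T*(1/2) ^ k < T*(d'/T)" using k T by (rule mult_strict_left_mono)
 moreover have "T*(1/2) ^ k = q" by (simp add: power_one_over q_def)
 moreover have "T*(d'/T) = d'" using T by simp
 ultimately have qd: "q < d'" by linarith
 define i where "i = nat \<lceil>t/q\<rceil>"
 have "0 <= t/q" using t q by simp
 hence "real i = real_of_int \<lceil>t/q\<rceil>" by (simp add: i_def)
 hence ir: "t/q <= real i" "real i < t/q+1" by linarith+
 have c: "t/q * q = t" using q by simp
 have "t/q * q <= real i * q" using ir(1) q by (intro mult_right_mono) auto
 hence 1: "t <= real i * q" by (simp only: c)
 have "real i * q < (t/q+1) * q" using ir(2) q by (intro mult_strict_right_mono) auto
 hence "real i * q < t+q" by (simp only: distrib_right c mult_1)
 hence 2: "real i * q < t+d'" using qd by linarith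
 have "2 ^ k * q = T" by (simp add: q_def)
 moreover have "real i * q < T" using 2 by (simp add: d'_def)
 ultimately have "real i * q < 2 ^ k * q" by linarith
 hence "real i < 2 ^ k" using q by (simp only: mult_less_cancel_right_pos)
 hence "real i < real (2 ^ k)" by simp
 hence "i <= 2 ^ k" by (simp only: of_nat_less_iff less_imp_le)
 moreover have "real i * q < t+d" using 2 by (simp add: d'_def)
 ultimately show ?thesis using 1 unfolding q_def by (intro exI[of _ k] exI[of _ i] conjI)
qed

context exclusion_MP
begin

text \<open>Doob's argument: decompose by the first index at which the threshold is exceeded. That
  event belongs to the past of \<open>tau i\<close>, so on it the martingale may be moved to the
  final time.\<close>

lemma mart_maximal_grid:
 fixes tau :: "nat => real"
 assumes B: "!!eta. eta \<in> chiR ==> \<bar>F eta\<bar> <= B" and C: "!!eta. eta \<in> chiR ==> \<bar>L F eta\<bar> <= C"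
  and g: "!!eta. eta \<in> chiR ==> c * carre eps F eta <= gm"
  and tau: "!!i. 0 <= tau i" "mono tau" and a: "a > 0"
 shows "prob {xi\<in>space M. EX i<=n. mart F (tau i) xi > a} <= sqrt (2 * gm * tau n)/a"
proof -
 define A where "A i = {xi\<in>space M. mart F (tau i) xi > a & (ALL j<i. mart F (tau j) xi <= a)}" for i
 have mm: "mart F (tau j) \<in> borel_measurable (filt (tau i))" if "j <= i" for i j
  by (rule measurable_filt_mono[OF mart_measurable[OF tau(1)]]) (use tau(2) that in \<open>auto simp: mono_def\<close>)
 have Af: "A i \<in> sets (filt (tau i))" for i
 proof -
  have "A i = {xi\<in>space (filt (tau i)). mart F (tau i) xi > a} \<inter> {xi\<in>space (filt (tau i)). ALL j:{..<i}. mart F (tau j) xi <= a}"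
   by (auto simp: A_def)
  moreover have "{xi\<in>space (filt (tau i)). mart F (tau i) xi > a} \<in> sets (filt (tau i))"
   by (intro borel_measurable_less borel_measurable_const mm order_refl)
  moreover have "{xi\<in>space (filt (tau i)). ALL j:{..<i}. mart F (tau j) xi <= a} \<in> sets (filt (tau i))"
  proof (rule sets.sets_Collect_finite_All)
   fix j assume "j \<in> {..<i}"
   thus "{xi\<in>space (filt (tau i)). mart F (tau j) xi <= a} \<in> sets (filt (tau i))"
    by (intro borel_measurable_le borel_measurable_const mm) auto
  qed simp
  ultimately show ?thesis by (simp only: sets.Int)
 qed
 have AM: "A i \<in> sets M" for i using Af sets_filt_subset by blast
 have bd: "\<bar>mart F (tau i) xi\<bar> <= 2 * B+C * tau i" if "xi \<in> space M" for i xi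
  by (rule mart_bound[OF tau(1) that B C])
 have ii: "integrable M (%xi. indicator (A i) xi * mart F (tau j) xi)" for i j
 proof (rule integrable_bounded[where K = "2 * B+C * tau j"])
  fix xi assume "xi \<in> space M"
  from bd[OF this, of j] show "\<bar>indicator (A i) xi * mart F (tau j) xi\<bar> <= 2 * B+C * tau j"
   by (auto simp: indicator_def)
 qed (intro borel_measurable_times borel_measurable_indicator AM mart_measurable_M tau(1))
 have one: "a * prob (A i) <= (LINT xi|M. indicator (A i) xi * mart F (tau n) xi)" if "i <= n" for i
 proof -
  have "a * prob (A i) = (LINT xi|M. indicator (A i) xi * a)" using AM by simp
  also have "... <= (LINT xi|M. indicator (A i) xi * mart F (tau i) xi)"
  proof (rule integral_mono[OF _ ii])
   show "integrable M (%xi. indicator (A i) xi * a)"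
    by (rule integrable_bounded[where K = "\<bar>a\<bar>"]) (use AM in \<open>auto simp: indicator_def\<close>)
  qed (auto simp: A_def indicator_def)
  also have "... = (LINT xi|M. indicator (A i) xi * mart F (tau n) xi)"
  proof -
   have "(LINT xi|M. indicator (A i) xi*(mart F (tau n) xi-mart F (tau i) xi)) = 0"
    by (rule mart_orth_indicator[OF B C tau(1) _ Af]) (use tau(2) that in \<open>auto simp: mono_def\<close>)
   thus ?thesis unfolding right_diff_distrib
    by (subst (asm) Bochner_Integration.integral_diff[OF ii ii]) simp
  qed
  finally show ?thesis .
 qed
 have disj: "(\<Sum>i\<le>n. indicator (A i) xi :: real) <= 1" for xi
 proof (cases "EX i<=n. xi \<in> A i")
  case True
  then obtain i where i: "i <= n" "xi \<in> A i" by blast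
  have "xi \<notin> A j" if "j ~= i" for j
  proof
   assume j: "xi \<in> A j"
   have "mart F (tau i) xi > a" "mart F (tau j) xi > a"
    "j < i ==> mart F (tau j) xi <= a" "i < j ==> mart F (tau i) xi <= a"
    using i(2) j by (simp_all add: A_def)
   thus False using that by (cases "j < i") auto
  qed
  hence "indicator (A j) xi = (if j = i then 1 else (0::real))" for j using i by simp
  hence "(\<Sum>j\<le>n. indicator (A j) xi :: real) = (\<Sum>j\<le>n. if j = i then 1 else 0)"
   by (intro sum.cong) simp_all
  also have "... <= 1" by (simp add: sum.delta)
  finally show ?thesis .
 next
  case False
  hence "indicator (A j) xi = (0::real)" if "j <= n" for j using that by simp
  hence "(\<Sum>j\<le>n. indicator (A j) xi :: real) = 0" by (intro sum.neutral) simp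
  thus ?thesis by linarith
 qed
 have iabs: "integrable M (%xi. \<bar>mart F (tau n) xi\<bar>)"
 proof (rule integrable_bounded)
  show "\<bar>\<bar>mart F (tau n) xi\<bar>\<bar> <= 2 * B+C * tau n" if "xi \<in> space M" for xi
   using bd[OF that, of n] by linarith
 qed (intro borel_measurable_abs mart_measurable_M tau(1))
 have "{xi\<in>space M. EX i<=n. mart F (tau i) xi > a} \<subseteq> (\<Union>i\<in>{..n}. A i)"
 proof
  fix xi assume "xi \<in> {xi\<in>space M. EX i<=n. mart F (tau i) xi > a}"
  then obtain i where i: "xi \<in> space M" "i <= n" "mart F (tau i) xi > a" by blast
  define k where "k = (LEAST k. mart F (tau k) xi > a)"
  have "mart F (tau k) xi > a" unfolding k_def
   by (rule LeastI[of "%k. mart F (tau k) xi > a" i]) (rule i(3))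
  moreover have "k <= i" unfolding k_def
   by (rule Least_le[of "%k. mart F (tau k) xi > a" i]) (rule i(3))
  moreover have "ALL j<k. mart F (tau j) xi <= a"
  proof (intro allI impI)
   fix j assume "j < k"
   hence "\<not> mart F (tau j) xi > a" unfolding k_def by (rule not_less_Least[of j "%k. mart F (tau k) xi > a"])
   thus "mart F (tau j) xi <= a" by simp
  qed
  ultimately show "xi \<in> (\<Union>i\<in>{..n}. A i)" using i(1,2) unfolding A_def
   by (intro UN_I[of k]) auto
 qed
 hence "prob {xi\<in>space M. EX i<=n. mart F (tau i) xi > a} <= prob (\<Union>i\<in>{..n}. A i)"
  by (rule finite_measure_mono) (use AM in auto)
 also have "... <= (\<Sum>i\<le>n. prob (A i))"
  by (rule finite_measure_subadditive_finite) (use AM in auto)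
 finally have "a * prob {xi\<in>space M. EX i<=n. mart F (tau i) xi > a} <= (\<Sum>i\<le>n. a * prob (A i))"
  using a by (simp add: sum_distrib_left[symmetric])
 also have "... <= (\<Sum>i\<le>n. LINT xi|M. indicator (A i) xi * mart F (tau n) xi)"
  by (rule sum_mono) (use one in auto)
 also have "... = (LINT xi|M. (\<Sum>i\<le>n. indicator (A i) xi * mart F (tau n) xi))"
  by (rule Bochner_Integration.integral_sum[symmetric]) (rule ii)
 also have "... <= (LINT xi|M. \<bar>mart F (tau n) xi\<bar>)"
 proof (rule integral_mono[OF Bochner_Integration.integrable_sum[OF ii] iabs])
  fix xi assume "xi \<in> space M"
  have "(\<Sum>i\<le>n. indicator (A i) xi * mart F (tau n) xi) = (\<Sum>i\<le>n. indicator (A i) xi) * mart F (tau n) xi"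
   by (simp add: sum_distrib_right)
  also have "... <= (\<Sum>i\<le>n. indicator (A i) xi) * \<bar>mart F (tau n) xi\<bar>"
   by (intro mult_left_mono sum_nonneg) auto
  also have "... <= 1 * \<bar>mart F (tau n) xi\<bar>"
   by (intro mult_right_mono disj) auto
  finally show "(\<Sum>i\<le>n. indicator (A i) xi * mart F (tau n) xi) <= \<bar>mart F (tau n) xi\<bar>" by simp
 qed
 also have "... <= sqrt (2 * gm * tau n)" by (rule mart_first_moment[OF B C g tau(1)])
 finally show ?thesis using a by (simp add: pos_le_divide_eq mult.commute)
qed

text \<open>Dyadic grids are nested, so the exceedance events increase and their union inherits the
  bound. An exceedance at any time is seen at a grid time shortly after, because the state is
  constant to the right and the drift is bounded.\<close>

lemma mart_maximal_above:
 assumes B: "!!eta. eta \<in> chiR ==> \<bar>F eta\<bar> <= B" and C: "!!eta. eta \<in> chiR ==> \<bar>L F eta\<bar> <= C"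
  and g: "!!eta. eta \<in> chiR ==> c * carre eps F eta <= gm" and T: "T > 0" and a: "a > 0"
 shows "EX E:sets M. prob E <= sqrt (2 * gm * T)/a & (ALL xi:space M-E. ALL t:{0..T}. mart F t xi <= a)"
proof -
 define E where "E k = {xi\<in>space M. EX i<=2 ^ k. mart F (real i*(T/2 ^ k)) xi > a}" for k :: nat
 have EM: "E k \<in> sets M" for k
 proof -
  have "E k = (\<Union>i\<in>{..2 ^ k}. {xi\<in>space M. mart F (real i*(T/2 ^ k)) xi > a})" by (auto simp: E_def)
  also have "... \<in> sets M"
   using T by (intro sets.finite_UN borel_measurable_less mart_measurable_M) auto
  finally show ?thesis .
 qed
 have Ep: "prob (E k) <= sqrt (2 * gm * T)/a" for k
 proof -
  have "prob (E k) <= sqrt (2 * gm*(real (2 ^ k)*(T/2 ^ k)))/a" unfolding E_def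
   by (rule mart_maximal_grid[OF B C g]) (use T a in \<open>auto simp: mono_def intro!: divide_right_mono mult_right_mono\<close>)
  thus ?thesis by simp
 qed
 have inc: "incseq E"
 proof (rule incseq_SucI, rule subsetI)
  fix k xi assume "xi \<in> E k"
  then obtain i where i: "xi \<in> space M" "i <= 2 ^ k" "mart F (real i*(T/2 ^ k)) xi > a" by (auto simp: E_def)
  have "real (2 * i)*(T/2 ^ Suc k) = real i*(T/2 ^ k)" by simp
  thus "xi \<in> E (Suc k)" using i by (auto simp: E_def intro!: exI[of _ "2 * i"])
 qed
 have "(\<Union>k. E k) \<in> sets M" using EM by blast
 have "(%k. prob (E k)) \<longlonglongrightarrow> prob (\<Union>k. E k)"
  by (rule finite_Lim_measure_incseq[OF _ inc]) (use EM in auto)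
 hence "prob (\<Union>k. E k) <= sqrt (2 * gm * T)/a"
  by (rule LIMSEQ_le_const2) (use Ep in blast)
 moreover have "mart F t xi <= a" if xi: "xi \<in> space M-(\<Union>k. E k)" and t: "0 <= t" "t <= T" for xi t
 proof (rule ccontr)
  assume "\<not> mart F t xi <= a"
  hence big: "mart F t xi > a" by simp
  have xis: "xi \<in> space M" using xi by simp
  show False
  \<comment> \<open>The end point leaves no room to its right, but it lies in every grid.\<close>
  proof (cases "t = T")
   case True
   hence "mart F (real 1*(T/2 ^ 0)) xi > a" using big by simp
   moreover have "(1::nat) <= 2 ^ 0" by simp
   ultimately have "xi \<in> E 0" unfolding E_def using xis by blast
   thus False using xi by blast
  next
   case False
   hence tT: "t < T" using t by simp
   obtain e where e: "e > 0" "ALL s. t <= s & s < t+e --> X s xi = X t xi"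
    using X_right_cont[OF t(1) xis] by blast
   have C0: "0 <= C" using C[OF X_chiR[OF t(1) xis]] by linarith
   \<comment> \<open>Three constraints on the grid time s: the state is still that of time t, s
     stays below T, and the drift on {t..s} cannot consume the excess over a. C + 1 keeps the
     quotient defined when C = 0.\<close>
   define d where "d = min e (min (T-t) ((mart F t xi-a)/(C+1)))"
   have "(mart F t xi-a)/(C+1) > 0" using big C0 by (intro divide_pos_pos) auto
   hence d: "d > 0" unfolding d_def using e(1) tT by (simp only: min_less_iff_conj diff_gt_0_iff_gt)
   obtain k i where ki: "t <= real i*(T/2 ^ k)" "real i*(T/2 ^ k) < t+d" "i <= 2 ^ k"
    using dyadic_approx[OF t(1) tT d] by (elim exE conjE) (rule that)
   define s where "s = real i*(T/2 ^ k)"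
   have s1: "t <= s" and s2: "s < t+d" using ki by (simp_all only: s_def)
   have "mart F s xi-mart F t xi = F (X s xi)-F (X t xi)-(LBINT r:{t..s}. L F (X r xi))"
    by (rule mart_diff[OF t(1) s1 xis C])
   moreover have "F (X s xi) = F (X t xi)" using e(2)[rule_format, of s] s1 s2 unfolding d_def by simp
   moreover have "\<bar>LBINT r:{t..s}. L F (X r xi)\<bar> <= C*(s-t)"
    by (rule path_integral_bound[OF t(1) s1 xis C])
   moreover have "C*(s-t) < mart F t xi-a"
   proof -
    have "C*(s-t) <= (C+1)*(s-t)" using s1 by (intro mult_right_mono) auto
    also have "... < (C+1)*((mart F t xi-a)/(C+1))"
    proof (rule mult_strict_left_mono)
     show "s-t < (mart F t xi-a)/(C+1)" using s2 unfolding d_def by linarith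
    qed (use C0 in linarith)
    also have "... = mart F t xi-a" using C0 by (intro nonzero_mult_div_cancel_left[of "C+1", unfolded times_divide_eq_right[symmetric]]) linarith
    finally show ?thesis .
   qed
   ultimately have "mart F s xi > a" by linarith
   with ki(3) xis have "xi \<in> E k" unfolding E_def s_def by (intro CollectI conjI exI[of _ i])
   thus False using xi by blast
  qed
 qed
 ultimately show ?thesis using \<open>(\<Union>k. E k) \<in> sets M\<close>
  by (intro bexI[of _ "\<Union>k. E k"] conjI ballI) simp_all
qed

lemma L_uminus:
 assumes eta: "eta \<in> chiR"
 shows "L (%eta.-F eta) eta = - L F eta"
proof -
 obtain m where m: "eta \<subseteq> {..m}" using chiR_bounded[OF eta] by blast
 have "genR eps (%eta.-F eta) eta = - genR eps F eta"
  unfolding genR_sum[OF m] sum_negf[symmetric] by (rule sum.cong) (auto simp: algebra_simps)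
 thus ?thesis by simp
qed

lemma carre_uminus:
 assumes eta: "eta \<in> chiR"
 shows "carre eps (%eta.-F eta) eta = carre eps F eta"
proof -
 obtain m where m: "eta \<subseteq> {..m}" using chiR_bounded[OF eta] by blast
 show ?thesis unfolding carre_sum[OF m] by (simp add: power2_commute)
qed

lemma mart_uminus:
 assumes "0 <= t" "xi \<in> space M"
 shows "mart (%eta.-F eta) t xi = - mart F t xi"
proof -
 have "(LBINT s:{0..t}. L (%eta.-F eta) (X s xi)) = (LBINT s:{0..t}.-L F (X s xi))"
  by (rule set_lebesgue_integral_cong) (use assms in \<open>auto intro!: L_uminus X_chiR\<close>)
 also have "... = - (LBINT s:{0..t}. L F (X s xi))"
  unfolding set_lebesgue_integral_def by (simp only: scaleR_minus_right Bochner_Integration.integral_minus)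
 finally show ?thesis unfolding mart_def by linarith
qed

lemma mart_maximal:
 assumes B: "!!eta. eta \<in> chiR ==> \<bar>F eta\<bar> <= B" and C: "!!eta. eta \<in> chiR ==> \<bar>L F eta\<bar> <= C"
  and g: "!!eta. eta \<in> chiR ==> c * carre eps F eta <= gm" and T: "T > 0" and a: "a > 0"
 shows "EX E:sets M. prob E <= 2 * sqrt (2 * gm * T)/a & (ALL xi:space M-E. ALL t:{0..T}. \<bar>mart F t xi\<bar> <= a)"
proof -
 have "EX E:sets M. prob E <= sqrt (2 * gm * T)/a & (ALL xi:space M-E. ALL t:{0..T}. mart F t xi <= a)"
  by (rule mart_maximal_above[OF B C g T a])
 then obtain E1 where E1: "E1 \<in> sets M" "prob E1 <= sqrt (2 * gm * T)/a"
  "ALL xi:space M-E1. ALL t:{0..T}. mart F t xi <= a" by blast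
 have B': "\<bar>- F eta\<bar> <= B" if "eta \<in> chiR" for eta using B[OF that] by simp
 have C': "\<bar>L (%eta.-F eta) eta\<bar> <= C" if "eta \<in> chiR" for eta unfolding L_uminus[OF that] using C[OF that] by simp
 have g': "c * carre eps (%eta.-F eta) eta <= gm" if "eta \<in> chiR" for eta unfolding carre_uminus[OF that] using g[OF that] .
 have "EX E:sets M. prob E <= sqrt (2 * gm * T)/a & (ALL xi:space M-E. ALL t:{0..T}. mart (%eta.-F eta) t xi <= a)"
  by (rule mart_maximal_above[OF B' C' g' T a])
 then obtain E2 where E2: "E2 \<in> sets M" "prob E2 <= sqrt (2 * gm * T)/a"
  "ALL xi:space M-E2. ALL t:{0..T}. mart (%eta.-F eta) t xi <= a" by blast
 show ?thesis
 proof (intro bexI[of _ "E1 \<union> E2"] conjI ballI)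
  have "prob (E1 \<union> E2) <= prob E1+prob E2" by (rule measure_Un_le[OF E1(1) E2(1)])
  thus "prob (E1 \<union> E2) <= 2 * sqrt (2 * gm * T)/a" using E1(2) E2(2) by simp
  fix xi t assume h: "xi \<in> space M-(E1 \<union> E2)" "t \<in> {0..T}"
  hence "mart F t xi <= a" "mart (%eta.-F eta) t xi <= a" using E1(3) E2(3) by auto
  thus "\<bar>mart F t xi\<bar> <= a" using mart_uminus[of t xi F] h by auto
 qed (use E1 E2 in auto)
qed

end

section \<open>The exponential transform\<close>

text \<open>Gaertner's discrete form of the Cole-Hopf transform, read at site x.\<close>

definition hz :: "real => nat set => nat => real" where
 "hz eps eta x = (1/eps) ^ card {y\<in>eta. x <= y}"

lemma card_ge_Suc:
 assumes "finite eta"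
 shows "card {y\<in>eta. x <= y} = of_bool (x \<in> eta)+card {y\<in>eta. Suc x <= y}"
proof (cases "x \<in> eta")
 case True
 hence "{y\<in>eta. x <= y} = insert x {y\<in>eta. Suc x <= y}" by auto
 thus ?thesis using True assms by simp
next
 case False
 hence "{y\<in>eta. x <= y} = {y\<in>eta. Suc x <= y}"
  by (intro Collect_cong conj_cong refl) (auto simp: Suc_le_eq le_less)
 thus ?thesis using False by simp
qed

lemma hz_Suc:
 assumes "eta \<in> chiR"
 shows "hz eps eta x = (if x \<in> eta then 1/eps else 1) * hz eps eta (Suc x)"
 using assms unfolding hz_def chiR_def by (simp add: card_ge_Suc[of eta x])

lemma hz_ge_1:
 assumes "0 < eps" "eps <= 1"
 shows "1 <= hz eps eta x"
 unfolding hz_def using assms by (intro one_le_power) simp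

lemma hz_decreasing:
 assumes "eta \<in> chiR" "0 < eps" "eps <= 1" "x <= y"
 shows "hz eps eta y <= hz eps eta x"
 unfolding hz_def using assms by (intro power_increasing card_mono) (auto simp: chiR_def)

text \<open>Passing one site loses at most one particle, hence at most a factor eps. This
  deterministic inequality takes the place of probabilistic regularity estimates in space.\<close>

lemma hz_harnack:
 assumes eta: "eta \<in> chiR" and e: "0 < eps" "eps <= 1"
 shows "eps ^ k * hz eps eta x <= hz eps eta (x+k)"
proof (induction k)
 case (Suc k)
 have "eps * hz eps eta (x+k) <= hz eps eta (Suc (x+k))"
  using hz_Suc[OF eta, of eps "x+k"] e hz_ge_1[OF e, of eta "Suc (x+k)"]
  by (cases "x+k \<in> eta") (auto simp: mult_left_le_one_le)
 moreover have "eps*(eps ^ k * hz eps eta x) <= eps * hz eps eta (x+k)"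
  using Suc e by (intro mult_left_mono) auto
 ultimately show ?case by (simp add: mult.assoc)
qed simp

lemma rate_nonzero_cases:
 assumes "rate eps x eta ~= 0"
 shows "x = 0 \<or> (x ~= 0 & x \<in> eta & Suc x \<notin> eta) \<or> (x ~= 0 & x \<notin> eta & Suc x \<in> eta)"
 using assms by (auto simp: rate_def cplus_def cminus_def split: if_splits)

lemma hz_move_above:
 assumes "Suc x < y"
 shows "hz eps (move x eta) y = hz eps eta y"
proof -
 have "{z\<in>move x eta. y <= z} = {z\<in>eta. y <= z}"
  using assms by (auto simp: move_def flip1_def swap_def split: if_splits)
 thus ?thesis by (simp add: hz_def)
qed

text \<open>An exchange across the bond x, x+1 alters the number of particles at or beyond y only
  for y = x+1, the flip only for y = 1. Above the bond nothing moves, at x both sites together hold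
  the same number, and further down \<open>hz_Suc\<close> propagates equality.\<close>

lemma hz_move_other:
 assumes eta: "eta \<in> chiR" and r: "rate eps x eta ~= 0" and y: "1 <= y" "y ~= Suc x"
 shows "hz eps (move x eta) y = hz eps eta y"
proof (cases "Suc x < y")
 case True
 thus ?thesis by (rule hz_move_above)
next
 case False
 hence yx: "y <= x" "x ~= 0" using y by auto
 have mv: "move x eta \<in> chiR" by (rule move_chiR[OF eta])
 have a: "hz eps (move x eta) (Suc (Suc x)) = hz eps eta (Suc (Suc x))" by (rule hz_move_above) simp
 have xx: "hz eps (move x eta) x = hz eps eta x"
  unfolding hz_Suc[OF mv, of eps x] hz_Suc[OF mv, of eps "Suc x"] a hz_Suc[OF eta, of eps x] hz_Suc[OF eta, of eps "Suc x"]
  using rate_nonzero_cases[OF r] yx by (auto simp: move_def swap_def)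
 have "hz eps (move x eta) (x-k) = hz eps eta (x-k)" if "k < x" for k
  using that
 proof (induction k)
  case 0
  thus ?case using xx by simp
 next
  case (Suc k)
  have s: "Suc (x-Suc k) = x-k" using Suc by simp
  have "x-Suc k \<in> move x eta \<longleftrightarrow> x-Suc k \<in> eta" using Suc yx by (auto simp: move_def swap_def)
  thus ?case using Suc unfolding hz_Suc[OF mv, of eps "x-Suc k"] hz_Suc[OF eta, of eps "x-Suc k"] s by simp
 qed
 from this[of "x-y"] show ?thesis using yx y by simp
qed

text \<open>The reason for the transform: the rates are quadratic in the occupation variables, yet
  rate times jump is linear in \<open>hz\<close> at three neighbouring sites. The four local
  configurations are checked one by one.\<close>

lemma hz_drift:
 assumes eta: "eta \<in> chiR" and e: "0 < eps" and x: "x ~= 0"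
 shows "rate eps x eta*(hz eps (move x eta) (Suc x)-hz eps eta (Suc x))
   = eps * hz eps eta x-(1+eps) * hz eps eta (Suc x)+hz eps eta (Suc (Suc x))"
proof -
 have mv: "move x eta \<in> chiR" by (rule move_chiR[OF eta])
 have a: "hz eps (move x eta) (Suc (Suc x)) = hz eps eta (Suc (Suc x))" by (rule hz_move_above) simp
 show ?thesis
  unfolding hz_Suc[OF mv, of eps "Suc x"] a hz_Suc[OF eta, of eps x] hz_Suc[OF eta, of eps "Suc x"]
  using e x by (cases "x \<in> eta"; cases "Suc x \<in> eta")
   (auto simp: rate_def cplus_def cminus_def move_def swap_def field_simps)
qed

text \<open>The formula of \<open>hz_drift\<close> at x = 0 with the ghost value
  \<open>hz eps eta 2 / eps\<close> in place of a value at site 0.\<close>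

lemma hz_drift_0:
 assumes eta: "eta \<in> chiR" and e: "0 < eps"
 shows "rate eps 0 eta*(hz eps (move 0 eta) 1-hz eps eta 1) = - (1+eps) * hz eps eta 1+2 * hz eps eta 2"
proof -
 have mv: "move 0 eta \<in> chiR" by (rule move_chiR[OF eta])
 have a: "hz eps (move 0 eta) (Suc (Suc 0)) = hz eps eta (Suc (Suc 0))" by (rule hz_move_above) simp
 have b: "(2::nat) = Suc (Suc 0)" "(1::nat) = Suc 0" by simp_all
 show ?thesis
  unfolding b hz_Suc[OF mv, of eps "Suc 0"] a hz_Suc[OF eta, of eps "Suc 0"]
  using e by (cases "Suc 0 \<in> eta") (auto simp: rate_def move_def flip1_def field_simps)
qed

text \<open>The exponent changes by at most one. The first bound makes relative jumps of order 1/N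
  for eps = \<open>epsN N\<close>; the second compares backwards, for moves that enter the region
  below a threshold.\<close>

lemma hz_move_ratio:
 assumes eta: "eta \<in> chiR" and e: "0 < eps" "eps <= 1" and r: "rate eps x eta ~= 0" and y: "1 <= y"
 shows "\<bar>hz eps (move x eta) y-hz eps eta y\<bar> <= (1/eps-1) * hz eps eta y" (is ?A)
  and "hz eps eta y <= 1/eps * hz eps (move x eta) y" (is ?B)
proof -
 have q: "1 <= 1/eps" using e by simp
 have h: "0 <= hz eps eta z" for z using hz_ge_1[OF e, of eta z] by linarith
 have "?A & ?B"
 proof (cases "y = Suc x")
  case False
  have "hz eps (move x eta) y = hz eps eta y" by (rule hz_move_other[OF eta r y False])
  moreover have "0 <= (1/eps-1) * hz eps eta y" using q h by simp
  ultimately show ?thesis by (simp add: left_diff_distrib)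
 next
  case True
  have mv: "move x eta \<in> chiR" by (rule move_chiR[OF eta])
  have a: "hz eps (move x eta) (Suc (Suc x)) = hz eps eta (Suc (Suc x))" by (rule hz_move_above) simp
  define k where "k = hz eps eta (Suc (Suc x))"
  have k: "0 <= k" unfolding k_def by (rule h)
  have "(hz eps (move x eta) y = 1/eps * k & hz eps eta y = k) \<or> (hz eps (move x eta) y = k & hz eps eta y = 1/eps * k)"
   unfolding True hz_Suc[OF mv, of eps "Suc x"] a hz_Suc[OF eta, of eps "Suc x"] k_def[symmetric]
   using rate_nonzero_cases[OF r] by (auto simp: move_def swap_def flip1_def)
  moreover have "k <= 1/eps * k" using q k mult_right_mono[OF q k] by simp
  moreover have "1/eps * k <= 1/eps*(1/eps * k)"
  proof -
   have "0 <= 1/eps * k" using e k by simp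
   from mult_right_mono[OF q this] show ?thesis by simp
  qed
  moreover have "1/eps * k-k <= (1/eps-1)*(1/eps * k)"
  proof -
   have "(1/eps-1) * k <= (1/eps-1)*(1/eps * k)"
    using q \<open>k <= 1 / eps * k\<close> by (intro mult_left_mono) auto
   thus ?thesis by (simp add: left_diff_distrib)
  qed
  moreover have "1/eps * k-k = (1/eps-1) * k" by (simp add: left_diff_distrib)
  ultimately show ?thesis by (elim disjE) (simp_all only:, linarith+)
 qed
 thus ?A ?B by auto
qed

text \<open>The weight of the first site is halved; this is the discrete form of the boundary condition
 \<open>2 g'(0) = \<beta> g(0)\<close>, since the reflected profile satisfies \<open>\<zeta>(2) = eps \<zeta>(0)\<close>.\<close>
definition lin :: "real => (nat => real) => nat => nat set => real" where
 "lin eps \<alpha> m eta = \<alpha> 1/2 * hz eps eta 1+(\<Sum>i<m. \<alpha> (i+2) * hz eps eta (i+2))"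

lemma lin_move:
 assumes eta: "eta \<in> chiR" and r: "rate eps x eta ~= 0"
 shows "lin eps \<alpha> m (move x eta)-lin eps \<alpha> m eta
  = (if x = 0 then \<alpha> 1/2 else if x <= m then \<alpha> (Suc x) else 0)*(hz eps (move x eta) (Suc x)-hz eps eta (Suc x))"
proof (cases "x = 0")
 case True
 have "hz eps (move x eta) (i+2) = hz eps eta (i+2)" for i
  by (rule hz_move_other[OF eta r]) (use True in auto)
 thus ?thesis using True by (simp add: lin_def right_diff_distrib)
next
 case False
 have 1: "hz eps (move x eta) 1 = hz eps eta 1" by (rule hz_move_other[OF eta r]) (use False in auto)
 have "lin eps \<alpha> m (move x eta)-lin eps \<alpha> m eta = (\<Sum>i<m. \<alpha> (i+2)*(hz eps (move x eta) (i+2)-hz eps eta (i+2)))"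
  unfolding lin_def 1 by (simp add: sum_subtractf right_diff_distrib)
 also have "... = (\<Sum>i<m. if i = x-1 then \<alpha> (Suc x)*(hz eps (move x eta) (Suc x)-hz eps eta (Suc x)) else 0)"
 proof (rule sum.cong[OF refl])
  fix i
  show "\<alpha> (i+2)*(hz eps (move x eta) (i+2)-hz eps eta (i+2))
   = (if i = x-1 then \<alpha> (Suc x)*(hz eps (move x eta) (Suc x)-hz eps eta (Suc x)) else 0)"
  proof (cases "i = x-1")
   case True
   hence "i+2 = Suc x" using False by simp
   thus ?thesis using True by simp
  next
   case i: False
   have "hz eps (move x eta) (i+2) = hz eps eta (i+2)"
    by (rule hz_move_other[OF eta r]) (use i False in auto)
   thus ?thesis using i by simp
  qed
 qed
 also have "... = (if x <= m then \<alpha> (Suc x)*(hz eps (move x eta) (Suc x)-hz eps eta (Suc x)) else 0)"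
  using False by (auto simp: sum.delta)
 finally show ?thesis using False by simp
qed

text \<open>Discrete Green formula, moving the operator from h to \<alpha>. The last bracket is the
  boundary term at the upper end, which disappears when \<alpha> vanishes at m+1 and m+2; the
  coefficient of h 1 is the one at the wall.\<close>

lemma summation_by_parts:
 fixes \<alpha> h :: "nat => real"
 shows "\<alpha> 1/2*(- (1+eps) * h 1+2 * h 2)
  +(\<Sum>i<m. \<alpha> (i+2)*(eps * h (i+1)-(1+eps) * h (i+2)+h (i+3)))
  = (eps * \<alpha> 2-(1+eps) * \<alpha> 1/2) * h 1
  +(\<Sum>i<m. (\<alpha> (i+1)-(1+eps) * \<alpha> (i+2)+eps * \<alpha> (i+3)) * h (i+2))
  +(\<alpha> (m+1) * h (m+2)-eps * \<alpha> (m+2) * h (m+1))"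
proof (induction m)
 case 0
 show ?case by (simp add: field_simps numeral_2_eq_2)
next
 case (Suc m)
 have n: "Suc m+1 = m+2" "Suc m+2 = m+3" by simp_all
 show ?case unfolding sum.lessThan_Suc n using Suc by (simp add: algebra_simps)
qed

lemma genR_lin:
 assumes eta: "eta \<in> chiR" and e: "0 < eps" and z: "\<alpha> (m+1) = 0" "\<alpha> (m+2) = 0"
 shows "genR eps (lin eps \<alpha> m) eta = (eps * \<alpha> 2-(1+eps) * \<alpha> 1/2) * hz eps eta 1
  +(\<Sum>i<m. (\<alpha> (i+1)-(1+eps) * \<alpha> (i+2)+eps * \<alpha> (i+3)) * hz eps eta (i+2))"
proof -
 obtain n0 where n0: "eta \<subseteq> {..n0}" using eta by (rule chiR_bounded)
 define n where "n = n0+m"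
 have n: "eta \<subseteq> {..n}" "m <= n" using n0 by (auto simp: n_def)
 let ?d = "%x. rate eps x eta*(hz eps (move x eta) (Suc x)-hz eps eta (Suc x))"
 have "genR eps (lin eps \<alpha> m) eta = (\<Sum>x\<le>n. (if x = 0 then \<alpha> 1/2 else if x <= m then \<alpha> (Suc x) else 0) * ?d x)"
  unfolding genR_sum[OF n(1)]
 proof (rule sum.cong[OF refl])
  fix x
  show "rate eps x eta*(lin eps \<alpha> m (move x eta)-lin eps \<alpha> m eta)
   = (if x = 0 then \<alpha> 1/2 else if x <= m then \<alpha> (Suc x) else 0) * ?d x"
   by (cases "rate eps x eta = 0") (simp_all add: lin_move[OF eta])
 qed
 also have "... = (\<Sum>x\<le>m. (if x = 0 then \<alpha> 1/2 else \<alpha> (Suc x)) * ?d x)"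
  by (rule sum.mono_neutral_cong_right) (use n(2) in auto)
 also have "... = \<alpha> 1/2 * ?d 0+(\<Sum>i<m. \<alpha> (i+2) * ?d (Suc i))"
  by (simp add: lessThan_Suc_atMost[symmetric] sum.lessThan_Suc_shift del: sum.lessThan_Suc)
 also have "... = \<alpha> 1/2*(- (1+eps) * hz eps eta 1+2 * hz eps eta 2)
  +(\<Sum>i<m. \<alpha> (i+2)*(eps * hz eps eta (i+1)-(1+eps) * hz eps eta (i+2)+hz eps eta (i+3)))"
 proof -
  have "?d 0 = - (1+eps) * hz eps eta 1+2 * hz eps eta 2" using hz_drift_0[OF eta e] by simp
  moreover have "?d (Suc i) = eps * hz eps eta (i+1)-(1+eps) * hz eps eta (i+2)+hz eps eta (i+3)" for i
   using hz_drift[OF eta e, of "Suc i"] by (simp add: numeral_3_eq_3)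
  ultimately show ?thesis by (simp only:)
 qed
 finally show ?thesis unfolding summation_by_parts z by simp
qed

section \<open>The interpolated profile and its deterministic regularity\<close>

definition clamp01 :: "real => real" where
 "clamp01 z = max 0 (min 1 z)"

text \<open>The exponent of \<open>zeta\<close>, written as one ramp per particle, so that
  monotonicity and continuity in u are termwise.\<close>

definition zexp :: "nat => nat set => real => real" where
 "zexp N eta u = (\<Sum>y\<in>eta. clamp01 (real y+1-real N * u))"

text \<open>For u < 1/N the interpolating term would belong to site 0, which is always empty, so the
  case distinction in \<open>zeta\<close> disappears.\<close>

lemma zeta_eq:
 assumes eta: "eta \<in> chiR" and N: "N >= 1" and u: "u >= 0"
 shows "zeta N eps eta u = exp (- ln eps * zexp N eta u)"
proof -
 define p where "p = real N * u"
 define n where "n = nat \<lfloor>p\<rfloor>"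
 have p: "0 <= p" using u by (simp add: p_def)
 have fl: "real_of_int \<lfloor>p\<rfloor> = real n" using p by (simp add: n_def)
 have n1: "real n <= p" "p < real n+1" using fl by linarith+
 have fin: "finite eta" and 0: "0 \<notin> eta" using eta by (auto simp: chiR_def)
 have "zexp N eta u = (\<Sum>y\<in>eta. of_bool (n+1 <= y)+(if y = n then real n+1-p else 0))"
  unfolding zexp_def p_def[symmetric]
 proof (rule sum.cong[OF refl])
  fix y
  consider "y < n" | "y = n" | "n+1 <= y" by linarith
  thus "clamp01 (real y+1-p) = of_bool (n+1 <= y)+(if y = n then real n+1-p else 0)"
  proof cases
   case 1
   hence "real y+1 <= real n" by linarith
   thus ?thesis using 1 n1 by (simp add: clamp01_def)
  next
   case 2
   thus ?thesis using n1 by (simp add: clamp01_def)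
  next
   case 3
   hence "real n+1 <= real y" by linarith
   thus ?thesis using 3 n1 by (simp add: clamp01_def)
  qed
 qed
 also have "... = real (card {y\<in>eta. n+1 <= y})+(if n \<in> eta then real n+1-p else 0)"
  using fin by (simp add: sum.distrib sum.delta Int_def)
 also have "(if n \<in> eta then real n+1-p else 0)
   = (if u >= 1/real N then (of_int \<lfloor>p\<rfloor>+1-p)*(if n \<in> eta then 1 else 0) else 0)"
 proof (cases "u >= 1/real N")
  case False
  hence "p < 1" using N by (simp add: p_def field_simps)
  hence "n = 0" using n1 by linarith
  thus ?thesis using 0 False by simp
 qed (simp add: fl)
 finally show ?thesis unfolding zeta_def p_def[symmetric] n_def[symmetric] by simp
qed

lemma sum_clamp01:
 assumes "0 <= p"
 shows "(\<Sum>y<n. clamp01 (real y+1-p)) = max 0 (real n-p)"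
 using assms by (induction n) (auto simp: clamp01_def)

text \<open>Exclusion at work: the exponent decreases at most as fast as for a completely filled
  configuration, whose ramps sum to \<open>max 0 (real n - p)\<close>.\<close>

lemma zexp_mono_lipschitz:
 assumes eta: "eta \<in> chiR" and uv: "0 <= u" "u <= v"
 shows "zexp N eta v <= zexp N eta u" "zexp N eta u-zexp N eta v <= real N*(v-u)" "0 <= zexp N eta v"
proof -
 have Nuv: "real N * u <= real N * v" using uv by (intro mult_left_mono) auto
 have tm: "0 <= clamp01 (real y+1-real N * u)-clamp01 (real y+1-real N * v)" for y
  using Nuv by (auto simp: clamp01_def)
 have eq: "zexp N eta u-zexp N eta v = (\<Sum>y\<in>eta. clamp01 (real y+1-real N * u)-clamp01 (real y+1-real N * v))"
  by (simp add: zexp_def sum_subtractf)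
 have "0 <= zexp N eta u-zexp N eta v" unfolding eq by (intro sum_nonneg tm)
 thus "zexp N eta v <= zexp N eta u" by simp
 obtain n where n: "eta \<subseteq> {..n}" using eta by (rule chiR_bounded)
 have "zexp N eta u-zexp N eta v <= (\<Sum>y<Suc n. clamp01 (real y+1-real N * u)-clamp01 (real y+1-real N * v))"
  unfolding eq by (rule sum_mono2) (use n tm in auto)
 also have "... = max 0 (real (Suc n)-real N * u)-max 0 (real (Suc n)-real N * v)"
  unfolding sum_subtractf using uv by (subst (1 2) sum_clamp01) auto
 also have "... <= real N * v-real N * u" using Nuv by (auto simp: max_def)
 finally show "zexp N eta u-zexp N eta v <= real N*(v-u)" by (simp add: right_diff_distrib)
 show "0 <= zexp N eta v" unfolding zexp_def by (rule sum_nonneg) (simp add: clamp01_def)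
qed

lemma zeta_harnack:
 assumes eta: "eta \<in> chiR" and N: "N >= 1" and uv: "0 <= u" "u <= v" and e: "0 < eps" "eps <= 1"
 shows "1 <= zeta N eps eta v" "zeta N eps eta v <= zeta N eps eta u"
  "zeta N eps eta u <= exp (- real N * ln eps*(v-u)) * zeta N eps eta v"
proof -
 have l: "0 <= - ln eps" using e by simp
 note z = zexp_mono_lipschitz[OF eta uv, of N]
 have v: "0 <= v" using uv by simp
 show "1 <= zeta N eps eta v" unfolding zeta_eq[OF eta N v] using l z(3) by (simp add: mult_nonpos_nonneg)
 show "zeta N eps eta v <= zeta N eps eta u" unfolding zeta_eq[OF eta N v] zeta_eq[OF eta N uv(1)]
  using mult_left_mono[OF z(1) l] by simp
 have "- ln eps*(zexp N eta u-zexp N eta v) <= - ln eps*(real N*(v-u))"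
  by (rule mult_left_mono[OF z(2) l])
 thus "zeta N eps eta u <= exp (- real N * ln eps*(v-u)) * zeta N eps eta v"
  unfolding zeta_eq[OF eta N v] zeta_eq[OF eta N uv(1)] exp_add[symmetric] by (simp add: algebra_simps)
qed

lemma zeta_site:
 assumes eta: "eta \<in> chiR" and N: "N >= 1" and x: "x >= 1" and e: "0 < eps"
 shows "zeta N eps eta (real x/real N) = hz eps eta x"
proof -
 have fin: "finite eta" using eta by (simp add: chiR_def)
 have Nx: "real N*(real x/real N) = real x" using N by simp
 have "zexp N eta (real x/real N) = (\<Sum>y\<in>eta. of_bool (x <= y))"
  unfolding zexp_def Nx
 proof (rule sum.cong[OF refl])
  fix y
  show "clamp01 (real y+1-real x) = of_bool (x <= y)"
  proof (cases "x <= y")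
   case False
   hence "real y+1 <= real x" by linarith
   thus ?thesis using False by (simp add: clamp01_def)
  qed (simp add: clamp01_def)
 qed
 also have "... = real (card {y\<in>eta. x <= y})" using fin by (simp add: Int_def)
 finally have z: "zexp N eta (real x/real N) = real (card {y\<in>eta. x <= y})" .
 have "zeta N eps eta (real x/real N) = exp (real (card {y\<in>eta. x <= y}) * ln (1/eps))"
  using e by (subst zeta_eq[OF eta N]) (auto simp: z ln_div)
 also have "... = (1/eps) ^ card {y\<in>eta. x <= y}" using e by (simp add: exp_of_nat_mult)
 finally show ?thesis by (simp add: hz_def)
qed

text \<open>With no particle at 0, the profile is constant on [0, 1/N].\<close>

lemma zeta_zero:
 assumes eta: "eta \<in> chiR" and N: "N >= 1" and e: "0 < eps"
 shows "zeta N eps eta 0 = hz eps eta 1"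
proof -
 have "zexp N eta 0 = zexp N eta (real 1/real N)"
  unfolding zexp_def
 proof (rule sum.cong[OF refl])
  fix y assume "y \<in> eta"
  hence "y >= 1" using eta by (cases y) (auto simp: chiR_def)
  moreover have "real N*(real 1/real N) = 1" using N by simp
  ultimately show "clamp01 (real y+1-real N*0) = clamp01 (real y+1-real N*(real 1/real N))"
   by (simp add: clamp01_def)
 qed
 hence "zeta N eps eta 0 = zeta N eps eta (real 1/real N)" by (simp only: zeta_eq[OF eta N] order_refl zero_le_divide_1_iff of_nat_1 of_nat_0_le_iff)
 also have "... = hz eps eta 1" by (rule zeta_site[OF eta N _ e]) simp
 finally show ?thesis .
qed

lemma zeta_diff_bound:
 assumes eta: "eta \<in> chiR" and N: "N >= 1" and uv: "0 <= u" "0 <= v" "\<bar>u-v\<bar> <= d" and e: "0 < eps" "eps <= 1"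
 shows "\<bar>zeta N eps eta u-zeta N eps eta v\<bar> <= (exp (- real N * ln eps * d)-1) * zeta N eps eta 0"
proof -
 have *: "\<bar>zeta N eps eta a-zeta N eps eta b\<bar> <= (exp (- real N * ln eps * d)-1) * zeta N eps eta 0"
  if ab: "0 <= a" "a <= b" "b-a <= d" for a b
 proof -
  note h = zeta_harnack[OF eta N ab(1,2) e]
  have b0: "0 <= b" using ab by simp
  have l: "0 <= - real N * ln eps" using e by (simp add: mult_nonneg_nonpos)
  have "zeta N eps eta a-zeta N eps eta b <= (exp (- real N * ln eps*(b-a))-1) * zeta N eps eta b"
   using h(3) by (simp add: left_diff_distrib)
  also have "... <= (exp (- real N * ln eps * d)-1) * zeta N eps eta 0"
  proof (rule mult_mono)
   show "exp (- real N * ln eps*(b-a))-1 <= exp (- real N * ln eps * d)-1"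
    using mult_left_mono[OF ab(3) l] by simp
   show "zeta N eps eta b <= zeta N eps eta 0" by (rule zeta_harnack(2)[OF eta N _ b0 e]) simp
   show "0 <= exp (- real N * ln eps * d)-1" using mult_nonneg_nonneg[OF l, of d] ab by simp
   show "0 <= zeta N eps eta b" using h(1) by linarith
  qed
  finally show ?thesis using h(2) by simp
 qed
 show ?thesis
 proof (cases "u <= v")
  case True
  thus ?thesis using *[of u v] uv by simp
 next
  case False
  thus ?thesis using *[of v u] uv by (simp add: abs_minus_commute)
 qed
qed

lemma zeta_continuous:
 assumes eta: "eta \<in> chiR" and N: "N >= 1"
 shows "continuous_on {0..} (zeta N eps eta)"
proof -
 have "continuous_on {0..} (%u. exp (- ln eps * zexp N eta u))"
  unfolding zexp_def clamp01_def by (intro continuous_intros)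
 thus ?thesis
  by (rule continuous_on_eq) (use zeta_eq[OF eta N] in auto)
qed

section \<open>Riemann sums and the discrete generator on test functions\<close>

lemma riemann_sum_error:
 fixes G :: "real => real"
 assumes d: "0 < d" and G: "continuous_on {0..} G"
  and e: "!!x u. x < m ==> real x * d <= u ==> u <= real (Suc x) * d ==> \<bar>G u-G (real (Suc x) * d)\<bar> <= e"
 shows "\<bar>(LBINT u:{0..real m * d}. G u)-(\<Sum>x<m. d * G (real (Suc x) * d))\<bar> <= real m * d * e"
 using e
proof (induction m)
 case 0
 have "(LBINT u:{0..0}. G u) = 0"
  using set_integral_Icc_abs_le[of 0 0 G "\<bar>G 0\<bar>"] borel_integrable_atLeastAtMost'[of 0 0 G]
   continuous_on_subset[OF G, of "{0..0}"] by auto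
 thus ?case by simp
next
 case (Suc m)
 let ?a = "real m * d" and ?b = "real (Suc m) * d"
 have ab: "0 <= ?a" "?a <= ?b" "?b-?a = d" using d by (auto simp: algebra_simps)
 have int: "set_integrable lborel {s..t} G" if "0 <= s" for s t
  by (rule borel_integrable_atLeastAtMost', rule continuous_on_subset[OF G]) (use that in auto)
 have c: "set_integrable lborel {?a..?b} (%_. G ?b)"
  unfolding set_integrable_def by (auto intro!: integrable_mult_left integrable_indicator_Icc)
 have "\<bar>LBINT u:{?a..?b}. G u-G ?b\<bar> <= e*(?b-?a)"
  by (rule set_integral_Icc_abs_le[OF set_integral_diff(1)[OF int c]])
   (use Suc.prems[of m] ab in auto)
 also have "(LBINT u:{?a..?b}. G u-G ?b) = (LBINT u:{?a..?b}. G u)-d * G ?b"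
  using ab unfolding set_integral_diff(2)[OF int[OF ab(1)] c] by (simp add: set_lebesgue_integral_def)
 finally have 1: "\<bar>(LBINT u:{?a..?b}. G u)-d * G ?b\<bar> <= e * d" unfolding ab(3) .
 have 2: "\<bar>(LBINT u:{0..?a}. G u)-(\<Sum>x<m. d * G (real (Suc x) * d))\<bar> <= real m * d * e"
  by (rule Suc.IH) (use Suc.prems in auto)
 have 3: "(LBINT u:{0..?b}. G u) = (LBINT u:{0..?a}. G u)+(LBINT u:{?a..?b}. G u)"
  by (rule set_integral_Icc_split[OF int]) (use ab in auto)
 have 4: "real (Suc m) * d * e = real m * d * e+e * d" by (simp add: algebra_simps)
 show ?case unfolding 3 4 sum.lessThan_Suc using 1 2 by linarith
qed

lemma uniform_modulus:
 fixes f :: "real => real"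
 assumes f: "continuous_on UNIV f" and e: "e > 0"
 obtains d where "d > 0" "!!u v. u \<in> {a..b} ==> v \<in> {a..b} ==> \<bar>u-v\<bar> < d ==> \<bar>f u-f v\<bar> <= e"
proof -
 have "uniformly_continuous_on {a..b} f"
  by (rule compact_uniformly_continuous[OF continuous_on_subset[OF f]]) auto
 then obtain d where "d > 0" "ALL u:{a..b}. ALL v:{a..b}. dist v u < d --> dist (f v) (f u) < e"
  using e unfolding uniformly_continuous_on_def by blast
 thus ?thesis by (intro that[of d]) (auto simp: dist_real_def abs_minus_commute less_imp_le)
qed

lemma bounded_support:
 fixes f :: "real => real"
 assumes f: "continuous_on UNIV f" and K: "!!u. u >= K ==> f u = 0"
 shows "EX B>0. ALL u>=0. \<bar>f u\<bar> <= B"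
proof -
 have "compact (f ` {0..K})" by (rule compact_continuous_image[OF continuous_on_subset[OF f]]) auto
 hence "bounded (f ` {0..K})" by (rule compact_imp_bounded)
 then obtain B where B: "ALL x:f ` {0..K}. norm x <= B" by (auto simp: bounded_iff)
 show ?thesis
 proof (intro exI[of _ "\<bar>B\<bar>+1"] conjI allI impI)
  fix u :: real assume u: "u >= 0"
  show "\<bar>f u\<bar> <= \<bar>B\<bar>+1"
  proof (cases "u <= K")
   case True
   hence "norm (f u) <= B" using B u by auto
   thus ?thesis by simp
  qed (simp add: K)
 qed simp
qed

lemma eventually_sequentiallyI1:
 assumes "\<forall>\<^sub>F N in sequentially. P N"
 shows "EX N0>=1. ALL N>=N0. P N"
proof -
 obtain N0 where "ALL N>=N0. P N" using assms by (auto simp: eventually_sequentially)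
 thus ?thesis by (intro exI[of _ "max 1 N0"]) auto
qed

lemma beta_pos: "beta > 0"
 by (simp add: beta_def)

lemma epsN_tendsto_1: "epsN \<longlonglongrightarrow> 1"
proof -
 have "(%N. 1-real N*(1-epsN N)*(1/real N)) \<longlonglongrightarrow> 1-beta*0"
  by (intro tendsto_intros epsN_asymp lim_1_over_n)
 hence "(%N. 1-real N*(1-epsN N)*(1/real N)) \<longlonglongrightarrow> 1" by simp
 thus ?thesis
  by (rule Lim_transform_eventually) (auto simp: eventually_sequentially intro!: exI[of _ 1])
qed

text \<open>Any constant above \<open>beta\<close> would serve: N |log eps| and N (1/eps - 1) tend
  to \<open>beta\<close> and lie below it for large N.\<close>

abbreviation Lam :: real where "Lam \<equiv> beta+1"

lemma epsN_bounds:
 "EX N0>=1. ALL N>=N0.-real N * ln (epsN N) <= Lam & real N*(1/epsN N-1) <= Lam & 1/epsN N <= 2"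
proof (rule eventually_sequentiallyI1)
 have i: "(%N. 1/epsN N) \<longlonglongrightarrow> 1/1" by (intro tendsto_divide tendsto_const epsN_tendsto_1) simp
 have "(%N. real N*(1-epsN N)*(1/epsN N)) \<longlonglongrightarrow> beta*(1/1)"
  by (intro tendsto_mult epsN_asymp i)
 hence m: "(%N. real N*(1-epsN N)*(1/epsN N)) \<longlonglongrightarrow> beta" by simp
 have e1: "\<forall>\<^sub>F N in sequentially.-real N * ln (epsN N) < Lam"
  by (rule order_tendstoD(2)[OF epsN_log_asymp]) simp
 have e2: "\<forall>\<^sub>F N in sequentially. real N*(1-epsN N)*(1/epsN N) < Lam"
  by (rule order_tendstoD(2)[OF m]) simp
 have e3: "\<forall>\<^sub>F N in sequentially. 1/epsN N < 2"
  by (rule order_tendstoD(2)[OF i]) simp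
 have e4: "\<forall>\<^sub>F N in sequentially. 1 <= (N::nat)" by (rule eventually_ge_at_top)
 show "\<forall>\<^sub>F N in sequentially.-real N * ln (epsN N) <= Lam & real N*(1/epsN N-1) <= Lam & 1/epsN N <= 2"
  using e1 e2 e3 e4
 proof eventually_elim
  case (elim N)
  have "(1-epsN N)*(1/epsN N) = 1/epsN N-1" using epsN_pos[OF elim(4)] by (simp add: diff_divide_distrib)
  hence "real N*(1-epsN N)*(1/epsN N) = real N*(1/epsN N-1)" by (simp only: mult.assoc)
  thus ?case using elim by linarith
 qed
qed

definition pairing :: "nat => (real => real) => nat set => real" where
 "pairing N k eta = (LBINT u:{0..}. k u * zeta N (epsN N) eta u)"

text \<open>The error is measured in units of \<open>hz\<close> at site 1, the maximum of the
  profile; this makes the estimate uniform over all configurations. The range of m leaves room for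
  \<open>Suc (sites N K)\<close> cells.\<close>

lemma pairing_riemann:
 fixes k :: "real => real"
 assumes k: "continuous_on UNIV k" and K: "!!u. u >= K ==> k u = 0" "K >= 0" and e: "e > 0"
 shows "EX N0>=1. ALL N>=N0. ALL m. ALL eta:chiR. real N * K <= real m --> real m <= real N*(K+3) -->
  \<bar>pairing N k eta-(\<Sum>x<m. k (real (Suc x)/real N)/real N * hz (epsN N) eta (Suc x))\<bar> <= e * hz (epsN N) eta 1"
proof -
 obtain B where B0: "B > 0" "ALL u>=0. \<bar>k u\<bar> <= B"
  using bounded_support[OF k K(1)] by blast
 hence B: "B > 0" "!!u. u >= 0 ==> \<bar>k u\<bar> <= B" by auto
 \<comment> \<open>The cells cover a length of at most K+3, and each has two sources of error, the
   variation of k and that of \<open>zeta\<close>.\<close>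
 define e' where "e' = e/2/(K+3)"
 have e': "e' > 0" using e K by (simp add: e'_def)
 obtain d where d: "d > 0" "!!u v. u \<in> {0..K+3} ==> v \<in> {0..K+3} ==> \<bar>u-v\<bar> < d ==> \<bar>k u-k v\<bar> <= e'"
  using uniform_modulus[OF k e', of 0 "K+3"] by blast
 obtain N1 where N1: "N1 >= 1" "ALL N>=N1.-real N * ln (epsN N) <= Lam & real N*(1/epsN N-1) <= Lam & 1/epsN N <= 2"
  using epsN_bounds by blast
 have "(%N. B*(exp (Lam*(1/real N))-1)) \<longlonglongrightarrow> B*(exp (Lam*0)-1)"
  by (intro tendsto_intros lim_1_over_n)
 hence "(%N. B*(exp (Lam*(1/real N))-1)) \<longlonglongrightarrow> 0" by simp
 from order_tendstoD(2)[OF this e'] have ev1: "\<forall>\<^sub>F N in sequentially. B*(exp (Lam*(1/real N))-1) < e'" .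
 have ev2: "\<forall>\<^sub>F N in sequentially. 1/real N < d" by (rule order_tendstoD(2)[OF lim_1_over_n d(1)])
 obtain N2 where N2: "ALL N>=N2. B*(exp (Lam*(1/real N))-1) < e' & 1/real N < d"
  using eventually_conj[OF ev1 ev2] by (auto simp: eventually_sequentially)
 show ?thesis
 proof (intro exI[of _ "max N1 N2"] conjI allI impI ballI)
  show "1 <= max N1 N2" using N1 by simp
  fix N m eta assume N: "max N1 N2 <= N" and eta: "eta \<in> chiR" and m: "real N * K <= real m" "real m <= real N*(K+3)"
  have Ng: "N >= 1" "N >= N1" "N >= N2" using N N1 by auto
  define eps where "eps = epsN N"
  have eps: "0 < eps" "eps <= 1" using epsN_pos[OF Ng(1)] epsN_lt_1[OF Ng(1)] by (auto simp: eps_def)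
  have lam: "- real N * ln eps <= Lam" using N1(2) Ng by (simp add: eps_def)
  have c: "B*(exp (Lam*(1/real N))-1) < e'" "1/real N < d" using N2 Ng by auto
  let ?z = "zeta N eps eta"
  define G where "G u = k u * ?z u" for u
  have Gc: "continuous_on {0..} G"
   unfolding G_def by (intro continuous_intros continuous_on_subset[OF k] zeta_continuous[OF eta Ng(1)]) auto
  have dN: "0 < 1/real N" using Ng by simp
  have mN: "real m*(1/real N) <= K+3" "K <= real m*(1/real N)" using m Ng by (auto simp: field_simps)
  have z0: "0 <= ?z u" "?z u <= ?z 0" if "0 <= u" for u
  proof -
   show "0 <= ?z u" using zeta_harnack(1)[OF eta Ng(1) that order_refl eps] by linarith
   show "?z u <= ?z 0" by (rule zeta_harnack(2)[OF eta Ng(1) order_refl that eps])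
  qed
  have cell: "\<bar>G u-G (real (Suc x)*(1/real N))\<bar> <= 2 * e' * ?z 0"
   if x: "x < m" "real x*(1/real N) <= u" "u <= real (Suc x)*(1/real N)" for x u
  proof -
   define v where "v = real (Suc x)*(1/real N)"
   have u0: "0 <= u" by (rule order_trans[OF _ x(2)]) simp
   have "v = real x*(1/real N)+1/real N" unfolding v_def by (simp add: add_divide_distrib)
   hence uv: "\<bar>u-v\<bar> <= 1/real N" "0 <= v" using x(2,3) u0 unfolding v_def[symmetric] by linarith+
   have "real (Suc x)*(1/real N) <= real m*(1/real N)" using x(1) by (intro mult_right_mono) auto
   hence vK: "v <= K+3" "u <= K+3" using mN x(3) by (auto simp: v_def)
   have "\<bar>k u-k v\<bar> <= e'" by (rule d(2)) (use u0 uv vK c in auto)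
   hence a: "\<bar>k u-k v\<bar> * ?z u <= e' * ?z 0" by (intro mult_mono z0 u0) (use e' in auto)
   have "\<bar>?z u-?z v\<bar> <= (exp (- real N * ln eps*(1/real N))-1) * ?z 0"
    by (rule zeta_diff_bound[OF eta Ng(1) u0 uv(2) uv(1) eps])
   also have "... <= (exp (Lam*(1/real N))-1) * ?z 0"
    using mult_right_mono[OF lam, of "1/real N"] z0(1)[of 0] by (intro mult_right_mono) auto
   finally have zz: "\<bar>?z u-?z v\<bar> <= (exp (Lam*(1/real N))-1) * ?z 0" .
   have "\<bar>k v\<bar> * \<bar>?z u-?z v\<bar> <= B*((exp (Lam*(1/real N))-1) * ?z 0)"
    by (rule mult_mono[OF B(2)[OF uv(2)] zz]) (use B in auto)
   also have "... = (B*(exp (Lam*(1/real N))-1)) * ?z 0" by simp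
   also have "... <= e' * ?z 0" using c(1) z0(1)[of 0] by (intro mult_right_mono) auto
   finally have b: "\<bar>k v\<bar> * \<bar>?z u-?z v\<bar> <= e' * ?z 0" .
   have "G u-G v = (k u-k v) * ?z u+k v * (?z u-?z v)" by (simp add: G_def algebra_simps)
   hence "\<bar>G u-G v\<bar> <= \<bar>k u-k v\<bar> * ?z u+\<bar>k v\<bar> * \<bar>?z u-?z v\<bar>"
    using abs_triangle_ineq[of "(k u-k v) * ?z u" "k v * (?z u-?z v)"] z0(1)[OF u0] by (simp add: abs_mult)
   thus ?thesis using a b unfolding v_def[symmetric] by (simp add: algebra_simps)
  qed
  have R: "\<bar>(LBINT u:{0..real m*(1/real N)}. G u)-(\<Sum>x<m. 1/real N * G (real (Suc x)*(1/real N)))\<bar>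
    <= real m*(1/real N)*(2 * e' * ?z 0)"
   by (rule riemann_sum_error[OF dN Gc cell])
  have "real m*(1/real N)*(2 * e' * ?z 0) <= (K+3)*(2 * e' * ?z 0)"
   using mN z0(1)[of 0] e' by (intro mult_right_mono) auto
  also have "... = e * ?z 0"
  proof -
   have "c*(x/c) = x" if "c ~= 0" for c x :: real using that by simp
   from this[of "K+3" "e/2"] have "(K+3) * e' = e/2" using K(2) unfolding e'_def by linarith
   hence "2*((K+3) * e') * ?z 0 = e * ?z 0" by simp
   thus ?thesis by (simp only: mult_ac)
  qed
  finally have R': "real m*(1/real N)*(2 * e' * ?z 0) <= e * ?z 0" .
  have "pairing N k eta = (LBINT u:{0..real m*(1/real N)}. G u)"
   unfolding pairing_def set_lebesgue_integral_def G_def eps_def[symmetric]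
  proof (rule Bochner_Integration.integral_cong[OF refl])
   fix u
   show "indicator {0..} u *\<^sub>R (k u * ?z u) = indicator {0..real m*(1/real N)} u *\<^sub>R (k u * ?z u)"
    using K(1)[of u] mN by (cases "u <= real m*(1/real N)") (auto simp: indicator_def)
  qed
  moreover have "1/real N * G (real (Suc x)*(1/real N)) = k (real (Suc x)/real N)/real N * hz eps eta (Suc x)" for x
   using zeta_site[OF eta Ng(1), of "Suc x" eps] eps by (simp add: G_def)
  moreover have "?z 0 = hz eps eta 1" by (rule zeta_zero[OF eta Ng(1) eps(1)])
  ultimately show "\<bar>pairing N k eta-(\<Sum>x<m. k (real (Suc x)/real N)/real N * hz (epsN N) eta (Suc x))\<bar> <= e * hz (epsN N) eta 1"
   using R R' unfolding eps_def[symmetric] by (simp only:)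
 qed
qed

lemma first_difference:
 fixes f f' :: "real => real"
 assumes f: "!!x. (f has_real_derivative f' x) (at x)" and h: "h > 0"
  and m: "!!xi. u <= xi ==> xi <= u+h ==> \<bar>f' xi-f' u\<bar> <= m"
 shows "\<bar>f (u+h)-f u-h * f' u\<bar> <= h * m"
proof -
 obtain z where z: "z > u" "z < u+h" "f (u+h)-f u = (u+h-u) * f' z"
  using MVT2[of u "u+h" f f'] f h by auto
 have "f (u+h)-f u-h * f' u = h*(f' z-f' u)" using z(3) by (simp add: algebra_simps)
 thus ?thesis using m[of z] z h by (simp add: abs_mult)
qed

text \<open>The mean value theorem is used for the difference as a function of the step and again
  for f'. The bound is phrased through a modulus of f'' because test functions are only C^2.\<close>

lemma second_difference:
 fixes f f' f'' :: "real => real"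
 assumes f: "!!x. (f has_real_derivative f' x) (at x)" and f': "!!x. (f' has_real_derivative f'' x) (at x)"
  and h: "h > 0" and m: "!!xi. u-h <= xi ==> xi <= u+h ==> \<bar>f'' xi-f'' u\<bar> <= m"
 shows "\<bar>f (u+h)+f (u-h)-2 * f u-h^2 * f'' u\<bar> <= 2 * h^2 * m"
proof -
 let ?p = "%s. f (u+s)+f (u-s)-2 * f u-s^2 * f'' u"
 let ?p' = "%s. f' (u+s)-f' (u-s)-2 * s * f'' u"
 have "(?p has_real_derivative ?p' s) (at s)" for s
  by (rule derivative_eq_intros DERIV_chain2[OF f] | simp)+
 then obtain s where s: "s > 0" "s < h" "?p h-?p 0 = (h-0) * ?p' s"
  using MVT2[of 0 h ?p ?p'] h by blast
 obtain z where z: "z > u-s" "z < u+s" "f' (u+s)-f' (u-s) = (u+s-(u-s)) * f'' z"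
  using MVT2[of "u-s" "u+s" f' f''] f' s by auto
 have "?p' s = 2 * s*(f'' z-f'' u)" using z(3) by (simp add: algebra_simps)
 moreover have "\<bar>f'' z-f'' u\<bar> <= m" by (rule m) (use z s in auto)
 ultimately have "\<bar>?p' s\<bar> <= 2 * s * m" using s by (simp add: abs_mult)
 also have "... <= 2 * h * m" using s order_trans[OF abs_ge_zero \<open>\<bar>f'' z - f'' u\<bar> <= m\<close>] by (intro mult_right_mono) auto
 finally have "h * \<bar>?p' s\<bar> <= h*(2 * h * m)" using h by (intro mult_left_mono) auto
 thus ?thesis using s(3) h by (simp add: abs_mult power2_eq_square)
qed

lemma test_fun_support:
 assumes t: "test_fun b g g' g''"
 obtains K where "K > 0" "!!u. u >= K ==> g u = 0" "!!u. u >= K ==> g' u = 0" "!!u. u >= K ==> g'' u = 0"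
proof -
 obtain K0 where K0: "ALL u>=K0. g u = 0" using t by (auto simp: test_fun_def)
 have d: "(g has_real_derivative g' x) (at x)" "(g' has_real_derivative g'' x) (at x)" for x
  using t by (auto simp: test_fun_def)
 have g': "g' u = 0" if "u > K0" for u
 proof -
  have "((%_. 0) has_real_derivative g' u) (at u)"
   by (rule has_field_derivative_transform_within_open[OF d(1), of "{K0<..}"]) (use that K0 in auto)
  thus ?thesis using DERIV_unique DERIV_const by blast
 qed
 have g'': "g'' u = 0" if "u > K0" for u
 proof -
  have "((%_. 0) has_real_derivative g'' u) (at u)"
   by (rule has_field_derivative_transform_within_open[OF d(2), of "{K0<..}"]) (use that g' in auto)
  thus ?thesis using DERIV_unique DERIV_const by blast
 qed
 show ?thesis by (rule that[of "\<bar>K0\<bar>+1"]) (use K0 g' g'' in auto)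
qed

lemma test_fun_continuous:
 assumes "test_fun b g g' g''"
 shows "continuous_on UNIV g" "continuous_on UNIV g'" "continuous_on UNIV g''"
 using assms unfolding test_fun_def by (auto intro!: DERIV_continuous_on)

text \<open>With h = 1/N the expression is N^2 times a second difference minus N (1 - eps) times N
  times a forward difference, so the limits are g'' and \<open>beta\<close> g'.\<close>

lemma discrete_generator:
 assumes t: "test_fun beta g g' g''" and e: "e > 0"
 shows "EX N0>=1. ALL N>=N0. ALL x. 2 <= x -->
  \<bar>(real N)^2*(g (real (x-1)/real N)-(1+epsN N) * g (real x/real N)+epsN N * g (real (x+1)/real N))
  -(g'' (real x/real N)-beta * g' (real x/real N))\<bar> <= e"
proof -
 obtain K where K: "K > 0" "!!u. u >= K ==> g u = 0" "!!u. u >= K ==> g' u = 0" "!!u. u >= K ==> g'' u = 0"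
  by (rule test_fun_support[OF t]) blast
 note c = test_fun_continuous[OF t]
 have der: "(g has_real_derivative g' x) (at x)" "(g' has_real_derivative g'' x) (at x)" for x
  using t by (auto simp: test_fun_def)
 obtain B where B0: "B > 0" "ALL u>=0. \<bar>g' u\<bar> <= B"
  using bounded_support[OF c(2) K(3)] by blast
 hence B: "B > 0" "!!u. u >= 0 ==> \<bar>g' u\<bar> <= B" by auto
 \<comment> \<open>A third of e each for the second difference, the forward difference, and N (1 -
   eps) - \<open>beta\<close>; \<open>second_difference\<close> doubles its modulus, hence the
   sixth.\<close>
 define e1 where "e1 = e/6"
 define e2 where "e2 = e/(3*(Lam+1))"
 define e3 where "e3 = e/(3*(B+1))"
 have e123: "e1 > 0" "e2 > 0" "e3 > 0" using e B beta_pos by (auto simp: e1_def e2_def e3_def)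
 obtain d1 where d1: "d1 > 0" "!!u v. u \<in> {0..K+2} ==> v \<in> {0..K+2} ==> \<bar>u-v\<bar> < d1 ==> \<bar>g'' u-g'' v\<bar> <= e1"
  using uniform_modulus[OF c(3) e123(1), of 0 "K+2"] by blast
 obtain d2 where d2: "d2 > 0" "!!u v. u \<in> {0..K+2} ==> v \<in> {0..K+2} ==> \<bar>u-v\<bar> < d2 ==> \<bar>g' u-g' v\<bar> <= e2"
  using uniform_modulus[OF c(2) e123(2), of 0 "K+2"] by blast
 have ev: "\<forall>\<^sub>F N in sequentially. (1/real N < d1 & 1/real N < d2) & (\<bar>real N*(1-epsN N)-beta\<bar> < e3 & \<bar>real N*(1-epsN N)-beta\<bar> < 1) & 1 <= N"
  by (intro eventually_conj order_tendstoD(2)[OF lim_1_over_n] d1 d2 eventually_ge_at_top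
    order_tendstoD(2)[OF tendsto_rabs[OF LIM_zero[OF epsN_asymp], simplified]]) (use e123 in auto)
 then obtain N0 where N0: "N0 >= 1" "ALL N>=N0. (1/real N < d1 & 1/real N < d2) & (\<bar>real N*(1-epsN N)-beta\<bar> < e3 & \<bar>real N*(1-epsN N)-beta\<bar> < 1) & 1 <= N"
  using eventually_sequentiallyI1 by blast
 show ?thesis
 proof (intro exI[of _ N0] conjI allI impI)
  show "1 <= N0" by (rule N0(1))
  fix N x :: nat assume N: "N0 <= N" and x: "2 <= x"
  have c1: "1/real N < d1" "1/real N < d2" "\<bar>real N*(1-epsN N)-beta\<bar> < e3" "\<bar>real N*(1-epsN N)-beta\<bar> < 1" "1 <= N"
   using N0(2) N by auto
  define h where "h = 1/real N"
  define u where "u = real x * h"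
  define b where "b = real N*(1-epsN N)"
  have h: "h > 0" "h <= 1" "real N * h = 1" using c1(5) by (auto simp: h_def)
  have hu: "h <= u" using x h by (simp add: u_def)
  have hh: "real (x-1)/real N = u-h" "real x/real N = u" "real (x+1)/real N = u+h"
   using x by (auto simp: u_def h_def of_nat_diff diff_divide_distrib add_divide_distrib)
  show "\<bar>(real N)^2*(g (real (x-1)/real N)-(1+epsN N) * g (real x/real N)+epsN N * g (real (x+1)/real N))
  -(g'' (real x/real N)-beta * g' (real x/real N))\<bar> <= e"
   unfolding hh
  proof (cases "u-h >= K")
   case True
   hence "g (u-h) = 0" "g u = 0" "g (u+h) = 0" "g'' u = 0" "g' u = 0" using h K by auto
   thus "\<bar>(real N)^2*(g (u-h)-(1+epsN N) * g u+epsN N * g (u+h))-(g'' u-beta * g' u)\<bar> <= e"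
    using e by simp
  next
   case False
   have I: "xi \<in> {0..K+2}" if "u-h <= xi" "xi <= u+h" for xi
    using that False h hu by auto
   have s2: "\<bar>g (u+h)+g (u-h)-2 * g u-h^2 * g'' u\<bar> <= 2 * h^2 * e1"
   proof (rule second_difference[OF der h(1)])
    fix xi assume xi: "u-h <= xi" "xi <= u+h"
    hence "\<bar>xi-u\<bar> <= h" by auto
    thus "\<bar>g'' xi-g'' u\<bar> <= e1"
     using c1(1) by (intro d1(2) I xi) (use h in \<open>auto simp: h_def\<close>)
   qed
   have s1: "\<bar>g (u+h)-g u-h * g' u\<bar> <= h * e2"
   proof (rule first_difference[OF der(1) h(1)])
    fix xi assume xi: "u <= xi" "xi <= u+h"
    hence "\<bar>xi-u\<bar> <= h" by auto
    thus "\<bar>g' xi-g' u\<bar> <= e2"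
     using c1(2) xi by (intro d2(2) I) (use h in \<open>auto simp: h_def\<close>)
   qed
   define P where "P = g (u+h)+g (u-h)-2 * g u-h^2 * g'' u"
   define Q where "Q = g (u+h)-g u-h * g' u"
   have NN: "(real N)^2 * h^2 = 1" using h(3) by (simp add: power_mult_distrib[symmetric])
   have "\<bar>(real N)^2 * P\<bar> <= (real N)^2*(2 * h^2 * e1)" using s2 by (simp add: P_def abs_mult mult_left_mono)
   also have "... = 2 * e1*((real N)^2 * h^2)" by simp
   finally have p: "\<bar>(real N)^2 * P\<bar> <= 2 * e1" unfolding NN by simp
   have "\<bar>real N * Q\<bar> <= real N*(h * e2)" using s1 by (simp add: Q_def abs_mult mult_left_mono)
   also have "... = real N * h * e2" by simp
   finally have "\<bar>real N * Q\<bar> <= e2" unfolding h(3) by simp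
   moreover have "\<bar>b\<bar> <= Lam" using c1(4) beta_pos unfolding b_def by linarith
   ultimately have "\<bar>b\<bar> * \<bar>real N * Q\<bar> <= Lam * e2" by (intro mult_mono) (use beta_pos in auto)
   also have "... <= e/3" using e beta_pos by (simp add: e2_def field_simps)
   finally have q: "\<bar>b*(real N * Q)\<bar> <= e/3" by (simp only: abs_mult)
   have "\<bar>b-beta\<bar> * \<bar>g' u\<bar> <= e3 * B"
    by (rule mult_mono) (use c1(3) B(2)[of u] hu h e123 in \<open>auto simp: b_def\<close>)
   also have "... <= e/3" using e B by (simp add: e3_def field_simps)
   finally have r: "\<bar>(b-beta) * g' u\<bar> <= e/3" by (simp only: abs_mult)
   have "(real N)^2*(g (u-h)-(1+epsN N) * g u+epsN N * g (u+h))
    = (real N)^2*(P+h^2 * g'' u)-b*(real N*(Q+h * g' u))"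
    by (simp add: P_def Q_def b_def power2_eq_square algebra_simps)
   also have "... = (real N)^2 * P+((real N)^2 * h^2) * g'' u-b*(real N * Q)-b*((real N * h) * g' u)"
    by (simp add: algebra_simps)
   finally have "(real N)^2*(g (u-h)-(1+epsN N) * g u+epsN N * g (u+h))-(g'' u-beta * g' u)
    = (real N)^2 * P-b*(real N * Q)-(b-beta) * g' u"
    unfolding NN h(3) by (simp add: algebra_simps)
   moreover have "2 * e1 = e/3" by (simp add: e1_def)
   ultimately show "\<bar>(real N)^2*(g (u-h)-(1+epsN N) * g u+epsN N * g (u+h))-(g'' u-beta * g' u)\<bar> <= e"
    using p q r by linarith
  qed
 qed
qed

text \<open>In the scaled generator this is the coefficient of the single site at the wall, where no
  cell width compensates it. It tends to g' 0 - \<open>beta\<close> / 2 * g 0, which is zero exactly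
  by the boundary condition in \<open>test_fun\<close>.\<close>

lemma discrete_boundary:
 assumes t: "test_fun beta g g' g''"
 shows "(%N. real N*(epsN N*(g (2/real N)-g (1/real N))-(1-epsN N)/2 * g (1/real N))) \<longlonglongrightarrow> 0"
proof -
 have der: "(g has_real_derivative g' 0) (at 0)" and bc: "2 * g' 0-beta * g 0 = 0"
  using t by (auto simp: test_fun_def)
 have q: "((%h. (g h-g 0)/h) \<longlongrightarrow> g' 0) (at 0)" using der by (simp add: DERIV_def)
 have quo: "(%N. (g (c/real N)-g 0)/(c/real N)) \<longlonglongrightarrow> g' 0" if c: "c > 0" for c
 proof (rule filterlim_compose[OF q])
  have "(%N. c*(1/real N)) \<longlonglongrightarrow> c*0" by (intro tendsto_intros lim_1_over_n)
  thus "filterlim (%N. c/real N) (at 0) sequentially"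
   using c by (auto simp: filterlim_at eventually_sequentially intro!: exI[of _ 1])
 qed
 have g0: "(%N. g (1/real N)) \<longlonglongrightarrow> g 0"
  by (rule isCont_tendsto_compose[OF _ lim_1_over_n]) (rule DERIV_isCont[OF der])
 have "(%N. epsN N*(2*((g (2/real N)-g 0)/(2/real N))-(g (1/real N)-g 0)/(1/real N))
  -real N*(1-epsN N)/2 * g (1/real N)) \<longlonglongrightarrow> 1*(2 * g' 0-g' 0)-beta/2 * g 0"
  by (intro tendsto_intros quo epsN_tendsto_1 epsN_asymp g0) auto
 hence "(%N. epsN N*(2*((g (2/real N)-g 0)/(2/real N))-(g (1/real N)-g 0)/(1/real N))
  -real N*(1-epsN N)/2 * g (1/real N)) \<longlonglongrightarrow> 0"
 proof -
  have "1*(2 * g' 0-g' 0)-beta/2 * g 0 = 0" using bc by simp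
  thus "?thesis" using \<open>_ \<longlonglongrightarrow> 1 * (2 * g' 0 - g' 0) - beta / 2 * g 0\<close> by (simp only:)
 qed
 moreover have "epsN N*(2*((g (2/real N)-g 0)/(2/real N))-(g (1/real N)-g 0)/(1/real N))
  -real N*(1-epsN N)/2 * g (1/real N)
   = real N*(epsN N*(g (2/real N)-g (1/real N))-(1-epsN N)/2 * g (1/real N))" for N
 proof -
  have a: "2*(a/(2/real N)) = real N * a" "a/(1/real N) = real N * a" for a by simp_all
  show ?thesis unfolding a by (simp add: field_simps)
 qed
 ultimately show ?thesis by (simp only:)
qed

text \<open>A Riemann sum for \<open>pairing\<close>, except that \<open>lin\<close> halves the
  weight of the first site.\<close>

definition Yfun :: "nat => nat => (real => real) => nat set => real" where
 "Yfun N m g = lin (epsN N) (%x. g (real x/real N)/real N) m"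

definition sites :: "nat => real => nat" where
 "sites N K = nat \<lceil>real N * K\<rceil>"

lemma sites_bounds:
 assumes "0 <= K"
 shows "real N * K <= real (sites N K)" "real (sites N K) <= real N * K+1"
proof -
 have "0 <= real N * K" using assms by simp
 hence "0 <= \<lceil>real N * K\<rceil>" by linarith
 hence "real (sites N K) = real_of_int \<lceil>real N * K\<rceil>" by (simp add: sites_def)
 thus "real N * K <= real (sites N K)" "real (sites N K) <= real N * K+1" by linarith+
qed

lemma sum_sites_shift:
 fixes f :: "nat => real"
 shows "(\<Sum>x<Suc m. f (Suc x)) = f 1+(\<Sum>i<m. f (i+2))"
 by (simp add: sum.lessThan_Suc_shift del: sum.lessThan_Suc)

lemma Yfun_pairing:
 assumes g: "continuous_on UNIV g" and K: "!!u. u >= K ==> g u = 0" "K >= 0" and e: "e > 0"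
 shows "EX N0>=1. ALL N>=N0. ALL eta:chiR. \<bar>Yfun N (sites N K) g eta-pairing N g eta\<bar> <= e * hz (epsN N) eta 1"
proof -
 obtain B where B0: "B > 0" "ALL u>=0. \<bar>g u\<bar> <= B"
  using bounded_support[OF g K(1)] by blast
 hence B: "B > 0" "!!u. u >= 0 ==> \<bar>g u\<bar> <= B" by auto
 have e2: "e/2 > 0" using e by simp
 obtain N1 where N1: "N1 >= 1" "ALL N>=N1. ALL m. ALL eta:chiR. real N * K <= real m --> real m <= real N*(K+3) -->
  \<bar>pairing N g eta-(\<Sum>x<m. g (real (Suc x)/real N)/real N * hz (epsN N) eta (Suc x))\<bar> <= e/2 * hz (epsN N) eta 1"
  using pairing_riemann[OF g K e2] by blast
 have "(%N. B*(1/real N)) \<longlonglongrightarrow> B*0" by (intro tendsto_intros lim_1_over_n)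
 hence "\<forall>\<^sub>F N in sequentially. B*(1/real N) < e/2" by (rule order_tendstoD(2)) (use e in simp)
 then obtain N2 where N2: "ALL N>=N2. B*(1/real N) < e/2" by (auto simp: eventually_sequentially)
 show ?thesis
 proof (intro exI[of _ "max N1 N2"] conjI allI impI ballI)
  show "1 <= max N1 N2" using N1 by simp
  fix N eta assume N: "max N1 N2 <= N" and eta: "eta \<in> chiR"
  define m where "m = sites N K"
  define eps where "eps = epsN N"
  have Ng: "N >= 1" "N >= N1" "N >= N2" using N N1 by auto
  have h1: "1 <= hz eps eta 1"
   using hz_ge_1[of eps] epsN_pos[OF Ng(1)] epsN_lt_1[OF Ng(1)] by (simp add: eps_def)
  have m: "real N * K <= real (Suc m)" "real (Suc m) <= real N*(K+3)"
  proof -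
   have "1 <= real N" using Ng by simp
   thus "real N * K <= real (Suc m)" "real (Suc m) <= real N*(K+3)"
    using sites_bounds[OF K(2), of N] unfolding m_def distrib_left of_nat_Suc by linarith+
  qed
  have R: "\<bar>pairing N g eta-(\<Sum>x<Suc m. g (real (Suc x)/real N)/real N * hz eps eta (Suc x))\<bar> <= e/2 * hz eps eta 1"
   using N1(2) Ng(2) eta m unfolding eps_def by blast
  have "(\<Sum>x<Suc m. g (real (Suc x)/real N)/real N * hz eps eta (Suc x))
    = g (real 1/real N)/real N * hz eps eta 1+(\<Sum>i<m. g (real (i+2)/real N)/real N * hz eps eta (i+2))"
   by (rule sum_sites_shift[of "%x. g (real x/real N)/real N * hz eps eta x"])
  hence eq: "(\<Sum>x<Suc m. g (real (Suc x)/real N)/real N * hz eps eta (Suc x))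
    = Yfun N m g eta+g (1/real N)/real N/2 * hz eps eta 1"
   unfolding Yfun_def lin_def eps_def by simp
  have "\<bar>g (1/real N)/real N/2 * hz eps eta 1\<bar> = \<bar>g (1/real N)\<bar>*(1/real N)*(1/2) * hz eps eta 1"
   using h1 by (simp add: abs_mult)
  also have "... <= B*(1/real N)*1 * hz eps eta 1"
   using h1 B(2)[of "1/real N"] B(1) by (intro mult_mono mult_nonneg_nonneg) auto
  also have "... <= e/2 * hz eps eta 1"
   using N2 Ng(3) h1 by (intro mult_right_mono) (auto intro: less_imp_le)
  finally have Q: "\<bar>g (1/real N)/real N/2 * hz eps eta 1\<bar> <= e/2 * hz eps eta 1" .
  have "e * hz eps eta 1 = e/2 * hz eps eta 1+e/2 * hz eps eta 1" by simp
  thus "\<bar>Yfun N (sites N K) g eta-pairing N g eta\<bar> <= e * hz (epsN N) eta 1"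
   unfolding m_def[symmetric] eps_def[symmetric]
  proof -
   have "\<bar>y-p\<bar> <= c" if "\<bar>p-(y+q)\<bar> <= b" "\<bar>q\<bar> <= b" "c = b+b" for p y q b c :: real
    using that by linarith
   from this[OF R[unfolded eq] Q] show "\<bar>Yfun N m g eta-pairing N g eta\<bar> <= e * hz eps eta 1" by simp
  qed
 qed
qed

text \<open>Four errors of a quarter of e each: the coefficient at the wall, the bulk operator, the
  first term of the Riemann sum, which the bulk sum lacks, and the Riemann approximation
  itself.\<close>

lemma genR_Yfun:
 assumes t: "test_fun beta g g' g''" and K: "!!u. u >= K ==> g u = 0" "!!u. u >= K ==> g' u = 0" "!!u. u >= K ==> g'' u = 0" "K >= 0"
  and e: "e > 0"
 shows "EX N0>=1. ALL N>=N0. ALL eta:chiR. \<bar>(real N)^2 * genR (epsN N) (Yfun N (sites N K) g) eta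
 -pairing N (%u. g'' u-beta * g' u) eta\<bar> <= e * hz (epsN N) eta 1"
proof -
 let ?k = "%u. g'' u-beta * g' u"
 note c = test_fun_continuous[OF t]
 have k: "continuous_on UNIV ?k" by (intro continuous_intros c)
 have kK: "?k u = 0" if "u >= K" for u using K that by simp
 obtain B where B0: "B > 0" "ALL u>=0. \<bar>?k u\<bar> <= B"
  using bounded_support[OF k kK] by blast
 hence B: "B > 0" "!!u. u >= 0 ==> \<bar>?k u\<bar> <= B" by auto
 define e1 where "e1 = e/4"
 define e2 where "e2 = e1/(K+1)"
 have e12: "e1 > 0" "e2 > 0" using e K by (auto simp: e1_def e2_def)
 obtain N1 where N1: "N1 >= 1" "ALL N>=N1. ALL m. ALL eta:chiR. real N * K <= real m --> real m <= real N*(K+3) -->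
  \<bar>pairing N ?k eta-(\<Sum>x<m. ?k (real (Suc x)/real N)/real N * hz (epsN N) eta (Suc x))\<bar> <= e1 * hz (epsN N) eta 1"
  using pairing_riemann[OF k kK K(4) e12(1)] by blast
 obtain N2 where N2: "N2 >= 1" "ALL N>=N2. ALL x. 2 <= x -->
  \<bar>(real N)^2*(g (real (x-1)/real N)-(1+epsN N) * g (real x/real N)+epsN N * g (real (x+1)/real N))
  -?k (real x/real N)\<bar> <= e2"
  using discrete_generator[OF t e12(2)] by blast
 have "(%N. B*(1/real N)) \<longlonglongrightarrow> B*0" by (intro tendsto_intros lim_1_over_n)
 hence ev1: "\<forall>\<^sub>F N in sequentially. B*(1/real N) < e1" by (rule order_tendstoD(2)) (use e12 in simp)
 have "(%N. \<bar>real N*(epsN N*(g (2/real N)-g (1/real N))-(1-epsN N)/2 * g (1/real N))\<bar>) \<longlonglongrightarrow> 0"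
  using tendsto_rabs[OF discrete_boundary[OF t]] by simp
 from order_tendstoD(2)[OF this e12(1)]
 have ev2: "\<forall>\<^sub>F N in sequentially. \<bar>real N*(epsN N*(g (2/real N)-g (1/real N))-(1-epsN N)/2 * g (1/real N))\<bar> < e1" .
 obtain N3 where N3: "ALL N>=N3. B*(1/real N) < e1 &
   \<bar>real N*(epsN N*(g (2/real N)-g (1/real N))-(1-epsN N)/2 * g (1/real N))\<bar> < e1"
  using eventually_conj[OF ev1 ev2] by (auto simp: eventually_sequentially)
 show ?thesis
 proof (intro exI[of _ "max N1 (max N2 N3)"] conjI allI impI ballI)
  show "1 <= max N1 (max N2 N3)" using N1 by simp
  fix N eta assume N: "max N1 (max N2 N3) <= N" and eta: "eta \<in> chiR"
  define m where "m = sites N K"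
  define eps where "eps = epsN N"
  have Ng: "N >= 1" "N >= N1" "N >= N2" "N >= N3" using N N1 by auto
  have eps: "0 < eps" "eps <= 1" using epsN_pos[OF Ng(1)] epsN_lt_1[OF Ng(1)] by (auto simp: eps_def)
  define h1 where "h1 = hz eps eta 1"
  have h1: "1 <= h1" unfolding h1_def by (rule hz_ge_1[OF eps])
  have hx: "0 <= hz eps eta x" "x >= 1 ==> hz eps eta x <= h1" for x
   using hz_ge_1[OF eps, of eta x] hz_decreasing[OF eta eps, of 1 x] by (auto simp: h1_def)
  have N1': "1 <= real N" using Ng by simp
  have m: "real N * K <= real m" "real N * K <= real (Suc m)" "real (Suc m) <= real N*(K+3)" "real m <= real N*(K+1)"
   using sites_bounds[OF K(4), of N] N1' unfolding m_def distrib_left of_nat_Suc by linarith+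
  let ?al = "%x. g (real x/real N)/real N"
  have big: "g (real x/real N) = 0" if "m <= x" for x
  proof (rule K(1))
   have "real N * K <= real x" using m(1) that by linarith
   thus "K <= real x/real N" using N1' by (simp add: field_simps)
  qed
  have z: "?al (m+1) = 0" "?al (m+2) = 0" unfolding big[OF le_add1] by simp_all
  let ?D = "%x. (real N)^2*(g (real (x-1)/real N)-(1+eps) * g (real x/real N)+eps * g (real (x+1)/real N))"
  have "(real N)^2 * genR eps (Yfun N m g) eta = (real N)^2*(eps * ?al 2-(1+eps) * ?al 1/2) * h1
   +(\<Sum>i<m. (real N)^2*(?al (i+1)-(1+eps) * ?al (i+2)+eps * ?al (i+3)) * hz eps eta (i+2))"
   unfolding Yfun_def eps_def[symmetric] genR_lin[OF eta eps(1) z] h1_def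
   by (subst distrib_left) (simp only: sum_distrib_left mult.assoc)
  also have "(real N)^2*(eps * ?al 2-(1+eps) * ?al 1/2)
    = real N*(eps*(g (2/real N)-g (1/real N))-(1-eps)/2 * g (1/real N))"
   using N1' by (simp add: power2_eq_square field_simps)
  also have "(\<Sum>i<m. (real N)^2*(?al (i+1)-(1+eps) * ?al (i+2)+eps * ?al (i+3)) * hz eps eta (i+2))
    = (\<Sum>i<m. ?D (i+2)/real N * hz eps eta (i+2))"
  proof (rule sum.cong[OF refl])
   fix i :: nat
   have a: "i+2-1 = i+1" "i+2+1 = i+3" by simp_all
   show "(real N)^2*(?al (i+1)-(1+eps) * ?al (i+2)+eps * ?al (i+3)) * hz eps eta (i+2)
    = ?D (i+2)/real N * hz eps eta (i+2)"
    unfolding a by (simp add: diff_divide_distrib add_divide_distrib algebra_simps)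
  qed
  finally have gen: "(real N)^2 * genR eps (Yfun N m g) eta
    = real N*(eps*(g (2/real N)-g (1/real N))-(1-eps)/2 * g (1/real N)) * h1
    +(\<Sum>i<m. ?D (i+2)/real N * hz eps eta (i+2))" .
  have b1: "\<bar>real N*(eps*(g (2/real N)-g (1/real N))-(1-eps)/2 * g (1/real N)) * h1\<bar> <= e1 * h1"
   unfolding abs_mult[of _ h1] using N3 Ng(4) h1 by (intro mult_mono) (auto simp: eps_def intro: less_imp_le)
  have b2: "\<bar>(\<Sum>i<m. ?D (i+2)/real N * hz eps eta (i+2))-(\<Sum>i<m. ?k (real (i+2)/real N)/real N * hz eps eta (i+2))\<bar> <= e1 * h1"
  proof -
   have "\<bar>\<Sum>i<m. ?D (i+2)/real N * hz eps eta (i+2)-?k (real (i+2)/real N)/real N * hz eps eta (i+2)\<bar>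
     <= (\<Sum>i<m. e2/real N * h1)"
   proof (rule order_trans[OF sum_abs sum_mono])
    fix i
    have d: "\<bar>?D (i+2)-?k (real (i+2)/real N)\<bar> <= e2"
     using N2(2)[rule_format, of N "i+2"] Ng(3) unfolding eps_def by simp
    have "\<bar>?D (i+2)/real N * hz eps eta (i+2)-?k (real (i+2)/real N)/real N * hz eps eta (i+2)\<bar>
      = \<bar>?D (i+2)-?k (real (i+2)/real N)\<bar>/real N * hz eps eta (i+2)"
     using hx(1)[of "i+2"] by (simp only: left_diff_distrib[symmetric] diff_divide_distrib[symmetric] abs_mult abs_divide abs_of_nonneg of_nat_0_le_iff)
    also have "... <= e2/real N * h1"
     using hx[of "i+2"] e12 by (intro mult_mono divide_right_mono d) auto
    finally show "\<bar>?D (i+2)/real N * hz eps eta (i+2)-?k (real (i+2)/real N)/real N * hz eps eta (i+2)\<bar> <= e2/real N * h1" .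
   qed
   also have "... = real m/real N*(e2 * h1)" by simp
   also have "... <= (K+1)*(e2 * h1)"
    using m(4) N1' e12 h1 by (intro mult_right_mono) (auto simp: field_simps)
   also have "... = e1 * h1" using K(4) by (simp add: e2_def)
   finally show ?thesis by (simp only: sum_subtractf)
  qed
  have b3: "\<bar>?k (1/real N)/real N * h1\<bar> <= e1 * h1"
  proof -
   have "\<bar>?k (1/real N)\<bar>/real N <= B/real N" by (intro divide_right_mono B(2)) auto
   also have "... <= e1" using N3 Ng(4) by (auto intro: less_imp_le)
   finally have "\<bar>?k (1/real N)\<bar>/real N * h1 <= e1 * h1" using h1 by (intro mult_right_mono) auto
   thus ?thesis using h1 by (simp add: abs_mult)
  qed
  have b4: "\<bar>pairing N ?k eta-(\<Sum>x<Suc m. ?k (real (Suc x)/real N)/real N * hz eps eta (Suc x))\<bar> <= e1 * h1"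
   using N1(2) Ng(2) eta m unfolding eps_def h1_def by blast
  have sh: "(\<Sum>x<Suc m. ?k (real (Suc x)/real N)/real N * hz eps eta (Suc x))
    = ?k (1/real N)/real N * h1+(\<Sum>i<m. ?k (real (i+2)/real N)/real N * hz eps eta (i+2))"
   using sum_sites_shift[of "%x. ?k (real x/real N)/real N * hz eps eta x" m] unfolding h1_def by simp
  have "e1 * h1+e1 * h1+e1 * h1+e1 * h1 = e * h1" by (simp add: e1_def)
  thus "\<bar>(real N)^2 * genR (epsN N) (Yfun N (sites N K) g) eta-pairing N ?k eta\<bar> <= e * hz (epsN N) eta 1"
   using b1 b2 b3 b4 unfolding sh m_def[symmetric] eps_def[symmetric] h1_def[symmetric] gen by linarith
 qed
qed

section \<open>The discrete weak formulation\<close>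

text \<open>Let S be the supremum of exp (- 2 c s) \<phi> s. The integral contributes at most S/2
  after discounting, so S <= a + S/2. Integrability and boundedness are enough, which suits paths
  with jumps.\<close>

lemma gronwall_crude:
 fixes \<phi> :: "real => real"
 assumes c: "c > 0" and T: "T >= 0" and nn: "!!t. t \<in> {0..T} ==> 0 <= \<phi> t" and bd: "!!t. t \<in> {0..T} ==> \<phi> t <= B"
  and int: "set_integrable lborel {0..T} \<phi>"
  and le: "!!t. t \<in> {0..T} ==> \<phi> t <= a+(LBINT s:{0..t}. c * \<phi> s)"
  and t: "t \<in> {0..T}"
 shows "\<phi> t <= 2 * a * exp (2 * c * T)"
proof -
 define S where "S = (SUP s\<in>{0..T}. exp (- (2 * c * s)) * \<phi> s)"
 have B: "0 <= B" using nn[OF t] bd[OF t] by linarith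
 have bdd: "bdd_above ((%s. exp (- (2 * c * s)) * \<phi> s) ` {0..T})"
 proof (rule bdd_aboveI2)
  fix s assume s: "s \<in> {0..T}"
  have "exp (- (2 * c * s)) * \<phi> s <= 1 * B" by (rule mult_mono) (use s c bd nn in auto)
  thus "exp (- (2 * c * s)) * \<phi> s <= B" by simp
 qed
 have up: "\<phi> s <= S * exp (2 * c * s)" if s: "s \<in> {0..T}" for s
 proof -
  have "exp (- (2 * c * s)) * \<phi> s <= S" unfolding S_def by (rule cSUP_upper[OF s bdd])
  hence "exp (2 * c * s)*(exp (- (2 * c * s)) * \<phi> s) <= exp (2 * c * s) * S" by (intro mult_left_mono) auto
  moreover have "exp y*(exp (- y) * z) = z" for y z :: real by (simp add: exp_minus)
  ultimately show ?thesis by (simp only: mult.commute[of S])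
 qed
 have S0: "0 <= S" using up[of 0] nn[of 0] T by (auto intro: order_trans)
 have key: "exp (- (2 * c * s)) * \<phi> s <= a+S/2" if s: "s \<in> {0..T}" for s
 proof -
  have i1: "set_integrable lborel {0..s} (%r. c * \<phi> r)"
   by (intro set_integrable_mult_right set_integrable_subset[OF int]) (use s in auto)
  have cont: "continuous_on {0..s} (%r. c*(S * exp (2 * c * r)))" by (intro continuous_intros)
  have i2: "set_integrable lborel {0..s} (%r. c*(S * exp (2 * c * r)))"
   by (rule borel_integrable_atLeastAtMost'[OF cont])
  have "(LBINT r:{0..s}. c * \<phi> r) <= (LBINT r:{0..s}. c*(S * exp (2 * c * r)))"
   by (rule set_integral_mono[OF i1 i2]) (use up s c in auto)
  also have "... = S/2 * exp (2 * c * s)-S/2 * exp (2 * c*0)"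
   unfolding set_lebesgue_integral_def
   by (rule integral_FTC_atLeastAtMost[where F = "%r. S/2 * exp (2 * c * r)"])
    (use s c cont in \<open>auto intro!: derivative_eq_intros simp: has_real_derivative_iff_has_vector_derivative[symmetric]\<close>)
  also have "... <= S/2 * exp (2 * c * s)" using S0 by simp
  finally have "\<phi> s <= a+S/2 * exp (2 * c * s)" using le[OF s] by linarith
  moreover have "0 <= a"
   using le[of 0] nn[of 0] T set_integral_Icc_abs_le[OF set_integrable_subset[OF int, of "{0..0}"], of "\<phi> 0"] by (auto simp: set_lebesgue_integral_def)
  ultimately have "exp (- (2 * c * s)) * \<phi> s <= exp (- (2 * c * s))*(a+S/2 * exp (2 * c * s))"
   by (intro mult_left_mono) auto
  also have "... = exp (- (2 * c * s)) * a+S/2" by (simp add: distrib_left exp_minus)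
  also have "... <= 1 * a+S/2" using \<open>0 <= a\<close> s c by (intro add_right_mono mult_right_mono) auto
  finally show ?thesis by simp
 qed
 have "S <= a+S/2" unfolding S_def by (rule cSUP_least) (use T key[unfolded S_def] in auto)
 hence S2: "S <= 2 * a" by simp
 have "\<phi> t <= S * exp (2 * c * t)" by (rule up[OF t])
 also have "... <= 2 * a * exp (2 * c * T)" using S2 S0 t c by (intro mult_mono) auto
 finally show ?thesis .
qed

text \<open>Nonnegative test functions bounded below near the origin: by the Harnack inequality
 for \<open>\<zeta>\<close> such a functional controls \<open>\<zeta>(0)\<close>, hence its own drift and square bracket.\<close>
definition posfun :: "(real => real) => real => real => bool" where
 "posfun g K G \<longleftrightarrow> (ALL u>=0. 0 <= g u & g u <= G) & (ALL u:{0..1}. 1 <= g u) & (ALL u>=K. g u = 0)"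

lemma posfun_K: "posfun g K G ==> K > 1"
 and posfun_G: "posfun g K G ==> G >= 1"
proof -
 assume p: "posfun g K G"
 have g1: "1 <= g 1" "g 1 <= G" using p by (auto simp: posfun_def)
 thus "G >= 1" by linarith
 show "K > 1"
 proof (rule ccontr)
  assume "\<not> K > 1"
  hence "g 1 = 0" using p by (auto simp: posfun_def)
  thus False using g1 by simp
 qed
qed

text \<open>The factor 2 undoes the halved weight of the first site; exp \<open>Lam\<close> is the
  Harnack constant across the N sites of the unit interval.\<close>

definition C0 :: real where "C0 = 2 * exp Lam"

lemma C0_pos: "C0 > 0" by (simp add: C0_def)

definition Ngood :: "nat => bool" where
 "Ngood N \<longleftrightarrow> N >= 1 &-real N * ln (epsN N) <= Lam & real N*(1/epsN N-1) <= Lam & 1/epsN N <= 2"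

lemma eventually_Ngood: "\<forall>\<^sub>F N in sequentially. Ngood N"
proof -
 obtain N0 where "N0 >= 1" "ALL N>=N0.-real N * ln (epsN N) <= Lam & real N*(1/epsN N-1) <= Lam & 1/epsN N <= 2"
  using epsN_bounds by blast
 thus ?thesis unfolding eventually_sequentially Ngood_def by (intro exI[of _ N0]) auto
qed

section \<open>Positive functionals, truncated at level b: jumps, bracket and drift\<close>

context
 fixes N :: nat and g :: "real => real" and K G :: real
 assumes N: "Ngood N" and g: "posfun g K G"
begin

private abbreviation (input) "Y \<equiv> Yfun N (sites N K) g"
private abbreviation (input) "e \<equiv> epsN N"

lemma N1: "N >= 1" "1 <= real N" using N by (auto simp: Ngood_def)

lemma e01: "0 < e" "e <= 1" using epsN_pos[OF N1(1)] epsN_lt_1[OF N1(1)] by auto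

lemma K1: "K > 1" "G >= 1" using posfun_K[OF g] posfun_G[OF g] by auto

lemma gb: "u >= 0 ==> 0 <= g u" "u >= 0 ==> g u <= G" "0 <= u ==> u <= 1 ==> 1 <= g u"
 using g by (auto simp: posfun_def)

lemma hz_nonneg: "0 <= hz e eta x"
 using hz_ge_1[OF e01, of eta x] by linarith

lemma sites_le: "real (sites N K)+1 <= real N*(K+2)"
 using sites_bounds(2)[of K N] K1 N1(2) unfolding distrib_left by linarith

lemma N_le_sites: "N <= sites N K"
proof -
 have "real N*1 <= real N * K" using K1 by (intro mult_left_mono) auto
 hence "real N <= real (sites N K)" using sites_bounds(1)[of K N] K1 by linarith
 thus ?thesis by simp
qed

text \<open>On the sites 1, ..., N the weight function is at least 1 and, by Harnack,
  \<open>hz\<close> is at least exp (- \<open>Lam\<close>) times its value at 1; averaging over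
  these sites gives the bound.\<close>

lemma hz1_le_Y:
 assumes eta: "eta \<in> chiR"
 shows "hz e eta 1 <= C0 * Y eta"
proof -
 have eN: "exp (- Lam) <= e ^ N"
 proof -
  have "e ^ N = exp (real N * ln e)" using e01 by (simp add: exp_of_nat_mult)
  thus ?thesis using N by (simp add: Ngood_def)
 qed
 \<comment> \<open>A common lower bound for all terms: the 2 in the denominator is exact for the
   halved first site and generous elsewhere.\<close>
 have x: "exp (- Lam) * hz e eta 1/(2 * real N) <= g (real x/real N)/real N * hz e eta x/(if x = 1 then 2 else 1)"
  if x: "1 <= x" "x <= N" for x
 proof -
  have "e ^ N <= e ^ (x-1)" by (rule power_decreasing) (use x e01 in auto)
  hence "exp (- Lam) * hz e eta 1 <= e ^ (x-1) * hz e eta 1"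
   using eN hz_nonneg by (intro mult_right_mono) auto
  also have "... <= hz e eta (1+(x-1))" by (rule hz_harnack[OF eta e01])
  finally have a: "exp (- Lam) * hz e eta 1 <= hz e eta x" using x by simp
  have "1 <= g (real x/real N)" using x N1 by (intro gb) auto
  hence "1 * hz e eta x <= g (real x/real N) * hz e eta x" using hz_nonneg by (intro mult_right_mono) auto
  hence b: "exp (- Lam) * hz e eta 1 <= g (real x/real N) * hz e eta x" using a by simp
  have "exp (- Lam) * hz e eta 1/(2 * real N) <= g (real x/real N) * hz e eta x/(2 * real N)"
   using b by (rule divide_right_mono) simp
  also have "... = g (real x/real N)/real N * hz e eta x/2" by simp
  also have "... <= g (real x/real N)/real N * hz e eta x/(if x = 1 then 2 else 1)"
  proof -
   have "0 <= g (real x/real N)/real N * hz e eta x"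
    using hz_nonneg[of eta x] gb(1)[of "real x/real N"] by (intro mult_nonneg_nonneg divide_nonneg_nonneg) auto
   thus ?thesis by simp
  qed
  finally show ?thesis .
 qed
 have "exp (- Lam) * hz e eta 1/2 = real N*(exp (- Lam) * hz e eta 1/(2 * real N))" using N1 by simp
 also have "... = exp (- Lam) * hz e eta 1/(2 * real N)+(\<Sum>i<N-1. exp (- Lam) * hz e eta 1/(2 * real N))"
 proof -
  have "real N * q = q+(\<Sum>i<N-1. q)" for q :: real using N1(1) by (simp add: of_nat_diff left_diff_distrib)
  thus ?thesis .
 qed
 also have "... <= g (real 1/real N)/real N * hz e eta 1/2+(\<Sum>i<N-1. g (real (i+2)/real N)/real N * hz e eta (i+2))"
 proof (intro add_mono sum_mono)
  show "exp (- Lam) * hz e eta 1/(2 * real N) <= g (real 1/real N)/real N * hz e eta 1/2"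
   using x[of 1] N1 by simp
  fix i assume "i \<in> {..<N-1}"
  thus "exp (- Lam) * hz e eta 1/(2 * real N) <= g (real (i+2)/real N)/real N * hz e eta (i+2)"
   using x[of "i+2"] by simp
 qed
 also have "... <= g (real 1/real N)/real N * hz e eta 1/2+(\<Sum>i<sites N K. g (real (i+2)/real N)/real N * hz e eta (i+2))"
  by (intro add_left_mono sum_mono2) (use N_le_sites gb(1) hz_nonneg in auto)
 also have "... = Y eta" by (simp add: Yfun_def lin_def)
 finally have "exp (- Lam) * hz e eta 1/2 <= Y eta" .
 hence "C0*(exp (- Lam) * hz e eta 1/2) <= C0 * Y eta" using C0_pos by (intro mult_left_mono) auto
 moreover have "C0*(exp (- Lam) * hz e eta 1/2) = hz e eta 1"
 proof -
  have "exp Lam * exp (- Lam) = 1" by (rule exp_minus_inverse)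
  moreover have "C0*(exp (- Lam) * hz e eta 1/2) = (exp Lam * exp (- Lam)) * hz e eta 1" by (simp add: C0_def)
  ultimately show ?thesis by (simp only: mult_1)
 qed
 ultimately show ?thesis by linarith
qed

lemma Y_nonneg: "eta \<in> chiR ==> 0 <= Y eta"
 using hz1_le_Y[of eta] hz_nonneg[of eta 1] C0_pos by (smt (verit) mult_pos_neg)

lemma Y_le_hz1:
 assumes eta: "eta \<in> chiR"
 shows "Y eta <= (K+2) * G * hz e eta 1"
proof -
 have t: "g (real x/real N)/real N * hz e eta x <= G/real N * hz e eta 1" if "1 <= x" for x
  using gb(1,2)[of "real x/real N"] hz_decreasing[OF eta e01 that] hz_nonneg[of eta x] K1
  by (intro mult_mono divide_right_mono) auto
 have "g (real 1/real N)/real N/2 * hz e eta 1 <= g (real 1/real N)/real N * hz e eta 1"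
 proof (rule mult_right_mono[OF _ hz_nonneg])
  have "x/2 <= x" if "0 <= x" for x :: real using that by simp
  thus "g (real 1/real N)/real N/2 <= g (real 1/real N)/real N"
   by this (intro divide_nonneg_nonneg gb(1), auto)
 qed
 hence "Y eta <= G/real N * hz e eta 1+(\<Sum>i<sites N K. G/real N * hz e eta 1)"
  unfolding Yfun_def lin_def by (intro add_mono sum_mono t order_trans[OF _ t]) auto
 also have "... = (real (sites N K)+1)*(G/real N * hz e eta 1)"
  by (simp only: sum_constant card_lessThan distrib_right mult_1 add.commute)
 also have "... <= (real N*(K+2))*(G/real N * hz e eta 1)"
  using sites_le K1 hz_nonneg[of eta 1] by (intro mult_right_mono mult_nonneg_nonneg) auto
 also have "... = (K+2) * G * hz e eta 1" using N1 by simp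
 finally show ?thesis .
qed

text \<open>One term changes: a weight of order 1/N times a relative jump of \<open>hz\<close> of
  order 1/N.\<close>

lemma Y_move:
 assumes eta: "eta \<in> chiR" and r: "rate e x eta ~= 0"
 shows "\<bar>Y (move x eta)-Y eta\<bar> <= G * Lam/(real N)^2 * hz e eta 1" "sites N K < x ==> Y (move x eta) = Y eta"
proof -
 note lm = lin_move[OF eta r, of "%x. g (real x/real N)/real N" "sites N K", folded Yfun_def]
 show "sites N K < x ==> Y (move x eta) = Y eta" using lm by simp
 define a where "a = (if x = 0 then g (real 1/real N)/real N/2 else if x <= sites N K then g (real (Suc x)/real N)/real N else 0)"
 have a: "\<bar>a\<bar> <= G/real N"
  unfolding a_def using gb(1,2)[of "real 1/real N"] gb(1,2)[of "real (Suc x)/real N"] N1 K1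
  by (auto intro!: divide_right_mono simp del: of_nat_Suc) (simp add: field_simps)
 have d: "\<bar>hz e (move x eta) (Suc x)-hz e eta (Suc x)\<bar> <= (1/e-1) * hz e eta (Suc x)"
  by (rule hz_move_ratio(1)[OF eta e01 r]) simp
 also have "... <= Lam/real N * hz e eta 1"
 proof (rule mult_mono)
  show "1/e-1 <= Lam/real N" using N N1 by (simp add: Ngood_def pos_le_divide_eq mult.commute)
  show "hz e eta (Suc x) <= hz e eta 1" by (rule hz_decreasing[OF eta e01]) simp
 qed (use beta_pos hz_nonneg in auto)
 finally have d': "\<bar>hz e (move x eta) (Suc x)-hz e eta (Suc x)\<bar> <= Lam/real N * hz e eta 1" .
 have "\<bar>Y (move x eta)-Y eta\<bar> = \<bar>a\<bar> * \<bar>hz e (move x eta) (Suc x)-hz e eta (Suc x)\<bar>"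
  unfolding lm a_def by (simp only: abs_mult)
 also have "... <= G/real N*(Lam/real N * hz e eta 1)"
  by (rule mult_mono[OF a d']) (use K1 in auto)
 also have "... = G * Lam/(real N)^2 * hz e eta 1" by (simp add: power2_eq_square)
 finally show "\<bar>Y (move x eta)-Y eta\<bar> <= G * Lam/(real N)^2 * hz e eta 1" .
qed

context
 fixes b :: real
 assumes b: "b > 0"
begin

private abbreviation (input) "F \<equiv> (%eta. min (Yfun N (sites N K) g eta) b)"
private abbreviation (input) "\<kappa> \<equiv> G * Lam*(2 * C0 * b)"

lemma F_bounds: "eta \<in> chiR ==> 0 <= F eta" "eta \<in> chiR ==> \<bar>F eta\<bar> <= b"
 using Y_nonneg[of eta] b by (auto simp: min_def)

lemma kappa_nonneg: "0 <= \<kappa>"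
 using K1 beta_pos C0_pos b by (intro mult_nonneg_nonneg) auto

text \<open>If both values of \<open>Y\<close> are at least b, the minimum does not change.
  Otherwise \<open>hz\<close> at 1 is at most 2 C0 b; the 2 covers the case that only the
  configuration after the move lies below b, through 1/eps <= 2.\<close>

lemma F_move:
 assumes eta: "eta \<in> chiR" and r: "rate e x eta ~= 0"
 shows "\<bar>F (move x eta)-F eta\<bar> <= \<kappa>/(real N)^2"
proof (cases "Y eta < b \<or> Y (move x eta) < b")
 case True
 have "hz e eta 1 <= 2*(C0 * b)"
 proof (cases "Y eta < b")
  case True
  have "C0 * Y eta <= C0 * b" using True C0_pos by (intro mult_left_mono) auto
  moreover have "0 <= C0 * b" using C0_pos b by simp
  ultimately show ?thesis using hz1_le_Y[OF eta] by linarith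
 next
  case False
  have y: "Y (move x eta) < b" using True False by simp
  have "hz e eta 1 <= 1/e * hz e (move x eta) 1" by (rule hz_move_ratio(2)[OF eta e01 r]) simp
  also have "... <= 2 * hz e (move x eta) 1" using N hz_nonneg by (intro mult_right_mono) (auto simp: Ngood_def)
  also have "... <= 2*(C0 * Y (move x eta))" using hz1_le_Y[OF move_chiR[OF eta], of x] by simp
  also have "... <= 2*(C0 * b)" using y C0_pos by (intro mult_left_mono) auto
  finally show ?thesis .
 qed
 hence "G * Lam/(real N)^2 * hz e eta 1 <= G * Lam/(real N)^2*(2*(C0 * b))"
  using K1 beta_pos by (intro mult_left_mono) auto
 hence "\<bar>Y (move x eta)-Y eta\<bar> <= \<kappa>/(real N)^2"
  using Y_move(1)[OF eta r] by (simp add: mult.assoc)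
 moreover have "\<bar>F (move x eta)-F eta\<bar> <= \<bar>Y (move x eta)-Y eta\<bar>" by (simp add: min_def)
 ultimately show ?thesis by linarith
next
 case False
 hence "F (move x eta) = b" "F eta = b" by (auto simp: min_def)
 thus ?thesis using kappa_nonneg by simp
qed

lemma sum_moves_bound:
 fixes t :: "nat => real"
 assumes z: "!!x. sites N K < x ==> t x = 0" and le: "!!x. \<bar>t x\<bar> <= B"
 shows "\<bar>\<Sum>x\<le>n+sites N K. t x\<bar> <= (real (sites N K)+1) * B"
proof -
 have "(\<Sum>x\<le>n+sites N K. t x) = (\<Sum>x\<le>sites N K. t x)"
  by (rule sum.mono_neutral_right) (use z in auto)
 also have "\<bar>...\<bar> <= (\<Sum>x\<le>sites N K. B)" by (rule order_trans[OF sum_abs sum_mono]) (use le in auto)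
 also have "... = (real (sites N K)+1) * B" by (simp add: algebra_simps)
 finally show ?thesis .
qed

text \<open>Of order N active moves, each with a squared jump of order N^-4, times the speed N^2:
  this is the smallness that makes the martingale part vanish.\<close>

lemma F_carre:
 assumes eta: "eta \<in> chiR"
 shows "(real N)^2 * carre e F eta <= (K+2) * \<kappa>^2/real N"
proof -
 obtain n0 where n0: "eta \<subseteq> {..n0}" using eta by (rule chiR_bounded)
 hence n: "eta \<subseteq> {..n0+sites N K}" by auto
 have "\<bar>carre e F eta\<bar> <= (real (sites N K)+1)*(\<kappa>/(real N)^2)^2"
  unfolding carre_sum[OF n]
 proof (rule sum_moves_bound)
  fix x
  show "rate e x eta*(F (move x eta)-F eta)^2 = 0" if "sites N K < x"
   using Y_move(2)[OF eta _ that] by (cases "rate e x eta = 0") auto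
  show "\<bar>rate e x eta*(F (move x eta)-F eta)^2\<bar> <= (\<kappa>/(real N)^2)^2"
  proof (cases "rate e x eta = 0")
   case False
   have "\<bar>F (move x eta)-F eta\<bar>^2 <= (\<kappa>/(real N)^2)^2" by (rule power_mono[OF F_move[OF eta False]]) simp
   hence "(F (move x eta)-F eta)^2 <= (\<kappa>/(real N)^2)^2" by simp
   moreover have "\<bar>rate e x eta\<bar> <= 1" using rate_bounds[of e x eta] e01 by simp
   ultimately have "\<bar>rate e x eta\<bar>*(F (move x eta)-F eta)^2 <= 1*(\<kappa>/(real N)^2)^2"
    by (intro mult_mono) auto
   thus ?thesis by (simp add: abs_mult)
  qed simp
 qed
 also have "... <= (real N*(K+2))*(\<kappa>/(real N)^2)^2"
  using sites_le by (intro mult_right_mono) auto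
 finally have "(real N)^2 * carre e F eta <= (real N)^2*((real N*(K+2))*(\<kappa>/(real N)^2)^2)"
  by (intro mult_left_mono) auto
 also have "... = (K+2) * \<kappa>^2/real N" using N1 by (simp add: power2_eq_square)
 finally show ?thesis .
qed

text \<open>The bound grows like N. It is only used at fixed N, to bring the truncated functional
  under the martingale lemmas.\<close>

lemma F_generator_bound:
 assumes eta: "eta \<in> chiR"
 shows "\<bar>(real N)^2 * genR e F eta\<bar> <= (real N)^2*((real (sites N K)+1)*(\<kappa>/(real N)^2))"
proof -
 obtain n0 where n0: "eta \<subseteq> {..n0}" using eta by (rule chiR_bounded)
 hence n: "eta \<subseteq> {..n0+sites N K}" by auto
 have "\<bar>genR e F eta\<bar> <= (real (sites N K)+1)*(\<kappa>/(real N)^2)"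
  unfolding genR_sum[OF n]
 proof (rule sum_moves_bound)
  fix x
  show "rate e x eta*(F (move x eta)-F eta) = 0" if "sites N K < x"
   using Y_move(2)[OF eta _ that] by (cases "rate e x eta = 0") auto
  show "\<bar>rate e x eta*(F (move x eta)-F eta)\<bar> <= \<kappa>/(real N)^2"
  proof (cases "rate e x eta = 0")
   case False
   have "\<bar>rate e x eta\<bar> <= 1" using rate_bounds[of e x eta] e01 by simp
   hence "\<bar>rate e x eta\<bar> * \<bar>F (move x eta)-F eta\<bar> <= 1*(\<kappa>/(real N)^2)"
    by (intro mult_mono F_move[OF eta False]) auto
   thus ?thesis by (simp add: abs_mult)
  qed (use kappa_nonneg in simp)
 qed
 hence "(real N)^2 * \<bar>genR e F eta\<bar> <= (real N)^2*((real (sites N K)+1)*(\<kappa>/(real N)^2))"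
  by (rule mult_left_mono) simp
 thus ?thesis by (simp only: abs_mult abs_power2)
qed

text \<open>Truncation from above only helps: below b the minimum increases by at most what
  \<open>Y\<close> does, and at level b no move increases it.\<close>

lemma F_drift:
 assumes eta: "eta \<in> chiR" and C: "C >= 0" and d: "(real N)^2 * genR e Y eta <= C * Y eta"
 shows "(real N)^2 * genR e F eta <= C * F eta"
proof -
 obtain n where n: "eta \<subseteq> {..n}" using eta by (rule chiR_bounded)
 show ?thesis
 proof (cases "Y eta < b")
  case True
  have "genR e F eta <= genR e Y eta" unfolding genR_sum[OF n]
   by (intro sum_mono mult_left_mono rate_bounds) (use True e01 in \<open>auto simp: min_def\<close>)
  hence "(real N)^2 * genR e F eta <= (real N)^2 * genR e Y eta" by (intro mult_left_mono) auto
  moreover have "F eta = Y eta" using True by simp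
  ultimately show ?thesis using d by simp
 next
  case False
  have "genR e F eta <= (\<Sum>x\<le>n. 0)" unfolding genR_sum[OF n]
   by (intro sum_mono mult_nonneg_nonpos rate_bounds) (use False e01 in \<open>auto simp: min_def\<close>)
  hence "(real N)^2 * genR e F eta <= 0" by (simp add: mult_nonneg_nonpos)
  moreover have "0 <= C * F eta" using C F_bounds(1)[OF eta] by (intro mult_nonneg_nonneg)
  ultimately show ?thesis by linarith
 qed
qed

text \<open>For N large one move at most doubles \<open>Y\<close>, so from below b/2 neither the
  configuration nor its neighbours feel the truncation.\<close>

lemma F_exact:
 assumes eta: "eta \<in> chiR" and Yb: "Y eta <= b/2" and big: "G * Lam * C0 <= (real N)^2"
 shows "genR e F eta = genR e Y eta"
proof -
 obtain n where n: "eta \<subseteq> {..n}" using eta by (rule chiR_bounded)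
 show ?thesis unfolding genR_sum[OF n]
 proof (rule sum.cong[OF refl])
  fix x
  show "rate e x eta*(F (move x eta)-F eta) = rate e x eta*(Y (move x eta)-Y eta)"
  proof (cases "rate e x eta = 0")
   case False
   have "G * Lam/(real N)^2 * hz e eta 1 <= G * Lam/(real N)^2*(C0 * Y eta)"
    using K1 beta_pos by (intro mult_left_mono hz1_le_Y[OF eta]) auto
   also have "... = (G * Lam * C0/(real N)^2) * Y eta" by simp
   also have "... <= 1 * Y eta"
    using big N1 by (intro mult_right_mono Y_nonneg[OF eta]) (auto simp: divide_le_eq)
   finally have "Y (move x eta) <= b" using Y_move(1)[OF eta False] Yb by linarith
   moreover have "Y eta <= b" using Yb b by simp
   ultimately show ?thesis by (simp add: min_absorb1)
  qed simp
 qed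
qed

end

end

text \<open>Probability tending to one, expressed through measurable exceptional sets; P itself need
  not be measurable, which fits suprema over uncountable time sets and
  \<open>outer_prob\<close>.\<close>

definition prob_event :: "(nat => 'w measure) => (nat => 'w => bool) => bool" where
 "prob_event M P \<longleftrightarrow> (ALL p>0. EX N0>=1. ALL N>=N0. EX E:sets (M N). measure (M N) E <= p & (ALL xi:space (M N)-E. P N xi))"

lemma pairing_bound:
 assumes N: "N >= 1" and eta: "eta \<in> chiR" and k: "continuous_on UNIV k" and K: "!!u. u >= K ==> k u = 0" "K >= 0"
  and B: "!!u. u >= 0 ==> \<bar>k u\<bar> <= B"
 shows "\<bar>pairing N k eta\<bar> <= B * K * hz (epsN N) eta 1"
proof -
 have e: "0 < epsN N" "epsN N <= 1" using epsN_pos[OF N] epsN_lt_1[OF N] by auto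
 have z: "\<bar>zeta N (epsN N) eta u\<bar> <= hz (epsN N) eta 1" if "0 <= u" for u
  using zeta_harnack(1)[OF eta N that order_refl e] zeta_harnack(2)[OF eta N order_refl that e] zeta_zero[OF eta N e(1)] by simp
 have "pairing N k eta = (LBINT u:{0..K}. k u * zeta N (epsN N) eta u)"
  unfolding pairing_def set_lebesgue_integral_def
 proof (rule Bochner_Integration.integral_cong[OF refl])
  fix u
  show "indicator {0..} u *\<^sub>R (k u * zeta N (epsN N) eta u) = indicator {0..K} u *\<^sub>R (k u * zeta N (epsN N) eta u)"
   using K(1)[of u] by (cases "u <= K") (auto simp: indicator_def)
 qed
 also have "\<bar>...\<bar> <= (B * hz (epsN N) eta 1)*(K-0)"
 proof (rule set_integral_Icc_abs_le)
  have "continuous_on {0..K} (%u. k u * zeta N (epsN N) eta u)"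
   by (intro continuous_intros continuous_on_subset[OF k] continuous_on_subset[OF zeta_continuous[OF eta N]]) auto
  thus "set_integrable lborel {0..K} (%u. k u * zeta N (epsN N) eta u)" by (rule borel_integrable_atLeastAtMost')
  show "\<bar>k u * zeta N (epsN N) eta u\<bar> <= B * hz (epsN N) eta 1" if "u \<in> {0..K}" for u
   unfolding abs_mult by (rule mult_mono[OF B z]) (use that B[of 0] in auto)
 qed (use K in auto)
 finally show ?thesis by (simp add: mult_ac)
qed

text \<open>The maximal inequality is applied to the truncation at b, whose drift is at most
  \<open>cc\<close> times itself, so Gronwall bounds it by b/2. Hence the truncation was never
  active, and the martingale estimate is one for \<open>Y\<close> itself. The level b does not
  depend on the accuracy d.\<close>

lemma good_event:
 fixes M :: "nat => 'w measure" and X :: "nat => real => 'w => nat set" and \<nu> :: "nat => nat set pmf"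
 assumes process: "ALL N>=1. solves_MP (M N) (X N) (%f eta. (real N)^2 * genR (epsN N) f eta) (\<nu> N)"
  and t: "test_fun beta g g' g''" and p: "posfun g K G"
  and K: "!!u. u >= K ==> g' u = 0" "!!u. u >= K ==> g'' u = 0"
  and T: "T > 0" and B0: "B0 > 0"
 shows "EX b. ALL d>0. prob_event M (%N xi. Yfun N (sites N K) g (X N 0 xi) <= B0 --> (ALL t:{0..T}. Yfun N (sites N K) g (X N t xi) <= b &
   \<bar>Yfun N (sites N K) g (X N t xi)-Yfun N (sites N K) g (X N 0 xi)
   -(LBINT s:{0..t}. (real N)^2 * genR (epsN N) (Yfun N (sites N K) g) (X N s xi))\<bar> <= d))"
proof -
 let ?k = "%u. g'' u-beta * g' u"
 note ct = test_fun_continuous[OF t]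
 have k: "continuous_on UNIV ?k" by (intro continuous_intros ct)
 have kK: "?k u = 0" if "u >= K" for u using K that by simp
 have gK: "g u = 0" if "u >= K" for u using p that by (simp add: posfun_def)
 have K1: "K > 1" "K >= 0" "G >= 1" using posfun_K[OF p] posfun_G[OF p] by auto
 obtain Bk where Bk: "Bk > 0" "ALL u>=0. \<bar>?k u\<bar> <= Bk" using bounded_support[OF k kK] by blast
 \<comment> \<open>The drift of \<open>Y\<close> is at most (1 + Bk K) \<open>hz\<close> at 1, where
   the 1 is the error of \<open>genR_Yfun\<close>; C0 converts \<open>hz\<close> back into
   \<open>Y\<close>.\<close>
 define cc where "cc = (1+Bk * K) * C0"
 have cc: "cc > 0" using Bk K1 C0_pos by (auto simp: cc_def intro!: mult_pos_pos add_pos_nonneg)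
 \<comment> \<open>Twice the Gronwall bound 2 (B0 + d) exp (2 cc T) for d <= 1; this is why d is
   capped at 1 below.\<close>
 define b where "b = 4*(B0+1) * exp (2 * cc * T)"
 have b: "b > 0" using B0 by (simp add: b_def)
 obtain N1 where N1: "N1 >= 1" "ALL N>=N1. ALL eta:chiR. \<bar>(real N)^2 * genR (epsN N) (Yfun N (sites N K) g) eta-pairing N ?k eta\<bar>
   <= 1 * hz (epsN N) eta 1"
  using genR_Yfun[OF t gK K(1,2) K1(2), of 1] by auto
 define \<kappa> where "\<kappa> = G * Lam*(2 * C0 * b)"
 show ?thesis
 proof (intro exI[of _ "b/2"] allI impI, unfold prob_event_def, intro allI impI)
  fix d0 pr :: real assume d0: "d0 > 0" and pr: "pr > 0"
  define d where "d = min d0 1"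
  have d: "d > 0" "d <= 1" "d <= d0" using d0 by (auto simp: d_def)
  have "(%N. 2 * sqrt (2*((K+2) * \<kappa>^2*(1/real N)) * T)/d) \<longlonglongrightarrow> 2 * sqrt (2*((K+2) * \<kappa>^2*0) * T)/d"
   by (intro tendsto_intros lim_1_over_n) (use d in auto)
  hence "(%N. 2 * sqrt (2*((K+2) * \<kappa>^2/real N) * T)/d) \<longlonglongrightarrow> 0" by simp
  from order_tendstoD(2)[OF this pr]
  have ev1: "\<forall>\<^sub>F N in sequentially. 2 * sqrt (2*((K+2) * \<kappa>^2/real N) * T)/d < pr" .
  have "(%N. G * Lam * C0*(1/real N)) \<longlonglongrightarrow> G * Lam * C0*0" by (intro tendsto_intros lim_1_over_n)
  hence ev2: "\<forall>\<^sub>F N in sequentially. G * Lam * C0*(1/real N) < 1" by (rule order_tendstoD(2)) simp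
  have ev: "\<forall>\<^sub>F N in sequentially. (2 * sqrt (2*((K+2) * \<kappa>^2/real N) * T)/d < pr & G * Lam * C0*(1/real N) < 1) & Ngood N & N1 <= N"
   by (intro eventually_conj ev1 ev2 eventually_Ngood eventually_ge_at_top)
  then obtain N0 where N0: "N0 >= 1" "ALL N>=N0. (2 * sqrt (2*((K+2) * \<kappa>^2/real N) * T)/d < pr & G * Lam * C0*(1/real N) < 1) & Ngood N & N1 <= N"
   using eventually_sequentiallyI1 by blast
  show "EX N0>=1. ALL N>=N0. EX E:sets (M N). measure (M N) E <= pr &
   (ALL xi:space (M N)-E. Yfun N (sites N K) g (X N 0 xi) <= B0 --> (ALL t:{0..T}. Yfun N (sites N K) g (X N t xi) <= b/2 &
   \<bar>Yfun N (sites N K) g (X N t xi)-Yfun N (sites N K) g (X N 0 xi)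
   -(LBINT s:{0..t}. (real N)^2 * genR (epsN N) (Yfun N (sites N K) g) (X N s xi))\<bar> <= d0))"
  proof (intro exI[of _ N0] conjI allI impI)
   fix N assume N: "N0 <= N"
   have Ng: "Ngood N" "N1 <= N" "2 * sqrt (2*((K+2) * \<kappa>^2/real N) * T)/d < pr" "G * Lam * C0*(1/real N) < 1"
    using N0(2) N by auto
   have N1': "N >= 1" "1 <= real N" using Ng(1) by (auto simp: Ngood_def)
   have big: "G * Lam * C0 <= (real N)^2"
   proof -
    have "G * Lam * C0 < real N" using Ng(4) N1' by (simp add: divide_less_eq)
    moreover have "real N*1 <= real N * real N" using N1' by (intro mult_left_mono) auto
    ultimately show ?thesis by (simp add: power2_eq_square)
   qed
   interpret ex: exclusion_MP "M N" "X N" "(real N)^2" "epsN N" "\<nu> N"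
    by unfold_locales (use process N1' epsN_pos[OF N1'(1)] epsN_lt_1[OF N1'(1)] in auto)
   let ?Y = "Yfun N (sites N K) g"
   let ?F = "%eta. min (?Y eta) b"
   let ?L = "%f eta. (real N)^2 * genR (epsN N) f eta"
   define C where "C = (real N)^2*((real (sites N K)+1)*(\<kappa>/(real N)^2))"
   have Fb: "\<bar>?F eta\<bar> <= b" if "eta \<in> chiR" for eta by (rule F_bounds(2)[OF Ng(1) p b that])
   have Fn: "0 <= ?F eta" if "eta \<in> chiR" for eta by (rule F_bounds(1)[OF Ng(1) p b that])
   have FC: "\<bar>?L ?F eta\<bar> <= C" if "eta \<in> chiR" for eta
    unfolding C_def \<kappa>_def by (rule F_generator_bound[OF Ng(1) p b that])
   have Fg: "(real N)^2 * carre (epsN N) ?F eta <= (K+2) * \<kappa>^2/real N" if "eta \<in> chiR" for eta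
    unfolding \<kappa>_def by (rule F_carre[OF Ng(1) p b that])
   have LY: "?L ?Y eta <= cc * ?Y eta" if eta: "eta \<in> chiR" for eta
   proof -
    have "\<bar>pairing N ?k eta\<bar> <= Bk * K * hz (epsN N) eta 1"
     by (rule pairing_bound[OF N1'(1) eta k kK K1(2)]) (use Bk in auto)
    moreover have "\<bar>?L ?Y eta-pairing N ?k eta\<bar> <= 1 * hz (epsN N) eta 1" using N1(2) Ng(2) eta by blast
    ultimately have "?L ?Y eta <= (1+Bk * K) * hz (epsN N) eta 1" unfolding distrib_right by linarith
    also have "... <= (1+Bk * K)*(C0 * ?Y eta)"
     by (rule mult_left_mono[OF hz1_le_Y[OF Ng(1) p eta]]) (use Bk K1 in simp)
    finally show ?thesis by (simp add: cc_def mult.assoc)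
   qed
   have LF: "?L ?F eta <= cc * ?F eta" if "eta \<in> chiR" for eta
    by (rule F_drift[OF Ng(1) p b that _ LY[OF that]]) (use cc in simp)
   have "EX E:sets (M N). measure (M N) E <= 2 * sqrt (2*((K+2) * \<kappa>^2/real N) * T)/d &
     (ALL xi:space (M N)-E. ALL t:{0..T}. \<bar>ex.mart ?F t xi\<bar> <= d)"
    by (rule ex.mart_maximal[OF Fb FC Fg T d(1)])
   then obtain E where E: "E \<in> sets (M N)" "measure (M N) E <= 2 * sqrt (2*((K+2) * \<kappa>^2/real N) * T)/d"
     "ALL xi:space (M N)-E. ALL t:{0..T}. \<bar>ex.mart ?F t xi\<bar> <= d" by blast
   show "EX E:sets (M N). measure (M N) E <= pr &
    (ALL xi:space (M N)-E. Yfun N (sites N K) g (X N 0 xi) <= B0 --> (ALL t:{0..T}. Yfun N (sites N K) g (X N t xi) <= b/2 &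
    \<bar>Yfun N (sites N K) g (X N t xi)-Yfun N (sites N K) g (X N 0 xi)
    -(LBINT s:{0..t}. (real N)^2 * genR (epsN N) (Yfun N (sites N K) g) (X N s xi))\<bar> <= d0))"
   proof (rule bexI[OF _ E(1)], rule conjI, use E(2) Ng(3) in linarith, rule ballI, rule impI)
    fix xi assume xiE: "xi \<in> space (M N)-E" and init: "?Y (X N 0 xi) <= B0"
    have xi: "xi \<in> space (M N)" using xiE by simp
    have mart: "\<bar>ex.mart ?F s xi\<bar> <= d" if "s \<in> {0..T}" for s using E(3) xiE that by blast
    have ch: "X N s xi \<in> chiR" if "0 <= s" for s by (rule ex.X_chiR[OF that xi])
    have intF: "set_integrable lborel {0..s} (%r. ?F (X N r xi))" for s
     by (rule ex.path_integrable[OF order_refl xi, of ?F, OF Fb])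
    have gron: "?F (X N s xi) <= 2*(B0+d) * exp (2 * cc * T)" if s: "s \<in> {0..T}" for s
    proof (rule gronwall_crude[where \<phi> = "%s. ?F (X N s xi)" and B = b, OF cc _ _ _ intF _ s])
     fix r assume r: "r \<in> {0..T}"
     have cr: "X N r xi \<in> chiR" using ch r by simp
     show "0 <= ?F (X N r xi)" by (rule Fn[OF cr])
     show "?F (X N r xi) <= b" by simp
     have "(LBINT q:{0..r}. ?L ?F (X N q xi)) <= (LBINT q:{0..r}. cc * ?F (X N q xi))"
      by (rule set_integral_mono[OF ex.path_integrable[OF order_refl xi, of "?L ?F", OF FC] set_integrable_mult_right[OF intF]])
       (use LF ch in auto)
     thus "?F (X N r xi) <= (B0+d)+(LBINT q:{0..r}. cc * ?F (X N q xi))"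
      using mart[OF r] init unfolding ex.mart_def by (simp add: min_def split: if_splits)
    qed (use T in auto)
    have half: "2*(B0+d) * exp (2 * cc * T) <= b/2"
    proof -
     have "2*(B0+d) * exp (2 * cc * T) <= 2*(B0+1) * exp (2 * cc * T)" using d by (intro mult_right_mono) auto
     thus ?thesis by (simp add: b_def)
    qed
    have Yb: "?Y (X N s xi) <= b/2" if "s \<in> {0..T}" for s
     using gron[OF that] half b by (auto simp: min_def split: if_splits)
    show "ALL t:{0..T}. ?Y (X N t xi) <= b/2 & \<bar>?Y (X N t xi)-?Y (X N 0 xi)-(LBINT s:{0..t}. ?L ?Y (X N s xi))\<bar> <= d0"
    proof (intro ballI conjI)
     fix t assume t: "t \<in> {0..T}"
     show "?Y (X N t xi) <= b/2" by (rule Yb[OF t])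
     \<comment> \<open>Here the truncation is removed: along the whole path \<open>Y\<close> is at
       most b/2, so both generators agree.\<close>
     have "(LBINT s:{0..t}. ?L ?Y (X N s xi)) = (LBINT s:{0..t}. ?L ?F (X N s xi))"
      by (rule set_lebesgue_integral_cong) (use F_exact[OF Ng(1) p b ch Yb big] t in auto)
     moreover have "?F (X N t xi) = ?Y (X N t xi)" "?F (X N 0 xi) = ?Y (X N 0 xi)"
      using Yb[OF t] Yb[of 0] T b by (auto simp: min_def)
     ultimately show "\<bar>?Y (X N t xi)-?Y (X N 0 xi)-(LBINT s:{0..t}. ?L ?Y (X N s xi))\<bar> <= d0"
      using mart[OF t] d(3) unfolding ex.mart_def by (simp only:)
    qed
   qed
  qed (rule N0(1))
 qed
qed

section \<open>Explicit test functions\<close>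

lemma DERIV_pos_power:
 "((%z::real. (max 0 z) ^ Suc (Suc n)) has_real_derivative real (Suc (Suc n))*(max 0 z) ^ Suc n) (at z)"
proof -
 consider "z > 0" | "z < 0" | "z = 0" by linarith
 thus ?thesis
 proof cases
  case 1
  have "((%z::real. z ^ Suc (Suc n)) has_real_derivative real (Suc (Suc n)) * z ^ Suc n) (at z)"
   using DERIV_pow[of "Suc (Suc n)" z] by simp
  hence "((%z::real. (max 0 z) ^ Suc (Suc n)) has_real_derivative real (Suc (Suc n)) * z ^ Suc n) (at z)"
   by (rule has_field_derivative_transform_within_open[of _ _ _ "{0<..}"]) (use 1 in auto)
  thus ?thesis using 1 by simp
 next
  case 2
  have "((%z::real. (0::real)) has_real_derivative 0) (at z)" by simp
  hence "((%z::real. (max 0 z) ^ Suc (Suc n)) has_real_derivative 0) (at z)"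
   by (rule has_field_derivative_transform_within_open[of _ _ _ "{..<0}"]) (use 2 in auto)
  thus ?thesis using 2 by simp
 next
  case 3
  have "((%h::real. (max 0 (0+h) ^ Suc (Suc n)-max 0 0 ^ Suc (Suc n))/h) \<longlongrightarrow> 0) (at 0)"
  proof (rule Lim_null_comparison)
   have "\<forall>\<^sub>F h in at 0. h ~= (0::real)" by (simp add: eventually_at_filter)
   thus "\<forall>\<^sub>F h in at 0. norm ((max 0 (0+h) ^ Suc (Suc n)-max 0 0 ^ Suc (Suc n))/h) <= \<bar>h::real\<bar> ^ Suc n"
   proof eventually_elim
    case (elim h)
    show ?case
    proof (cases "h > 0")
     case True
     thus ?thesis by (simp add: abs_mult)
    next
     case False
     hence "max 0 (0+h) = 0" by simp
     thus ?thesis by (simp del: power_Suc add: power_0_Suc)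
    qed
   qed
   have "((%h::real. \<bar>h\<bar> ^ Suc n) \<longlongrightarrow> \<bar>0\<bar> ^ Suc n) (at 0)" by (intro tendsto_intros)
   thus "((%h::real. \<bar>h\<bar> ^ Suc n) \<longlongrightarrow> 0) (at 0)" by simp
  qed
  thus ?thesis using 3 by (simp add: DERIV_def)
 qed
qed

lemma DERIV_pos_power_chain:
 assumes "(q has_real_derivative q') (at x)"
 shows "((%x. (max 0 (q x)) ^ Suc (Suc n)) has_real_derivative real (Suc (Suc n))*(max 0 (q x)) ^ Suc n * q') (at x)"
 by (rule DERIV_chain2[OF DERIV_pos_power assms])

text \<open>The factor exp (b u/2) turns the Robin condition into the Neumann condition \<phi>' 0 =
  0.\<close>

lemma test_fun_of_even:
 assumes d1: "!!x. (\<phi> has_real_derivative \<phi>' x) (at x)" and d2: "!!x. (\<phi>' has_real_derivative \<phi>'' x) (at x)"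
  and c: "continuous_on UNIV \<phi>''" and K: "!!u. u >= K ==> \<phi> u = 0" and z: "\<phi>' 0 = 0"
 shows "test_fun b (%u. exp (b * u/2) * \<phi> u) (%u. exp (b * u/2)*(b/2 * \<phi> u+\<phi>' u))
  (%u. exp (b * u/2)*(b^2/4 * \<phi> u+b * \<phi>' u+\<phi>'' u))"
proof -
 have c0: "continuous_on UNIV \<phi>" "continuous_on UNIV \<phi>'" using d1 d2 by (auto intro!: DERIV_continuous_on)
 have e: "((%u. exp (b * u/2)) has_real_derivative (b/2) * exp (b * x/2)) (at x)" for x
  by (auto intro!: derivative_eq_intros)
 show ?thesis unfolding test_fun_def
 proof (intro conjI allI)
  fix x
  show "((%u. exp (b * u/2) * \<phi> u) has_real_derivative exp (b * x/2)*(b/2 * \<phi> x+\<phi>' x)) (at x)"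
   by (rule DERIV_cong[OF DERIV_mult[OF e d1]]) (simp add: algebra_simps)
  have "((%u. b/2 * \<phi> u+\<phi>' u) has_real_derivative b/2 * \<phi>' x+\<phi>'' x) (at x)"
   by (intro DERIV_add DERIV_cmult d1 d2)
  from DERIV_mult[OF e this]
  show "((%u. exp (b * u/2)*(b/2 * \<phi> u+\<phi>' u)) has_real_derivative
    exp (b * x/2)*(b^2/4 * \<phi> x+b * \<phi>' x+\<phi>'' x)) (at x)"
   by (rule DERIV_cong) (simp add: field_simps power2_eq_square)
 next
  show "continuous_on UNIV (%u. exp (b * u/2)*(b^2/4 * \<phi> u+b * \<phi>' u+\<phi>'' u))"
   by (intro continuous_intros c c0) auto
  show "EX K. ALL u>=K. exp (b * u/2) * \<phi> u = 0" using K by (intro exI[of _ K]) auto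
 qed (simp add: z)
qed

text \<open>Take exp (beta u/2) times c (1 - a u^2)_+^3: the cube of a positive part is C^2,
  evenness gives the boundary condition, and a = 1/(4 R^2) puts the zero at 2 R.\<close>

lemma ex_posfun:
 fixes R \<kappa> :: real
 assumes R: "R >= 1" and k: "\<kappa> >= 1"
 shows "EX h h' h'' G. test_fun beta h h' h'' & (ALL u>=0. 0 <= h u & h u <= G) & (ALL u:{0..R}. \<kappa> <= h u)
  & (ALL u>=2*R. h u = 0 & h' u = 0 & h'' u = 0)"
proof -
 define a where "a = 1/(4 * R^2)"
 define q where "q u = 1-a * u^2" for u :: real
 define q' where "q' u = - (2 * a * u)" for u :: real
 define q'' :: real where "q'' = - (2 * a)"
 have a: "a > 0" "a * R^2 = 1/4" using R by (auto simp: a_def)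
 have dq: "(q has_real_derivative q' u) (at u)" for u
  unfolding q_def[abs_def] q'_def
  by (auto intro!: derivative_eq_intros)
 have dq': "(q' has_real_derivative q'') (at u)" for u
  unfolding q'_def[abs_def] q''_def by (auto intro!: derivative_eq_intros)
 \<comment> \<open>On {0..R} the bracket is at least 3/4 and (3/4)^3 >= 1/3.\<close>
 define c where "c = 3 * \<kappa>"
 define P where "P u = c*(max 0 (q u)) ^ 3" for u
 define P' where "P' u = c*(3*(max 0 (q u)) ^ 2 * q' u)" for u
 define P'' where "P'' u = c*(3*((2*(max 0 (q u)) ^ 1 * q' u) * q' u+q''*(max 0 (q u)) ^ 2))" for u
 have d1: "(P has_real_derivative P' u) (at u)" for u
  unfolding P_def[abs_def] P'_def
  using DERIV_cmult[OF DERIV_pos_power_chain[OF dq, of 1], of c] by (simp add: numeral_3_eq_3 numeral_2_eq_2)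
 have d2: "(P' has_real_derivative P'' u) (at u)" for u
 proof -
  have "((%u. (max 0 (q u)) ^ 2 * q' u) has_real_derivative (2*(max 0 (q u)) ^ 1 * q' u) * q' u+q''*(max 0 (q u)) ^ 2) (at u)"
   using DERIV_mult[OF DERIV_pos_power_chain[OF dq, of 0] dq'] by (simp add: numeral_2_eq_2)
  from DERIV_cmult[OF DERIV_cmult[OF this, of 3], of c] show ?thesis
   unfolding P'_def[abs_def] P''_def by (simp add: mult.assoc)
 qed
 have cq: "continuous_on UNIV q" "continuous_on UNIV q'" using dq dq' by (auto intro!: DERIV_continuous_on)
 have cont: "continuous_on UNIV P''" unfolding P''_def[abs_def] by (intro continuous_intros cq)
 have qn: "q u <= 0" if "u >= 2 * R" for u
 proof -
  have "(2 * R)^2 <= u^2" using that R by (intro power_mono) auto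
  hence "a*(2 * R)^2 <= a * u^2" using a by (intro mult_left_mono) auto
  moreover have "a*(2 * R)^2 = 4*(a * R^2)" by (simp add: power_mult_distrib)
  ultimately show ?thesis unfolding q_def a(2) by simp
 qed
 have PK: "P u = 0" "P' u = 0" "P'' u = 0" if "u >= 2 * R" for u
  using qn[OF that] by (simp_all add: P_def P'_def P''_def max_def)
 have t: "test_fun beta (%u. exp (beta * u/2) * P u) (%u. exp (beta * u/2)*(beta/2 * P u+P' u))
  (%u. exp (beta * u/2)*(beta^2/4 * P u+beta * P' u+P'' u))"
  by (rule test_fun_of_even[OF d1 d2 cont PK(1)]) (simp_all add: P'_def q'_def)
 have Pn: "0 <= P u" for u using k by (simp add: P_def c_def)
 have big: "\<kappa> <= exp (beta * u/2) * P u" if u: "u \<in> {0..R}" for u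
 proof -
  have "u^2 <= R^2" using u by (intro power_mono) auto
  hence "a * u^2 <= a * R^2" using a by (intro mult_left_mono) auto
  hence "3/4 <= q u" unfolding q_def a(2) by simp
  hence "(3/4) ^ 3 <= (max 0 (q u)) ^ 3" by (intro power_mono) auto
  hence "1/3 <= (max 0 (q u)) ^ 3" by (simp add: power3_eq_cube)
  hence "c*(1/3) <= P u" unfolding P_def using k by (intro mult_left_mono) (auto simp: c_def)
  hence "\<kappa> <= P u" by (simp add: c_def)
  moreover have "1 * P u <= exp (beta * u/2) * P u" using u beta_pos by (intro mult_right_mono Pn) auto
  ultimately show ?thesis by simp
 qed
 have hK: "exp (beta * u/2) * P u = 0" if "u >= 2 * R" for u using PK(1)[OF that] by simp
 obtain G where G: "G > 0" "ALL u>=0. \<bar>exp (beta * u/2) * P u\<bar> <= G"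
  using bounded_support[OF test_fun_continuous(1)[OF t] hK] by blast
 have hn: "0 <= exp (beta * u/2) * P u" for u by (intro mult_nonneg_nonneg Pn) simp
 have hG: "exp (beta * u/2) * P u <= G" if "0 <= u" for u
  using G(2) that by (auto intro: order_trans[OF abs_ge_self])
 show ?thesis
  by (rule exI, rule exI, rule exI, rule exI[of _ G], rule conjI[OF t])
   (use hn hG big PK in simp)
qed

lemma test_fun_add:
 assumes "test_fun b g g' g''" "test_fun b h h' h''"
 shows "test_fun b (%u. g u+h u) (%u. g' u+h' u) (%u. g'' u+h'' u)"
proof -
 obtain K1 where K1: "ALL u>=K1. g u = 0" using assms(1) by (auto simp: test_fun_def)
 obtain K2 where K2: "ALL u>=K2. h u = 0" using assms(2) by (auto simp: test_fun_def)
 have "ALL u>=max K1 K2. g u+h u = 0" using K1 K2 by auto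
 hence ex: "EX K. ALL u>=K. g u+h u = 0" by (rule exI)
 show ?thesis using assms unfolding test_fun_def
  by (intro conjI allI ex DERIV_add continuous_on_add) (auto simp: algebra_simps)
qed

lemma lin_add: "lin e (%x. (\<alpha> x+gm x)) m eta = lin e \<alpha> m eta+lin e gm m eta"
 unfolding lin_def distrib_right sum.distrib add_divide_distrib by simp

lemma Yfun_add: "Yfun N m (%u. g u+h u) eta = Yfun N m g eta+Yfun N m h eta"
 unfolding Yfun_def add_divide_distrib lin_add ..

lemma genR_add:
 assumes "eta \<in> chiR"
 shows "genR e (%eta. f eta+h eta) eta = genR e f eta+genR e h eta"
proof -
 obtain m where m: "eta \<subseteq> {..m}" using assms by (rule chiR_bounded)
 show ?thesis unfolding genR_sum[OF m] sum.distrib[symmetric]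
  by (rule sum.cong) (simp_all add: algebra_simps)
qed

section \<open>Events of probability tending to one, and the weak equation on them\<close>

lemma prob_event_mono:
 assumes "prob_event M P" and "\<forall>\<^sub>F N in sequentially. ALL xi:space (M N). P N xi --> Q N xi"
 shows "prob_event M Q"
 unfolding prob_event_def
proof (intro allI impI)
 fix p :: real assume "p > 0"
 then obtain N0 where N0: "N0 >= 1" "ALL N>=N0. EX E:sets (M N). measure (M N) E <= p & (ALL xi:space (M N)-E. P N xi)"
  using assms(1) unfolding prob_event_def by blast
 obtain N1 where N1: "ALL N>=N1. ALL xi:space (M N). P N xi --> Q N xi"
  using assms(2) by (auto simp: eventually_sequentially)
 show "EX N0>=1. ALL N>=N0. EX E:sets (M N). measure (M N) E <= p & (ALL xi:space (M N)-E. Q N xi)"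
 proof (intro exI[of _ "max N0 N1"] conjI allI impI)
  fix N assume N: "max N0 N1 <= N"
  then obtain E where E: "E \<in> sets (M N)" "measure (M N) E <= p" "ALL xi:space (M N)-E. P N xi"
   using N0(2) by auto
  show "EX E:sets (M N). measure (M N) E <= p & (ALL xi:space (M N)-E. Q N xi)"
   by (rule bexI[OF _ E(1)]) (use E N1 N in auto)
 qed (use N0 in simp)
qed

lemma prob_event_conj:
 assumes P: "prob_event M P" and Q: "prob_event M Q"
 shows "prob_event M (%N xi. P N xi & Q N xi)"
 unfolding prob_event_def
proof (intro allI impI)
 fix p :: real assume p: "p > 0"
 hence p2: "p/2 > 0" by simp
 obtain N0 where N0: "N0 >= 1" "ALL N>=N0. EX E:sets (M N). measure (M N) E <= p/2 & (ALL xi:space (M N)-E. P N xi)"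
  using P p2 unfolding prob_event_def by blast
 obtain N1 where N1: "N1 >= 1" "ALL N>=N1. EX E:sets (M N). measure (M N) E <= p/2 & (ALL xi:space (M N)-E. Q N xi)"
  using Q p2 unfolding prob_event_def by blast
 show "EX N0>=1. ALL N>=N0. EX E:sets (M N). measure (M N) E <= p & (ALL xi:space (M N)-E. P N xi & Q N xi)"
 proof (intro exI[of _ "max N0 N1"] conjI allI impI)
  fix N assume "max N0 N1 <= N"
  hence N: "N0 <= N" "N1 <= N" by auto
  obtain E where E: "E \<in> sets (M N)" "measure (M N) E <= p/2" "ALL xi:space (M N)-E. P N xi"
   using N0(2) N(1) by blast
  obtain E' where E': "E' \<in> sets (M N)" "measure (M N) E' <= p/2" "ALL xi:space (M N)-E'. Q N xi"
   using N1(2) N(2) by blast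
  have "measure (M N) (E \<union> E') <= measure (M N) E+measure (M N) E'" by (rule measure_Un_le[OF E(1) E'(1)])
  hence "measure (M N) (E \<union> E') <= p" using E(2) E'(2) by linarith
  thus "EX E:sets (M N). measure (M N) E <= p & (ALL xi:space (M N)-E. P N xi & Q N xi)"
   using E E' by (intro bexI[of _ "E \<union> E'"]) auto
 qed (use N0 in simp)
qed

lemma prob_event_finite_ball:
 assumes "finite I" "!!i. i \<in> I ==> prob_event M (P i)"
 shows "prob_event M (%N xi. ALL i:I. P i N xi)"
 using assms
proof (induction I rule: finite_induct)
 case empty
 show ?case unfolding prob_event_def by (auto intro!: exI[of _ 1] bexI[of _ "{}"])
next
 case (insert i I)
 have "prob_event M (%N xi. P i N xi & (ALL i:I. P i N xi))"
  using insert by (intro prob_event_conj) auto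
 thus ?case by (rule prob_event_mono) auto
qed

context
 fixes M :: "nat => 'w measure" and X :: "nat => real => 'w => nat set" and \<nu> :: "nat => nat set pmf" and B :: real
 assumes process: "ALL N>=1. solves_MP (M N) (X N) (%f eta. (real N)^2 * genR (epsN N) f eta) (\<nu> N)"
  and B: "prob_event M (%N xi. hz (epsN N) (X N 0 xi) 1 <= B)"
begin

lemma X_in_chiR: "N >= 1 ==> 0 <= t ==> xi \<in> space (M N) ==> X N t xi \<in> chiR"
 using process by (auto simp: solves_MP_def)

text \<open>Control of \<open>hz\<close> at time 0 bounds the initial value of every positive
  functional, so the premise on it in \<open>good_event\<close> disappears.\<close>

lemma good_event_posfun:
 assumes t: "test_fun beta g g' g''" and p: "posfun g K G"
  and K: "!!u. u >= K ==> g' u = 0" "!!u. u >= K ==> g'' u = 0" and T: "T > 0"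
 shows "EX b. ALL d>0. prob_event M (%N xi. ALL t:{0..T}. Yfun N (sites N K) g (X N t xi) <= b &
   \<bar>Yfun N (sites N K) g (X N t xi)-Yfun N (sites N K) g (X N 0 xi)
   -(LBINT s:{0..t}. (real N)^2 * genR (epsN N) (Yfun N (sites N K) g) (X N s xi))\<bar> <= d)"
proof -
 have K1: "K > 1" "G >= 1" using posfun_K[OF p] posfun_G[OF p] by auto
 define B0 where "B0 = (K+2) * G * \<bar>B\<bar>+1"
 have B0: "B0 > 0" using K1 by (auto simp: B0_def intro!: add_nonneg_pos mult_nonneg_nonneg)
 have "EX b. ALL d>0. prob_event M (%N xi. Yfun N (sites N K) g (X N 0 xi) <= B0 --> (ALL t:{0..T}. Yfun N (sites N K) g (X N t xi) <= b &
   \<bar>Yfun N (sites N K) g (X N t xi)-Yfun N (sites N K) g (X N 0 xi)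
   -(LBINT s:{0..t}. (real N)^2 * genR (epsN N) (Yfun N (sites N K) g) (X N s xi))\<bar> <= d))"
  by (rule good_event[OF process t p K T B0])
 then obtain b where b: "ALL d>0. prob_event M (%N xi. Yfun N (sites N K) g (X N 0 xi) <= B0 --> (ALL t:{0..T}. Yfun N (sites N K) g (X N t xi) <= b &
   \<bar>Yfun N (sites N K) g (X N t xi)-Yfun N (sites N K) g (X N 0 xi)
   -(LBINT s:{0..t}. (real N)^2 * genR (epsN N) (Yfun N (sites N K) g) (X N s xi))\<bar> <= d))"
  by (elim exE) (rule that)
 show ?thesis
 proof (intro exI[of _ b] allI impI)
  fix d :: real assume d: "d > 0"
  let ?Q = "%N xi. ALL t:{0..T}. Yfun N (sites N K) g (X N t xi) <= b &
   \<bar>Yfun N (sites N K) g (X N t xi)-Yfun N (sites N K) g (X N 0 xi)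
   -(LBINT s:{0..t}. (real N)^2 * genR (epsN N) (Yfun N (sites N K) g) (X N s xi))\<bar> <= d"
  have 1: "prob_event M (%N xi. Yfun N (sites N K) g (X N 0 xi) <= B0 --> ?Q N xi)"
   by (rule b[rule_format, OF d])
  show "prob_event M ?Q"
  proof (rule prob_event_mono[OF prob_event_conj[OF 1 B]])
   show "\<forall>\<^sub>F N in sequentially. ALL xi:space (M N). (Yfun N (sites N K) g (X N 0 xi) <= B0 --> ?Q N xi) & hz (epsN N) (X N 0 xi) 1 <= B --> ?Q N xi"
    using eventually_Ngood
   proof eventually_elim
    case (elim N)
    show ?case
    proof (rule ballI, rule impI)
     fix xi assume xi: "xi \<in> space (M N)"
      and h: "(Yfun N (sites N K) g (X N 0 xi) <= B0 --> ?Q N xi) & hz (epsN N) (X N 0 xi) 1 <= B"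
     have N: "N >= 1" using elim by (simp add: Ngood_def)
     have "Yfun N (sites N K) g (X N 0 xi) <= (K+2) * G * hz (epsN N) (X N 0 xi) 1"
      by (rule Y_le_hz1[OF elim p X_in_chiR[OF N order_refl xi]])
     also have "... <= (K+2) * G * \<bar>B\<bar>" using h K1 by (intro mult_left_mono) auto
     also have "... <= B0" by (simp add: B0_def)
     finally show "?Q N xi" using h by blast
    qed
   qed
  qed
 qed
qed

text \<open>One fixed positive functional suffices: it stays bounded on the time interval and
  dominates \<open>hz\<close> at 1, the maximum of the profile.\<close>

lemma zeta_bounded_event:
 assumes T: "T > 0"
 shows "EX Cz>0. prob_event M (%N xi. ALL t:{0..T}. hz (epsN N) (X N t xi) 1 <= Cz)"
proof -
 obtain h h' h'' G where h: "test_fun beta h h' h''" "ALL u>=0. 0 <= h u & h u <= G" "ALL u:{0..1}. 1 <= h u"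
   "ALL u>=2*1. h u = 0 & h' u = 0 & h'' u = 0"
  using ex_posfun[of 1 1] by auto
 have p: "posfun h 2 G" using h by (simp add: posfun_def)
 have "EX b. ALL d>0. prob_event M (%N xi. ALL t:{0..T}. Yfun N (sites N 2) h (X N t xi) <= b &
   \<bar>Yfun N (sites N 2) h (X N t xi)-Yfun N (sites N 2) h (X N 0 xi)
   -(LBINT s:{0..t}. (real N)^2 * genR (epsN N) (Yfun N (sites N 2) h) (X N s xi))\<bar> <= d)"
  by (rule good_event_posfun[OF h(1) p _ _ T]) (use h(4) in simp_all)
 then obtain b where b: "ALL d>0. prob_event M (%N xi. ALL t:{0..T}. Yfun N (sites N 2) h (X N t xi) <= b &
   \<bar>Yfun N (sites N 2) h (X N t xi)-Yfun N (sites N 2) h (X N 0 xi)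
   -(LBINT s:{0..t}. (real N)^2 * genR (epsN N) (Yfun N (sites N 2) h) (X N s xi))\<bar> <= d)"
  by (elim exE) (rule that)
 show ?thesis
 proof (intro exI[of _ "C0 * \<bar>b\<bar>+1"] conjI)
  show "0 < C0 * \<bar>b\<bar>+1" using C0_pos by (intro add_nonneg_pos mult_nonneg_nonneg) auto
  show "prob_event M (%N xi. ALL t:{0..T}. hz (epsN N) (X N t xi) 1 <= C0 * \<bar>b\<bar>+1)"
  proof (rule prob_event_mono[OF b[rule_format, of 1]])
   show "\<forall>\<^sub>F N in sequentially. ALL xi:space (M N). (ALL t:{0..T}. Yfun N (sites N 2) h (X N t xi) <= b &
   \<bar>Yfun N (sites N 2) h (X N t xi)-Yfun N (sites N 2) h (X N 0 xi)
   -(LBINT s:{0..t}. (real N)^2 * genR (epsN N) (Yfun N (sites N 2) h) (X N s xi))\<bar> <= 1) -->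
    (ALL t:{0..T}. hz (epsN N) (X N t xi) 1 <= C0 * \<bar>b\<bar>+1)"
    using eventually_Ngood
   proof eventually_elim
    case (elim N)
    have N: "N >= 1" using elim by (simp add: Ngood_def)
    show ?case
    proof (intro ballI impI)
     fix xi t assume xi: "xi \<in> space (M N)" and t: "t \<in> {0..T}"
      and y: "ALL t:{0..T}. Yfun N (sites N 2) h (X N t xi) <= b &
   \<bar>Yfun N (sites N 2) h (X N t xi)-Yfun N (sites N 2) h (X N 0 xi)
   -(LBINT s:{0..t}. (real N)^2 * genR (epsN N) (Yfun N (sites N 2) h) (X N s xi))\<bar> <= 1"
     have "hz (epsN N) (X N t xi) 1 <= C0 * Yfun N (sites N 2) h (X N t xi)"
      by (rule hz1_le_Y[OF elim p X_in_chiR[OF N _ xi]]) (use t in auto)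
     also have "... <= C0 * \<bar>b\<bar>"
     proof (rule mult_left_mono)
      have "Yfun N (sites N 2) h (X N t xi) <= b" using y t by blast
      thus "Yfun N (sites N 2) h (X N t xi) <= \<bar>b\<bar>" by linarith
     qed (use C0_pos in simp)
     finally show "hz (epsN N) (X N t xi) 1 <= C0 * \<bar>b\<bar>+1" by simp
    qed
   qed
  qed simp
 qed
qed

lemma weak_form_event:
 assumes t: "test_fun beta g g' g''" and T: "T > 0" and d: "d > 0"
 shows "prob_event M (%N xi. ALL t:{0..T}. \<bar>pairing N g (X N t xi)-pairing N g (X N 0 xi)
  -(LBINT s:{0..t}. pairing N (%u. g'' u-beta * g' u) (X N s xi))\<bar> <= d)"
proof -
 let ?k = "%u. g'' u-beta * g' u"
 obtain Kg where Kg: "Kg > 0" "!!u. u >= Kg ==> g u = 0" "!!u. u >= Kg ==> g' u = 0" "!!u. u >= Kg ==> g'' u = 0"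
  by (rule test_fun_support[OF t]) blast
 note ct = test_fun_continuous[OF t]
 obtain Bg where Bg: "Bg > 0" "ALL u>=0. \<bar>g u\<bar> <= Bg" using bounded_support[OF ct(1) Kg(2)] by blast
 define R where "R = Kg+1"
 define K where "K = 2 * R"
 have R1: "R >= 1" "Kg <= K" "K >= 0" "Kg <= R" using Kg(1) by (auto simp: R_def K_def)
 have gK: "g u = 0" "g' u = 0" "g'' u = 0" if "u >= K" for u using Kg R1 that by auto
 \<comment> \<open>Bg + 1 makes g + h at least 1 wherever g may be nonzero, and R >= 1 makes both
   functions at least 1 on the unit interval.\<close>
 obtain h h' h'' G where h: "test_fun beta h h' h''" "ALL u>=0. 0 <= h u & h u <= G" "ALL u:{0..R}. Bg+1 <= h u"
   "ALL u>=2*R. h u = 0 & h' u = 0 & h'' u = 0"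
  using ex_posfun[OF R1(1), of "Bg+1"] Bg(1) by auto
 have hK: "h u = 0" "h' u = 0" "h'' u = 0" if "u >= K" for u using h(4) that by (auto simp: K_def)
 have ph: "posfun h K G" unfolding posfun_def
 proof (intro conjI ballI)
  fix u :: real assume "u \<in> {0..1}"
  hence "Bg+1 <= h u" using h(3) R1(1) by auto
  thus "1 <= h u" using Bg(1) by simp
 qed (use h(2) hK in auto)
 have pgh: "posfun (%u. g u+h u) K (Bg+G)" unfolding posfun_def
 proof (intro conjI ballI allI impI)
  fix u :: real assume u: "0 <= u"
  have gu: "\<bar>g u\<bar> <= Bg" using Bg u by simp
  show "g u+h u <= Bg+G" using gu h(2) u by (intro add_mono) auto
  show "0 <= g u+h u"
  proof (cases "u <= R")
   case True
   hence "Bg+1 <= h u" using h(3) u by simp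
   thus ?thesis using gu by simp
  next
   case False
   hence "g u = 0" using Kg(2) R1 by simp
   thus ?thesis using h(2) u by simp
  qed
 next
  fix u :: real assume u: "u \<in> {0..1}"
  hence "Bg+1 <= h u" using h(3) R1(1) by simp
  moreover have "\<bar>g u\<bar> <= Bg" using Bg u by simp
  ultimately show "1 <= g u+h u" by simp
 qed (use gK hK in auto)
 have tgh: "test_fun beta (%u. g u+h u) (%u. g' u+h' u) (%u. g'' u+h'' u)" by (rule test_fun_add[OF t h(1)])
 let ?W = "%f N xi t d. \<bar>Yfun N (sites N K) f (X N t xi)-Yfun N (sites N K) f (X N 0 xi)
   -(LBINT s:{0..t}. (real N)^2 * genR (epsN N) (Yfun N (sites N K) f) (X N s xi))\<bar> <= d"
 have "EX b1. ALL d>0. prob_event M (%N xi. ALL t:{0..T}. Yfun N (sites N K) h (X N t xi) <= b1 & ?W h N xi t d)"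
  by (rule good_event_posfun[OF h(1) ph hK(2,3) T])
 then obtain b1 where b1: "ALL d>0. prob_event M (%N xi. ALL t:{0..T}. Yfun N (sites N K) h (X N t xi) <= b1 & ?W h N xi t d)"
  by (elim exE) (rule that)
 have "EX b2. ALL d>0. prob_event M (%N xi. ALL t:{0..T}. Yfun N (sites N K) (%u. g u+h u) (X N t xi) <= b2 & ?W (%u. g u+h u) N xi t d)"
  by (rule good_event_posfun[OF tgh pgh _ _ T]) (use gK hK in simp_all)
 then obtain b2 where b2: "ALL d>0. prob_event M (%N xi. ALL t:{0..T}. Yfun N (sites N K) (%u. g u+h u) (X N t xi) <= b2 & ?W (%u. g u+h u) N xi t d)"
  by (elim exE) (rule that)
 obtain Cz where Cz: "Cz > 0" "prob_event M (%N xi. ALL t:{0..T}. hz (epsN N) (X N t xi) 1 <= Cz)"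
  using zeta_bounded_event[OF T] by blast
 have k: "continuous_on UNIV ?k" by (intro continuous_intros ct)
 have kK: "?k u = 0" if "u >= K" for u using gK that by simp
 obtain Bk where Bk: "Bk > 0" "ALL u>=0. \<bar>?k u\<bar> <= Bk" using bounded_support[OF k kK] by blast
 \<comment> \<open>Half of d goes to the two martingale estimates; the other half pays for replacing
   \<open>Yfun\<close> by \<open>pairing\<close> at both end times and in the time integral, where
   the profile is at most Cz.\<close>
 define e1 where "e1 = d/(6 * Cz*(T+1))"
 have e1: "e1 > 0" using d Cz T by (simp add: e1_def)
 obtain N1 where N1: "N1 >= 1" "ALL N>=N1. ALL eta:chiR. \<bar>Yfun N (sites N K) g eta-pairing N g eta\<bar> <= e1 * hz (epsN N) eta 1"
  using Yfun_pairing[OF ct(1) gK(1) R1(3) e1] by blast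
 obtain N2 where N2: "N2 >= 1" "ALL N>=N2. ALL eta:chiR. \<bar>(real N)^2 * genR (epsN N) (Yfun N (sites N K) g) eta-pairing N ?k eta\<bar> <= e1 * hz (epsN N) eta 1"
  using genR_Yfun[OF t gK R1(3) e1] by blast
 have d4: "d/4 > 0" using d by simp
 have all: "prob_event M (%N xi. ((ALL t:{0..T}. Yfun N (sites N K) h (X N t xi) <= b1 & ?W h N xi t (d/4)) &
   (ALL t:{0..T}. Yfun N (sites N K) (%u. g u+h u) (X N t xi) <= b2 & ?W (%u. g u+h u) N xi t (d/4))) &
   (ALL t:{0..T}. hz (epsN N) (X N t xi) 1 <= Cz))"
  by (rule prob_event_conj[OF prob_event_conj[OF b1[rule_format, OF d4] b2[rule_format, OF d4]] Cz(2)])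
 show ?thesis
 proof (rule prob_event_mono[OF all], unfold eventually_sequentially, intro exI[of _ "max N1 N2"] allI impI ballI)
  fix N xi t0
  assume N: "max N1 N2 <= N" and xi: "xi \<in> space (M N)" and t0: "t0 \<in> {0..T}"
   and H: "((ALL t:{0..T}. Yfun N (sites N K) h (X N t xi) <= b1 & ?W h N xi t (d/4)) &
   (ALL t:{0..T}. Yfun N (sites N K) (%u. g u+h u) (X N t xi) <= b2 & ?W (%u. g u+h u) N xi t (d/4))) &
   (ALL t:{0..T}. hz (epsN N) (X N t xi) 1 <= Cz)"
  have Ng: "N >= 1" "N >= N1" "N >= N2" using N N1(1) by auto
  interpret ex: exclusion_MP "M N" "X N" "(real N)^2" "epsN N" "\<nu> N"
   by unfold_locales (use process Ng(1) epsN_pos[OF Ng(1)] epsN_lt_1[OF Ng(1)] in auto)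
  have ch: "X N s xi \<in> chiR" if "0 <= s" for s by (rule ex.X_chiR[OF that xi])
  have hz: "hz (epsN N) (X N s xi) 1 <= Cz" if "s \<in> {0..T}" for s using H that by blast
  have t00: "0 <= t0" "t0 <= T" using t0 by auto
  let ?L = "%f s. (real N)^2 * genR (epsN N) (Yfun N (sites N K) f) (X N s xi)"
  have int: "set_integrable lborel {0..t0} (%s. G (X N s xi))"
   if bd: "!!s. s \<in> {0..t0} ==> \<bar>G (X N s xi)\<bar> <= Q" for G :: "nat set => real" and Q
  proof -
   have "set_integrable lborel {0..t0} (%r. G (ex.Xc t0 r xi))"
    by (rule set_integrable_Icc_bounded[where K = Q, OF ex.path_measurable[OF t00(1) xi]]) (use bd t00 in auto)
   also have "?this \<longleftrightarrow> ?thesis"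
    by (rule set_integrable_cong) (use t00 in \<open>auto simp: ex.Xc_eq\<close>)
   finally show ?thesis .
  qed
  have pk: "\<bar>pairing N f (X N s xi)\<bar> <= Bf * K * Cz"
   if "continuous_on UNIV f" "!!u. u >= K ==> f u = 0" "ALL u>=0. \<bar>f u\<bar> <= Bf" "s \<in> {0..t0}" for f Bf s
  proof -
   have "\<bar>pairing N f (X N s xi)\<bar> <= Bf * K * hz (epsN N) (X N s xi) 1"
    by (rule pairing_bound[OF Ng(1) ch that(1,2) R1(3)]) (use that in auto)
   also have "... <= Bf * K * Cz"
    using that(3)[rule_format, of 0] R1 that(4) t00 by (intro mult_left_mono hz mult_nonneg_nonneg) auto
   finally show ?thesis .
  qed
  have Lg: "\<bar>?L g s-pairing N ?k (X N s xi)\<bar> <= e1 * Cz" if "s \<in> {0..t0}" for s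
  proof -
   have "\<bar>?L g s-pairing N ?k (X N s xi)\<bar> <= e1 * hz (epsN N) (X N s xi) 1"
    using N2(2) Ng(3) ch that by auto
   also have "... <= e1 * Cz" using e1 that t00 by (intro mult_left_mono hz) auto
   finally show ?thesis .
  qed
  have pg: "\<bar>Yfun N (sites N K) g (X N s xi)-pairing N g (X N s xi)\<bar> <= e1 * Cz" if "s \<in> {0..t0}" for s
  proof -
   have "\<bar>Yfun N (sites N K) g (X N s xi)-pairing N g (X N s xi)\<bar> <= e1 * hz (epsN N) (X N s xi) 1"
    using N1(2) Ng(2) ch that by auto
   also have "... <= e1 * Cz" using e1 that t00 by (intro mult_left_mono hz) auto
   finally show ?thesis .
  qed
  have ik: "set_integrable lborel {0..t0} (%s. pairing N ?k (X N s xi))"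
   by (rule int[of "pairing N ?k"]) (rule pk[OF k kK Bk(2)])
  have iLg: "set_integrable lborel {0..t0} (?L g)"
  proof (rule int[of "%eta. (real N)^2 * genR (epsN N) (Yfun N (sites N K) g) eta" "Bk * K * Cz+e1 * Cz"])
   fix s assume "s \<in> {0..t0}"
   thus "\<bar>?L g s\<bar> <= Bk * K * Cz+e1 * Cz" using Lg[of s] pk[OF k kK Bk(2), of s] by linarith
  qed
  \<comment> \<open>A bound at fixed N suffices for integrability, so the explicit formula
    \<open>genR_lin\<close> is used.\<close>
  have iLh: "set_integrable lborel {0..t0} (?L h)"
  proof -
   have z: "h (real x/real N)/real N = 0" if "sites N K <= x" for x
   proof -
    have "real N * K <= real x" using sites_bounds(1)[OF R1(3), of N] that by linarith
    hence "K <= real x/real N" using Ng(1) by (simp add: field_simps)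
    thus ?thesis using hK(1) by simp
   qed
   let ?al = "%x. h (real x/real N)/real N"
   let ?c = "%i. ?al (i+1)-(1+epsN N) * ?al (i+2)+epsN N * ?al (i+3)"
   let ?bd = "epsN N * ?al 2-(1+epsN N) * ?al 1/2"
   show ?thesis
   proof (rule int[of "%eta. (real N)^2 * genR (epsN N) (Yfun N (sites N K) h) eta" "(real N)^2*(\<bar>?bd\<bar> * Cz+(\<Sum>i<sites N K. \<bar>?c i\<bar> * Cz))"])
    fix s assume s: "s \<in> {0..t0}"
    have cs: "X N s xi \<in> chiR" using ch s by simp
    have hx: "\<bar>hz (epsN N) (X N s xi) x\<bar> <= Cz" if "1 <= x" for x
     using hz_decreasing[OF cs epsN_pos[OF Ng(1)] ex.eps(2) that]
      hz_ge_1[OF epsN_pos[OF Ng(1)] ex.eps(2), of "X N s xi" x] hz[of s] s t00 by auto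
    have comb: "\<bar>g\<bar> <= A+B" if "g = x+y" "\<bar>x\<bar> <= A" "\<bar>y\<bar> <= B" for g x y A B :: real
     using that by linarith
    have "genR (epsN N) (Yfun N (sites N K) h) (X N s xi) = ?bd * hz (epsN N) (X N s xi) 1+(\<Sum>i<sites N K. ?c i * hz (epsN N) (X N s xi) (i+2))"
     unfolding Yfun_def by (rule genR_lin[OF cs epsN_pos[OF Ng(1)]]) (rule z, simp)+
    moreover have "\<bar>?bd * hz (epsN N) (X N s xi) 1\<bar> <= \<bar>?bd\<bar> * Cz"
     unfolding abs_mult by (intro mult_left_mono hx) auto
    moreover have "\<bar>\<Sum>i<sites N K. ?c i * hz (epsN N) (X N s xi) (i+2)\<bar> <= (\<Sum>i<sites N K. \<bar>?c i\<bar> * Cz)"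
     by (rule order_trans[OF sum_abs sum_mono], unfold abs_mult, intro mult_left_mono hx) auto
    ultimately have "\<bar>genR (epsN N) (Yfun N (sites N K) h) (X N s xi)\<bar> <= \<bar>?bd\<bar> * Cz+(\<Sum>i<sites N K. \<bar>?c i\<bar> * Cz)"
     by (rule comb)
    hence "(real N)^2 * \<bar>genR (epsN N) (Yfun N (sites N K) h) (X N s xi)\<bar> <= (real N)^2*(\<bar>?bd\<bar> * Cz+(\<Sum>i<sites N K. \<bar>?c i\<bar> * Cz))"
     by (rule mult_left_mono) simp
    thus "\<bar>?L h s\<bar> <= (real N)^2*(\<bar>?bd\<bar> * Cz+(\<Sum>i<sites N K. \<bar>?c i\<bar> * Cz))"
     by (simp only: abs_mult abs_power2)
   qed
  qed
  have "(LBINT s:{0..t0}. ?L (%u. g u+h u) s) = (LBINT s:{0..t0}. ?L g s+?L h s)"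
  proof (rule set_lebesgue_integral_cong)
   show "ALL s. s \<in> {0..t0} --> ?L (%u. g u+h u) s = ?L g s+?L h s"
   proof (intro allI impI)
    fix s assume "s \<in> {0..t0}"
    hence "genR (epsN N) (%eta. Yfun N (sites N K) g eta+Yfun N (sites N K) h eta) (X N s xi)
     = genR (epsN N) (Yfun N (sites N K) g) (X N s xi)+genR (epsN N) (Yfun N (sites N K) h) (X N s xi)"
     by (intro genR_add ch) simp
    moreover have "Yfun N (sites N K) (%u. g u+h u) = (%eta. Yfun N (sites N K) g eta+Yfun N (sites N K) h eta)"
     by (intro ext Yfun_add)
    ultimately show "?L (%u. g u+h u) s = ?L g s+?L h s" by (simp add: distrib_left)
   qed
  qed simp
  also have "... = (LBINT s:{0..t0}. ?L g s)+(LBINT s:{0..t0}. ?L h s)" by (rule set_integral_add(2)[OF iLg iLh])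
  finally have Isum: "(LBINT s:{0..t0}. ?L (%u. g u+h u) s) = (LBINT s:{0..t0}. ?L g s)+(LBINT s:{0..t0}. ?L h s)" .
  have Wh: "?W h N xi t0 (d/4)" and Wgh: "?W (%u. g u+h u) N xi t0 (d/4)" using H t0 by blast+
  have Wg: "?W g N xi t0 (d/2)" using Wh Wgh unfolding Isum Yfun_add by linarith
  have "\<bar>LBINT s:{0..t0}. ?L g s-pairing N ?k (X N s xi)\<bar> <= (e1 * Cz)*(t0-0)"
   by (rule set_integral_Icc_abs_le[OF set_integral_diff(1)[OF iLg ik] Lg t00(1)])
  hence D: "\<bar>(LBINT s:{0..t0}. ?L g s)-(LBINT s:{0..t0}. pairing N ?k (X N s xi))\<bar> <= e1 * Cz * t0"
   unfolding set_integral_diff(2)[OF iLg ik] by simp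
  have "e1 * Cz * t0 <= e1 * Cz * T" using e1 Cz t00 by (intro mult_left_mono) auto
  moreover have "e1 * Cz * T+e1 * Cz+e1 * Cz <= d/2"
  proof -
   have "6 * Cz*(T+1) * e1 = d" using Cz T by (simp add: e1_def)
   hence "6*(e1 * Cz * T)+6*(e1 * Cz) = d" by (simp add: algebra_simps)
   moreover have "0 <= e1 * Cz * T" "0 <= e1 * Cz" using e1 Cz T by auto
   ultimately show ?thesis by linarith
  qed
  moreover have "0 \<in> {0..t0}" "t0 \<in> {0..t0}" using t00 by auto
  ultimately show "\<bar>pairing N g (X N t0 xi)-pairing N g (X N 0 xi)-(LBINT s:{0..t0}. pairing N ?k (X N s xi))\<bar> <= d"
   using Wg D pg[of 0] pg[of t0] by linarith
 qed
qed

end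

section \<open>Stability by iterated averaging\<close>

text \<open>From cosh (x+y) cosh (x-y) = cosh^2 x + sinh^2 y >= cosh^2 x. The weight 1/cosh thus
  survives symmetric averaging up to the factor cosh y, and it decays fast enough to absorb the
  growth exp (beta u/2) in the pairing.\<close>

lemma cosh_average_bound:
 fixes x y :: real
 shows "1/cosh (x+y)+1/cosh (x-y) <= 2*(cosh y/cosh x)"
proof -
 define p where "p = cosh x * cosh y"
 define s where "s = sinh x * sinh y"
 have c: "cosh (x+y) = p+s" "cosh (x-y) = p-s"
  by (simp_all add: p_def s_def cosh_add cosh_diff)
 have pos: "p+s > 0" "p-s > 0" unfolding c[symmetric] by (simp_all add: cosh_real_pos)
 have "p^2-s^2 = (cosh x)^2*(cosh y)^2-(sinh x)^2*(sinh y)^2"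
  by (simp add: p_def s_def power_mult_distrib)
 also have "... = (cosh x)^2+(sinh y)^2"
  by (simp add: cosh_square_eq algebra_simps)
 finally have ps: "(cosh x)^2 <= (p+s)*(p-s)" by (simp add: power2_eq_square algebra_simps)
 have cx: "cosh x > 0" "cosh y > 0" by (simp_all add: cosh_real_pos)
 have "1/(p+s)+1/(p-s) = 2 * p/((p+s)*(p-s))"
  using pos by (simp add: field_simps)
 also have "... <= 2 * p/(cosh x)^2"
 proof (rule divide_left_mono[OF ps])
  show "0 <= 2 * p" using cx by (simp add: p_def)
  show "0 < (p+s)*(p-s)*(cosh x)^2" using pos cx by simp
 qed
 also have "... = 2*(cosh y/cosh x)" using cx by (simp add: p_def power2_eq_square)
 finally show ?thesis unfolding c .
qed

lemma cosh_shift_bound: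
 fixes u v a :: real
 assumes "\<bar>u-v\<bar> <= a"
 shows "1/cosh v <= exp a/cosh u"
proof -
 have "exp u <= exp a * exp v" "exp (- u) <= exp a * exp (- v)"
  unfolding exp_add[symmetric] using assms by auto
 hence "cosh u <= exp a * cosh v" by (simp add: cosh_field_def distrib_left)
 thus ?thesis using cosh_real_pos[of u] cosh_real_pos[of v] by (simp add: field_simps)
qed

text \<open>Quadratic in y: n averages with step of order n^(-1/2) then cost only a bounded
  factor.\<close>

lemma cosh_le_exp_square:
 fixes y :: real
 assumes "0 <= y" "y <= 1"
 shows "cosh y <= exp (y^2)"
proof -
 have 1: "exp y <= 1+y+y^2" by (rule exp_bound[OF assms])
 have "1+y <= exp y" by (rule exp_ge_add_one_self)
 hence "exp (- y) <= 1/(1+y)" using assms by (simp add: exp_minus inverse_eq_divide divide_left_mono)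
 also have "1/(1+y) <= 1-y+y^2"
 proof -
  have "(1-y+y^2)*(1+y) = 1+y ^ 3" by (simp add: power2_eq_square power3_eq_cube algebra_simps)
  hence "1 <= (1-y+y^2)*(1+y)" using assms by simp
  thus ?thesis using assms by (simp add: divide_le_eq)
 qed
 finally have "exp (- y) <= 1-y+y\<^sup>2" .
 hence "cosh y <= 1+y^2" using 1 by (simp add: cosh_field_def)
 also have "... <= exp (y^2)" by (rule exp_ge_add_one_self)
 finally show ?thesis .
qed

definition csupp :: "(real => real) => bool" where
 "csupp f \<longleftrightarrow> continuous_on UNIV f & (EX K. ALL u. \<bar>u\<bar> >= K --> f u = 0)"

lemma csupp_linear:
 assumes "csupp f" "csupp g"
 shows "csupp (%u. c * f u+g u)"
proof -
 obtain K1 where K1: "ALL u. \<bar>u\<bar> >= K1 --> f u = 0" using assms(1) by (auto simp: csupp_def)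
 obtain K2 where K2: "ALL u. \<bar>u\<bar> >= K2 --> g u = 0" using assms(2) by (auto simp: csupp_def)
 have "ALL u. \<bar>u\<bar> >= max K1 K2 --> c * f u+g u = 0" using K1 K2 by auto
 moreover have "continuous_on UNIV (%u. c * f u+g u)"
  using assms by (intro continuous_intros) (auto simp: csupp_def)
 ultimately show ?thesis unfolding csupp_def by (intro conjI exI)
qed

lemma csupp_shift:
 assumes "csupp f"
 shows "csupp (%u. f (u+a))"
proof -
 obtain K where K: "ALL u. \<bar>u\<bar> >= K --> f u = 0" using assms by (auto simp: csupp_def)
 have "ALL u. \<bar>u\<bar> >= K+\<bar>a\<bar> --> f (u+a) = 0"
 proof (intro allI impI)
  fix u assume "\<bar>u\<bar> >= K+\<bar>a\<bar>"
  hence "\<bar>u+a\<bar> >= K" by linarith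
  thus "f (u+a) = 0" using K by blast
 qed
 moreover have "continuous_on UNIV (%u. f (u+a))"
  by (rule continuous_on_compose2[of UNIV f UNIV "%u. u+a"])
   (use assms in \<open>auto simp: csupp_def intro: continuous_intros\<close>)
 ultimately show ?thesis unfolding csupp_def by (intro conjI exI)
qed

lemma csupp_bound:
 assumes f: "csupp f"
 shows "EX B>0. ALL u. \<bar>f u\<bar> <= B/cosh (b * u)"
proof -
 obtain K where K: "ALL u. \<bar>u\<bar> >= K --> f u = 0" using f by (auto simp: csupp_def)
 have "continuous_on {-K..K} f" by (rule continuous_on_subset[of UNIV]) (use f in \<open>auto simp: csupp_def\<close>)
 hence "continuous_on {-K..K} (%u. f u * cosh (b * u))" by (intro continuous_intros)
 hence "compact ((%u. f u * cosh (b * u)) ` {-K..K})" by (rule compact_continuous_image) simp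
 hence "bounded ((%u. f u * cosh (b * u)) ` {-K..K})" by (rule compact_imp_bounded)
 then obtain B where B: "ALL x:(%u. f u * cosh (b * u)) ` {-K..K}. norm x <= B" by (auto simp: bounded_iff)
 show ?thesis
 proof (intro exI[of _ "\<bar>B\<bar>+1"] conjI allI)
  fix u
  have cp: "cosh (b * u) > 0" by (simp add: cosh_real_pos)
  show "\<bar>f u\<bar> <= (\<bar>B\<bar>+1)/cosh (b * u)"
  proof (cases "\<bar>u\<bar> <= K")
   case True
   hence "u \<in> {-K..K}" by auto
   hence "norm (f u * cosh (b * u)) <= B" by (rule bspec[OF B imageI])
   hence "\<bar>f u\<bar> * cosh (b * u) <= \<bar>B\<bar>+1" using cp by (simp add: abs_mult abs_of_pos)
   thus ?thesis using cp by (simp add: pos_le_divide_eq)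
  next
   case False
   hence "f u = 0" using K[rule_format, of u] by simp
   thus ?thesis using cp by simp
  qed
 qed simp
qed

text \<open>\<open>f j\<close> is the j-th derivative of an even function. Order 4 is needed because
  a step of the scheme tests the equation also with f'' - c f, whose own image contains
  f''''.\<close>

definition jet :: "(nat => real => real) => bool" where
 "jet f \<longleftrightarrow> (ALL j<4. ALL x. (f j has_real_derivative f (Suc j) x) (at x)) & (ALL j<=4. csupp (f j))
  & (ALL j<=4. ALL u. f j (- u) = (- 1) ^ j * f j u)"

definition avg :: "real => (nat => real => real) => nat => real => real" where
 "avg a f j u = (f j (u+a)+f j (u-a))/2"

lemma csupp_avg:
 assumes "csupp (f j)"
 shows "csupp (avg a f j)"
proof -
 have s: "csupp (%u. f j (u-a))" using csupp_shift[OF assms, of "- a"] by simp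
 have z: "csupp (%u. 0)" by (auto simp: csupp_def)
 have "csupp (%u. 1/2 * f j (u+a)+(1/2 * f j (u-a)+0))"
  by (rule csupp_linear[OF csupp_shift[OF assms] csupp_linear[OF s z]])
 moreover have "(%u. 1/2 * f j (u+a)+(1/2 * f j (u-a)+0)) = avg a f j"
  by (intro ext) (simp add: avg_def)
 ultimately show ?thesis by simp
qed

lemma jet_avg:
 assumes f: "jet f"
 shows "jet (avg a f)"
 unfolding jet_def
proof (intro conjI allI impI)
 fix j x assume j: "j < (4::nat)"
 have d: "(f j has_real_derivative f (Suc j) x) (at x)" for x using f j by (simp add: jet_def)
 have "((%u. (f j (u+a)+f j (u-a))/2) has_real_derivative (f (Suc j) (x+a)+f (Suc j) (x-a))/2) (at x)"
  by (rule derivative_eq_intros DERIV_chain2[OF d] | simp)+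
 thus "(avg a f j has_real_derivative avg a f (Suc j) x) (at x)" by (simp add: avg_def[abs_def])
next
 fix j assume j: "j <= (4::nat)"
 show "csupp (avg a f j)" by (rule csupp_avg) (use f j in \<open>simp add: jet_def\<close>)
 fix u
 have s: "f j (- v) = (- 1) ^ j * f j v" for v using f j by (simp add: jet_def)
 have "f j (- u+a) = (- 1) ^ j * f j (u-a)" "f j (- u-a) = (- 1) ^ j * f j (u+a)"
  using s[of "u-a"] s[of "u+a"] by simp_all
 thus "avg a f j (- u) = (- 1) ^ j * avg a f j u" by (simp add: avg_def algebra_simps)
qed

lemma jet_iter: "jet f ==> jet ((avg a ^^ k) f)"
 by (induction k) (auto intro: jet_avg)

lemma avg_bound:
 assumes "!!u. \<bar>f j u\<bar> <= B/cosh (b * u)"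
 shows "\<bar>avg a f j u\<bar> <= B * cosh (b * a)/cosh (b * u)"
proof -
 have B: "0 <= B" using assms[of 0] by simp
 have "\<bar>avg a f j u\<bar> <= (\<bar>f j (u+a)\<bar>+\<bar>f j (u-a)\<bar>)/2" by (simp add: avg_def)
 also have "... <= (B/cosh (b*(u+a))+B/cosh (b*(u-a)))/2"
  by (intro divide_right_mono add_mono assms) simp
 also have "... = B/2*(1/cosh (b * u+b * a)+1/cosh (b * u-b * a))"
  by (simp add: algebra_simps)
 also have "... <= B/2*(2*(cosh (b * a)/cosh (b * u)))"
  by (rule mult_left_mono[OF cosh_average_bound]) (use B in simp)
 finally show ?thesis by simp
qed

definition jbound :: "real => real => (nat => real => real) => bool" where
 "jbound b B f \<longleftrightarrow> (ALL j<=4. ALL u. \<bar>f j u\<bar> <= B/cosh (b * u))"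

lemma jbound_avg: "jbound b B f ==> jbound b (B * cosh (b * a)) (avg a f)"
 unfolding jbound_def by (intro allI impI avg_bound) auto

lemma jbound_iter: "jbound b B f ==> jbound b (B * cosh (b * a) ^ k) ((avg a ^^ k) f)"
proof (induction k)
 case (Suc k)
 from jbound_avg[OF Suc.IH[OF Suc.prems], of a] show ?case by (simp add: mult_ac)
qed simp

lemma jet_jbound:
 assumes "jet f"
 shows "EX B>0. jbound b B f"
proof -
 have "ALL j. EX B>0. j <= 4 --> (ALL u. \<bar>f j u\<bar> <= B/cosh (b * u))"
 proof
  fix j
  show "EX B>0. j <= 4 --> (ALL u. \<bar>f j u\<bar> <= B/cosh (b * u))"
  proof (cases "j <= 4")
   case True
   hence "csupp (f j)" using assms by (simp add: jet_def)
   from csupp_bound[OF this, of b] show ?thesis by auto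
  qed (auto intro: exI[of _ 1])
 qed
 then obtain B where B: "ALL j. B j > 0 & (j <= 4 --> (ALL u. \<bar>f j u\<bar> <= B j/cosh (b * u)))"
  using choice[of "%j B. B > 0 & (j <= 4 --> (ALL u. \<bar>f j u\<bar> <= B/cosh (b * u)))"] by blast
 show ?thesis
 proof (intro exI[of _ "\<Sum>j\<le>4. B j"] conjI)
  show "0 < (\<Sum>j\<le>4. B j)" using B by (intro sum_pos) auto
  show "jbound b (\<Sum>j\<le>4. B j) f" unfolding jbound_def
  proof (intro allI impI)
   fix j u assume j: "j <= (4::nat)"
   have "B j <= (\<Sum>j\<le>4. B j)" by (rule member_le_sum) (use B j in \<open>auto intro: less_imp_le\<close>)
   hence "B j/cosh (b * u) <= (\<Sum>j\<le>4. B j)/cosh (b * u)"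
    by (rule divide_right_mono) (simp add: cosh_real_pos less_imp_le)
   moreover have "\<bar>f j u\<bar> <= B j/cosh (b * u)" using B j by simp
   ultimately show "\<bar>f j u\<bar> <= (\<Sum>j\<le>4. B j)/cosh (b * u)" by linarith
  qed
 qed
qed

definition residual :: "real => (nat => real => real) => real => real" where
 "residual a f u = avg a f 0 u-f 0 u-a^2/2 * f 2 u"

text \<open>Consistency of the average with 1 + (a^2/2) d^2/du^2. The third derivative gives order
  a^3, that is h^(3/2) per step, and T/h steps leave h^(1/2).\<close>

lemma residual_bound:
 assumes f: "jet f" and B: "jbound b B f" and b: "0 <= b" and a: "0 < a"
 shows "\<bar>residual a f u\<bar> <= a ^ 3 * B * exp (b * a)/cosh (b * u)"
proof -
 have d: "(f j has_real_derivative f (Suc j) x) (at x)" if "j < 4" for j x using f that by (simp add: jet_def)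
 have d0: "(f 0 has_real_derivative f 1 x) (at x)" "(f 1 has_real_derivative f 2 x) (at x)" "(f 2 has_real_derivative f 3 x) (at x)" for x
  using d[of 0 x] d[of 1 x] d[of 2 x] by (simp_all add: numeral_2_eq_2 numeral_3_eq_3)
 have B0: "0 <= B" using B[unfolded jbound_def, rule_format, of 0 0] by simp
 define m where "m = a*(B * exp (b * a)/cosh (b * u))"
 have m: "\<bar>f 2 xi-f 2 u\<bar> <= m" if xi: "u-a <= xi" "xi <= u+a" for xi
 proof -
  have *: "\<bar>f 3 z\<bar> <= B * exp (b * a)/cosh (b * u)" if "\<bar>z-u\<bar> <= a" for z
  proof -
   have "\<bar>b * u-b * z\<bar> <= b * a"
    using that b unfolding right_diff_distrib[symmetric] abs_mult by (auto intro!: mult_left_mono simp: abs_minus_commute)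
   hence "B*(1/cosh (b * z)) <= B*(exp (b * a)/cosh (b * u))"
    by (intro mult_left_mono cosh_shift_bound B0)
   moreover have "\<bar>f 3 z\<bar> <= B/cosh (b * z)" using B by (simp add: jbound_def)
   ultimately show ?thesis by simp
  qed
  have Q: "0 <= B * exp (b * a)/cosh (b * u)" using *[of u] a by linarith
  show ?thesis
  proof (cases "xi = u")
   case True
   have "0 <= m" unfolding m_def by (rule mult_nonneg_nonneg[OF less_imp_le[OF a] Q])
   thus ?thesis using True by simp
  next
   case False
   have "EX z. \<bar>z-u\<bar> <= a & f 2 xi-f 2 u = (xi-u) * f 3 z"
   proof (cases "xi < u")
    case True
    obtain z where "z > xi" "z < u" "f 2 u-f 2 xi = (u-xi) * f 3 z"
     using MVT2[OF True, of "f 2" "f 3"] d0(3) by blast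
    thus ?thesis using xi by (intro exI[of _ z]) (auto simp: algebra_simps)
   next
    case F: False
    hence "u < xi" using False by simp
    then obtain z where "z > u" "z < xi" "f 2 xi-f 2 u = (xi-u) * f 3 z"
     using MVT2[of u xi "f 2" "f 3"] d0(3) by blast
    thus ?thesis using xi by (intro exI[of _ z]) auto
   qed
   then obtain z where z: "\<bar>z-u\<bar> <= a" "f 2 xi-f 2 u = (xi-u) * f 3 z" by blast
   have "\<bar>xi-u\<bar> * \<bar>f 3 z\<bar> <= a*(B * exp (b * a)/cosh (b * u))"
    by (intro mult_mono * z(1)) (use xi a in auto)
   thus ?thesis unfolding z(2) m_def abs_mult .
  qed
 qed
 have "\<bar>f 0 (u+a)+f 0 (u-a)-2 * f 0 u-a^2 * f 2 u\<bar> <= 2 * a^2 * m"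
  by (rule second_difference[OF d0(1,2) a m])
 moreover have "residual a f u = (f 0 (u+a)+f 0 (u-a)-2 * f 0 u-a^2 * f 2 u)/2"
  by (simp add: residual_def avg_def field_simps)
 ultimately have "\<bar>residual a f u\<bar> <= a^2 * m" by simp
 thus ?thesis by (simp add: m_def power2_eq_square power3_eq_cube mult_ac)
qed

text \<open>The averaging operator with step \<open>a = \<surd>(2h)\<close> approximates \<open>1 + h \<partial>\<^sup>2\<close>, so a functional whose
 time derivative is \<open>D(\<phi>'' - c \<phi>)\<close> satisfies \<open>D t \<phi> \<approx> (1 - c h) D (t - h) (avg \<phi>)\<close>; averages of
 compactly supported functions stay compactly supported and even, hence admissible test functions.\<close>
locale scheme =
 fixes D :: "real => (real => real) => real" and b C c T dl :: real
 assumes b: "0 <= b" and C: "0 <= C" and c: "0 <= c" and T: "0 < T" and dl: "0 <= dl"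
  and lin: "!!t k f g. t \<in> {0..T} ==> csupp f ==> csupp g ==> D t (%u. k * f u+g u) = k * D t f+D t g"
  and bd: "!!t f B. t \<in> {0..T} ==> csupp f ==> (!!u. \<bar>f u\<bar> <= B/cosh (b * u)) ==> \<bar>D t f\<bar> <= C * B"
  and int: "!!f. csupp f ==> set_integrable lborel {0..T} (%r. D r f)"
begin

lemma increment:
 assumes w: "!!t. t \<in> {0..T} ==> \<bar>D t f-D 0 f-(LBINT r:{0..t}. D r g)\<bar> <= dl"
  and g: "csupp g" "!!u. \<bar>g u\<bar> <= B/cosh (b * u)" and st: "0 <= s" "s <= t" "t <= T"
 shows "\<bar>D t f-D s f-(LBINT r:{s..t}. D r g)\<bar> <= 2 * dl" "\<bar>D t f-D s f\<bar> <= 2 * dl+C * B*(t-s)"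
proof -
 have i: "set_integrable lborel {0..t} (%r. D r g)" by (rule set_integrable_subset[OF int[OF g(1)]]) (use st in auto)
 have sp: "(LBINT r:{0..t}. D r g) = (LBINT r:{0..s}. D r g)+(LBINT r:{s..t}. D r g)"
  by (rule set_integral_Icc_split[OF i]) (use st in auto)
 have wt: "\<bar>D t f-D 0 f-(LBINT r:{0..t}. D r g)\<bar> <= dl" and ws: "\<bar>D s f-D 0 f-(LBINT r:{0..s}. D r g)\<bar> <= dl"
  by (rule w; use st in simp)+
 show 1: "\<bar>D t f-D s f-(LBINT r:{s..t}. D r g)\<bar> <= 2 * dl"
  using wt ws unfolding sp by linarith
 have "\<bar>LBINT r:{s..t}. D r g\<bar> <= C * B*(t-s)"
  by (rule set_integral_Icc_abs_le[OF set_integrable_subset[OF int[OF g(1)]] bd[OF _ g]]) (use st in auto)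
 thus "\<bar>D t f-D s f\<bar> <= 2 * dl+C * B*(t-s)" using 1 by linarith
qed

text \<open>The equation up to \<open>dl\<close> for f and for f'' - c f: the second controls how
  far the time derivative of the first drifts within a step.\<close>

definition wf1 :: "(nat => real => real) => bool" where
 "wf1 f \<longleftrightarrow> (ALL t:{0..T}. \<bar>D t (f 0)-D 0 (f 0)-(LBINT r:{0..t}. D r (%u.-c * f 0 u+f 2 u))\<bar> <= dl)
  & (ALL t:{0..T}. \<bar>D t (%u.-c * f 0 u+f 2 u)-D 0 (%u.-c * f 0 u+f 2 u)
   -(LBINT r:{0..t}. D r (%u.-c*(- c * f 0 u+f 2 u)+(- c * f 2 u+f 4 u)))\<bar> <= dl)"

text \<open>An explicit Euler step in time, with f + h f'' replaced by the average. What is left,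
  apart from (1 - c h) times the averaged pairing, is of second order in h or a residual; the factor
  1 - c h lies in [0, 1] and is dropped.\<close>

lemma one_step:
 assumes f: "jet f" and B: "jbound b B f" and w: "wf1 f" and h: "0 < h" "h <= 1" "c * h <= 1"
  and t: "0 <= t" "t+h <= T" and a: "a = sqrt (2 * h)"
 shows "\<bar>D (t+h) (f 0)\<bar> <= \<bar>D t (avg a f 0)\<bar>
 +(4 * dl+C * B*(h^2*((1+c)^2+c)+2*(a ^ 3 * exp (b * a))))"
proof -
 have cs: "csupp (f 0)" "csupp (f 2)" "csupp (f 4)" using f by (simp_all add: jet_def)
 define \<psi> where "\<psi> = (%u.-c * f 0 u+f 2 u)"
 define \<theta> where "\<theta> = (%u.-c * \<psi> u+(- c * f 2 u+f 4 u))"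
 have cs\<psi>: "csupp \<psi>" and cs\<theta>: "csupp \<theta>" unfolding \<psi>_def \<theta>_def by (intro csupp_linear cs)+
 have Bj: "\<bar>f j u\<bar> <= B/cosh (b * u)" if "j <= 4" for j u using B that by (simp add: jbound_def)
 have B0: "0 <= B" using Bj[of 0 0] by simp
 have a0: "0 < a" "a^2 = 2 * h" using h by (auto simp: a)
 have comb: "\<bar>- c * x+y\<bar> <= (1+c) * q" if "\<bar>x\<bar> <= q" "\<bar>y\<bar> <= q" for x y q :: real
 proof -
  have "\<bar>- c * x+y\<bar> <= c * \<bar>x\<bar>+\<bar>y\<bar>" using abs_triangle_ineq[of "- c * x" y] c by (simp add: abs_mult)
  also have "... <= c * q+q" using that c by (intro add_mono mult_left_mono) auto
  finally show ?thesis by (simp add: distrib_right)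
 qed
 have \<psi>B: "\<bar>\<psi> u\<bar> <= (1+c) * B/cosh (b * u)" for u
  unfolding \<psi>_def using comb[OF Bj[of 0 u] Bj[of 2 u]] by simp
 have \<theta>B: "\<bar>\<theta> u\<bar> <= (1+c)^2 * B/cosh (b * u)" for u
 proof -
  have "\<bar>- c * f 2 u+f 4 u\<bar> <= (1+c) * B/cosh (b * u)" using comb[OF Bj[of 2 u] Bj[of 4 u]] by simp
  from comb[OF \<psi>B[of u] this] show ?thesis unfolding \<theta>_def by (simp add: power2_eq_square mult.assoc)
 qed
 have w1: "!!t. t \<in> {0..T} ==> \<bar>D t (f 0)-D 0 (f 0)-(LBINT r:{0..t}. D r \<psi>)\<bar> <= dl"
  and w2: "!!t. t \<in> {0..T} ==> \<bar>D t \<psi> - D 0 \<psi> - (LBINT r:{0..t}. D r \<theta>)\<bar> <= dl"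
  using w unfolding wf1_def \<psi>_def \<theta>_def by simp_all
 have tT: "t \<in> {0..T}" "t <= t+h" using t h by auto
 have s1: "\<bar>D (t+h) (f 0)-D t (f 0)-(LBINT r:{t..t+h}. D r \<psi>)\<bar> <= 2 * dl"
  by (rule increment(1)[OF w1 cs\<psi> \<psi>B t(1) tT(2) t(2)])
 have i\<psi>: "set_integrable lborel {t..t+h} (%r. D r \<psi>)" by (rule set_integrable_subset[OF int[OF cs\<psi>]]) (use t in auto)
 have ic: "set_integrable lborel {t..t+h} (%r. D t \<psi>)"
  unfolding set_integrable_def by (auto intro!: integrable_mult_left integrable_indicator_Icc)
 have "\<bar>LBINT r:{t..t+h}. D r \<psi> - D t \<psi>\<bar> <= (2 * dl+C*((1+c)^2 * B) * h)*(t+h-t)"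
 proof (rule set_integral_Icc_abs_le[OF set_integral_diff(1)[OF i\<psi> ic]])
  fix r assume r: "r \<in> {t..t+h}"
  have "\<bar>D r \<psi> - D t \<psi>\<bar> <= 2 * dl+C*((1+c)^2 * B)*(r-t)"
   by (rule increment(2)[OF w2 cs\<theta> \<theta>B t(1)]) (use r t in auto)
  also have "... <= 2 * dl+C*((1+c)^2 * B) * h"
   using r C B0 by (intro add_left_mono mult_left_mono mult_nonneg_nonneg) auto
  finally show "\<bar>D r \<psi> - D t \<psi>\<bar> <= 2 * dl+C*((1+c)^2 * B) * h" .
 qed (use h in simp)
 hence s2: "\<bar>(LBINT r:{t..t+h}. D r \<psi>)-h * D t \<psi>\<bar> <= 2 * dl * h+C*((1+c)^2 * B) * h^2"
  using h unfolding set_integral_diff(2)[OF i\<psi> ic] by (simp add: set_lebesgue_integral_def power2_eq_square algebra_simps)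
 define R where "R = residual a f"
 have csA: "csupp (avg a f 0)" by (rule csupp_avg) (rule cs(1))
 have Req: "R = (%u.-h * f 2 u+(- 1 * f 0 u+avg a f 0 u))"
  unfolding R_def by (intro ext) (simp add: residual_def a0(2))
 have csR: "csupp R" unfolding Req by (intro csupp_linear cs csA)
 have RB: "\<bar>R u\<bar> <= a ^ 3 * B * exp (b * a)/cosh (b * u)" for u
  unfolding R_def by (rule residual_bound[OF f B b a0(1)])
 define P where "P = a ^ 3 * B * exp (b * a)"
 have P: "0 <= P" using a0 B0 by (simp add: P_def)
 have DR: "\<bar>D t R\<bar> <= C * P" unfolding P_def by (rule bd[OF tT(1) csR RB])
 have D2: "\<bar>D t (f 2)\<bar> <= C * B" by (rule bd[OF tT(1) cs(2)]) (rule Bj, simp)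
 have DRe: "D t R = - h * D t (f 2)+(- D t (f 0)+D t (avg a f 0))"
 proof -
  have "D t R = - h * D t (f 2)+D t (%u.-1 * f 0 u+avg a f 0 u)"
   unfolding Req by (rule lin[OF tT(1) cs(2) csupp_linear[OF cs(1) csA]])
  also have "D t (%u.-1 * f 0 u+avg a f 0 u) = - 1 * D t (f 0)+D t (avg a f 0)"
   by (rule lin[OF tT(1) cs(1) csA])
  finally show ?thesis by simp
 qed
 have D\<psi>: "D t \<psi> = - c * D t (f 0)+D t (f 2)" unfolding \<psi>_def by (rule lin[OF tT(1) cs(1,2)])
 define A where "A = D t (avg a f 0)"
 \<comment> \<open>Insert x + h y = A - r, where x and y are the pairings with f and f'' and r that
   with the residual; the only extra term is c h^2 y.\<close>
 have main: "D t (f 0)+h * D t \<psi> = (1-c * h) * A+c * h*(h * D t (f 2))-(1-c * h) * D t R"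
 proof -
  have "x+h*(- c * x+y) = (1-c * h) * A+c * h*(h * y)-(1-c * h) * r"
   if "r = - h * y+(- x+A)" for x y r by (simp add: that algebra_simps)
  from this[OF DRe[folded A_def]] show ?thesis unfolding D\<psi> .
 qed
 have ch: "0 <= 1-c * h" "1-c * h <= 1" "0 <= c * h" using h c by auto
 have t1: "\<bar>(1-c * h) * A\<bar> <= \<bar>A\<bar>"
  using ch by (simp add: abs_mult mult_left_le_one_le)
 have t2: "\<bar>(1-c * h) * D t R\<bar> <= C * P"
 proof -
  have "\<bar>(1-c * h) * D t R\<bar> <= \<bar>D t R\<bar>" using ch by (simp add: abs_mult mult_left_le_one_le)
  thus ?thesis using DR by linarith
 qed
 have t3: "\<bar>c * h*(h * D t (f 2))\<bar> <= c * h^2*(C * B)"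
 proof -
  have "c * h*(h * D t (f 2)) = c * h^2 * D t (f 2)" by (simp add: power2_eq_square)
  moreover have "c * h^2 * \<bar>D t (f 2)\<bar> <= c * h^2*(C * B)" by (rule mult_left_mono[OF D2]) (use c in simp)
  moreover have "\<bar>c * h^2 * D t (f 2)\<bar> = c * h^2 * \<bar>D t (f 2)\<bar>" using c by (simp add: abs_mult)
  ultimately show ?thesis by (simp only:)
 qed
 have dh: "2 * dl * h <= 2 * dl" using h dl by (simp add: mult_left_le)
 have "\<bar>D (t+h) (f 0)\<bar> <= \<bar>A\<bar>+C * P+c * h^2*(C * B)+(2 * dl+(2 * dl * h+C*((1+c)^2 * B) * h^2))"
 proof -
  have "\<bar>x\<bar> <= \<bar>A\<bar>+u2+u3+(v1+v2)"
   if "\<bar>x-y-i\<bar> <= v1" "\<bar>i-z\<bar> <= v2" "y+z = p1+p3-p2" "\<bar>p1\<bar> <= \<bar>A\<bar>" "\<bar>p2\<bar> <= u2" "\<bar>p3\<bar> <= u3"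
   for x y i z p1 p2 p3 u2 u3 v1 v2 :: real using that by linarith
  from this[OF s1 s2 main t1 t2 t3] show ?thesis .
 qed
 also have "... <= \<bar>A\<bar>+(4 * dl+C * B*(h^2*((1+c)^2+c)+2*(a ^ 3 * exp (b * a))))"
 proof -
  have e: "C * B*(h^2*((1+c)^2+c)+2*(a ^ 3 * exp (b * a)))
   = C*((1+c)^2 * B) * h^2+c * h^2*(C * B)+C * P+C * P"
   by (simp add: P_def algebra_simps)
  have "0 <= C * P" using C P by simp
  thus ?thesis unfolding e using dh by linarith
 qed
 finally show ?thesis unfolding A_def .
qed

text \<open>Each step back in time adds one average to the test function. The weighted bound of the
  k-fold average grows by cosh (b a)^k, which E dominates for all k <= n.\<close>

lemma iterate_steps:
 assumes f: "jet f" and B: "jbound b B f" and h: "0 < h" "h <= 1" "c * h <= 1" and a: "a = sqrt (2 * h)"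
  and w: "!!k. k < n ==> wf1 ((avg a ^^ k) f)" and E: "1 <= E" "cosh (b * a) ^ n <= E"
  and kn: "k <= n" and kT: "real n * h <= T"
 shows "j <= k ==> \<bar>D (real j * h) ((avg a ^^ (k-j)) f 0)\<bar> <= \<bar>D 0 ((avg a ^^ k) f 0)\<bar>
 +real j*(4 * dl+C*(B * E)*(h^2*((1+c)^2+c)+2*(a ^ 3 * exp (b * a))))"
proof (induction j)
 case (Suc j)
 let ?S = "h^2*((1+c)^2+c)+2*(a ^ 3 * exp (b * a))"
 define i where "i = k-Suc j"
 have i: "k-j = Suc i" "i < n" "i <= n" using Suc.prems kn by (auto simp: i_def)
 have a0: "0 <= a" using h by (simp add: a)
 have B0: "0 <= B" using B[unfolded jbound_def, rule_format, of 0 0] by simp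
 have c1: "1 <= cosh (b * a)" by (rule cosh_real_ge_1)
 have "cosh (b * a) ^ i <= cosh (b * a) ^ n" by (rule power_increasing[OF i(3) c1])
 hence "B * cosh (b * a) ^ i <= B * E" using E B0 by (intro mult_left_mono) auto
 hence "C*(B * cosh (b * a) ^ i) <= C*(B * E)" by (rule mult_left_mono[OF _ C])
 hence BE: "C*(B * cosh (b * a) ^ i) * ?S <= C*(B * E) * ?S"
  by (rule mult_right_mono) (use c a0 in simp)
 have jT: "0 <= real j * h" "real j * h+h <= T"
 proof -
  have "real (Suc j) * h <= real n * h" using Suc.prems kn h by (intro mult_right_mono) auto
  thus "0 <= real j * h" "real j * h+h <= T" using kT h by (auto simp: algebra_simps)
 qed
 have "\<bar>D (real j * h+h) ((avg a ^^ i) f 0)\<bar> <= \<bar>D (real j * h) (avg a ((avg a ^^ i) f) 0)\<bar>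
  +(4 * dl+C*(B * cosh (b * a) ^ i) * ?S)"
  by (rule one_step[OF jet_iter[OF f] jbound_iter[OF B] w[OF i(2)] h jT a])
 also have "avg a ((avg a ^^ i) f) = (avg a ^^ (k-j)) f" unfolding i(1) by simp
 finally have "\<bar>D (real j * h+h) ((avg a ^^ i) f 0)\<bar> <= \<bar>D (real j * h) ((avg a ^^ (k-j)) f 0)\<bar>
  +(4 * dl+C*(B * E) * ?S)" using BE by linarith
 moreover have "\<bar>D (real j * h) ((avg a ^^ (k-j)) f 0)\<bar> <= \<bar>D 0 ((avg a ^^ k) f 0)\<bar>+real j*(4 * dl+C*(B * E) * ?S)"
  by (rule Suc.IH) (use Suc.prems in simp)
 moreover have "real (Suc j) * h = real j * h+h" by (simp add: distrib_right)
 moreover have "real (Suc j)*(4 * dl+C*(B * E) * ?S) = real j*(4 * dl+C*(B * E) * ?S)+(4 * dl+C*(B * E) * ?S)"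
  by (simp only: of_nat_Suc distrib_right mult_1 add.commute)
 moreover have "x <= z+(p+q)" if "x <= y+q" "y <= z+p" for x y z p q :: real using that by linarith
 ultimately show ?case unfolding i_def by (simp only:)
qed simp

end

text \<open>Parameters of the scheme: the step is \<open>h = T/n\<close>, and \<open>dl\<close> bounds the defect for the finitely
 many test functions \<open>avg\<^sup>k f\<close>, \<open>k <= n\<close>.\<close>
lemma scheme_parameters:
 fixes b C c T e B :: real
 assumes b: "0 <= b" and C: "0 <= C" and c: "0 <= c" and T: "0 < T" and e: "0 < e" and f: "jet f" and B: "jbound b B f"
 shows "EX n>=1. EX dl>0. ALL D. scheme D b C c T dl -->
  (ALL k<n. scheme.wf1 D c T dl ((avg (sqrt (2*(T/real n))) ^^ k) f)) -->
  (ALL k<=n. \<bar>D 0 ((avg (sqrt (2*(T/real n))) ^^ k) f 0)\<bar> <= dl) --> (ALL t:{0..T}. \<bar>D t (f 0)\<bar> <= e)"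
proof -
 have B0: "0 <= B" using B[unfolded jbound_def, rule_format, of 0 0] by simp
 \<comment> \<open>cosh (b a)^n <= exp (n b^2 a^2), and n a^2 = 2 n h = 2 T.\<close>
 define E where "E = exp (2 * b^2 * T)"
 have E1: "1 <= E" using T by (simp add: E_def)
 let ?h = "%n. T*(1/real n)"
 let ?a = "%n. sqrt (2*(T*(1/real n)))"
 let ?Q = "%n. C*(B * E)*(T*(?h n*((1+c)^2+c)+4*(?a n * exp (b * ?a n))))+C*((1+c) * B) * ?h n"
 have hl: "?h \<longlonglongrightarrow> T*0" by (intro tendsto_intros lim_1_over_n)
 have al: "?a \<longlonglongrightarrow> sqrt (2*(T*0))" by (intro tendsto_intros lim_1_over_n)
 have "?Q \<longlonglongrightarrow> C*(B * E)*(T*(T*0*((1+c)^2+c)+4*(sqrt (2*(T*0)) * exp (b * sqrt (2*(T*0))))))+C*((1+c) * B)*(T*0)"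
  by (intro tendsto_intros hl al)
 hence "?Q \<longlonglongrightarrow> 0" by simp
 hence ev1: "\<forall>\<^sub>F n in sequentially. ?Q n < e/2" by (rule order_tendstoD(2)) (use e in simp)
 have "?h \<longlonglongrightarrow> 0" using hl by simp
 hence ev2: "\<forall>\<^sub>F n in sequentially. ?h n < 1" by (rule order_tendstoD(2)) simp
 have "(%n. c * ?h n) \<longlonglongrightarrow> c*(T*0)" by (intro tendsto_intros hl)
 hence "(%n. c * ?h n) \<longlonglongrightarrow> 0" by simp
 hence ev3: "\<forall>\<^sub>F n in sequentially. c * ?h n < 1" by (rule order_tendstoD(2)) simp
 have "(%n. b * ?a n) \<longlonglongrightarrow> b * sqrt (2*(T*0))" by (intro tendsto_intros al)
 hence "(%n. b * ?a n) \<longlonglongrightarrow> 0" by simp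
 hence ev4: "\<forall>\<^sub>F n in sequentially. b * ?a n < 1" by (rule order_tendstoD(2)) simp
 have "\<forall>\<^sub>F n in sequentially. (?Q n < e/2 & ?h n < 1) & (c * ?h n < 1 & b * ?a n < 1)"
  by (intro eventually_conj ev1 ev2 ev3 ev4)
 then obtain n where n: "n >= 1" "(?Q n < e/2 & ?h n < 1) & (c * ?h n < 1 & b * ?a n < 1)"
  using eventually_sequentiallyI1 by blast
 define h where "h = T/real n"
 define a where "a = sqrt (2 * h)"
 have hh: "?h n = h" "?a n = a" by (simp_all add: h_def a_def)
 have Q: "C*(B * E)*(T*(h*((1+c)^2+c)+4*(a * exp (b * a))))+C*((1+c) * B) * h < e/2"
  and h1': "h < 1" "c * h < 1" and ba': "b * a < 1"
 proof -
  have *: "(C*(B * E)*(T*(h*((1+c)^2+c)+4*(a * exp (b * a))))+C*((1+c) * B) * h < e/2 & h < 1)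
   & (c * h < 1 & b * a < 1)"
   using n(2) by (simp only: hh a_def[symmetric])
  show "C*(B * E)*(T*(h*((1+c)^2+c)+4*(a * exp (b * a))))+C*((1+c) * B) * h < e/2"
   by (rule conjunct1[OF conjunct1[OF *]])
  show "h < 1" "c * h < 1" "b * a < 1" using * by simp_all
 qed
 have h1: "0 < h" "h <= 1" "c * h <= 1" using h1' n(1) T by (simp_all add: h_def)
 have ba: "b * a <= 1" using ba' by simp
 have nh: "real n * h = T" using n by (simp add: h_def)
 have a0: "0 <= a" "a^2 = 2 * h" using h1 by (auto simp: a_def)
 have a3: "a ^ 3 = 2 * h * a" using a0(2) by (simp add: power3_eq_cube power2_eq_square)
 have coshE: "cosh (b * a) ^ n <= E"
 proof -
  have "0 <= b * a" using b a0 by simp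
  hence "cosh (b * a) ^ n <= exp ((b * a)^2) ^ n"
   by (intro power_mono cosh_le_exp_square ba less_imp_le[OF cosh_real_pos])
  also have "... = exp (real n*(b * a)^2)" by (simp add: exp_of_nat_mult)
  also have "real n*(b * a)^2 = 2 * b^2*(real n * h)" using a0(2) by (simp add: power_mult_distrib)
  finally show ?thesis unfolding nh E_def .
 qed
 \<comment> \<open>The defect enters 4 times in each of n steps, once through the initial pairing
   and twice in the last partial step, in total within e/2.\<close>
 define dl where "dl = e/(2*(4 * real n+4))"
 have dl: "dl > 0" using e by (simp add: dl_def add_nonneg_pos)
 have dle: "dl+real n*(4 * dl)+2 * dl <= e/2"
 proof -
  have "(4 * real n+4) * dl = e/2" using e by (simp add: dl_def field_simps)
  thus ?thesis using dl by (simp add: algebra_simps)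
 qed
 show ?thesis
 proof (intro exI[of _ n] exI[of _ dl] conjI allI impI ballI, rule n(1), rule dl)
  fix D t assume S: "scheme D b C c T dl"
   and w: "ALL k<n. scheme.wf1 D c T dl ((avg (sqrt (2*(T/real n))) ^^ k) f)"
   and z: "ALL k<=n. \<bar>D 0 ((avg (sqrt (2*(T/real n))) ^^ k) f 0)\<bar> <= dl" and t: "t \<in> {0..T}"
  interpret scheme D b C c T dl by (rule S)
  \<comment> \<open>Whole steps reach k h; the remaining time, less than h, is bridged by the
    Lipschitz estimate \<open>increment\<close>.\<close>
  define k where "k = nat \<lfloor>t/h\<rfloor>"
  have th: "0 <= t/h" using t h1 by simp
  hence kr: "real k = real_of_int \<lfloor>t/h\<rfloor>" by (simp add: k_def)
  have k12: "real k <= t/h" "t/h < real k+1" unfolding kr by linarith+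
  have ct: "t/h * h = t" using h1 by simp
  have "real k * h <= t/h * h" using k12(1) h1 by (intro mult_right_mono) auto
  hence k1: "real k * h <= t" unfolding ct .
  have "t/h * h < (real k+1) * h" using k12(2) h1 by (intro mult_strict_right_mono) auto
  hence k2: "t < real k * h+h" unfolding ct by (simp add: distrib_right)
  have "real k * h <= real n * h" using k1 t nh by simp
  hence kn: "k <= n" using h1 by simp
  have wk: "wf1 ((avg a ^^ k) f)" if "k < n" for k using w[rule_format, OF that] unfolding a_def h_def .
  have i1: "\<bar>D (real k * h) ((avg a ^^ (k-k)) f 0)\<bar> <= \<bar>D 0 ((avg a ^^ k) f 0)\<bar>
  +real k*(4 * dl+C*(B * E)*(h^2*((1+c)^2+c)+2*(a ^ 3 * exp (b * a))))"
   by (rule iterate_steps[OF f B h1 a_def wk E1 coshE kn _ order_refl]) (use nh in simp_all)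
  have i2: "\<bar>D 0 ((avg a ^^ k) f 0)\<bar> <= dl" using z[rule_format, OF kn] unfolding a_def h_def .
  have "real k*(4 * dl+C*(B * E)*(h^2*((1+c)^2+c)+2*(a ^ 3 * exp (b * a))))
   <= real n*(4 * dl+C*(B * E)*(h^2*((1+c)^2+c)+2*(a ^ 3 * exp (b * a))))"
   using kn C B0 E1 c dl a0 by (intro mult_right_mono add_nonneg_nonneg mult_nonneg_nonneg) auto
  also have "... = real n*(4 * dl)+C*(B * E)*((real n * h)*(h*((1+c)^2+c)+4*(a * exp (b * a))))"
  proof -
   have "r*(x+z*(h^2 * p+2*(2 * h * a * q))) = r * x+z*((r * h)*(h * p+4*(a * q)))" for r x z p q
    by (simp add: power2_eq_square algebra_simps)
   thus ?thesis unfolding a3 .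
  qed
  finally have i3: "real k*(4 * dl+C*(B * E)*(h^2*((1+c)^2+c)+2*(a ^ 3 * exp (b * a))))
   <= real n*(4 * dl)+C*(B * E)*(T*(h*((1+c)^2+c)+4*(a * exp (b * a))))" unfolding nh .
  have "(avg a ^^ (k-k)) f 0 = f 0" by simp
  hence g: "\<bar>D (real k * h) (f 0)\<bar> <= dl+(real n*(4 * dl)+C*(B * E)*(T*(h*((1+c)^2+c)+4*(a * exp (b * a)))))"
   using order_trans[OF i1 add_mono[OF i2 i3]] by (simp only:)
  have "wf1 ((avg a ^^ 0) f)" by (rule wk) (use n in simp)
  hence w0: "\<bar>D t (f 0)-D 0 (f 0)-(LBINT r:{0..t}. D r (%u.-c * f 0 u+f 2 u))\<bar> <= dl" if "t \<in> {0..T}" for t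
   unfolding wf1_def using that by (elim conjE) (simp only: funpow_0)
  have cs: "csupp (%u.-c * f 0 u+f 2 u)" by (rule csupp_linear) (use f in \<open>simp_all add: jet_def\<close>)
  have bb: "\<bar>- c * f 0 u+f 2 u\<bar> <= (1+c) * B/cosh (b * u)" for u
  proof -
   have "\<bar>f 0 u\<bar> <= B/cosh (b * u)" "\<bar>f 2 u\<bar> <= B/cosh (b * u)" using B by (simp_all add: jbound_def)
   hence "c * \<bar>f 0 u\<bar>+\<bar>f 2 u\<bar> <= c*(B/cosh (b * u))+B/cosh (b * u)" using c by (intro add_mono mult_left_mono)
   moreover have "\<bar>- c * f 0 u+f 2 u\<bar> <= c * \<bar>f 0 u\<bar>+\<bar>f 2 u\<bar>"
    using abs_triangle_ineq[of "- c * f 0 u" "f 2 u"] c by (simp add: abs_mult)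
   moreover have "c*(B/cosh (b * u))+B/cosh (b * u) = (1+c) * B/cosh (b * u)" by (simp add: algebra_simps add_divide_distrib)
   ultimately show ?thesis by linarith
  qed
  have "\<bar>D t (f 0)-D (real k * h) (f 0)\<bar> <= 2 * dl+C*((1+c) * B)*(t-real k * h)"
   by (rule increment(2)[OF w0 cs bb]) (use k1 t h1 in auto)
  also have "... <= 2 * dl+C*((1+c) * B) * h"
   using k2 C c B0 by (intro add_left_mono mult_left_mono mult_nonneg_nonneg) auto
  finally have g2: "\<bar>D t (f 0)-D (real k * h) (f 0)\<bar> <= 2 * dl+C*((1+c) * B) * h" .
  have "\<bar>x\<bar> <= e" if "\<bar>y\<bar> <= dl+(p+q)" "\<bar>x-y\<bar> <= r+s" "q+s < e/2" "dl+p+r <= e/2" for x y p q r s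
   using that by linarith
  from this[OF g g2 Q dle] show "\<bar>D t (f 0)\<bar> <= e" .
 qed
qed

section \<open>The Gaussian solution\<close>

abbreviation nd :: "real => real" where "nd \<equiv> std_normal_density"

text \<open>The moment generating function of the normal law, by completing the square.\<close>

lemma gauss_exp: "has_bochner_integral lborel (%z. nd z * exp (k * z)) (exp (k^2/2))"
proof -
 have "has_bochner_integral lborel nd 1"
  by (simp add: has_bochner_integral_iff integrable_normal_density integral_normal_density)
 hence "has_bochner_integral lborel (%z. nd (- k+1 * z)) (1 /\<^sub>R \<bar>1\<bar>)"
  by (subst lborel_has_bochner_integral_real_affine_iff[symmetric]) simp_all
 hence "has_bochner_integral lborel (%z. exp (k^2/2) * nd (z-k)) (exp (k^2/2)*1)"
  by (intro has_bochner_integral_mult_right) simp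
 moreover have "exp (k^2/2) * nd (z-k) = nd z * exp (k * z)" for z
 proof -
  have "k\<^sup>2/2 + - (z-k)\<^sup>2/2 = - z\<^sup>2/2+k * z" by (simp add: power2_eq_square field_simps)
  hence "exp (k\<^sup>2/2) * exp (- (z-k)\<^sup>2/2) = exp (- z\<^sup>2/2) * exp (k * z)"
   by (simp only: exp_add[symmetric])
  thus ?thesis by (simp add: std_normal_density_def)
 qed
 ultimately show ?thesis by simp
qed

text \<open>At most exponential growth: a class integrable against every Gaussian and stable under
  scaling and multiplication by the variable.\<close>

definition expb :: "real => real => (real => real) => bool" where
 "expb A k f \<longleftrightarrow> 0 <= k & f \<in> borel_measurable borel & (ALL z. \<bar>f z\<bar> <= A * exp (k * \<bar>z\<bar>))"

lemma expb_nonneg: "expb A k f ==> 0 <= A"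
 unfolding expb_def by (elim conjE) (drule spec[of _ 0], simp)

lemma gauss_expb:
 assumes "expb A k f"
 shows "integrable lborel (%z. nd z * f z)" "\<bar>LBINT z. nd z * f z\<bar> <= 2 * A * exp (k^2/2)"
proof -
 have A: "0 <= A" by (rule expb_nonneg[OF assms])
 have [measurable]: "f \<in> borel_measurable borel" using assms by (simp add: expb_def)
 define w where "w = (%z. A*(nd z * exp (k * z))+A*(nd z * exp ((- k) * z)))"
 have hw: "has_bochner_integral lborel w (A * exp (k\<^sup>2/2)+A * exp ((- k)\<^sup>2/2))"
  unfolding w_def by (intro has_bochner_integral_add has_bochner_integral_mult_right gauss_exp)
 have le: "\<bar>nd z * f z\<bar> <= w z" for z
 proof -
  have n0: "0 <= nd z" by simp
  have "exp (k * \<bar>z\<bar>) <= exp (k * z)+exp ((- k) * z)" by (cases "0 <= z") (simp_all add: add_nonneg_nonneg add.commute less_imp_le)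
  hence "A * exp (k * \<bar>z\<bar>) <= A*(exp (k * z)+exp ((- k) * z))" by (rule mult_left_mono[OF _ A])
  moreover have "\<bar>f z\<bar> <= A * exp (k * \<bar>z\<bar>)" using assms by (simp add: expb_def)
  ultimately have "\<bar>f z\<bar> <= A*(exp (k * z)+exp ((- k) * z))" by (rule order_trans[rotated])
  hence "nd z * \<bar>f z\<bar> <= nd z*(A*(exp (k * z)+exp ((- k) * z)))" by (rule mult_left_mono[OF _ n0])
  also have "... = w z" unfolding w_def by (simp only: distrib_left mult.assoc mult.left_commute)
  finally show ?thesis by (simp add: abs_mult)
 qed
 show i: "integrable lborel (%z. nd z * f z)"
  by (rule Bochner_Integration.integrable_bound[OF integrable.intros[OF hw]])
   (simp, rule AE_I2, simp only: real_norm_def order_trans[OF le abs_ge_self])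
 have "norm (LBINT z. nd z * f z) <= (LBINT z. w z)"
  by (rule order_trans[OF integral_norm_bound integral_mono[OF integrable_norm[OF i] integrable.intros[OF hw]]])
   (use le in simp)
 also have "(LBINT z. w z) = 2 * A * exp (k^2/2)" using has_bochner_integral_integral_eq[OF hw] by simp
 finally show "\<bar>LBINT z. nd z * f z\<bar> <= 2 * A * exp (k^2/2)" by simp
qed

lemma expb_times:
 assumes "expb A k f"
 shows "expb A (k+1) (%z. z * f z)"
proof -
 have [measurable]: "f \<in> borel_measurable borel" using assms by (simp add: expb_def)
 have "\<bar>z * f z\<bar> <= A * exp ((k+1) * \<bar>z\<bar>)" for z
 proof -
  have "\<bar>z\<bar> <= exp \<bar>z\<bar>" using exp_ge_add_one_self[of "\<bar>z\<bar>"] by linarith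
  hence "\<bar>z\<bar> * \<bar>f z\<bar> <= exp \<bar>z\<bar>*(A * exp (k * \<bar>z\<bar>))"
   by (rule mult_mono) (use assms in \<open>auto simp: expb_def\<close>)
  also have "... = A * exp ((k+1) * \<bar>z\<bar>)" by (simp add: distrib_right exp_add)
  finally show ?thesis by (simp add: abs_mult)
 qed
 thus ?thesis using assms by (simp add: expb_def)
qed

lemma expb_scale:
 assumes f: "expb A k f" and b: "\<bar>b\<bar> <= a"
 shows "expb A (k * a) (%z. f (b * z))"
proof -
 have [measurable]: "f \<in> borel_measurable borel" using f by (simp add: expb_def)
 have k: "0 <= k" using f by (simp add: expb_def)
 have "\<bar>f (b * z)\<bar> <= A * exp (k * a * \<bar>z\<bar>)" for z
 proof -
  have "k * \<bar>b * z\<bar> <= k * a * \<bar>z\<bar>" unfolding abs_mult mult.assoc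
   by (intro mult_left_mono mult_right_mono k b) simp
  hence "A * exp (k * \<bar>b * z\<bar>) <= A * exp (k * a * \<bar>z\<bar>)" using expb_nonneg[OF f] by (intro mult_left_mono) auto
  moreover have "\<bar>f (b * z)\<bar> <= A * exp (k * \<bar>b * z\<bar>)" using f by (simp add: expb_def)
  ultimately show ?thesis by linarith
 qed
 thus ?thesis using k b by (simp add: expb_def)
qed

text \<open>Stein's identity: integrate the derivative of density times f over the line; the
  Gaussian beats the exponential growth at both ends.\<close>

lemma gauss_IBP:
 assumes d: "!!x. (f has_real_derivative f' x) (at x)" and c: "continuous_on UNIV f'"
  and f: "expb A k f" and f': "expb A' k' f'"
 shows "(LBINT z. nd z*(z * f z)) = (LBINT z. nd z * f' z)"
proof -
 let ?F = "%z. nd z * f z"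
 let ?g = "%z. nd z * f' z-nd z*(z * f z)"
 have dn: "(nd has_real_derivative-x * nd x) (at x)" for x
  unfolding std_normal_density_def by (rule derivative_eq_intros | simp)+
 have cn: "continuous_on UNIV nd" by (rule DERIV_continuous_on) (rule dn[THEN DERIV_subset], simp)
 have cf: "continuous_on UNIV f" using d by (auto intro!: DERIV_continuous_on)
 have cg: "continuous_on UNIV ?g" by (intro continuous_intros cn cf c)
 have i1: "integrable lborel (%z. nd z * f' z)" by (rule gauss_expb(1)[OF f'])
 have i2: "integrable lborel (%z. nd z*(z * f z))" by (rule gauss_expb(1)[OF expb_times[OF f]])
 have A: "0 <= A" by (rule expb_nonneg[OF f])
 have top: "(?F \<longlongrightarrow> 0) at_top"
 proof (rule Lim_null_comparison)
  have "((%z. exp (k * z-z^2/2)) \<longlongrightarrow> 0) at_top" by real_asymp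
  hence "((%z. A*(1/sqrt (2 * pi)) * exp (k * z-z^2/2)) \<longlongrightarrow> 0) at_top" by (rule tendsto_mult_right_zero)
  moreover have "A*(1/sqrt (2 * pi)) * exp (k * z-z\<^sup>2/2) = A * exp (k * z)*(1/sqrt (2 * pi) * exp (- z\<^sup>2/2))" for z
   using exp_add[of "k * z" "- z\<^sup>2/2"] by simp
  ultimately show "((%z. A * exp (k * z)*(1/sqrt (2 * pi) * exp (- z\<^sup>2/2))) \<longlongrightarrow> 0) at_top"
   by (simp only:)
  show "\<forall>\<^sub>F z in at_top. norm (?F z) <= A * exp (k * z)*(1/sqrt (2 * pi) * exp (- z\<^sup>2/2))"
   using eventually_ge_at_top[of 0]
  proof eventually_elim
   case (elim z)
   have "nd z * \<bar>f z\<bar> <= nd z*(A * exp (k * z))" using f elim by (intro mult_left_mono) (auto simp: expb_def dest: spec[of _ z])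
   thus ?case by (simp add: abs_mult std_normal_density_def mult_ac)
  qed
 qed
 have bot: "(?F \<longlongrightarrow> 0) at_bot"
 proof (rule Lim_null_comparison)
  have "((%z. exp (k*(- z)-z\<^sup>2/2)) \<longlongrightarrow> 0) at_bot" by real_asymp
  hence "((%z. A*(1/sqrt (2 * pi)) * exp (k*(- z)-z\<^sup>2/2)) \<longlongrightarrow> 0) at_bot" by (rule tendsto_mult_right_zero)
  moreover have "A*(1/sqrt (2 * pi)) * exp (k*(- z)-z\<^sup>2/2) = A * exp (k*(- z))*(1/sqrt (2 * pi) * exp (- z\<^sup>2/2))" for z
   using exp_add[of "k*(- z)" "- z\<^sup>2/2"] by simp
  ultimately show "((%z. A * exp (k*(- z))*(1/sqrt (2 * pi) * exp (- z\<^sup>2/2))) \<longlongrightarrow> 0) at_bot"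
   by (simp only:)
  show "\<forall>\<^sub>F z in at_bot. norm (?F z) <= A * exp (k*(- z))*(1/sqrt (2 * pi) * exp (- z\<^sup>2/2))"
   using eventually_le_at_bot[of 0]
  proof eventually_elim
   case (elim z)
   have "nd z * \<bar>f z\<bar> <= nd z*(A * exp (k*(- z)))" using f elim by (intro mult_left_mono) (auto simp: expb_def dest: spec[of _ z])
   thus ?case by (simp add: abs_mult std_normal_density_def mult_ac)
  qed
 qed
 have "(LBINT z=-\<infinity>..\<infinity>. ?g z) = 0-0"
 proof (rule interval_integral_FTC_integrable[where F = ?F])
  fix x :: real
  have "(?F has_real_derivative nd x * f' x + - x * nd x * f x) (at x)" by (rule DERIV_mult'[OF dn d])
  thus "(?F has_vector_derivative ?g x) (at x)"
   by (simp add: has_real_derivative_iff_has_vector_derivative mult_ac)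
  show "isCont ?g x" using cg by (simp add: continuous_on_eq_continuous_at)
 next
  show "set_integrable lborel (einterval (- \<infinity>) \<infinity>) ?g"
   unfolding set_integrable_def einterval_def using Bochner_Integration.integrable_diff[OF i1 i2] by simp
  show "((?F \<circ> real_of_ereal) \<longlongrightarrow> 0) (at_right (- \<infinity>))" using bot by (simp add: ereal_tendsto_simps)
  show "((?F \<circ> real_of_ereal) \<longlongrightarrow> 0) (at_left \<infinity>)" using top by (simp add: ereal_tendsto_simps)
 qed simp
 hence "(LBINT z. ?g z) = 0"
  unfolding interval_lebesgue_integral_def einterval_def set_lebesgue_integral_def by simp
 thus ?thesis unfolding Bochner_Integration.integral_diff[OF i1 i2] by simp
qed

text \<open>Write f (a z) - f 0 as an integral of z f' (b z) over b in {0..a}, exchange the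
  integrals, and remove the factor z by Stein's identity, which yields b f'' (b z).\<close>

lemma gauss_heat:
 assumes d1: "!!x. (f has_real_derivative f' x) (at x)" and d2: "!!x. (f' has_real_derivative f'' x) (at x)"
  and c: "continuous_on UNIV f''" and f: "expb A k f" and f': "expb A k f'" and f'': "expb A k f''" and a: "0 <= a"
 shows "(LBINT z. nd z * f (a * z))-f 0 = (LBINT b:{0..a}. b*(LBINT z. nd z * f'' (b * z)))"
proof -
 have [measurable]: "f' \<in> borel_measurable borel" using f' by (simp add: expb_def)
 have cf': "continuous_on UNIV f'" using d2 by (auto intro!: DERIV_continuous_on)
 \<comment> \<open>The integrand before the exchange: its b-integral is the increment of f along the
   ray through z, its z-integral is what Stein's identity evaluates.\<close>
 define H where "H = (%(z, b). nd z*(z * f' (b * z)) * indicator {0..a} (b :: real))"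
 have Hm[measurable]: "H \<in> borel_measurable (lborel \<Otimes>\<^sub>M lborel)" unfolding H_def by measurable
 have k: "0 <= k" using f by (simp add: expb_def)
 have A: "0 <= A" by (rule expb_nonneg[OF f])
 let ?w = "%z. exp ((k * a+1) * \<bar>z\<bar>)"
 have wi: "integrable lborel (%z. nd z * ?w z)"
  by (rule gauss_expb(1)[of 1 "k * a+1"]) (use k a in \<open>simp add: expb_def\<close>)
 have Hb: "\<bar>H (z, b)\<bar> <= A*(nd z * ?w z) * indicator {0..a} b" for z b
 proof (cases "b \<in> {0..a}")
  case True
  hence "expb A (k * a+1) (%z. z * f' (b * z))" by (intro expb_times expb_scale f') auto
  hence "\<bar>z * f' (b * z)\<bar> <= A * ?w z" by (simp add: expb_def)
  hence "nd z * \<bar>z * f' (b * z)\<bar> <= nd z*(A * ?w z)" by (rule mult_left_mono) simp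
  thus ?thesis using True by (simp add: H_def abs_mult mult_ac)
 qed (simp add: H_def)
 have inner: "integrable lborel (%b. H (z, b))" for z
 proof (rule Bochner_Integration.integrable_bound)
  show "integrable lborel (%b. A*(nd z * ?w z) * indicator {0..a} b)"
   by (intro integrable_mult_right integrable_indicator_Icc)
  show "AE b in lborel. norm (H (z, b)) <= norm (A*(nd z * ?w z) * indicator {0..a} b)"
   by (rule AE_I2) (simp only: real_norm_def order_trans[OF Hb abs_ge_self])
 qed (unfold H_def, simp)
 have Hi: "integrable (lborel \<Otimes>\<^sub>M lborel) H"
 proof (rule lborel_pair.Fubini_integrable[OF Hm])
  show "integrable lborel (%z. LBINT b. norm (H (z, b)))"
  proof (rule Bochner_Integration.integrable_bound)
   show "integrable lborel (%z. A * a*(nd z * ?w z))" by (intro integrable_mult_right wi)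
   show "AE z in lborel. norm (LBINT b. norm (H (z, b))) <= norm (A * a*(nd z * ?w z))"
   proof (rule AE_I2)
    fix z :: real
    have "(LBINT b. norm (H (z, b))) <= (LBINT b. A*(nd z * ?w z) * indicator {0..a} b)"
     by (rule integral_mono[OF integrable_norm[OF inner]])
      (use Hb in \<open>auto intro!: integrable_mult_right integrable_indicator_Icc\<close>)
    also have "... = A * a*(nd z * ?w z)" using a by simp
    finally show "norm (LBINT b. norm (H (z, b))) <= norm (A * a*(nd z * ?w z))"
     using A a by simp
   qed
  qed measurable
 qed (use inner in simp)
 have ftc: "(LBINT b. H (z, b)) = nd z * f (a * z)-nd z * f 0" for z
 proof -
  have "(LBINT b. (z * f' (b * z)) * indicator {0..a} b) = f (a * z)-f (0 * z)"
  proof (rule integral_FTC_Icc_real[OF a])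
   fix x show "((%b. f (b * z)) has_real_derivative z * f' (x * z)) (at x)"
    by (rule DERIV_cong[OF DERIV_chain2[OF d1]]) (auto intro!: derivative_eq_intros)
   have "continuous_on UNIV (%b. z * f' (b * z))"
    by (intro continuous_on_mult continuous_on_const) (rule continuous_on_compose2[OF cf'], auto intro: continuous_intros)
   thus "isCont (%b. z * f' (b * z)) x" by (simp add: continuous_on_eq_continuous_at)
  qed
  hence "nd z*(LBINT b. (z * f' (b * z)) * indicator {0..a} b) = nd z*(f (a * z)-f 0)" by simp
  thus ?thesis unfolding H_def prod.case
   by (subst (asm) integral_mult_right_zero[symmetric]) (simp add: mult.assoc right_diff_distrib)
 qed
 have ibp: "(LBINT z. H (z, b)) = indicator {0..a} b*(b*(LBINT z. nd z * f'' (b * z)))" for b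
 proof (cases "b \<in> {0..a}")
  case True
  have dd: "((%z. f' (b * z)) has_real_derivative b * f'' (b * x)) (at x)" for x
   by (rule DERIV_cong[OF DERIV_chain2[OF d2]]) (auto intro!: derivative_eq_intros)
  have cc: "continuous_on UNIV (%z. b * f'' (b * z))"
   by (intro continuous_on_mult continuous_on_const) (rule continuous_on_compose2[OF c], auto intro: continuous_intros)
  have e2: "expb (b * A) (k * a) (%z. b * f'' (b * z))"
  proof -
   have "expb A (k * a) (%z. f'' (b * z))" by (rule expb_scale[OF f'']) (use True in simp)
   thus ?thesis using True by (auto simp: expb_def abs_mult mult.assoc intro!: mult_left_mono borel_measurable_times)
  qed
  have "(LBINT z. nd z*(z * f' (b * z))) = (LBINT z. nd z*(b * f'' (b * z)))"
   by (rule gauss_IBP[OF dd cc expb_scale[OF f', of b a] e2]) (use True in simp)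
  also have "... = b*(LBINT z. nd z * f'' (b * z))"
   by (subst integral_mult_right_zero[symmetric]) (simp add: mult_ac)
  finally show ?thesis using True by (simp add: H_def)
 qed (simp add: H_def)
 have i1: "integrable lborel (%z. nd z * f (a * z))" by (rule gauss_expb(1)[OF expb_scale[OF f, of a a]]) (use a in simp)
 have "has_bochner_integral lborel nd 1"
  by (simp add: has_bochner_integral_iff integrable_normal_density integral_normal_density)
 hence n1: "has_bochner_integral lborel (%z. nd z * f 0) (1 * f 0)" by (rule has_bochner_integral_mult_left)
 have "(LBINT z. (LBINT b. H (z, b))) = (LBINT b. (LBINT z. H (z, b)))"
  by (rule lborel_pair.Fubini_integral[symmetric]) (use Hi in \<open>simp add: H_def case_prod_eta\<close>)
 hence "(LBINT z. nd z * f (a * z)-nd z * f 0) = (LBINT b. indicator {0..a} b*(b*(LBINT z. nd z * f'' (b * z))))"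
  unfolding ftc ibp .
 thus ?thesis
  unfolding Bochner_Integration.integral_diff[OF i1 integrable.intros[OF n1]] has_bochner_integral_integral_eq[OF n1]
  by (simp add: set_lebesgue_integral_def mult_ac)
qed

lemma gauss_continuous:
 assumes V: "continuous_on UNIV V" and b: "expb A k V"
 shows "continuous_on UNIV (%p. LBINT z. nd z * V (fst p+snd p * z))"
proof -
 have [measurable]: "V \<in> borel_measurable borel" using b by (simp add: expb_def)
 have k: "0 <= k" and A: "0 <= A" using b expb_nonneg[OF b] by (simp_all add: expb_def)
 have "continuous (at q) (%p. LBINT z. nd z * V (fst p+snd p * z))" for q :: "real \<times> real"
  unfolding continuous_at_sequentially
 proof (intro allI impI)
  fix x :: "nat => real \<times> real" assume x: "x \<longlonglongrightarrow> q"
  have x12: "(%n. fst (x n)) \<longlonglongrightarrow> fst q" "(%n. snd (x n)) \<longlonglongrightarrow> snd q" by (intro tendsto_intros x)+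
  obtain B1 where B1: "!!n. \<bar>fst (x n)\<bar> <= B1"
   using convergent_imp_Bseq[OF convergentI[OF x12(1)]] by (auto simp: Bseq_def)
  obtain B2 where B2: "!!n. \<bar>snd (x n)\<bar> <= B2"
   using convergent_imp_Bseq[OF convergentI[OF x12(2)]] by (auto simp: Bseq_def)
  have B20: "0 <= B2" using B2[of 0] by linarith
  have "(%n. LBINT z. nd z * V (fst (x n)+snd (x n) * z)) \<longlonglongrightarrow> (LBINT z. nd z * V (fst q+snd q * z))"
  proof (rule integral_dominated_convergence[where w = "%z. nd z*(A * exp (k * B1) * exp (k * B2 * \<bar>z\<bar>))"])
   show "integrable lborel (%z. nd z*(A * exp (k * B1) * exp (k * B2 * \<bar>z\<bar>)))"
    by (rule gauss_expb(1)[of "A * exp (k * B1)" "k * B2"]) (use k B20 A in \<open>simp add: expb_def\<close>)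
   show "AE z in lborel. (%n. nd z * V (fst (x n)+snd (x n) * z)) \<longlonglongrightarrow> nd z * V (fst q+snd q * z)"
   proof (rule AE_I2)
    fix z
    have "isCont V (fst q+snd q * z)" using V by (simp add: continuous_on_eq_continuous_at)
    hence "(%n. V (fst (x n)+snd (x n) * z)) \<longlonglongrightarrow> V (fst q+snd q * z)"
     by (rule isCont_tendsto_compose) (intro tendsto_intros x12)
    thus "(%n. nd z * V (fst (x n)+snd (x n) * z)) \<longlonglongrightarrow> nd z * V (fst q+snd q * z)" by (intro tendsto_intros)
   qed
   fix n
   show "AE z in lborel. norm (nd z * V (fst (x n)+snd (x n) * z)) <= nd z*(A * exp (k * B1) * exp (k * B2 * \<bar>z\<bar>))"
   proof (rule AE_I2)
    fix z
    let ?y = "fst (x n)+snd (x n) * z"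
    have "\<bar>snd (x n) * z\<bar> <= B2 * \<bar>z\<bar>" unfolding abs_mult by (intro mult_right_mono B2) simp
    hence "\<bar>?y\<bar> <= B1+B2 * \<bar>z\<bar>" using B1[of n] by linarith
    hence "k * \<bar>?y\<bar> <= k*(B1+B2 * \<bar>z\<bar>)" by (rule mult_left_mono[OF _ k])
    hence "k * \<bar>?y\<bar> <= k * B1+k * B2 * \<bar>z\<bar>" by (simp only: distrib_left mult.assoc)
    hence "A * exp (k * \<bar>?y\<bar>) <= A * exp (k * B1+k * B2 * \<bar>z\<bar>)" using A by (intro mult_left_mono) auto
    moreover have "\<bar>V ?y\<bar> <= A * exp (k * \<bar>?y\<bar>)" using b by (simp add: expb_def)
    ultimately have "\<bar>V ?y\<bar> <= A * exp (k * B1) * exp (k * B2 * \<bar>z\<bar>)" by (simp add: exp_add mult.assoc)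
    hence "nd z * \<bar>V ?y\<bar> <= nd z*(A * exp (k * B1) * exp (k * B2 * \<bar>z\<bar>))" by (rule mult_left_mono) simp
    thus "norm (nd z * V ?y) <= nd z*(A * exp (k * B1) * exp (k * B2 * \<bar>z\<bar>))" by (simp add: abs_mult)
   qed
  qed measurable
  thus "((%p. LBINT z. nd z * V (fst p+snd p * z)) \<circ> x) \<longlonglongrightarrow> (LBINT z. nd z * V (fst q+snd q * z))"
   by (simp add: o_def)
 qed
 thus ?thesis by (simp add: continuous_on_eq_continuous_at)
qed

text \<open>The substitution s = b^2/2 turns the standard deviation into time; starting from the
  b-integral avoids the singular derivative of sqrt at time 0.\<close>

lemma gauss_heat_time:
 assumes d1: "!!x. (f has_real_derivative f' x) (at x)" and d2: "!!x. (f' has_real_derivative f'' x) (at x)"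
  and c: "continuous_on UNIV f''" and f: "expb A k f" "expb A k f'" "expb A k f''" and t: "0 <= t"
 shows "(LBINT z. nd z * f (sqrt (2 * t) * z))-f 0 = (LBINT s:{0..t}. (LBINT z. nd z * f'' (sqrt (2 * s) * z)))"
proof -
 let ?K = "%b. LBINT z. nd z * f'' (b * z)"
 define a where "a = sqrt (2 * t)"
 have a: "0 <= a" "a^2/2 = t" using t by (auto simp: a_def)
 have "continuous_on UNIV (%p. LBINT z. nd z * f'' (fst p+snd p * z))" by (rule gauss_continuous[OF c f(3)])
 hence "continuous_on UNIV (%b. (%p. LBINT z. nd z * f'' (fst p+snd p * z)) (0, b))"
  by (rule continuous_on_compose2) (auto intro: continuous_intros)
 hence cK: "continuous_on UNIV ?K" by simp
 have cs: "continuous_on {0..t} (%s. ?K (sqrt (2 * s)))"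
  by (rule continuous_on_compose2[OF cK]) (auto intro!: continuous_intros)
 have i: "set_integrable lborel {0^2/2..a^2/2} (%s. ?K (sqrt (2 * s)))"
  using borel_integrable_atLeastAtMost'[OF cs] a(2) by simp
 have "(LBINT s. ?K (sqrt (2 * s)) * indicator {0^2/2..a^2/2} s) = (LBINT b. ?K (sqrt (2*(b^2/2))) * b * indicator {0..a} b)"
  by (rule integral_substitution(2)[where g = "%b. b^2/2" and a = 0 and b = a, OF i]) (use a in \<open>auto intro!: derivative_eq_intros continuous_intros\<close>)
 also have "... = (LBINT b:{0..a}. b * ?K b)"
  unfolding set_lebesgue_integral_def by (intro Bochner_Integration.integral_cong) (auto simp: indicator_def)
 finally have "(LBINT s:{0..t}. ?K (sqrt (2 * s))) = (LBINT b:{0..a}. b * ?K b)"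
  unfolding a(2) by (simp add: set_lebesgue_integral_def mult.commute)
 thus ?thesis using gauss_heat[OF d1 d2 c f a(1)] by (simp add: a_def)
qed

text \<open>The product rule for exp (- c s) P s, where P is known only as an integral; this inserts
  the killing rate c into the heat equation.\<close>

lemma exponential_factor:
 fixes P q :: "real => real"
 assumes P: "!!s. s \<in> {0..t} ==> P s = P 0+(LBINT r:{0..s}. q r)" and q: "continuous_on {0..t} q" and t: "0 <= t"
 shows "exp (- c * t) * P t-P 0 = (LBINT s:{0..t}. exp (- c * s)*(q s-c * P s))"
proof -
 have Pi: "P s = P 0+integral {0..s} q" if "s \<in> {0..t}" for s
 proof -
  have "set_integrable lborel {0..s} q"
   by (rule borel_integrable_atLeastAtMost') (rule continuous_on_subset[OF q], use that in auto)
  hence "(LBINT r:{0..s}. q r) = integral {0..s} q" by (rule set_borel_integral_eq_integral)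
  thus ?thesis using P[OF that] by (simp only:)
 qed
 have dP: "(P has_real_derivative q s) (at s within {0..t})" if s: "s \<in> {0..t}" for s
 proof -
  have "((%s. P 0+integral {0..s} q) has_real_derivative 0+q s) (at s within {0..t})"
   by (intro DERIV_add DERIV_const) (use integral_has_vector_derivative[OF q s] in \<open>simp add: has_real_derivative_iff_has_vector_derivative\<close>)
  hence "((%s. P 0+integral {0..s} q) has_real_derivative q s) (at s within {0..t})" by simp
  thus ?thesis by (rule has_field_derivative_transform_within[where d = 1]) (use s in \<open>auto intro: Pi[symmetric]\<close>)
 qed
 have cP: "continuous_on {0..t} P" by (rule DERIV_continuous_on[OF dP])
 have "(LBINT s:{0..t}. exp (- c * s)*(q s-c * P s)) = exp (- c * t) * P t-exp (- c*0) * P 0"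
  unfolding set_lebesgue_integral_def
 proof (subst integral_FTC_Icc[OF t, where F = "%s. exp (- c * s) * P s"])
  fix x assume x: "0 <= x" "x <= t"
  have "((%s. exp (- c * s)) has_real_derivative-c * exp (- c * x)) (at x within {0..t})"
   by (rule derivative_eq_intros | simp)+
  from DERIV_mult[OF this dP[of x]] x
  show "((%s. exp (- c * s) * P s) has_vector_derivative exp (- c * x)*(q x-c * P x)) (at x within {0..t})"
   by (simp add: has_real_derivative_iff_has_vector_derivative algebra_simps)
 next
  show "continuous_on {0..t} (%s. exp (- c * s)*(q s-c * P s))" by (intro continuous_intros q cP)
 qed simp
 thus ?thesis by simp
qed

lemma csupp_mult:
 assumes "csupp f" "continuous_on UNIV g"
 shows "csupp (%u. g u * f u)"
proof -
 obtain K where K: "ALL u. \<bar>u\<bar> >= K --> f u = 0" using assms by (auto simp: csupp_def)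
 hence "ALL u. \<bar>u\<bar> >= K --> g u * f u = 0" by simp
 moreover have "continuous_on UNIV (%u. g u * f u)"
  by (rule continuous_on_mult[OF assms(2)]) (use assms(1) in \<open>simp add: csupp_def\<close>)
 ultimately show ?thesis unfolding csupp_def by (intro conjI exI)
qed

lemma csupp_measurable: "csupp f ==> f \<in> borel_measurable borel"
 by (simp add: csupp_def borel_measurable_continuous_onI)

lemma csupp_integrable:
 assumes f: "csupp f"
 shows "integrable lborel f"
proof -
 obtain K where K: "ALL u. \<bar>u\<bar> >= K --> f u = 0" using f by (auto simp: csupp_def)
 have "set_integrable lborel {-K..K} f"
  by (rule borel_integrable_atLeastAtMost') (use f in \<open>auto simp: csupp_def intro: continuous_on_subset\<close>)
 moreover have "indicator {-K..K} u *\<^sub>R f u = f u" for u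
 proof (cases "\<bar>u\<bar> >= K")
  case True
  thus ?thesis using K by simp
 next
  case False
  hence "u \<in> {-K..K}" by auto
  thus ?thesis by simp
 qed
 ultimately show ?thesis unfolding set_integrable_def by (simp only:)
qed

lemma even_half_line:
 fixes f :: "real => real"
 assumes i: "integrable lborel f" and e: "!!u. f (- u) = f u"
 shows "(LBINT u:{0..}. f u) = 1/2*(LBINT u. f u)"
proof -
 have [measurable]: "f \<in> borel_measurable borel" using borel_measurable_integrable[OF i] by simp
 have ii: "integrable lborel (%u. indicator S u * f u)" if "S \<in> sets borel" for S
  using integrable_mult_indicator[of S lborel f] i that by simp
 have "f u = indicator {0..} u * f u+indicator {..<0} u * f u" for u by (simp add: indicator_def)
 hence "(LBINT u. f u) = (LBINT u. indicator {0..} u * f u+indicator {..<0} u * f u)" by (simp only:)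
 also have "... = (LBINT u. indicator {0..} u * f u)+(LBINT u. indicator {..<0} u * f u)"
  by (rule Bochner_Integration.integral_add) (intro ii; simp)+
 also have "(LBINT u. indicator {..<0} u * f u) = (LBINT u. indicator {..<0} (0 + - 1 * u) * f (0 + - 1 * u))"
  by (subst lborel_integral_real_affine[where c = "- 1" and t = 0]) simp_all
 also have "... = (LBINT u. indicator {0..} u * f u)"
 proof (rule integral_cong_AE)
  have "AE u in lborel. u ~= (0::real)" by (rule AE_lborel_singleton)
  thus "AE u in lborel. indicator {..<0} (0 + - 1 * u) * f (0 + - 1 * u) = indicator {0..} u * f u"
   by eventually_elim (auto simp: e indicator_def)
 qed measurable
 finally show ?thesis by (simp add: set_lebesgue_integral_def)
qed

lemma integrable_product_bound:
 fixes H :: "real \<times> real => real"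
 assumes [measurable]: "H \<in> borel_measurable (lborel \<Otimes>\<^sub>M lborel)"
  and F: "integrable lborel F" "!!x. 0 <= F x" and G: "integrable lborel G" "!!y. 0 <= G y"
  and b: "!!x y. \<bar>H (x, y)\<bar> <= F x * G y"
 shows "integrable (lborel \<Otimes>\<^sub>M lborel) H"
proof (rule lborel_pair.Fubini_integrable)
 have inner: "integrable lborel (%y. H (x, y))" for x
  by (rule Bochner_Integration.integrable_bound[OF integrable_mult_right[OF G(1), of "F x"]])
   (simp, rule AE_I2, simp only: real_norm_def order_trans[OF b abs_ge_self])
 show "AE x in lborel. integrable lborel (%y. H (x, y))" using inner by simp
 show "integrable lborel (%x. LBINT y. norm (H (x, y)))"
 proof (rule Bochner_Integration.integrable_bound)
  show "integrable lborel (%x. F x*(LBINT y. G y))" by (rule integrable_mult_left[OF F(1)])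
  show "AE x in lborel. norm (LBINT y. norm (H (x, y))) <= norm (F x*(LBINT y. G y))"
  proof (rule AE_I2)
   fix x
   have "(LBINT y. norm (H (x, y))) <= (LBINT y. F x * G y)"
    by (rule integral_mono[OF integrable_norm[OF inner] integrable_mult_right[OF G(1)]]) (use b in simp)
   also have "... = F x*(LBINT y. G y)" by simp
   finally have "(LBINT y. norm (H (x, y))) <= F x*(LBINT y. G y)" .
   moreover have "0 <= (LBINT y. norm (H (x, y)))" by simp
   ultimately show "norm (LBINT y. norm (H (x, y))) <= norm (F x*(LBINT y. G y))" by simp
  qed
 qed measurable
qed simp

text \<open>The second derivative survives reflection because k' vanishes at 0; the first derivative
  becomes an odd function.\<close>

lemma even_extension_deriv:
 fixes k :: "real => real"
 assumes d1: "!!x. (k has_real_derivative k' x) (at x)" and d2: "!!x. (k' has_real_derivative k'' x) (at x)" and z: "k' 0 = 0"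
 defines "l \<equiv> %u. if 0 <= u then k' u else-k' (- u)"
 shows "((%u. k \<bar>u\<bar>) has_real_derivative l x) (at x)" "(l has_real_derivative k'' \<bar>x\<bar>) (at x)"
proof -
 consider "x > 0" | "x < 0" | "x = 0" by linarith
 hence "((%u. k \<bar>u\<bar>) has_real_derivative l x) (at x) & (l has_real_derivative k'' \<bar>x\<bar>) (at x)"
 proof cases
  case 1
  have "((%u. k \<bar>u\<bar>) has_real_derivative k' x) (at x)"
   by (rule has_field_derivative_transform_within_open[OF d1, of "{0<..}"]) (use 1 in auto)
  moreover have "(l has_real_derivative k'' x) (at x)"
   by (rule has_field_derivative_transform_within_open[OF d2, of "{0<..}"]) (use 1 in \<open>auto simp: l_def\<close>)
  ultimately show ?thesis using 1 by (simp add: l_def)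
 next
  case 2
  have m: "((%u.-u) has_real_derivative-1) (at x)" by (rule derivative_eq_intros | simp)+
  have "((%u. k (- u)) has_real_derivative k' (- x) * - 1) (at x)" by (rule DERIV_chain2[OF d1 m])
  hence "((%u. k \<bar>u\<bar>) has_real_derivative k' (- x) * - 1) (at x)"
   by (rule has_field_derivative_transform_within_open[of _ _ _ "{..<0}"]) (use 2 in auto)
  moreover have "((%u.-k' (- u)) has_real_derivative-(k'' (- x) * - 1)) (at x)"
   by (rule DERIV_minus[OF DERIV_chain2[OF d2 m]])
  hence "(l has_real_derivative-(k'' (- x) * - 1)) (at x)"
   by (rule has_field_derivative_transform_within_open[of _ _ _ "{..<0}"]) (use 2 in \<open>auto simp: l_def\<close>)
  ultimately show ?thesis using 2 by (simp add: l_def)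
 next
  case 3
  have ab: "filterlim abs (at (0::real)) (at 0)"
   unfolding filterlim_at by (auto intro!: tendsto_eq_intros simp: eventually_at_filter)
  have "((%h. (k (0+h)-k 0)/h) \<longlongrightarrow> 0) (at 0)" using d1[of 0] unfolding DERIV_def z .
  hence "((%h. (k (0+\<bar>h\<bar>)-k 0)/\<bar>h\<bar>) \<longlongrightarrow> 0) (at 0)" by (rule filterlim_compose[OF _ ab])
  hence "((%h. \<bar>(k (0+\<bar>h\<bar>)-k 0)/\<bar>h\<bar>\<bar>) \<longlongrightarrow> 0) (at 0)" by (rule tendsto_rabs_zero)
  moreover have "\<bar>(k (0+\<bar>h\<bar>)-k 0)/\<bar>h\<bar>\<bar> = \<bar>(k \<bar>0+h\<bar> - k \<bar>0\<bar>)/h\<bar>" for h by (simp add: abs_divide)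
  ultimately have "((%h. \<bar>(k \<bar>0+h\<bar> - k \<bar>0\<bar>)/h\<bar>) \<longlongrightarrow> 0) (at 0)" by (simp only:)
  hence "((%h. (k \<bar>0+h\<bar> - k \<bar>0\<bar>)/h) \<longlongrightarrow> 0) (at 0)" by (rule tendsto_rabs_zero_cancel)
  hence 1: "((%u. k \<bar>u\<bar>) has_real_derivative 0) (at 0)" unfolding DERIV_def .
  have "((%h. (k' (0+h)-k' 0)/h) \<longlongrightarrow> k'' 0) (at 0)" using d2[of 0] unfolding DERIV_def .
  hence "((%h. (k' (0+\<bar>h\<bar>)-k' 0)/\<bar>h\<bar>) \<longlongrightarrow> k'' 0) (at 0)" by (rule filterlim_compose[OF _ ab])
  moreover have "(k' (0+\<bar>h\<bar>)-k' 0)/\<bar>h\<bar> = (l (0+h)-l 0)/h" for h by (simp add: l_def z)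
  ultimately have "((%h. (l (0+h)-l 0)/h) \<longlongrightarrow> k'' 0) (at 0)" by (simp only:)
  hence "(l has_real_derivative k'' 0) (at 0)" unfolding DERIV_def .
  thus ?thesis using 1 3 by (simp add: l_def z)
 qed
 thus "((%u. k \<bar>u\<bar>) has_real_derivative l x) (at x)" "(l has_real_derivative k'' \<bar>x\<bar>) (at x)" by simp_all
qed

section \<open>The candidate solution and its weak equation\<close>

locale heat_data =
 fixes b A :: real and W :: "real => real"
 assumes b: "0 < b" and W_cont: "continuous_on {0..} W" and W_bound: "!!u. 0 <= u ==> \<bar>W u\<bar> <= A"
  and W_lim: "(W \<longlongrightarrow> 1) at_top"
begin

text \<open>The initial datum without its exponential factor, reflected at 0; evenness encodes the
  Neumann condition.\<close>

definition V :: "real => real" where "V y = exp (b * \<bar>y\<bar>/2) * W \<bar>y\<bar>"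

definition conv :: "(real => real) => real => real" where "conv f p = (LBINT y. V y * f (y+p))"

text \<open>The heat flow of \<open>V\<close> at time t with the killing factor and the removed
  exponential put back.\<close>

definition omega :: "real => real => real" where
 "omega t u = exp (- (b * u/2)-b\<^sup>2/4 * t)*(LBINT z. nd z * V (u+sqrt (2 * t) * z))"

lemma V_cont: "continuous_on UNIV V"
proof -
 have "continuous_on UNIV (%y::real. W \<bar>y\<bar>)" by (rule continuous_on_compose2[OF W_cont]) (auto intro: continuous_intros)
 thus ?thesis unfolding V_def[abs_def] by (intro continuous_intros) simp_all
qed

lemma V_even: "V (- y) = V y"
 by (simp add: V_def)

lemma A_nonneg: "0 <= A"
 using W_bound[of 0] by simp

lemma V_expb: "expb A (b/2) V"
proof -
 have "\<bar>V y\<bar> <= A * exp (b/2 * \<bar>y\<bar>)" for y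
  using mult_right_mono[OF W_bound[of "\<bar>y\<bar>"], of "exp (b * \<bar>y\<bar>/2)"] by (simp add: V_def abs_mult mult_ac)
 thus ?thesis using b V_cont by (simp add: expb_def borel_measurable_continuous_onI)
qed

lemma V_shift_bound: "\<bar>V (x+y)\<bar> <= A * exp (b/2 * \<bar>x\<bar>) * exp (b/2 * \<bar>y\<bar>)"
proof -
 have "b/2 * \<bar>x+y\<bar> <= b/2*(\<bar>x\<bar>+\<bar>y\<bar>)" by (rule mult_left_mono[OF abs_triangle_ineq]) (use b in simp)
 hence "exp (b/2 * \<bar>x+y\<bar>) <= exp (b/2 * \<bar>x\<bar>) * exp (b/2 * \<bar>y\<bar>)"
  unfolding exp_add[symmetric] distrib_left by simp
 hence "A * exp (b/2 * \<bar>x+y\<bar>) <= A*(exp (b/2 * \<bar>x\<bar>) * exp (b/2 * \<bar>y\<bar>))"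
  by (rule mult_left_mono[OF _ A_nonneg])
 moreover have "\<bar>V (x+y)\<bar> <= A * exp (b/2 * \<bar>x+y\<bar>)" using V_expb unfolding expb_def by blast
 ultimately show ?thesis by (simp add: mult.assoc)
qed

lemma V_shift_cont: "continuous_on UNIV (%y. V (y+p))"
 by (rule continuous_on_compose2[OF V_cont, of UNIV "%y. y+p"]) (auto intro: continuous_intros)

lemma conv_alt: "conv f p = (LBINT x. V (x + - p) * f x)"
 unfolding conv_def by (subst lborel_integral_real_affine[where c = 1 and t = "- p"]) (simp_all add: add_ac)

lemma conv_linear:
 assumes "csupp f" "csupp g"
 shows "conv (%u. c * f u+g u) p = c * conv f p+conv g p"
proof -
 have i: "integrable lborel (%x. V (x + - p) * f x)" "integrable lborel (%x. V (x + - p) * g x)"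
  by (rule csupp_integrable, rule csupp_mult, rule assms, rule V_shift_cont)+
 have "conv (%u. c * f u+g u) p = (LBINT x. c*(V (x + - p) * f x)+V (x + - p) * g x)"
  unfolding conv_alt by (intro Bochner_Integration.integral_cong) (simp_all add: algebra_simps)
 also have "... = (LBINT x. c*(V (x + - p) * f x))+(LBINT x. V (x + - p) * g x)"
  by (rule Bochner_Integration.integral_add[OF integrable_mult_right[OF i(1)] i(2)])
 also have "... = c * conv f p+conv g p" unfolding conv_alt by simp
 finally show ?thesis .
qed

lemma conv_box:
 assumes K: "ALL u. \<bar>u\<bar> >= K --> f u = 0" and f: "continuous_on UNIV f" and p: "\<bar>p\<bar> <= P" and R: "K+P <= R"
 shows "conv f p = integral (cbox (- R) R) (%y. V y * f (y+p))" "(%y. V y * f (y+p)) integrable_on cbox (- R) R"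
proof -
 have c: "continuous_on {-R..R} (%y. V y * f (y+p))"
  by (rule continuous_on_subset[OF continuous_on_mult[OF V_cont continuous_on_compose2[OF f, of UNIV "%y. y+p"]]])
   (auto intro: continuous_intros)
 hence i: "set_integrable lborel {-R..R} (%y. V y * f (y+p))" by (rule borel_integrable_atLeastAtMost')
 have "V y * f (y+p) = indicator {-R..R} y *\<^sub>R (V y * f (y+p))" for y
 proof (cases "y \<in> {-R..R}")
  case False
  hence "\<bar>y+p\<bar> >= K" using p R by auto
  thus ?thesis using K False by simp
 qed simp
 hence "conv f p = (LBINT y:{-R..R}. V y * f (y+p))" unfolding conv_def set_lebesgue_integral_def by (simp only:)
 thus "conv f p = integral (cbox (- R) R) (%y. V y * f (y+p))" "(%y. V y * f (y+p)) integrable_on cbox (- R) R"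
  using set_borel_integral_eq_integral[OF i] by (simp_all only: interval_cbox)
qed

lemma joint_cont:
 assumes f: "continuous_on UNIV f"
 shows "continuous_on S (%(p, y). V y * f (y+p))"
proof -
 have "continuous_on S (%x. V (snd x))" by (rule continuous_on_compose2[OF V_cont, of S snd]) (auto intro: continuous_intros)
 moreover have "continuous_on S (%x. f (snd x+fst x))"
  by (rule continuous_on_compose2[OF f, of S "%x. snd x+fst x"]) (intro continuous_intros, simp)
 ultimately show ?thesis unfolding case_prod_beta by (rule continuous_on_mult)
qed

lemma conv_cont:
 assumes f: "csupp f"
 shows "continuous_on UNIV (conv f)"
proof -
 obtain K where K: "ALL u. \<bar>u\<bar> >= K --> f u = 0" and c: "continuous_on UNIV f" using f by (auto simp: csupp_def)
 have "isCont (conv f) p" for p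
 proof -
  define U where "U = {p-1<..<p+1}"
  define R where "R = K+(\<bar>p\<bar>+1)"
  have "continuous_on U (%q. integral (cbox (- R) R) (%y. V y * f (y+q)))"
   by (rule integral_continuous_on_param[OF joint_cont[OF c]])
  moreover have "conv f q = integral (cbox (- R) R) (%y. V y * f (y+q))" if "q \<in> U" for q
   by (rule conv_box(1)[OF K c, of q "\<bar>p\<bar>+1"]) (use that in \<open>auto simp: U_def R_def\<close>)
  ultimately have "continuous_on U (conv f)" by (simp cong: continuous_on_cong)
  moreover have "open U" "p \<in> U" by (auto simp: U_def)
  ultimately show ?thesis by (simp add: continuous_on_eq_continuous_at)
 qed
 thus ?thesis by (simp add: continuous_on_eq_continuous_at)
qed

text \<open>\<open>V\<close> is merely continuous, so the derivative falls on the test function.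
  Near p the integration domain may be taken as one fixed box, by compact support.\<close>

lemma conv_deriv:
 assumes f: "csupp f" and f': "csupp f'" and d: "!!x. (f has_real_derivative f' x) (at x)"
 shows "(conv f has_real_derivative conv f' p) (at p)"
proof -
 obtain K1 where K1: "ALL u. \<bar>u\<bar> >= K1 --> f u = 0" and c: "continuous_on UNIV f" using f by (auto simp: csupp_def)
 obtain K2 where K2: "ALL u. \<bar>u\<bar> >= K2 --> f' u = 0" and c': "continuous_on UNIV f'" using f' by (auto simp: csupp_def)
 define K where "K = max K1 K2"
 have K: "ALL u. \<bar>u\<bar> >= K --> f u = 0" "ALL u. \<bar>u\<bar> >= K --> f' u = 0" using K1 K2 by (simp_all add: K_def)
 define U where "U = {p-1<..<p+1}"
 define R where "R = K+(\<bar>p\<bar>+1)"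
 have U: "open U" "p \<in> U" "convex U" by (auto simp: U_def)
 have qU: "\<bar>q\<bar> <= \<bar>p\<bar>+1" if "q \<in> U" for q using that by (auto simp: U_def)
 have e: "conv f q = integral (cbox (- R) R) (%y. V y * f (y+q))" "(%y. V y * f (y+q)) integrable_on cbox (- R) R"
  if "q \<in> U" for q by (rule conv_box[OF K(1) c qU[OF that]], simp add: R_def)+
 have e': "conv f' p = integral (cbox (- R) R) (%y. V y * f' (y+p))"
  by (rule conv_box(1)[OF K(2) c' qU[OF U(2)]]) (simp add: R_def)
 have "((%q. integral (cbox (- R) R) (%y. V y * f (y+q))) has_real_derivative integral (cbox (- R) R) (%y. V y * f' (y+p))) (at p within U)"
 proof (rule leibniz_rule_field_derivative[OF _ e(2) joint_cont[OF c'] U(2,3)])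
  fix q y
  have "((%q. y+q) has_real_derivative 1) (at q within U)" by (rule derivative_eq_intros | simp)+
  from DERIV_cmult[OF DERIV_chain2[OF d this]]
  show "((%q. V y * f (y+q)) has_real_derivative V y * f' (y+q)) (at q within U)" by simp
 qed
 hence "((%q. integral (cbox (- R) R) (%y. V y * f (y+q))) has_real_derivative conv f' p) (at p)"
  unfolding e' by (simp add: at_within_open[OF U(2,1)])
 thus ?thesis by (rule has_field_derivative_transform_within_open[OF _ U(1,2)]) (use e in simp)
qed

lemma conv_expb:
 assumes f: "csupp f"
 shows "EX B. expb B (b/2) (conv f)"
proof (intro exI)
 let ?w = "%x. A * exp (b/2 * \<bar>x\<bar>) * \<bar>f x\<bar>"
 have cw: "csupp (%x. A * exp (b/2 * \<bar>x\<bar>) * f x)" by (rule csupp_mult[OF f]) (intro continuous_intros)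
 have wi: "integrable lborel ?w"
  using integrable_norm[OF csupp_integrable[OF cw]] A_nonneg by (simp add: abs_mult)
 have "\<bar>conv f p\<bar> <= (LBINT x. ?w x) * exp (b/2 * \<bar>p\<bar>)" for p
 proof -
  have i: "integrable lborel (%x. V (x + - p) * f x)" by (rule csupp_integrable[OF csupp_mult[OF f V_shift_cont]])
  have "norm (conv f p) <= (LBINT x. ?w x * exp (b/2 * \<bar>p\<bar>))" unfolding conv_alt
  proof (rule order_trans[OF integral_norm_bound integral_mono[OF integrable_norm[OF i] integrable_mult_left[OF wi]]])
   fix x
   have "\<bar>V (x + - p)\<bar> * \<bar>f x\<bar> <= A * exp (b/2 * \<bar>x\<bar>) * exp (b/2 * \<bar>- p\<bar>) * \<bar>f x\<bar>"
    by (intro mult_right_mono V_shift_bound) simp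
   thus "norm (V (x + - p) * f x) <= ?w x * exp (b/2 * \<bar>p\<bar>)" by (simp add: abs_mult mult_ac)
  qed
  thus ?thesis by simp
 qed
 thus "expb (LBINT x. ?w x) (b/2) (conv f)"
  using b conv_cont[OF f] by (simp add: expb_def borel_measurable_continuous_onI)
qed

lemma conv_heat:
 assumes f: "csupp f" "csupp f'" "csupp f''"
  and d: "!!x. (f has_real_derivative f' x) (at x)" "!!x. (f' has_real_derivative f'' x) (at x)" and t: "0 <= t"
 shows "(LBINT z. nd z * conv f (sqrt (2 * t) * z))-conv f 0 = (LBINT s:{0..t}. (LBINT z. nd z * conv f'' (sqrt (2 * s) * z)))"
proof -
 obtain B0 B1 B2 where B: "expb B0 (b/2) (conv f)" "expb B1 (b/2) (conv f')" "expb B2 (b/2) (conv f'')"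
  using conv_expb[OF f(1)] conv_expb[OF f(2)] conv_expb[OF f(3)] by (elim exE) (rule that)
 define B where "B = max B0 (max B1 B2)"
 have e: "expb B (b/2) g" if "expb B' (b/2) g" "B' <= B" for B' g
 proof -
  have "\<bar>g z\<bar> <= B * exp (b/2 * \<bar>z\<bar>)" for z
  proof -
   have "B' * exp (b/2 * \<bar>z\<bar>) <= B * exp (b/2 * \<bar>z\<bar>)" by (rule mult_right_mono[OF that(2)]) simp
   moreover have "\<bar>g z\<bar> <= B' * exp (b/2 * \<bar>z\<bar>)" using that(1) unfolding expb_def by blast
   ultimately show ?thesis by (rule order_trans[rotated])
  qed
  thus ?thesis using that(1) unfolding expb_def by blast
 qed
 show ?thesis
  by (rule gauss_heat_time[OF conv_deriv[OF f(1,2) d(1)] conv_deriv[OF f(2,3) d(2)] conv_cont[OF f(3)] e[OF B(1)] e[OF B(2)] e[OF B(3)] t])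
   (simp_all add: B_def)
qed

lemma V_gauss_expb: "0 <= a ==> expb (A * exp (b/2 * \<bar>u\<bar>)) (b/2 * a) (%z. V (u+a * z))"
 using b V_shift_bound[of u "a * z" for z] borel_measurable_continuous_onI[OF V_cont]
 by (auto simp: expb_def abs_mult mult.assoc)

lemma mean_cont: "continuous_on UNIV (%u. LBINT z. nd z * V (u+a * z))"
proof -
 have "continuous_on UNIV (%u. (%p. LBINT z. nd z * V (fst p+snd p * z)) (u, a))"
  by (rule continuous_on_compose2[OF gauss_continuous[OF V_cont V_expb], of UNIV "%u. (u, a)"]) (auto intro: continuous_intros)
 thus ?thesis by simp
qed

lemma mean_even: "(LBINT z. nd z * V (- u+a * z)) = (LBINT z. nd z * V (u+a * z))"
proof -
 have "(LBINT z. nd z * V (- u+a * z)) = (LBINT z. nd (0 + - 1 * z) * V (- u+a*(0 + - 1 * z)))"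
  by (subst lborel_integral_real_affine[where c = "- 1" and t = 0]) simp_all
 moreover have "nd (0 + - 1 * z) * V (- u+a*(0 + - 1 * z)) = nd z * V (u+a * z)" for z
 proof -
  have "V (- u+a*(0 + - 1 * z)) = V (- (u+a * z))" by simp
  moreover have "nd (0 + - 1 * z) = nd z" by (simp add: std_normal_density_def)
  ultimately show ?thesis by (simp only: V_even)
 qed
 ultimately show ?thesis by (simp only:)
qed

text \<open>The exponential factors cancel, evenness turns the half line into half of the whole
  line, and exchanging the integrals moves the Gaussian average from \<open>V\<close> to
  \<open>conv f\<close>, which is as smooth as f.\<close>

lemma omega_pairing:
 assumes f: "csupp f" and ev: "!!u. f (- u) = f u" and t: "0 <= t"
 shows "(LBINT u:{0..}. exp (b * u/2) * f u * omega t u) = 1/2*(exp (- (b\<^sup>2/4) * t)*(LBINT z. nd z * conv f (sqrt (2 * t) * z)))"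
proof -
 define a where "a = sqrt (2 * t)"
 have a: "0 <= a" using t by (simp add: a_def)
 define E where "E = (%u. LBINT z. nd z * V (u+a * z))"
 have cE: "continuous_on UNIV E" unfolding E_def by (rule mean_cont)
 have cs: "csupp (%u. E u * f u)" by (rule csupp_mult[OF f cE])
 have [measurable]: "f \<in> borel_measurable borel" "V \<in> borel_measurable borel"
  using csupp_measurable[OF f] borel_measurable_continuous_onI[OF V_cont] by auto
 have ex: "exp (b * u/2) * f u * omega t u = exp (- (b\<^sup>2/4) * t)*(E u * f u)" for u
 proof -
  have "exp (b * u/2) * exp (- (b * u/2)-b\<^sup>2/4 * t) = exp (- (b\<^sup>2/4) * t)" by (simp add: exp_add[symmetric])
  moreover have "exp (b * u/2) * f u * omega t u = (exp (b * u/2) * exp (- (b * u/2)-b\<^sup>2/4 * t))*(E u * f u)"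
   by (simp add: omega_def E_def a_def)
  ultimately show ?thesis by (simp only:)
 qed
 have "(LBINT u:{0..}. exp (b * u/2) * f u * omega t u) = exp (- (b\<^sup>2/4) * t)*(LBINT u:{0..}. E u * f u)"
  unfolding ex by simp
 also have "(LBINT u:{0..}. E u * f u) = 1/2*(LBINT u. E u * f u)"
  by (rule even_half_line[OF csupp_integrable[OF cs]]) (simp only: ev E_def mean_even)
 also have "(LBINT u. E u * f u) = (LBINT z. nd z * conv f (a * z))"
 proof -
  define H where "H = (%(u, z). f u*(nd z * V (u+a * z)))"
  have Hi: "integrable (lborel \<Otimes>\<^sub>M lborel) H"
  proof (rule integrable_product_bound)
   show "H \<in> borel_measurable (lborel \<Otimes>\<^sub>M lborel)" unfolding H_def by measurable
   have "csupp (%u. A * exp (b/2 * \<bar>u\<bar>) * f u)" by (rule csupp_mult[OF f]) (intro continuous_intros)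
   hence "integrable lborel (%u. norm (A * exp (b/2 * \<bar>u\<bar>) * f u))" by (intro integrable_norm csupp_integrable)
   thus "integrable lborel (%u. \<bar>A * exp (b/2 * \<bar>u\<bar>) * f u\<bar>)" by simp
   show "integrable lborel (%z. nd z * exp (b/2 * a * \<bar>z\<bar>))"
    by (rule gauss_expb(1)[of 1 "b/2 * a"]) (use a b in \<open>simp add: expb_def\<close>)
   fix u z
   have "\<bar>V (u+a * z)\<bar> <= A * exp (b/2 * \<bar>u\<bar>) * exp (b/2 * a * \<bar>z\<bar>)"
    using V_shift_bound[of u "a * z"] a by (simp add: abs_mult mult.assoc)
   hence "\<bar>f u\<bar>*(nd z * \<bar>V (u+a * z)\<bar>) <= \<bar>f u\<bar>*(nd z*(A * exp (b/2 * \<bar>u\<bar>) * exp (b/2 * a * \<bar>z\<bar>)))"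
    by (intro mult_left_mono) simp_all
   thus "\<bar>H (u, z)\<bar> <= \<bar>A * exp (b/2 * \<bar>u\<bar>) * f u\<bar>*(nd z * exp (b/2 * a * \<bar>z\<bar>))"
    using A_nonneg by (simp add: H_def abs_mult mult_ac)
  qed simp_all
  have "(LBINT u. E u * f u) = (LBINT u. (LBINT z. H (u, z)))"
   by (simp add: E_def H_def mult.commute)
  also have "... = (LBINT z. (LBINT u. H (u, z)))"
   by (rule lborel_pair.Fubini_integral[symmetric]) (use Hi in \<open>simp add: H_def case_prod_eta\<close>)
  also have "(%z. LBINT u. H (u, z)) = (%z. nd z * conv f (a * z))"
  proof
   fix z
   have "(LBINT u. f u * V (u+a * z)) = (LBINT u. f (0 + - 1 * u) * V (0 + - 1 * u+a * z))"
    by (subst lborel_integral_real_affine[where c = "- 1" and t = 0]) simp_all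
   also have "(%u. f (0 + - 1 * u) * V (0 + - 1 * u+a * z)) = (%u. V (u + - (a * z)) * f u)"
   proof
    fix u
    have "V (0 + - 1 * u+a * z) = V (- (u + - (a * z)))" by simp
    thus "f (0 + - 1 * u) * V (0 + - 1 * u+a * z) = V (u + - (a * z)) * f u" unfolding V_even by (simp add: ev)
   qed
   also have "(LBINT u. V (u + - (a * z)) * f u) = conv f (a * z)" by (rule conv_alt[symmetric])
   finally have "nd z*(LBINT u. f u * V (u+a * z)) = nd z * conv f (a * z)" by simp
   thus "(LBINT u. H (u, z)) = nd z * conv f (a * z)" unfolding H_def prod.case by (subst (asm) integral_mult_right_zero[symmetric]) (simp add: mult_ac)
  qed
  finally show ?thesis .
 qed
 finally show ?thesis by (simp add: a_def)
qed

lemma omega_weak_even: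
 assumes f: "csupp f" "csupp f'" "csupp f''" and ev: "!!u. f (- u) = f u" "!!u. f'' (- u) = f'' u"
  and d: "!!x. (f has_real_derivative f' x) (at x)" "!!x. (f' has_real_derivative f'' x) (at x)" and t: "0 <= t"
 shows "(LBINT u:{0..}. exp (b * u/2) * f u * omega t u) = (LBINT u:{0..}. exp (b * u/2) * f u * omega 0 u)
 +(LBINT s:{0..t}. (LBINT u:{0..}. exp (b * u/2)*(- (b\<^sup>2/4) * f u+f'' u) * omega s u))"
proof -
 define c where "c = b^2/4"
 define P where "P = (%s. LBINT z. nd z * conv f (sqrt (2 * s) * z))"
 define q where "q = (%s. LBINT z. nd z * conv f'' (sqrt (2 * s) * z))"
 have n1: "(LBINT z. nd z) = 1" by (simp add: integral_normal_density)
 have P0: "P 0 = conv f 0" using n1 by (simp add: P_def)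
 have Pq: "P s = P 0+(LBINT r:{0..s}. q r)" if "s \<in> {0..t}" for s
  using conv_heat[OF f d, of s] that unfolding P0 by (simp add: P_def q_def)
 obtain B2 where B2: "expb B2 (b/2) (conv f'')" using conv_expb[OF f(3)] by blast
 have "continuous_on UNIV (%p. LBINT z. nd z * conv f'' (fst p+snd p * z))" by (rule gauss_continuous[OF conv_cont[OF f(3)] B2])
 hence "continuous_on {0..t} (%s. (%p. LBINT z. nd z * conv f'' (fst p+snd p * z)) (0, sqrt (2 * s)))"
  by (rule continuous_on_compose2) (auto intro!: continuous_intros)
 hence cq: "continuous_on {0..t} q" by (simp add: q_def)
 have ef: "exp (- c * t) * P t-P 0 = (LBINT s:{0..t}. exp (- c * s)*(q s-c * P s))"
  by (rule exponential_factor[OF Pq cq t])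
 have inner: "(LBINT u:{0..}. exp (b * u/2)*(- c * f u+f'' u) * omega s u) = 1/2*(exp (- c * s)*(q s-c * P s))"
  if s: "0 <= s" for s
 proof -
  have cs: "csupp (%u.-c * f u+f'' u)" by (rule csupp_linear[OF f(1,3)])
  obtain B0 where B0: "expb B0 (b/2) (conv f)" using conv_expb[OF f(1)] by blast
  have sq: "\<bar>sqrt (2 * s)\<bar> <= sqrt (2 * s)" using s by simp
  have i: "integrable lborel (%z. nd z * conv f (sqrt (2 * s) * z))" "integrable lborel (%z. nd z * conv f'' (sqrt (2 * s) * z))"
   by (rule gauss_expb(1)[OF expb_scale[OF B0 sq]] gauss_expb(1)[OF expb_scale[OF B2 sq]])+
  have "(LBINT z. nd z * conv (%u.-c * f u+f'' u) (sqrt (2 * s) * z))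
   = (LBINT z.-c*(nd z * conv f (sqrt (2 * s) * z))+nd z * conv f'' (sqrt (2 * s) * z))"
   unfolding conv_linear[OF f(1,3)] by (simp add: algebra_simps)
  also have "... = (LBINT z.-c*(nd z * conv f (sqrt (2 * s) * z)))+q s"
   unfolding q_def by (rule Bochner_Integration.integral_add[OF integrable_mult_right[OF i(1)] i(2)])
  also have "(LBINT z.-c*(nd z * conv f (sqrt (2 * s) * z))) = - c * P s" unfolding P_def by (rule integral_mult_right_zero)
  finally have e: "(LBINT z. nd z * conv (%u.-c * f u+f'' u) (sqrt (2 * s) * z)) = q s-c * P s" by simp
  show ?thesis using omega_pairing[OF cs _ s] unfolding e by (simp add: ev c_def)
 qed
 have "(LBINT s:{0..t}. (LBINT u:{0..}. exp (b * u/2)*(- c * f u+f'' u) * omega s u))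
   = (LBINT s:{0..t}. 1/2*(exp (- c * s)*(q s-c * P s)))"
  by (rule set_lebesgue_integral_cong) (use inner in auto)
 also have "... = 1/2*(exp (- c * t) * P t-P 0)" unfolding ef by simp
 finally have I: "(LBINT s:{0..t}. (LBINT u:{0..}. exp (b * u/2)*(- c * f u+f'' u) * omega s u)) = 1/2*(exp (- c * t) * P t-P 0)" .
 show ?thesis
  using omega_pairing[OF f(1) ev(1) t] omega_pairing[OF f(1) ev(1), of 0] I unfolding c_def P_def by simp
qed

text \<open>A general test function is exp (b u/2) times some k. The Robin condition says k' 0 = 0,
  so the reflection of k is C^2 and \<open>omega_weak_even\<close> applies.\<close>

lemma omega_weak:
 assumes g: "test_fun b g g' g''" and t: "0 <= t"
 shows "(LBINT u:{0..}. g u * omega t u) = (LBINT u:{0..}. g u * omega 0 u)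
 +(LBINT s:{0..t}. (LBINT u:{0..}. (g'' u-b * g' u) * omega s u))"
proof -
 obtain K where K: "K > 0" "!!u. u >= K ==> g u = 0" "!!u. u >= K ==> g' u = 0" "!!u. u >= K ==> g'' u = 0"
  by (rule test_fun_support[OF g]) blast
 define k where "k = (%u. exp (- b * u/2) * g u)"
 define k' where "k' = (%u. exp (- b * u/2)*(g' u-b/2 * g u))"
 define k'' where "k'' = (%u. exp (- b * u/2)*(g'' u-b * g' u+b\<^sup>2/4 * g u))"
 have dg: "(g has_real_derivative g' x) (at x)" "(g' has_real_derivative g'' x) (at x)" for x using g by (auto simp: test_fun_def)
 have e: "((%u. exp (- b * u/2)) has_real_derivative (- b/2) * exp (- b * x/2)) (at x)" for x
  by (auto intro!: derivative_eq_intros)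
 have dk: "(k has_real_derivative k' x) (at x)" for x
  unfolding k_def k'_def by (rule DERIV_cong[OF DERIV_mult[OF e dg(1)]]) (simp add: algebra_simps)
 have dk': "(k' has_real_derivative k'' x) (at x)" for x
  unfolding k'_def k''_def
  by (rule DERIV_cong[OF DERIV_mult[OF e DERIV_diff[OF dg(2) DERIV_cmult[OF dg(1)]]]]) (simp add: field_simps power2_eq_square)
 have z: "k' 0 = 0" using g by (simp add: k'_def test_fun_def)
 define f' where "f' = (%u. if 0 <= u then k' u else-k' (- u))"
 have dd: "((%u. k \<bar>u\<bar>) has_real_derivative f' x) (at x)" "(f' has_real_derivative k'' \<bar>x\<bar>) (at x)" for x
  unfolding f'_def by (rule even_extension_deriv[OF dk dk' z])+
 have cabs: "continuous_on UNIV (%u. h \<bar>u\<bar>)" if "continuous_on UNIV h" for h :: "real => real"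
  by (rule continuous_on_compose2[OF that, of UNIV abs]) (auto intro: continuous_intros)
 note cg = test_fun_continuous[OF g]
 have ck: "continuous_on UNIV k" "continuous_on UNIV k''" unfolding k_def k''_def by (intro continuous_intros cg; simp)+
 have s1: "csupp (%u. k \<bar>u\<bar>)" unfolding csupp_def
  by (intro conjI exI[of _ K] cabs ck) (use K in \<open>auto simp: k_def\<close>)
 have s3: "csupp (%u. k'' \<bar>u\<bar>)" unfolding csupp_def
  by (intro conjI exI[of _ K] cabs ck) (use K in \<open>auto simp: k''_def\<close>)
 have s2: "csupp f'" unfolding csupp_def
 proof (intro conjI exI[of _ K] allI impI)
  show "continuous_on UNIV f'" using dd(2) by (auto intro!: DERIV_continuous_on)
  fix u assume "\<bar>u\<bar> >= K"
  thus "f' u = 0" using K(2,3)[of u] K(2,3)[of "- u"] K(1) by (auto simp: f'_def k'_def abs_if split: if_splits)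
 qed
 have ee: "exp (b * u/2)*(exp (- b * u/2) * y) = y" for u y :: real
  by (simp add: mult.assoc[symmetric] exp_add[symmetric])
 have i1: "(LBINT u:{0..}. exp (b * u/2) * k \<bar>u\<bar> * omega s u) = (LBINT u:{0..}. g u * omega s u)" for s
  by (rule set_lebesgue_integral_cong) (auto simp only: k_def ee abs_of_nonneg atLeast_iff sets_lborel borel_closed[OF closed_atLeast])
 have i2: "(LBINT u:{0..}. exp (b * u/2)*(- (b\<^sup>2/4) * k \<bar>u\<bar>+k'' \<bar>u\<bar>) * omega s u) = (LBINT u:{0..}. (g'' u-b * g' u) * omega s u)" for s
 proof (rule set_lebesgue_integral_cong)
  have "exp (b * u/2)*(- (b\<^sup>2/4) * k \<bar>u\<bar>+k'' \<bar>u\<bar>) = g'' u-b * g' u" if "0 <= u" for u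
  proof -
   have "- (b\<^sup>2/4) * k \<bar>u\<bar>+k'' \<bar>u\<bar> = exp (- b * u/2)*(g'' u-b * g' u)"
    using that by (simp add: k_def k''_def algebra_simps)
   thus ?thesis by (simp only: ee)
  qed
  thus "ALL u. u \<in> {0..} --> exp (b * u/2)*(- (b\<^sup>2/4) * k \<bar>u\<bar>+k'' \<bar>u\<bar>) * omega s u = (g'' u-b * g' u) * omega s u"
   by simp
 qed simp
 show ?thesis using omega_weak_even[OF s1 s2 s3 _ _ dd t] unfolding i1 i2 by simp
qed

text \<open>The Gaussian average of exp (b a |z|/2) with a = sqrt (2 t) is at most 2 exp (b^2 t/4),
  which the killing factor cancels.\<close>

lemma omega_bound:
 assumes "0 <= t" "0 <= u"
 shows "\<bar>omega t u\<bar> <= 2 * A"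
proof -
 define a where "a = sqrt (2 * t)"
 have a: "0 <= a" "a^2 = 2 * t" using assms by (auto simp: a_def)
 have "\<bar>LBINT z. nd z * V (u+a * z)\<bar> <= 2*(A * exp (b/2 * \<bar>u\<bar>)) * exp ((b/2 * a)^2/2)"
  by (rule gauss_expb(2)[OF V_gauss_expb[OF a(1)]])
 also have "(b/2 * a)^2/2 = b^2/4 * t" using a(2) by (simp add: power_mult_distrib power_divide)
 finally have "\<bar>LBINT z. nd z * V (u+a * z)\<bar> <= 2 * A*(exp (b * u/2) * exp (b^2/4 * t))"
  using assms by (simp add: mult_ac)
 hence "exp (- (b * u/2)-b\<^sup>2/4 * t) * \<bar>LBINT z. nd z * V (u+a * z)\<bar>
   <= exp (- (b * u/2)-b\<^sup>2/4 * t)*(2 * A*(exp (b * u/2) * exp (b\<^sup>2/4 * t)))" by (rule mult_left_mono) simp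
 also have "... = 2 * A*(exp (- (b * u/2)-b\<^sup>2/4 * t) * exp (b * u/2+b\<^sup>2/4 * t))" by (simp only: exp_add mult_ac)
 also have "exp (- (b * u/2)-b\<^sup>2/4 * t) * exp (b * u/2+b\<^sup>2/4 * t) = 1" by (simp add: exp_add[symmetric])
 finally show ?thesis unfolding omega_def a_def by (simp add: abs_mult)
qed

lemma omega_init:
 assumes "0 <= u"
 shows "omega 0 u = W u"
proof -
 have n1: "(LBINT z. nd z) = 1" by (simp add: integral_normal_density)
 have "omega 0 u = exp (- (b * u/2))*(V u*(LBINT z. nd z))" by (simp add: omega_def mult.commute)
 also have "... = (exp (- (b * u/2)) * exp (b * u/2)) * W u" using assms unfolding n1 V_def by simp
 finally show ?thesis by (simp add: exp_add[symmetric])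
qed

lemma omega_cont: "continuous_on UNIV (%(t, u). omega t u)"
proof -
 have "continuous_on UNIV (%x. (%p. LBINT z. nd z * V (fst p+snd p * z)) (snd x, sqrt (2 * fst x)))"
  by (rule continuous_on_compose2[OF gauss_continuous[OF V_cont V_expb], of UNIV "%x. (snd x, sqrt (2 * fst x))"])
   (auto intro!: continuous_intros)
 hence "continuous_on UNIV (%x. exp (- (b * snd x/2)-b\<^sup>2/4 * fst x)*(LBINT z. nd z * V (snd x+sqrt (2 * fst x) * z)))"
  unfolding fst_conv snd_conv by (intro continuous_on_mult continuous_intros) simp_all
 thus ?thesis by (simp add: omega_def case_prod_beta)
qed

text \<open>For large u the datum behaves like exp (b y/2), whose Gaussian average exp (b^2 t/4) is
  compensated exactly by the killing factor; hence the limit 1.\<close>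

lemma omega_lim:
 assumes t: "0 <= t"
 shows "(omega t \<longlongrightarrow> 1) at_top"
proof -
 define a where "a = sqrt (2 * t)"
 have a: "0 <= a" "a^2 = 2 * t" using t by (auto simp: a_def)
 define c where "c = b^2/4 * t"
 have [measurable]: "V \<in> borel_measurable borel" using borel_measurable_continuous_onI[OF V_cont] .
 let ?s = "%u z. nd z*(exp (- (b * u/2)-c) * V (u+a * z))"
 let ?l = "%z. nd z*(exp (- c) * exp (b/2 * a * z))"
 have "((%u. LBINT z. ?s u z) \<longlongrightarrow> (LBINT z. ?l z)) at_top"
 proof (rule integral_dominated_convergence_at_top[where w = "%z. nd z*(A * exp (b/2 * a * \<bar>z\<bar>))"])
  show "integrable lborel (%z. nd z*(A * exp (b/2 * a * \<bar>z\<bar>)))"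
   by (rule gauss_expb(1)[of A "b/2 * a"]) (use a b A_nonneg in \<open>simp add: expb_def\<close>)
  show "\<forall>\<^sub>F u in at_top. AE z in lborel. norm (?s u z) <= nd z*(A * exp (b/2 * a * \<bar>z\<bar>))"
   using eventually_ge_at_top[of 0]
  proof eventually_elim
   case (elim u)
   show ?case
   proof (rule AE_I2)
    fix z
    have "\<bar>V (u+a * z)\<bar> <= A * exp (b/2 * \<bar>u\<bar>) * exp (b/2 * a * \<bar>z\<bar>)"
     using V_shift_bound[of u "a * z"] a by (simp add: abs_mult mult.assoc)
    hence "exp (- (b * u/2)-c) * \<bar>V (u+a * z)\<bar> <= exp (- (b * u/2)-c)*(A * exp (b/2 * \<bar>u\<bar>) * exp (b/2 * a * \<bar>z\<bar>))"
     by (rule mult_left_mono) simp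
    also have "... = (exp (- (b * u/2)-c) * exp (b/2 * u))*(A * exp (b/2 * a * \<bar>z\<bar>))" using elim by (simp add: mult_ac)
    also have "exp (- (b * u/2)-c) * exp (b/2 * u) = exp (- c)" by (simp add: exp_add[symmetric])
    also have "exp (- c)*(A * exp (b/2 * a * \<bar>z\<bar>)) <= 1*(A * exp (b/2 * a * \<bar>z\<bar>))"
     by (intro mult_right_mono) (use t A_nonneg in \<open>simp_all add: c_def\<close>)
    finally have "nd z*(exp (- (b * u/2)-c) * \<bar>V (u+a * z)\<bar>) <= nd z*(A * exp (b/2 * a * \<bar>z\<bar>))"
     by (intro mult_left_mono) simp_all
    thus "norm (?s u z) <= nd z*(A * exp (b/2 * a * \<bar>z\<bar>))" by (simp add: abs_mult)
   qed
  qed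
  show "AE z in lborel. ((%u. ?s u z) \<longlongrightarrow> ?l z) at_top"
  proof (rule AE_I2)
   fix z
   have "filterlim (%u. a * z+u) at_top at_top" by (rule filterlim_tendsto_add_at_top[OF tendsto_const filterlim_ident])
   hence "((%u. W (a * z+u)) \<longlongrightarrow> 1) at_top" by (rule filterlim_compose[OF W_lim])
   hence "((%u. nd z*(exp (- c) * exp (b/2 * a * z) * W (a * z+u))) \<longlongrightarrow> nd z*(exp (- c) * exp (b/2 * a * z)*1)) at_top"
    by (intro tendsto_mult tendsto_const)
   hence "((%u. nd z*(exp (- c) * exp (b/2 * a * z) * W (a * z+u))) \<longlongrightarrow> ?l z) at_top" by simp
   thus "((%u. ?s u z) \<longlongrightarrow> ?l z) at_top"
   proof (rule Lim_transform_eventually)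
    show "\<forall>\<^sub>F u in at_top. nd z*(exp (- c) * exp (b/2 * a * z) * W (a * z+u)) = ?s u z"
     using eventually_ge_at_top[of "- (a * z)"]
    proof eventually_elim
     case (elim u)
     have "exp (- (b * u/2)-c) * exp (b*(u+a * z)/2) = exp (- c) * exp (b/2 * a * z)"
      unfolding exp_add[symmetric] by (simp add: algebra_simps)
     hence "exp (- (b * u/2)-c) * V (u+a * z) = exp (- c) * exp (b/2 * a * z) * W (a * z+u)"
      using elim by (simp add: V_def add.commute mult.assoc[symmetric])
     thus ?case by simp
    qed
   qed
  qed
 qed measurable
 moreover have "(LBINT z. ?l z) = 1"
 proof -
  have "(LBINT z. ?l z) = exp (- c)*(LBINT z. nd z * exp (b/2 * a * z))"
   by (subst integral_mult_right_zero[symmetric]) (simp add: mult_ac)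
  also have "(LBINT z. nd z * exp (b/2 * a * z)) = exp ((b/2 * a)^2/2)" by (rule has_bochner_integral_integral_eq[OF gauss_exp])
  also have "(b/2 * a)^2/2 = c" using a(2) by (simp add: c_def power_mult_distrib power_divide)
  finally show ?thesis by (simp add: exp_add[symmetric])
 qed
 moreover have "(LBINT z. ?s u z) = omega t u" for u
  unfolding omega_def c_def a_def by (subst integral_mult_right_zero[symmetric]) (simp add: mult_ac)
 ultimately show ?thesis by simp
qed

lemma omega_weak_sol:
 assumes "!!u. 0 <= u ==> init u = W u"
 shows "weak_sol b init omega"
proof -
 have S: "{0..} \<times> {0..} \<in> sets (borel :: (real \<times> real) measure)" by (intro borel_closed closed_Times) auto
 have "(%(t, u). omega t u) \<in> borel_measurable borel" by (rule borel_measurable_continuous_onI[OF omega_cont])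
 hence "set_borel_measurable borel ({0..} \<times> {0..}) (%(t, u). omega t u)"
  unfolding set_borel_measurable_def using S by (intro borel_measurable_scaleR borel_measurable_indicator)
 thus ?thesis unfolding weak_sol_def
 proof (intro conjI allI impI)
  show "EX C. ALL t>=0. ALL u>=0. \<bar>omega t u\<bar> <= C" using omega_bound by blast
  show "omega 0 u = init u" if "0 <= u" for u using omega_init[OF that] assms[OF that] by simp
  show "(omega t \<longlongrightarrow> 1) at_top" if "0 < t" for t using omega_lim[of t] that by simp
  show "(LBINT u:{0..}. g u * omega t u) = (LBINT u:{0..}. g u * omega 0 u)
  +(LBINT s:{0..t}. (LBINT u:{0..}. (g'' u-b * g' u) * omega s u))"
   if "test_fun b g g' g''" "0 < t" for g g' g'' t by (rule omega_weak[OF that(1)]) (use that(2) in simp)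
 qed
qed

end

section \<open>Duality and uniqueness\<close>

definition wpair :: "(real => real) => (real => real) => real" where
 "wpair f w = (LBINT u:{0..}. exp (beta * u/2) * f u * w u)"

definition hmeas :: "(real => real) => bool" where
 "hmeas w \<longleftrightarrow> (%u. indicator {0..} u * w u) \<in> borel_measurable borel"

lemma exp_csupp: "csupp f ==> csupp (%u. exp (beta * u/2) * f u)"
 by (rule csupp_mult) (auto intro!: continuous_intros)

lemma wpair_integrable:
 assumes f: "csupp f" and w: "hmeas w" and B: "!!u. 0 <= u ==> \<bar>w u\<bar> <= B"
 shows "set_integrable lborel {0..} (%u. exp (beta * u/2) * f u * w u)"
 unfolding set_integrable_def
proof (rule Bochner_Integration.integrable_bound)
 have B0: "0 <= B" using B[of 0] by simp
 show "integrable lborel (%u. B * norm (exp (beta * u/2) * f u))"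
  by (intro integrable_mult_right integrable_norm csupp_integrable exp_csupp f)
 have "(%u. (exp (beta * u/2) * f u)*(indicator {0..} u * w u)) \<in> borel_measurable borel"
  by (rule borel_measurable_times[OF csupp_measurable[OF exp_csupp[OF f]] w[unfolded hmeas_def]])
 moreover have "(%u. (exp (beta * u/2) * f u)*(indicator {0..} u * w u)) = (%u. indicator {0..} u *\<^sub>R (exp (beta * u/2) * f u * w u))"
  by (intro ext) (simp add: indicator_def)
 ultimately show "(%u. indicator {0..} u *\<^sub>R (exp (beta * u/2) * f u * w u)) \<in> borel_measurable lborel" by simp
 show "AE u in lborel. norm (indicator {0..} u *\<^sub>R (exp (beta * u/2) * f u * w u)) <= norm (B * norm (exp (beta * u/2) * f u))"
 proof (rule AE_I2)
  fix u :: real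
  show "norm (indicator {0..} u *\<^sub>R (exp (beta * u/2) * f u * w u)) <= norm (B * norm (exp (beta * u/2) * f u))"
  proof (cases "0 <= u")
   case True
   have "\<bar>exp (beta * u/2) * f u\<bar> * \<bar>w u\<bar> <= \<bar>exp (beta * u/2) * f u\<bar> * B" by (intro mult_left_mono B True) simp
   thus ?thesis using True B0 by (simp add: abs_mult mult_ac)
  qed simp
 qed
qed

lemma wpair_bound_integrable:
 assumes G: "integrable lborel G" "!!u. 0 <= G u" and b: "!!u. 0 <= u ==> \<bar>exp (beta * u/2) * f u * w u\<bar> <= G u"
 shows "\<bar>wpair f w\<bar> <= (LBINT u. G u)"
proof (cases "integrable lborel (%u. indicator {0..} u *\<^sub>R (exp (beta * u/2) * f u * w u))")
 case True
 have "norm (wpair f w) <= (LBINT u. G u)" unfolding wpair_def set_lebesgue_integral_def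
 proof (rule order_trans[OF integral_norm_bound integral_mono[OF integrable_norm[OF True] G(1)]])
  fix u :: real
  show "norm (indicator {0..} u *\<^sub>R (exp (beta * u/2) * f u * w u)) <= G u"
   using b[of u] G(2)[of u] by (cases "0 <= u") (simp_all add: indicator_def)
 qed
 thus ?thesis by simp
next
 case False
 hence "wpair f w = 0" unfolding wpair_def set_lebesgue_integral_def by (rule not_integrable_integral_eq)
 thus ?thesis using G by (simp add: Bochner_Integration.integral_nonneg)
qed

lemma wpair_bound:
 assumes f: "csupp f" and d: "0 <= d" and b: "!!u. 0 <= u ==> f u ~= 0 ==> \<bar>w u\<bar> <= d"
 shows "\<bar>wpair f w\<bar> <= d*(LBINT u. \<bar>exp (beta * u/2) * f u\<bar>)"
proof -
 have "\<bar>wpair f w\<bar> <= (LBINT u. d * \<bar>exp (beta * u/2) * f u\<bar>)"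
 proof (rule wpair_bound_integrable)
  show "integrable lborel (%u. d * \<bar>exp (beta * u/2) * f u\<bar>)"
   by (intro integrable_mult_right integrable_abs csupp_integrable exp_csupp f)
  fix u :: real assume u: "0 <= u"
  have "\<bar>exp (beta * u/2) * f u\<bar> * \<bar>w u\<bar> <= \<bar>exp (beta * u/2) * f u\<bar> * d"
   by (cases "f u = 0") (auto intro!: mult_left_mono b u)
  thus "\<bar>exp (beta * u/2) * f u * w u\<bar> <= d * \<bar>exp (beta * u/2) * f u\<bar>" by (simp add: abs_mult mult_ac)
 qed (use d in simp)
 thus ?thesis by simp
qed

lemma wpair_diff:
 assumes f: "csupp f" and w: "hmeas w" "hmeas v" and B: "!!u. 0 <= u ==> \<bar>w u\<bar> <= B" "!!u. 0 <= u ==> \<bar>v u\<bar> <= B'"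
 shows "wpair f (%u. w u-v u) = wpair f w-wpair f v"
 unfolding wpair_def right_diff_distrib
 by (rule set_integral_diff(2)[OF wpair_integrable[OF f w(1) B(1)] wpair_integrable[OF f w(2) B(2)]])

text \<open>Comes from exp (beta u/2) / cosh (beta u) <= 2 exp (- beta u/2) on the half
  line.\<close>

definition Kexp :: real where "Kexp = (LBINT u. 2*(indicator {0..} u * exp (- (beta/2 * u))))"

lemma integrable_exp_half: "integrable lborel (%u. 2*(indicator {0..} u * exp (- (beta/2 * u))))"
proof -
 have "integrable lborel (%x::real. exp (- x) * indicator {0..} x)"
 proof (rule integrableI_nonneg)
  have "(\<integral>\<^sup>+x. ennreal (exp (- x) * indicator {0..} x) \<partial>lborel) = (\<integral>\<^sup>+x. ennreal (x ^ 0 * exp (- x)) * indicator {0..} x \<partial>lborel)"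
   by (intro nn_integral_cong) (simp add: indicator_def)
  thus "(\<integral>\<^sup>+x. ennreal (exp (- x) * indicator {0..} x) \<partial>lborel) < \<infinity>"
   unfolding nn_intergal_power_times_exp_Ici by simp
 qed auto
 from lborel_integrable_real_affine[OF this, of "beta/2" 0]
 have "integrable lborel (%u. exp (- (beta/2 * u)) * indicator {0..} (beta/2 * u))" using beta_pos by simp
 moreover have "exp (- (beta/2 * u)) * indicator {0..} (beta/2 * u) = indicator {0..} u * exp (- (beta/2 * u))" for u
  using beta_pos by (auto simp: indicator_def zero_le_mult_iff)
 ultimately show ?thesis by (intro integrable_mult_right) (simp only:)
qed

lemma wpair_cosh_bound:
 assumes B: "!!u. 0 <= u ==> \<bar>w u\<bar> <= B" and f: "!!u. \<bar>f u\<bar> <= Bf/cosh (beta * u)"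
 shows "\<bar>wpair f w\<bar> <= B * Kexp * Bf"
proof -
 have B0: "0 <= B" using B[of 0] by simp
 have Bf: "0 <= Bf" using f[of 0] by simp
 have "\<bar>wpair f w\<bar> <= (LBINT u. (B * Bf)*(2*(indicator {0..} u * exp (- (beta/2 * u)))))"
 proof (rule wpair_bound_integrable)
  fix u :: real assume u: "0 <= u"
  have "exp (beta * u)/2 <= cosh (beta * u)" by (simp add: cosh_field_def)
  hence "\<bar>f u\<bar>*(exp (beta * u)/2) <= \<bar>f u\<bar> * cosh (beta * u)" by (rule mult_left_mono) simp
  also have "... <= Bf" using f[of u] by (simp add: pos_le_divide_eq cosh_real_pos)
  finally have "\<bar>f u\<bar>*(exp (beta * u)/2)*(2 * exp (- (beta * u))) <= Bf*(2 * exp (- (beta * u)))" by (rule mult_right_mono) simp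
  moreover have "\<bar>f u\<bar>*(exp (beta * u)/2)*(2 * exp (- (beta * u))) = \<bar>f u\<bar>" by (simp add: exp_minus)
  ultimately have "\<bar>f u\<bar> <= Bf*(2 * exp (- (beta * u)))" by (simp only:)
  hence "exp (beta * u/2) * \<bar>f u\<bar> * \<bar>w u\<bar> <= exp (beta * u/2)*(Bf*(2 * exp (- (beta * u)))) * B"
   using B[OF u] Bf by (intro mult_mono mult_left_mono) auto
  also have "... = (B * Bf)*(2*(exp (beta * u/2) * exp (- (beta * u))))" by simp
  also have "exp (beta * u/2) * exp (- (beta * u)) = exp (- (beta/2 * u))" unfolding exp_add[symmetric] by simp
  finally show "\<bar>exp (beta * u/2) * f u * w u\<bar> <= (B * Bf)*(2*(indicator {0..} u * exp (- (beta/2 * u))))"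
   using u by (simp add: abs_mult)
 next
  show "integrable lborel (%u. (B * Bf)*(2*(indicator {0..} u * exp (- (beta/2 * u)))))"
   by (rule integrable_mult_right[OF integrable_exp_half])
 qed (use B0 Bf in simp)
 also have "... = B * Bf * Kexp" unfolding Kexp_def by (rule integral_mult_right_zero)
 finally show ?thesis by (simp add: mult_ac)
qed

text \<open>What a difference of candidate profiles must satisfy to enter the scheme; both a weak
  solution and a path of \<open>zeta\<close> qualify, so one estimate serves uniqueness and
  convergence.\<close>

definition admissible :: "(real => real => real) => real => real => bool" where
 "admissible W T B \<longleftrightarrow> (ALL t:{0..T}. hmeas (W t) & (ALL u>=0. \<bar>W t u\<bar> <= B))
  & (ALL f. csupp f --> set_integrable lborel {0..T} (%t. wpair f (W t)))"

lemma admissible_diff: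
 assumes "admissible W T B" "admissible W' T B'"
 shows "admissible (%t u. W t u-W' t u) T (B+B')"
 unfolding admissible_def
proof (intro conjI ballI allI impI)
 fix t assume t: "t \<in> {0..T}"
 have m: "hmeas (W t)" "hmeas (W' t)" using assms t unfolding admissible_def by blast+
 show "hmeas (%u. W t u-W' t u)" using borel_measurable_diff[OF m[unfolded hmeas_def]] by (simp add: hmeas_def right_diff_distrib)
 fix u :: real assume "0 <= u"
 hence "\<bar>W t u\<bar> <= B" "\<bar>W' t u\<bar> <= B'" using assms t unfolding admissible_def by blast+
 thus "\<bar>W t u-W' t u\<bar> <= B+B'" by linarith
next
 fix f assume f: "csupp f"
 have "set_integrable lborel {0..T} (%t. wpair f (W t)-wpair f (W' t))"
  by (rule set_integral_diff(1)) (use assms f in \<open>simp_all add: admissible_def\<close>)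
 moreover have "wpair f (%u. W t u-W' t u) = wpair f (W t)-wpair f (W' t)" if "t \<in> {0..T}" for t
  by (rule wpair_diff[OF f, of _ _ B B']) (use assms that in \<open>simp_all add: admissible_def\<close>)
 ultimately show "set_integrable lborel {0..T} (%t. wpair f (%u. W t u-W' t u))"
  by (subst set_integrable_cong[OF refl refl]) (assumption+)
qed

lemma admissible_of_measurable:
 assumes m: "set_borel_measurable borel ({0..} \<times> {0..}) (%(t, u). W t u)" and B: "!!t u. 0 <= t ==> 0 <= u ==> \<bar>W t u\<bar> <= B"
 shows "admissible W T B"
proof -
 define G where "G = (%(t, u). indicator ({0..} \<times> {0..}) (t, u) *\<^sub>R W t u)"
 have G[measurable]: "G \<in> borel_measurable (borel \<Otimes>\<^sub>M borel)"
  using m unfolding set_borel_measurable_def G_def borel_prod by (simp add: case_prod_beta')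
 have G_eq: "G (t, u) = indicator {0..} u * W t u" if "0 <= t" for t u using that by (simp add: G_def indicator_def)
 show ?thesis unfolding admissible_def
 proof (intro conjI ballI allI impI)
  fix t assume t: "t \<in> {0..T}"
  have "(%u. G (t, u)) \<in> borel_measurable borel" by measurable
  moreover have "(%u. G (t, u)) = (%u. indicator {0..} u * W t u)" using G_eq t by auto
  ultimately show "hmeas (W t)" by (simp only: hmeas_def)
  show "\<bar>W t u\<bar> <= B" if "0 <= u" for u using B t that by simp
 next
  fix f assume f: "csupp f"
  have fm[measurable]: "f \<in> borel_measurable borel" by (rule csupp_measurable[OF f])
  have "(%t. LBINT u. (exp (beta * u/2) * f u) * G (t, u)) \<in> borel_measurable borel"
   by (rule lborel.borel_measurable_lebesgue_integral) measurable
  moreover have e: "(LBINT u. (exp (beta * u/2) * f u) * G (t, u)) = wpair f (W t)" if "0 <= t" for t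
   unfolding wpair_def set_lebesgue_integral_def G_eq[OF that]
   by (intro Bochner_Integration.integral_cong) (auto simp: indicator_def)
  ultimately have "set_integrable lborel {0..T} (%t. LBINT u. (exp (beta * u/2) * f u) * G (t, u))"
   by (rule_tac set_integrable_Icc_bounded[where K = "B*(LBINT u. \<bar>exp (beta * u/2) * f u\<bar>)"])
    (auto simp: e intro!: wpair_bound f B order_trans[OF abs_ge_zero B[of 0 0]])
  thus "set_integrable lborel {0..T} (%t. wpair f (W t))"
   by (subst set_integrable_cong[OF refl refl, of _ "%t. wpair f (W t)" "%t. LBINT u. (exp (beta * u/2) * f u) * G (t, u)"])
    (simp_all add: e)
 qed
qed

abbreviation cB :: real where "cB \<equiv> beta^2/4"

text \<open>The error of W in the weak equation tested with exp (beta u/2) f; for weak solutions it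
  is zero.\<close>

definition defect :: "(real => real) => (real => real) => (real => real => real) => real => real" where
 "defect f f'' W t = wpair f (W t)-wpair f (W 0)-(LBINT r:{0..t}. wpair (%u.-cB * f u+f'' u) (W r))"

lemma defect_diff:
 assumes W: "admissible W T B" "admissible W' T B'" and f: "csupp f" "csupp f''" and t: "t \<in> {0..T}"
 shows "defect f f'' (%t u. W t u-W' t u) t = defect f f'' W t-defect f f'' W' t"
proof -
 have cs: "csupp (%u.-cB * f u+f'' u)" by (rule csupp_linear[OF f])
 have d: "wpair g (%u. W r u-W' r u) = wpair g (W r)-wpair g (W' r)" if "csupp g" "r \<in> {0..T}" for g r
  by (rule wpair_diff[OF that(1), of _ _ B B']) (use W that in \<open>simp_all add: admissible_def\<close>)
 have i: "set_integrable lborel {0..t} (%r. wpair (%u.-cB * f u+f'' u) (V r))" if "admissible V T b" for V b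
  by (rule set_integrable_subset[of _ "{0..T}"]) (use that t cs in \<open>auto simp: admissible_def\<close>)
 have "(LBINT r:{0..t}. wpair (%u.-cB * f u+f'' u) (%u. W r u-W' r u))
   = (LBINT r:{0..t}. wpair (%u.-cB * f u+f'' u) (W r)-wpair (%u.-cB * f u+f'' u) (W' r))"
  by (rule set_lebesgue_integral_cong, simp, intro allI impI, rule d[OF cs]) (use t in simp)
 also have "... = (LBINT r:{0..t}. wpair (%u.-cB * f u+f'' u) (W r))-(LBINT r:{0..t}. wpair (%u.-cB * f u+f'' u) (W' r))"
  by (rule set_integral_diff(2)[OF i[OF W(1)] i[OF W(2)]])
 finally show ?thesis unfolding defect_def using d[OF f(1) t] d[OF f(1), of 0] t by simp
qed

definition evt :: "(real => real) => (real => real) => bool" where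
 "evt f f'' \<longleftrightarrow> csupp f & csupp f'' &
  (EX f'. (ALL x. (f has_real_derivative f' x) (at x)) & (ALL x. (f' has_real_derivative f'' x) (at x)) & f' 0 = 0)"

lemma evt_test_fun:
 assumes "evt f f''"
 obtains g' g'' where "test_fun beta (%u. exp (beta * u/2) * f u) g' g''"
  "!!u. g'' u-beta * g' u = exp (beta * u/2)*(- cB * f u+f'' u)"
proof -
 obtain f' where d: "ALL x. (f has_real_derivative f' x) (at x)" "ALL x. (f' has_real_derivative f'' x) (at x)" "f' 0 = 0"
  using assms unfolding evt_def by blast
 obtain K where K: "ALL u. \<bar>u\<bar> >= K --> f u = 0" using assms by (auto simp: evt_def csupp_def)
 have "f u = 0" if "u >= max K 0" for u using K[rule_format, of u] that by simp
 moreover have "continuous_on UNIV f''" using assms by (simp add: evt_def csupp_def)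
 ultimately have "test_fun beta (%u. exp (beta * u/2) * f u) (%u. exp (beta * u/2)*(beta/2 * f u+f' u))
  (%u. exp (beta * u/2)*(beta^2/4 * f u+beta * f' u+f'' u))"
  using d by (intro test_fun_of_even[of f f' f'' "max K 0"]) simp_all
 thus ?thesis by (rule that) (simp add: algebra_simps power2_eq_square)
qed

lemma jet_evt:
 assumes f: "jet f"
 shows "evt (f 0) (f 2)" "evt (%u.-cB * f 0 u+f 2 u) (%u.-cB * f 2 u+f 4 u)"
proof -
 have d: "(f j has_real_derivative f (Suc j) x) (at x)" if "j < 4" for j x using f that by (simp add: jet_def)
 have d4: "(f 0 has_real_derivative f 1 x) (at x)" "(f 1 has_real_derivative f 2 x) (at x)"
  "(f 2 has_real_derivative f 3 x) (at x)" "(f 3 has_real_derivative f 4 x) (at x)" for x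
  using d[of 0 x] d[of 1 x] d[of 2 x] d[of 3 x] by (simp_all add: eval_nat_numeral)
 have par: "f j (- u) = (- 1) ^ j * f j u" if "j <= 4" for j u using f that by (simp add: jet_def)
 have z: "f 1 0 = 0" "f 3 0 = 0" using par[of 1 0] par[of 3 0] by simp_all
 have cs: "csupp (f 0)" "csupp (f 2)" "csupp (f 4)" using f by (simp_all add: jet_def)
 show "evt (f 0) (f 2)" unfolding evt_def using cs d4 z by blast
 have "((%u.-cB * f 0 u+f 2 u) has_real_derivative-cB * f 1 x+f 3 x) (at x)"
  "((%u.-cB * f 1 u+f 3 u) has_real_derivative-cB * f 2 x+f 4 x) (at x)" for x
  by (intro DERIV_add DERIV_cmult d4)+
 thus "evt (%u.-cB * f 0 u+f 2 u) (%u.-cB * f 2 u+f 4 u)"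
  unfolding evt_def using z by (intro conjI csupp_linear cs exI[of _ "%u.-cB * f 1 u+f 3 u"]) simp_all
qed

text \<open>S collects the averages \<open>F k 0\<close> and their images under the operator, k <=
  n, as the scheme needs both. S and dl are fixed before W, which makes the estimate usable on
  random profiles.\<close>

lemma duality_estimate:
 assumes f: "jet f" and T: "0 < T" and B: "0 <= B" and e: "0 < e"
 shows "EX S dl. finite S & (ALL (g, g''):S. evt g g'') & dl > 0 & (ALL W. admissible W T B -->
  (ALL (g, g''):S. \<bar>wpair g (W 0)\<bar> <= dl & (ALL t:{0..T}. \<bar>defect g g'' W t\<bar> <= dl)) --> (ALL t:{0..T}. \<bar>wpair (f 0) (W t)\<bar> <= e))"
proof -
 obtain Bj where Bj: "jbound beta Bj f" using jet_jbound[OF f] by blast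
 have K: "0 <= Kexp" unfolding Kexp_def by (intro Bochner_Integration.integral_nonneg) simp
 have C: "0 <= B * Kexp" using B K by simp
 obtain n dl where n: "n >= 1" and dl: "dl > 0" and est: "ALL D. scheme D beta (B * Kexp) cB T dl -->
  (ALL k<n. scheme.wf1 D cB T dl ((avg (sqrt (2*(T/real n))) ^^ k) f)) -->
  (ALL k<=n. \<bar>D 0 ((avg (sqrt (2*(T/real n))) ^^ k) f 0)\<bar> <= dl) --> (ALL t:{0..T}. \<bar>D t (f 0)\<bar> <= e)"
  using scheme_parameters[OF less_imp_le[OF beta_pos] C _ T e f Bj, of cB] by auto
 define F where "F = (%k. (avg (sqrt (2*(T/real n))) ^^ k) f)"
 have jF: "jet (F k)" for k unfolding F_def by (rule jet_iter[OF f])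
 define S where "S = (%k. (F k 0, F k 2)) ` {..n} \<union> (%k. (%u.-cB * F k 0 u+F k 2 u, %u.-cB * F k 2 u+F k 4 u)) ` {..n}"
 have "ALL (g, g''):S. evt g g''" unfolding S_def using jet_evt[OF jF] by blast
 moreover have "ALL t:{0..T}. \<bar>wpair (f 0) (W t)\<bar> <= e"
  if W: "admissible W T B" and h: "ALL (g, g''):S. \<bar>wpair g (W 0)\<bar> <= dl & (ALL t:{0..T}. \<bar>defect g g'' W t\<bar> <= dl)" for W
 proof -
  have S1: "\<bar>wpair (F k 0) (W 0)\<bar> <= dl" "ALL t:{0..T}. \<bar>defect (F k 0) (F k 2) W t\<bar> <= dl"
   "ALL t:{0..T}. \<bar>defect (%u.-cB * F k 0 u+F k 2 u) (%u.-cB * F k 2 u+F k 4 u) W t\<bar> <= dl" if "k <= n" for k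
  proof -
   have "(F k 0, F k 2) \<in> S" "(%u.-cB * F k 0 u+F k 2 u, %u.-cB * F k 2 u+F k 4 u) \<in> S"
    unfolding S_def using that by blast+
   from bspec[OF h this(1)] bspec[OF h this(2)]
   show "\<bar>wpair (F k 0) (W 0)\<bar> <= dl" "ALL t:{0..T}. \<bar>defect (F k 0) (F k 2) W t\<bar> <= dl"
    "ALL t:{0..T}. \<bar>defect (%u.-cB * F k 0 u+F k 2 u) (%u.-cB * F k 2 u+F k 4 u) W t\<bar> <= dl" by auto
  qed
  let ?D = "%t f. wpair f (W t)"
  have sch: "scheme ?D beta (B * Kexp) cB T dl"
  proof
   fix t k and g h :: "real => real" assume t: "t \<in> {0..T}" and gh: "csupp g" "csupp h"
   have Wt: "hmeas (W t)" "!!u. 0 <= u ==> \<bar>W t u\<bar> <= B" using W t by (simp_all add: admissible_def)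
   note i = wpair_integrable[OF gh(1) Wt] wpair_integrable[OF gh(2) Wt]
   have "wpair (%u. k * g u+h u) (W t)
     = (LBINT u:{0..}. k*(exp (beta * u/2) * g u * W t u)+exp (beta * u/2) * h u * W t u)"
    unfolding wpair_def by (rule arg_cong[of _ _ "%q. set_lebesgue_integral lborel {0..} q"]) (simp add: algebra_simps)
   also have "... = (LBINT u:{0..}. k*(exp (beta * u/2) * g u * W t u))+wpair h (W t)"
    unfolding wpair_def by (rule set_integral_add(2)[OF _ i(2)]) (use i(1) in simp)
   finally show "wpair (%u. k * g u+h u) (W t) = k * wpair g (W t)+wpair h (W t)" by (simp add: wpair_def)
  next
   fix t g Bg assume t: "t \<in> {0..T}" and g: "csupp g" "!!u. \<bar>g u\<bar> <= Bg/cosh (beta * u)"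
   show "\<bar>wpair g (W t)\<bar> <= B * Kexp * Bg" by (rule wpair_cosh_bound) (use W t g in \<open>simp_all add: admissible_def\<close>)
  next
   fix g assume "csupp g"
   thus "set_integrable lborel {0..T} (%r. wpair g (W r))" using W by (simp add: admissible_def)
  qed (use C T dl beta_pos in simp_all)
  have wf: "ALL k<n. scheme.wf1 ?D cB T dl ((avg (sqrt (2*(T/real n))) ^^ k) f)"
  proof (intro allI impI)
   fix k assume "k < n"
   hence k: "k <= n" by simp
   show "scheme.wf1 ?D cB T dl ((avg (sqrt (2*(T/real n))) ^^ k) f)"
    unfolding scheme.wf1_def[OF sch] using S1(2,3)[OF k] unfolding defect_def F_def by (rule conjI)
  qed
  have "ALL k<=n. \<bar>?D 0 ((avg (sqrt (2*(T/real n))) ^^ k) f 0)\<bar> <= dl" using S1(1) unfolding F_def by simp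
  thus ?thesis by (rule mp[OF mp[OF mp[OF spec[OF est, of ?D] sch] wf]])
 qed
 ultimately show ?thesis using dl by (intro exI[of _ S] exI[of _ dl]) (simp add: S_def)
qed

section \<open>Smooth bumps and the functions they determine\<close>

primrec cd :: "nat => (real => real) => bool" where
 "cd 0 f = continuous_on UNIV f"
| "cd (Suc n) f = (EX f'. (ALL x. (f has_real_derivative f' x) (at x)) & cd n f')"

lemma cd_mono: "cd (Suc n) f ==> cd n f"
proof (induction n arbitrary: f)
 case 0
 then obtain f' where "ALL x. (f has_real_derivative f' x) (at x)" by auto
 thus ?case by (auto intro!: DERIV_continuous_on)
next
 case (Suc n)
 then obtain f' where f': "ALL x. (f has_real_derivative f' x) (at x)" "cd (Suc n) f'" by auto
 have "cd n f'" by (rule Suc.IH[OF f'(2)])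
 thus ?case using f'(1) by auto
qed

lemma cd_const: "cd n (%x. c)"
proof (induction n arbitrary: c)
 case (Suc n)
 have "ALL x. ((%x. c) has_real_derivative 0) (at x)" by simp
 thus ?case using Suc.IH[of 0] unfolding cd.simps by (intro exI[of _ "%x. 0"] conjI)
qed (simp add: continuous_intros)

lemma cd_add: "cd n f ==> cd n g ==> cd n (%x. f x+g x)"
proof (induction n arbitrary: f g)
 case (Suc n)
 then obtain f' g' where d: "ALL x. (f has_real_derivative f' x) (at x)" "cd n f'" "ALL x. (g has_real_derivative g' x) (at x)" "cd n g'"
  by auto
 have "ALL x. ((%x. f x+g x) has_real_derivative f' x+g' x) (at x)" using d by (auto intro: DERIV_add)
 thus ?case using Suc.IH[OF d(2,4)] unfolding cd.simps by (intro exI[of _ "%x. f' x+g' x"] conjI)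
qed (simp add: continuous_intros)

lemma cd_mult: "cd n f ==> cd n g ==> cd n (%x. f x * g x)"
proof (induction n arbitrary: f g)
 case (Suc n)
 then obtain f' g' where d: "ALL x. (f has_real_derivative f' x) (at x)" "cd n f'" "ALL x. (g has_real_derivative g' x) (at x)" "cd n g'"
  by auto
 have "ALL x. ((%x. f x * g x) has_real_derivative f' x * g x+g' x * f x) (at x)" using d by (auto intro: DERIV_mult)
 moreover have "cd n (%x. f' x * g x+g' x * f x)"
  by (rule cd_add[OF Suc.IH[OF d(2) cd_mono[OF Suc.prems(2)]] Suc.IH[OF d(4) cd_mono[OF Suc.prems(1)]]])
 ultimately show ?case unfolding cd.simps by (intro exI[of _ "%x. f' x * g x+g' x * f x"] conjI)
qed (simp add: continuous_intros)

lemma cd_power: "cd n f ==> cd n (%x. f x ^ m)"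
 by (induction m) (auto intro: cd_const cd_mult)

lemma cd_ident: "cd n (%x. x)"
proof (cases n)
 case (Suc m)
 have "ALL x::real. ((%x. x) has_real_derivative 1) (at x)" by simp
 thus ?thesis unfolding Suc cd.simps using cd_const[of m 1] by (intro exI[of _ "%x. 1"] conjI)
qed (simp add: continuous_intros)

lemma cd_pos_power: "cd n q ==> cd n (%x. (max 0 (q x)) ^ Suc n)"
proof (induction n)
 case 0
 thus ?case by (simp add: continuous_intros)
next
 case (Suc n)
 then obtain q' where q': "ALL x. (q has_real_derivative q' x) (at x)" "cd n q'" by auto
 have "ALL x. ((%x. (max 0 (q x)) ^ Suc (Suc n)) has_real_derivative real (Suc (Suc n))*(max 0 (q x)) ^ Suc n * q' x) (at x)"
  using q'(1) by (intro allI DERIV_pos_power_chain) blast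
 moreover have "cd n (%x. real (Suc (Suc n))*(max 0 (q x)) ^ Suc n * q' x)"
  by (rule cd_mult[OF cd_mult[OF cd_const Suc.IH[OF cd_mono[OF Suc.prems]]] q'(2)])
 ultimately show ?case unfolding cd.simps(2) by (intro exI[of _ "%x. real (Suc (Suc n))*(max 0 (q x)) ^ Suc n * q' x"] conjI)
qed

lemma cd_chain: "cd n f ==> EX F. F 0 = f & (ALL j<n. ALL x. (F j has_real_derivative F (Suc j) x) (at x)) & (ALL j<=n. continuous_on UNIV (F j))"
proof (induction n arbitrary: f)
 case 0
 thus ?case by (intro exI[of _ "%_. f"]) simp
next
 case (Suc n)
 then obtain f' where f': "ALL x. (f has_real_derivative f' x) (at x)" "cd n f'" by auto
 obtain F where F: "F 0 = f'" "ALL j<n. ALL x. (F j has_real_derivative F (Suc j) x) (at x)" "ALL j<=n. continuous_on UNIV (F j)"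
  using Suc.IH[OF f'(2)] by blast
 have c: "continuous_on UNIV f" using f'(1) by (auto intro!: DERIV_continuous_on)
 show ?case
 proof (intro exI[of _ "case_nat f F"] conjI allI impI)
  fix j x assume "j < Suc n"
  thus "(case_nat f F j has_real_derivative case_nat f F (Suc j) x) (at x)"
   using F f'(1) by (cases j) simp_all
 next
  fix j assume "j <= Suc n"
  thus "continuous_on UNIV (case_nat f F j)" using F c by (cases j) simp_all
 qed simp
qed

text \<open>Differentiating the symmetry of f gives alternating parity. Vanishing passes to
  derivatives only on the open set |u| > K, so K+1 serves as the radius of support.\<close>

lemma jet_of_cd:
 assumes f: "cd 4 f" and ev: "!!u. f (- u) = f u" and K: "!!u. \<bar>u\<bar> >= K ==> f u = 0"
 shows "EX F. jet F & F 0 = f"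
proof -
 obtain F where F: "F 0 = f" "ALL j<4. ALL x. (F j has_real_derivative F (Suc j) x) (at x)" "ALL j<=4. continuous_on UNIV (F j)"
  using cd_chain[OF f] by blast
 have par: "j <= 4 --> (ALL u. F j (- u) = (- 1) ^ j * F j u)" for j
 proof (induction j)
  case 0
  thus ?case using F ev by simp
 next
  case (Suc j)
  show ?case
  proof (intro impI allI)
   fix u assume j: "Suc j <= 4"
   have "((%u. F j (- u)) has_real_derivative F (Suc j) (- u) * - 1) (at u)"
    by (rule DERIV_chain2[of "F j"]) (use F(2) j in \<open>auto intro!: derivative_eq_intros\<close>)
   moreover have "((%u. (- 1) ^ j * F j u) has_real_derivative (- 1) ^ j * F (Suc j) u) (at u)"
    by (rule DERIV_cmult) (use F(2) j in simp)
   moreover have "(%u. F j (- u)) = (%u. (- 1) ^ j * F j u)" using Suc j by (intro ext) simp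
   ultimately have "F (Suc j) (- u) * - 1 = (- 1) ^ j * F (Suc j) u" using DERIV_unique by metis
   thus "F (Suc j) (- u) = (- 1) ^ Suc j * F (Suc j) u" by simp
  qed
 qed
 have sup: "j <= 4 --> (ALL u. \<bar>u\<bar> > K --> F j u = 0)" for j
 proof (induction j)
  case 0
  thus ?case using F K by simp
 next
  case (Suc j)
  show ?case
  proof (intro impI allI)
   fix u assume j: "Suc j <= 4" and u: "\<bar>u\<bar> > K"
   have d: "(F j has_real_derivative F (Suc j) u) (at u)" using F(2) j by simp
   have o: "open {u::real. \<bar>u\<bar> > K}" by (intro open_Collect_less continuous_intros)
   have "((%x. 0) has_real_derivative F (Suc j) u) (at u)"
    by (rule has_field_derivative_transform_within_open[OF d o]) (use u Suc j in auto)
   from DERIV_unique[OF this DERIV_const] show "F (Suc j) u = 0" .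
  qed
 qed
 have "csupp (F j)" if "j <= 4" for j unfolding csupp_def
  by (intro conjI exI[of _ "K+1"]) (use F(3) sup[of j] that in auto)
 hence "jet F" unfolding jet_def using F(2) par by blast
 thus ?thesis using F(1) by blast
qed

text \<open>The fifth power of a positive part is C^4, as a jet requires. For m -> infinity the bump
  tends to the indicator of the open interval around c; m = 1 is used for localisation.\<close>

definition bump :: "real => real => nat => real => real" where
 "bump c r m y = (max 0 (1-((y-c)/r) ^ (2 * m))) ^ 5"

lemma bump_props:
 assumes r: "0 < r" and m: "m >= 1"
 shows "0 <= bump c r m y" "bump c r m y <= 1" "\<bar>y-c\<bar> >= r ==> bump c r m y = 0" "bump c r m c = 1"
proof -
 have p: "0 <= ((y-c)/r) ^ (2 * m)" by (simp add: power_mult)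
 show "0 <= bump c r m y" by (simp add: bump_def)
 show "bump c r m y <= 1" unfolding bump_def by (rule power_le_one) (use p in simp_all)
 show "bump c r m c = 1" using m by (simp add: bump_def power_0_left)
 show "bump c r m y = 0" if "\<bar>y-c\<bar> >= r"
 proof -
  have "1 <= \<bar>(y-c)/r\<bar>" using that r by (simp add: abs_divide)
  hence "1 <= \<bar>(y-c)/r\<bar> ^ (2 * m)" by (rule one_le_power)
  hence "1 <= ((y-c)/r) ^ (2 * m)" by (subst (asm) power_even_abs) simp_all
  thus ?thesis by (simp add: bump_def)
 qed
qed

lemma bump_jet:
 assumes r: "0 < r" and m: "m >= 1"
 shows "EX F. jet F & F 0 = (%y. bump c r m y+bump c r m (- y))"
proof (rule jet_of_cd)
 have q: "cd 4 (%y. 1+(- 1)*((1/r)*(s * y + - c)) ^ (2 * m))" for s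
  by (intro cd_add cd_mult cd_power cd_const cd_ident)
 have 5: "Suc 4 = (5::nat)" by simp
 have "cd 4 (%y. bump c r m (s * y))" for s
  using cd_pos_power[OF q[of s]] unfolding bump_def 5 by simp
 from cd_add[OF this[of 1] this[of "- 1"]] show "cd 4 (%y. bump c r m y+bump c r m (- y))" by simp
 fix y assume "\<bar>c\<bar>+r <= \<bar>y\<bar>"
 hence "\<bar>y-c\<bar> >= r" "\<bar>- y-c\<bar> >= r" by linarith+
 thus "bump c r m y+bump c r m (- y) = 0" by (simp add: bump_props[OF r m])
qed simp

text \<open>Open intervals are an intersection-stable generator; the total integral handles
  complements. So the integral vanishes over every Borel set, in particular over the sets where h
  has a fixed sign.\<close>

lemma AE_zero_of_intervals:
 fixes h :: "real => real"
 assumes h: "integrable lborel h" and z: "!!a b. (LBINT u:{a<..<b}. h u) = 0" and U: "(LBINT u. h u) = 0"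
 shows "AE u in lborel. h u = 0"
proof -
 have [measurable]: "h \<in> borel_measurable borel" using borel_measurable_integrable[OF h] by simp
 have si: "set_integrable lborel A h" if "A \<in> sets borel" for A
  unfolding set_integrable_def by (rule integrable_mult_indicator) (use that h in simp_all)
 let ?G = "range (%(a, b). {a<..<b::real})"
 have bs: "sets borel = sigma_sets UNIV ?G"
 proof -
  have "borel = sigma UNIV ?G" using borel_eq_box[where 'a = real] by (simp add: box_real)
  hence "sets borel = sets (sigma UNIV ?G)" by (rule arg_cong)
  also have "... = sigma_sets UNIV ?G" by (rule sets_measure_of) simp
  finally show ?thesis .
 qed
 have A: "(LBINT u:A. h u) = 0" if "A \<in> sets borel" for A
 proof -
  have "Int_stable ?G"
  proof (rule Int_stableI)
   fix A B :: "real set" assume "A \<in> ?G" "B \<in> ?G"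
   then obtain a b c d where "A = {a<..<b}" "B = {c<..<d}" by auto
   hence "A \<inter> B = {max a c<..<min b d}" by auto
   thus "A \<inter> B \<in> ?G" by auto
  qed
  moreover have "?G \<subseteq> Pow UNIV" by simp
  moreover have "A \<in> sigma_sets UNIV ?G" using that unfolding bs .
  ultimately show ?thesis
  proof (induction rule: sigma_sets_induct_disjoint)
   case (basic A)
   thus ?case using z by auto
  next
   case empty
   thus ?case by (simp add: set_lebesgue_integral_def)
  next
   case (compl A)
   have Ab: "A \<in> sets borel" "UNIV-A \<in> sets borel" using compl(1) unfolding bs[symmetric] by auto
   have "(LBINT u:A \<union> (UNIV-A). h u) = (LBINT u:A. h u)+(LBINT u:UNIV-A. h u)"
    by (rule set_integral_Un[OF _ si[OF Ab(1)] si[OF Ab(2)]]) simp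
   thus ?case using compl(2) U by (simp add: set_lebesgue_integral_def)
  next
   case (union A)
   have Ab: "A i \<in> sets borel" for i using union(2) unfolding bs[symmetric] by auto
   have "(LBINT u:(\<Union>i. A i). h u) = (\<Sum>i. (LBINT u:A i. h u))"
   proof (rule lebesgue_integral_countable_add)
    show "A i \<inter> A j = {}" if "i ~= j" for i j using union(1) that by (auto simp: disjoint_family_on_def)
    show "set_integrable lborel (\<Union>i. A i) h" by (rule si) (use Ab in auto)
   qed (use Ab in simp)
   thus ?case using union(3) by simp
  qed
 qed
 have pos: "AE u in lborel. indicator S u*(s * h u) = 0"
  if S: "S = {u. 0 <= s * h u}" for S and s :: real
 proof -
  have Sb: "S \<in> sets borel" unfolding S by measurable
  have i: "integrable lborel (%u. indicator S u*(s * h u))"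
   using integrable_mult_right[OF si[OF Sb, unfolded set_integrable_def], of s] by (simp add: mult_ac)
  have "(LBINT u. indicator S u*(s * h u)) = s*(LBINT u:S. h u)"
   unfolding set_lebesgue_integral_def by (subst integral_mult_right_zero[symmetric]) (simp add: mult_ac)
  hence "(LBINT u. indicator S u*(s * h u)) = 0" using A[OF Sb] by simp
  thus ?thesis
   by (subst (asm) integral_nonneg_eq_0_iff_AE[OF i]) (auto simp: S indicator_def)
 qed
 from pos[OF refl, of 1] pos[OF refl, of "- 1"] show ?thesis
 proof eventually_elim
  case (elim u)
  thus ?case by (cases "0 <= h u") (auto simp: indicator_def)
 qed
qed

text \<open>Symmetrised bumps are jets. For an interval in the half line the mirror image
  contributes nothing to the pairing, and m -> infinity yields the integral over the
  interval.\<close>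

lemma AE_zero_of_jets:
 assumes w: "hmeas w" and B: "!!u. 0 <= u ==> \<bar>w u\<bar> <= B" and z: "!!f. jet f ==> wpair (f 0) w = 0"
 shows "AE u in lborel. u >= 0 --> w u = 0"
proof -
 define v where "v = (%u. exp (beta * u/2)*(indicator {0..} u * w u))"
 have [measurable]: "v \<in> borel_measurable borel" unfolding v_def using w[unfolded hmeas_def] by measurable
 have B0: "0 <= B" using B[of 0] by simp
 have vb: "\<bar>v u\<bar> <= exp (beta * R/2) * B" if "u <= R" for u R
 proof (cases "0 <= u")
  case True
  have "exp (beta * u/2) * \<bar>w u\<bar> <= exp (beta * R/2) * B"
   by (intro mult_mono B True) (use that beta_pos in \<open>auto intro: mult_left_mono\<close>)
  thus ?thesis using True by (simp add: v_def abs_mult)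
 qed (use B0 in \<open>simp add: v_def\<close>)
 have zi: "(LBINT u. indicator {a<..<b} u * v u) = 0" if a: "0 <= a" for a b
 proof (cases "a < b")
  case True
  define c r where "c = (a+b)/2" and "r = (b-a)/2"
  have r: "0 < r" using True by (simp add: r_def)
  have cr: "c-r = a" "c+r = b" unfolding c_def r_def by (simp_all add: field_simps)
  have out: "u \<notin> {a<..<b} \<longleftrightarrow> \<bar>u-c\<bar> >= r" for u using cr r by auto
  have lim: "(%m. LBINT u. bump c r (Suc m) u * v u) \<longlonglongrightarrow> (LBINT u. indicator {a<..<b} u * v u)"
  proof (rule integral_dominated_convergence[where w = "%u. indicator {a..b} u*(exp (beta * b/2) * B)"])
   show "integrable lborel (%u. indicator {a..b} u*(exp (beta * b/2) * B))" by (intro integrable_mult_left integrable_indicator_Icc)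
   show "(%u. bump c r (Suc m) u * v u) \<in> borel_measurable lborel" for m unfolding bump_def by measurable
   show "AE u in lborel. (%m. bump c r (Suc m) u * v u) \<longlonglongrightarrow> indicator {a<..<b} u * v u"
   proof (rule AE_I2, rule tendsto_mult[OF _ tendsto_const])
    fix u
    show "(%m. bump c r (Suc m) u) \<longlonglongrightarrow> indicator {a<..<b} u"
    proof (cases "\<bar>u-c\<bar> >= r")
     case True
     hence "u \<notin> {a<..<b}" unfolding out .
     thus ?thesis using True by (simp add: bump_props[OF r])
    next
     case False
     hence u: "u \<in> {a<..<b}" using out[of u] by blast
     define x where "x = (u-c)/r"
     have "\<bar>x\<bar> < 1" using False r by (simp add: x_def abs_divide)
     hence "x^2 < 1" by (simp add: abs_square_less_1)
     hence "(%m. (x^2) ^ Suc m) \<longlonglongrightarrow> 0" by (intro LIMSEQ_Suc LIMSEQ_power_zero) simp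
     hence "(%m. (max 0 (1-(x^2) ^ Suc m)) ^ 5) \<longlonglongrightarrow> (max 0 (1-0)) ^ 5" by (intro tendsto_intros)
     moreover have "bump c r (Suc m) u = (max 0 (1-(x^2) ^ Suc m)) ^ 5" for m
      by (simp only: bump_def x_def power_mult)
     ultimately show ?thesis using u by simp
    qed
   qed
   show "AE u in lborel. norm (bump c r (Suc m) u * v u) <= indicator {a..b} u*(exp (beta * b/2) * B)" for m
   proof (rule AE_I2)
    fix u
    show "norm (bump c r (Suc m) u * v u) <= indicator {a..b} u*(exp (beta * b/2) * B)"
    proof (cases "u \<in> {a..b}")
     case True
     have "\<bar>bump c r (Suc m) u\<bar> * \<bar>v u\<bar> <= 1*(exp (beta * b/2) * B)"
      by (intro mult_mono vb) (use True bump_props(1,2)[OF r, where m = "Suc m" and c = c and y = u] in auto)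
     thus ?thesis using True by (simp add: abs_mult)
    next
     case False
     hence "u \<notin> {a<..<b}" by auto
     hence "\<bar>u-c\<bar> >= r" unfolding out .
     thus ?thesis using False by (simp add: bump_props[OF r])
    qed
   qed
  qed measurable
  have "(LBINT u. bump c r (Suc m) u * v u) = 0" for m
  proof -
   obtain F where F: "jet F" "F 0 = (%y. bump c r (Suc m) y+bump c r (Suc m) (- y))"
    using bump_jet[OF r, of "Suc m" c] by auto
   have "bump c r (Suc m) u * v u = indicator {0..} u *\<^sub>R (exp (beta * u/2) * F 0 u * w u)" for u
   proof (cases "0 <= u")
    case True
    have "- u \<notin> {a<..<b}" using True a by simp
    hence "\<bar>- u-c\<bar> >= r" unfolding out .
    hence "bump c r (Suc m) (- u) = 0" by (simp add: bump_props[OF r])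
    thus ?thesis using True F(2) by (simp add: v_def)
   qed (simp add: v_def)
   hence "(LBINT u. bump c r (Suc m) u * v u) = wpair (F 0) w" unfolding wpair_def set_lebesgue_integral_def by simp
   thus ?thesis using z[OF F(1)] by simp
  qed
  hence "(%m. 0) \<longlonglongrightarrow> (LBINT u. indicator {a<..<b} u * v u)" using lim by simp
  thus ?thesis by (simp add: LIMSEQ_const_iff)
 qed simp
 have "AE u in lborel. indicator {0<..<real n} u * v u = 0" for n
 proof (rule AE_zero_of_intervals)
  show "integrable lborel (%u. indicator {0<..<real n} u * v u)"
  proof (rule Bochner_Integration.integrable_bound)
   show "integrable lborel (%u. indicator {0..real n} u*(exp (beta * real n/2) * B))" by (intro integrable_mult_left integrable_indicator_Icc)
   show "AE u in lborel. norm (indicator {0<..<real n} u * v u) <= norm (indicator {0..real n} u*(exp (beta * real n/2) * B))"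
    using vb B0 by (intro AE_I2) (auto simp: indicator_def)
  qed measurable
  show "(LBINT u. indicator {0<..<real n} u * v u) = 0" by (rule zi) simp
  fix a b :: real
  have "(LBINT u:{a<..<b}. indicator {0<..<real n} u * v u) = (LBINT u. indicator {max a 0<..<min b (real n)} u * v u)"
   unfolding set_lebesgue_integral_def by (rule Bochner_Integration.integral_cong[OF refl]) (auto simp: indicator_def)
  also have "... = 0" by (rule zi) simp
  finally show "(LBINT u:{a<..<b}. indicator {0<..<real n} u * v u) = 0" .
 qed
 hence "AE u in lborel. ALL n. indicator {0<..<real n} u * v u = 0" unfolding AE_all_countable by (rule allI)
 moreover have "AE u in lborel. u ~= (0::real)" by (rule AE_lborel_singleton)
 ultimately show ?thesis
 proof eventually_elim
  case (elim u)
  obtain n where "u < real n" using reals_Archimedean2 by blast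
  thus ?case using elim(1)[rule_format, of n] elim(2) by (auto simp: v_def)
 qed
qed

section \<open>Uniqueness of weak solutions\<close>

lemma weak_sol_admissible:
 assumes "weak_sol beta init w"
 obtains B where "0 <= B" "!!T. admissible w T B"
proof -
 obtain C where C: "ALL t>=0. ALL u>=0. \<bar>w t u\<bar> <= C" using assms unfolding weak_sol_def by blast
 have "0 <= C" using C[rule_format, of 0 0] by simp
 moreover have "admissible w T C" for T
  by (rule admissible_of_measurable) (use assms C in \<open>simp_all add: weak_sol_def\<close>)
 ultimately show ?thesis by (rule that)
qed

lemma weak_sol_defect:
 assumes w: "weak_sol beta init w" and f: "evt f f''" and t: "0 <= t"
 shows "defect f f'' w t = 0"
proof (cases "t = 0")
 case True
 have "(LBINT r:{0..0}. wpair (%u.-cB * f u+f'' u) (w r)) = 0"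
  unfolding set_lebesgue_integral_def by (rule integral_eq_zero_AE) (use AE_lborel_singleton[of "0::real"] in \<open>auto elim!: eventually_mono\<close>)
 thus ?thesis using True by (simp add: defect_def)
next
 case False
 obtain g' g'' where g: "test_fun beta (%u. exp (beta * u/2) * f u) g' g''"
  "!!u. g'' u-beta * g' u = exp (beta * u/2)*(- cB * f u+f'' u)"
  by (rule evt_test_fun[OF f]) blast
 have "ALL g g' g''. test_fun beta g g' g'' --> (ALL t>0. (LBINT u:{0..}. g u * w t u) = (LBINT u:{0..}. g u * w 0 u)
 +(LBINT s:{0..t}. (LBINT u:{0..}. (g'' u-beta * g' u) * w s u)))" using w unfolding weak_sol_def by blast
 hence "(LBINT u:{0..}. exp (beta * u/2) * f u * w t u) = (LBINT u:{0..}. exp (beta * u/2) * f u * w 0 u)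
 +(LBINT s:{0..t}. (LBINT u:{0..}. (g'' u-beta * g' u) * w s u))" using g(1) False t by simp
 thus ?thesis unfolding g(2) defect_def wpair_def by simp
qed

text \<open>The difference has zero initial pairings and zero defects, so the stability estimate
  holds with every e > 0 and all pairings with jets vanish.\<close>

lemma weak_sol_unique:
 assumes w: "weak_sol beta init w" and v: "weak_sol beta init v" and t: "0 <= t"
 shows "AE u in lborel. u >= 0 --> w t u = v t u"
proof (cases "t = 0")
 case True
 have "w 0 u = v 0 u" if "0 <= u" for u using w v that by (simp add: weak_sol_def)
 thus ?thesis using True by simp
next
 case False
 hence T: "0 < t" using t by simp
 obtain B1 where B1: "0 <= B1" "!!T. admissible w T B1" by (rule weak_sol_admissible[OF w]) blast
 obtain B2 where B2: "0 <= B2" "!!T. admissible v T B2" by (rule weak_sol_admissible[OF v]) blast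
 let ?W = "%t u. w t u-v t u"
 have ad: "admissible ?W t (B1+B2)" by (rule admissible_diff[OF B1(2) B2(2)])
 have tt: "t \<in> {0..t}" using t by simp
 have "AE u in lborel. u >= 0 --> ?W t u = 0"
 proof (rule AE_zero_of_jets)
  show "hmeas (?W t)" using ad tt unfolding admissible_def by blast
  show "\<bar>?W t u\<bar> <= B1+B2" if "0 <= u" for u using ad tt that unfolding admissible_def by blast
  fix f assume f: "jet f"
  have "\<bar>wpair (f 0) (?W t)\<bar> <= e" if e: "0 < e" for e
  proof -
   obtain S dl where S: "ALL (g, g''):S. evt g g''" and dl: "dl > 0" and est: "ALL W. admissible W t (B1+B2) -->
    (ALL (g, g''):S. \<bar>wpair g (W 0)\<bar> <= dl & (ALL s:{0..t}. \<bar>defect g g'' W s\<bar> <= dl)) --> (ALL s:{0..t}. \<bar>wpair (f 0) (W s)\<bar> <= e)"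
    using duality_estimate[OF f T add_nonneg_nonneg[OF B1(1) B2(1)] e] by (elim exE conjE) (rule that)
   have "ALL (g, g''):S. \<bar>wpair g (?W 0)\<bar> <= dl & (ALL s:{0..t}. \<bar>defect g g'' ?W s\<bar> <= dl)"
   proof (intro ballI, clarify)
    fix g g'' assume "(g, g'') \<in> S"
    hence e: "evt g g''" using S by blast
    hence cs: "csupp g" "csupp g''" by (simp_all add: evt_def)
    have "\<bar>wpair g (?W 0)\<bar> <= 0*(LBINT u. \<bar>exp (beta * u/2) * g u\<bar>)"
     by (rule wpair_bound[OF cs(1)]) (use w v in \<open>auto simp: weak_sol_def\<close>)
    moreover have "defect g g'' ?W s = 0" if "s \<in> {0..t}" for s
     using defect_diff[OF B1(2) B2(2) cs that] weak_sol_defect[OF w e, of s] weak_sol_defect[OF v e, of s] that by simp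
    ultimately show "\<bar>wpair g (?W 0)\<bar> <= dl & (ALL s:{0..t}. \<bar>defect g g'' ?W s\<bar> <= dl)" using dl by simp
   qed
   hence "ALL s:{0..t}. \<bar>wpair (f 0) (?W s)\<bar> <= e" using est ad by blast
   thus ?thesis using tt by blast
  qed
  thus "wpair (f 0) (?W t) = 0" using field_le_epsilon[of "\<bar>wpair (f 0) (?W t)\<bar>" 0] by simp
 qed
 thus ?thesis by simp
qed

section \<open>Convergence\<close>

lemma card_nat_interval:
 assumes fin: "finite eta" and L: "0 <= L"
 shows "real (card {y\<in>eta. x < real y & real y < x+L}) <= L+1"
proof -
 let ?S = "{y\<in>eta. x < real y & real y < x+L}"
 have "card ?S = card (int ` ?S)" by (rule card_image[symmetric]) simp
 also have "... <= card {\<lfloor>x\<rfloor>+1..\<lceil>x+L\<rceil> - 1}"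
 proof (rule card_mono)
  show "int ` ?S \<subseteq> {\<lfloor>x\<rfloor>+1..\<lceil>x+L\<rceil> - 1}"
  proof
   fix i assume "i \<in> int ` ?S"
   then obtain y where y: "i = int y" "x < real y" "real y < x+L" by auto
   have "\<lfloor>x\<rfloor> < int y" using y(2) by (simp add: floor_less_iff)
   moreover have "int y < \<lceil>x+L\<rceil>" using y(3) by (simp add: less_ceiling_iff)
   ultimately show "i \<in> {\<lfloor>x\<rfloor>+1..\<lceil>x+L\<rceil> - 1}" using y(1) by simp
  qed
 qed simp
 also have "... = nat (\<lceil>x+L\<rceil> - 1-\<lfloor>x\<rfloor>)" by simp
 finally have "real (card ?S) <= real (nat (\<lceil>x+L\<rceil> - 1-\<lfloor>x\<rfloor>))" by simp
 also have "... <= L+1"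
 proof -
  define z where "z = \<lceil>x+L\<rceil> - 1-\<lfloor>x\<rfloor>"
  have "real_of_int z <= L+1" unfolding z_def by linarith
  thus ?thesis unfolding z_def[symmetric] using L by (cases "0 <= z") simp_all
 qed
 finally show ?thesis .
qed

text \<open>The microscopic ramp of width 1/N is replaced by one of width d. They are ordered and
  differ only in a window of length N d + 1, which by exclusion holds at most N d + 2
  particles.\<close>

lemma zexp_emp:
 assumes eta: "eta \<in> chiR" and N: "N >= 1" and d: "0 < d" and Nd: "1 <= real N * d"
 shows "\<bar>zexp N eta u/real N-emp N eta (%v. clamp01 ((v-u)/d))\<bar> <= d+2/real N"
proof -
 have fin: "finite eta" using eta by (simp add: chiR_def)
 have N0: "0 < real N" using N by simp
 define x L where "x = real N * u-1" and "L = real N * d+1"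
 let ?S = "{y\<in>eta. x < real y & real y < x+L}"
 let ?h = "%y::nat. clamp01 (real y+1-real N * u)-clamp01 ((real y/real N-u)/d)"
 have q: "(real y/real N-u)/d = (real y-real N * u)/(real N * d)" for y :: nat using N0 d by (simp add: field_simps)
 have h0: "0 <= ?h y" for y
 proof (cases "real y-real N * u <= 0")
  case True
  hence "(real y-real N * u)/(real N * d) <= 0" using N0 d by (simp add: divide_le_0_iff)
  thus ?thesis unfolding q by (simp add: clamp01_def)
 next
  case False
  thus ?thesis by (simp add: clamp01_def)
 qed
 have h1: "?h y <= (if y \<in> ?S then 1 else 0)" if "y \<in> eta" for y
 proof -
  consider "real y <= x" | "real y >= x+L" | "x < real y" "real y < x+L" by linarith
  thus ?thesis
  proof cases
   case 1
   hence "clamp01 (real y+1-real N * u) = 0" by (simp add: x_def clamp01_def)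
   moreover have "0 <= clamp01 ((real y/real N-u)/d)" by (simp add: clamp01_def)
   ultimately show ?thesis by auto
  next
   case 2
   hence "1 <= (real y-real N * u)/(real N * d)" using N0 d by (simp add: x_def L_def pos_le_divide_eq)
   hence "clamp01 ((real y/real N-u)/d) = 1" unfolding q by (simp add: clamp01_def)
   moreover have "clamp01 (real y+1-real N * u) <= 1" by (simp add: clamp01_def)
   ultimately show ?thesis by auto
  next
   case 3
   have "clamp01 z <= 1" "0 <= clamp01 z" for z by (simp_all add: clamp01_def)
   hence "?h y <= 1-0" by (intro diff_mono)
   thus ?thesis using 3 that by simp
  qed
 qed
 have "(\<Sum>y\<in>eta. ?h y) <= (\<Sum>y\<in>eta. if y \<in> ?S then 1 else 0)" by (rule sum_mono[OF h1])
 also have "... = real (card ?S)" using fin by (simp add: sum.If_cases Int_def)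
 also have "... <= L+1" by (rule card_nat_interval[OF fin]) (use N0 d in \<open>simp add: L_def\<close>)
 finally have up: "(\<Sum>y\<in>eta. ?h y) <= real N * d+2" by (simp add: L_def)
 have lo: "0 <= (\<Sum>y\<in>eta. ?h y)" by (rule sum_nonneg) (rule h0)
 have "zexp N eta u/real N-emp N eta (%v. clamp01 ((v-u)/d)) = (\<Sum>y\<in>eta. ?h y)/real N"
  by (simp add: zexp_def emp_def sum_subtractf diff_divide_distrib)
 moreover have "(\<Sum>y\<in>eta. ?h y)/real N <= (real N * d+2)/real N" using up N0 by (intro divide_right_mono) auto
 moreover have "(real N * d+2)/real N = d+2/real N" using N0 by (simp add: add_divide_distrib)
 moreover have "0 <= (\<Sum>y\<in>eta. ?h y)/real N" using lo N0 by simp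
 ultimately show ?thesis by (simp only: abs_of_nonneg)
qed

lemma grid_point:
 fixes u d K :: real
 assumes "0 < d" "0 <= u" "u <= K"
 obtains j where "j <= nat \<lceil>K/d\<rceil>" "real j * d <= u" "u-real j * d <= d"
proof -
 define j where "j = nat \<lfloor>u/d\<rfloor>"
 have ud: "0 <= u/d" "u/d <= K/d" using assms by (auto intro: divide_right_mono)
 have rj: "real j = real_of_int \<lfloor>u/d\<rfloor>" using ud(1) by (simp add: j_def)
 have "real j <= u/d" "u/d <= real j+1" unfolding rj by linarith+
 hence "real j * d <= u" "u <= (real j+1) * d" using assms(1) by (simp_all add: pos_le_divide_eq pos_divide_le_eq)
 moreover have "\<lfloor>u/d\<rfloor> <= \<lceil>K/d\<rceil>" using ud(2) by linarith
 hence "j <= nat \<lceil>K/d\<rceil>" unfolding j_def by (rule nat_mono)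
 ultimately show ?thesis by (intro that[of j]) (auto simp: distrib_right)
qed

lemma prob_event_outer:
 assumes "prob_event M P"
 shows "(%N. outer_prob (M N) {xi\<in>space (M N). \<not> P N xi}) \<longlonglongrightarrow> 0"
proof (rule LIMSEQ_I)
 fix p :: real assume p: "0 < p"
 then obtain N0 where N0: "ALL N>=N0. EX E:sets (M N). measure (M N) E <= p/2 & (ALL xi:space (M N)-E. P N xi)"
  using assms unfolding prob_event_def by (metis half_gt_zero)
 show "EX no. ALL n>=no. norm (outer_prob (M n) {xi\<in>space (M n). \<not> P n xi}-0) < p"
 proof (intro exI[of _ N0] allI impI)
  fix N assume "N >= N0"
  then obtain E where E: "E \<in> sets (M N)" "measure (M N) E <= p/2" "ALL xi:space (M N)-E. P N xi" using N0 by blast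
  let ?S = "{xi\<in>space (M N). \<not> P N xi}"
  let ?A = "{measure (M N) A | A. A \<in> sets (M N) & ?S \<subseteq> A}"
  have mem: "measure (M N) E \<in> ?A" using E by blast
  have "Inf ?A <= measure (M N) E" by (rule cInf_lower[OF mem]) (auto intro!: bdd_belowI[of _ 0])
  moreover have "0 <= Inf ?A" by (rule cInf_greatest) (use mem in auto)
  ultimately show "norm (outer_prob (M N) ?S-0) < p" using E(2) p unfolding outer_prob_def by simp
 qed
qed

lemma bump_mass:
 assumes r: "0 < r" and c: "0 <= c"
 shows "0 < (LBINT u. indicator {0..} u*(exp (beta * u/2)*(bump c r 1 u+bump c r 1 (- u))))"
  "integrable lborel (%u. indicator {0..} u*(exp (beta * u/2)*(bump c r 1 u+bump c r 1 (- u))))"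
proof -
 obtain F where F: "jet F" "F 0 = (%y. bump c r 1 y+bump c r 1 (- y))" using bump_jet[OF r, of 1 c] by auto
 have "csupp (F 0)" using F(1) by (simp add: jet_def)
 hence "integrable lborel (%u. exp (beta * u/2)*(bump c r 1 u+bump c r 1 (- u)))"
  using csupp_integrable[OF exp_csupp] unfolding F(2) by blast
 from integrable_mult_indicator[OF _ this, of "{0..}"]
 show i: "integrable lborel (%u. indicator {0..} u*(exp (beta * u/2)*(bump c r 1 u+bump c r 1 (- u))))" by simp
 have b0: "0 <= bump c r 1 y" for y by (rule bump_props(1)[OF r]) simp
 have "0 < (3/4) ^ 5*(r/2)" using r by simp
 also have "... = (LBINT u. indicator {c..c+r/2} u*(3/4) ^ 5)" using r by simp
 also have "... <= (LBINT u. indicator {0..} u*(exp (beta * u/2)*(bump c r 1 u+bump c r 1 (- u))))"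
 proof (rule integral_mono[OF integrable_mult_left[OF integrable_indicator_Icc] i])
  fix u :: real
  show "indicator {c..c+r/2} u*(3/4) ^ 5 <= indicator {0..} u*(exp (beta * u/2)*(bump c r 1 u+bump c r 1 (- u)))"
  proof (cases "u \<in> {c..c+r/2}")
   case True
   hence u: "0 <= u" using c by simp
   define x where "x = (u-c)/r"
   have "x <= 1/2" "0 <= x" unfolding x_def using True r by (simp_all add: pos_divide_le_eq)
   hence "x^2 <= (1/2)^2" by (intro power_mono)
   hence "x^2 <= 1/4" by (simp add: power_divide)
   hence "3/4 <= max 0 (1-x^2)" by simp
   hence "(3/4) ^ 5 <= (max 0 (1-x^2)) ^ 5" by (rule power_mono) simp
   hence "(3/4) ^ 5 <= bump c r 1 u" by (simp only: bump_def x_def mult_1_right)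
   moreover have "1 <= exp (beta * u/2)" using u beta_pos by simp
   ultimately have "1*(3/4) ^ 5 <= exp (beta * u/2)*(bump c r 1 u+bump c r 1 (- u))"
    using b0[of "- u"] by (intro mult_mono) auto
   thus ?thesis using True u by simp
  qed (use b0 in \<open>simp add: add_nonneg_nonneg\<close>)
 qed
 finally show "0 < (LBINT u. indicator {0..} u*(exp (beta * u/2)*(bump c r 1 u+bump c r 1 (- u))))" .
qed

text \<open>Testing with a bump at c is averaging near c; the average differs from the value at c by
  at most the oscillation d.\<close>

lemma value_from_bump:
 assumes r: "0 < r" and c: "0 <= c" and w: "hmeas w" "!!u. 0 <= u ==> \<bar>w u\<bar> <= B"
  and osc: "!!u. 0 <= u ==> \<bar>u-c\<bar> <= r ==> \<bar>w u-w c\<bar> <= d"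
 defines "f \<equiv> %u. bump c r 1 u+bump c r 1 (- u)"
 assumes f: "\<bar>wpair f w\<bar> <= e*(LBINT u. indicator {0..} u*(exp (beta * u/2) * f u))"
 shows "\<bar>w c\<bar> <= e+d"
proof -
 let ?I = "LBINT u. indicator {0..} u*(exp (beta * u/2) * f u)"
 have I: "0 < ?I" "integrable lborel (%u. indicator {0..} u*(exp (beta * u/2) * f u))"
  using bump_mass[OF r c] by (simp_all add: f_def)
 obtain F where F: "jet F" "F 0 = f" using bump_jet[OF r, of 1 c] unfolding f_def by auto
 have cs: "csupp f" using F by (auto simp: jet_def)
 have f0: "0 <= f u" for u using bump_props(1)[OF r, of 1] by (simp add: f_def add_nonneg_nonneg)
 have d0: "0 <= d" using osc[of c] c r by simp
 have mc: "hmeas (%u. w c)" unfolding hmeas_def by measurable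
 have "wpair f (%u. w u-w c) = wpair f w-wpair f (%u. w c)"
  by (rule wpair_diff[OF cs w(1) mc w(2), of "\<bar>w c\<bar>"]) simp_all
 moreover have "wpair f (%u. w c) = w c * ?I"
  unfolding wpair_def set_lebesgue_integral_def by (subst integral_mult_right_zero[symmetric]) (simp add: mult_ac)
 moreover have "\<bar>wpair f (%u. w u-w c)\<bar> <= (LBINT u. d*(indicator {0..} u*(exp (beta * u/2) * f u)))"
 proof (rule wpair_bound_integrable)
  show "integrable lborel (%u. d*(indicator {0..} u*(exp (beta * u/2) * f u)))" by (rule integrable_mult_right[OF I(2)])
  show "0 <= d*(indicator {0..} u*(exp (beta * u/2) * f u))" for u using d0 f0 by simp
  fix u :: real assume u: "0 <= u"
  have "\<bar>w u-w c\<bar>*(exp (beta * u/2) * f u) <= d*(exp (beta * u/2) * f u)"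
  proof (cases "\<bar>u-c\<bar> <= r")
   case True
   thus ?thesis using f0[of u] by (intro mult_right_mono osc u) simp_all
  next
   case False
   hence "\<bar>u-c\<bar> >= r" "\<bar>- u-c\<bar> >= r" using u c by linarith+
   hence "f u = 0" unfolding f_def using bump_props(3)[OF r] by simp
   thus ?thesis by simp
  qed
  thus "\<bar>exp (beta * u/2) * f u*(w u-w c)\<bar> <= d*(indicator {0..} u*(exp (beta * u/2) * f u))"
   using u f0[of u] by (simp add: abs_mult mult_ac)
 qed
 moreover have "(LBINT u. d*(indicator {0..} u*(exp (beta * u/2) * f u))) = d * ?I" by (rule integral_mult_right_zero)
 ultimately have "\<bar>w c * ?I\<bar> <= e * ?I+d * ?I" using f by linarith
 hence "\<bar>w c\<bar> * ?I <= (e+d) * ?I" using I(1) by (simp add: abs_mult distrib_right)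
 thus ?thesis using I(1) by simp
qed

section \<open>The random profile against the Gaussian solution\<close>

locale profile_limit =
 fixes \<nu> :: "nat => nat set pmf" and \<rho>0 :: "real => real"
  and M :: "nat => 'w measure" and X :: "nat => real => 'w => nat set"
 assumes rho_range: "!!v. 0 <= v ==> 0 <= \<rho>0 v & \<rho>0 v <= 1"
  and rho_int: "set_integrable lborel {0..} \<rho>0"
  and profile: "!!dl g K. dl > 0 ==> continuous_on {0..} g ==> bounded (g ` {0..}) ==> K > 0 ==> (ALL v>=K. g v = g K) ==>
    (%N. measure_pmf.prob (\<nu> N) {eta. \<bar>emp N eta g-(LBINT v:{0..}. g v * \<rho>0 v)\<bar> > dl}) \<longlonglongrightarrow> 0"
  and process: "ALL N>=1. solves_MP (M N) (X N) (%f eta. (real N)^2 * genR (epsN N) f eta) (\<nu> N)"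
begin

lemma chi_path: "N >= 1 ==> 0 <= t ==> xi \<in> space (M N) ==> X N t xi \<in> chiR"
 using process by (auto simp: solves_MP_def)

definition tail :: "real => real" where "tail u = (LBINT v:{u..}. \<rho>0 v)"

lemma rho_sub: "A \<in> sets borel ==> A \<subseteq> {0..} ==> set_integrable lborel A \<rho>0"
 by (rule set_integrable_subset[OF rho_int]) auto

lemma tail_diff:
 assumes "0 <= u" "u <= v"
 shows "0 <= tail u-tail v" "tail u-tail v <= v-u"
proof -
 have i: "set_integrable lborel {u..<v} \<rho>0" "set_integrable lborel {v..} \<rho>0" by (rule rho_sub; use assms in auto)+
 have "{u..} = {u..<v} \<union> {v..}" using assms by auto
 hence "tail u = (LBINT x:{u..<v}. \<rho>0 x)+tail v"
  unfolding tail_def using set_integral_Un[OF _ i] by (simp add: disjoint_iff)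
 moreover have "0 <= (LBINT x:{u..<v}. \<rho>0 x)"
  unfolding set_lebesgue_integral_def
  by (rule Bochner_Integration.integral_nonneg) (use rho_range assms in \<open>auto simp: indicator_def\<close>)
 moreover have "(LBINT x:{u..<v}. \<rho>0 x) <= (LBINT x. indicator {u..v} x)"
  unfolding set_lebesgue_integral_def
  by (rule integral_mono[OF i(1)[unfolded set_integrable_def] integrable_indicator_Icc])
   (use rho_range assms in \<open>auto simp: indicator_def\<close>)
 ultimately show "0 <= tail u-tail v" "tail u-tail v <= v-u" using assms by simp_all
qed

lemma tail_lim: "(tail \<longlongrightarrow> 0) at_top"
proof -
 \<comment> \<open>The maximum keeps the half lines inside {0..}, where integrability is
   assumed.\<close>
 have "((%u. LBINT v. indicator {max 0 u..} v *\<^sub>R \<rho>0 v) \<longlongrightarrow> integral\<^sup>L lborel (%v::real. 0 :: real)) at_top"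
 proof (rule integral_dominated_convergence_at_top[where w = "%v. norm (indicator {0..} v *\<^sub>R \<rho>0 v)"])
  show "integrable lborel (%v. norm (indicator {0..} v *\<^sub>R \<rho>0 v))"
   by (rule integrable_norm) (use rho_int in \<open>simp add: set_integrable_def\<close>)
  show "(%v. indicator {max 0 u..} v *\<^sub>R \<rho>0 v) \<in> borel_measurable lborel" for u
   by (rule borel_measurable_integrable[OF rho_sub[unfolded set_integrable_def]]) auto
  show "\<forall>\<^sub>F u in at_top. AE v in lborel. norm (indicator {max 0 u..} v *\<^sub>R \<rho>0 v) <= norm (indicator {0..} v *\<^sub>R \<rho>0 v)"
   by (intro always_eventually allI AE_I2) (simp add: indicator_def)
  show "AE v in lborel. ((%u. indicator {max 0 u..} v *\<^sub>R \<rho>0 v) \<longlongrightarrow> 0) at_top"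
  proof (rule AE_I2)
   fix v
   show "((%u. indicator {max 0 u..} v *\<^sub>R \<rho>0 v) \<longlongrightarrow> 0) at_top"
    by (rule tendsto_eventually, rule eventually_mono[OF eventually_gt_at_top[of v]]) simp
  qed
 qed simp
 hence "((%u. tail (max 0 u)) \<longlongrightarrow> 0) at_top" by (simp add: tail_def set_lebesgue_integral_def)
 thus ?thesis
  by (rule Lim_transform_eventually) (rule eventually_mono[OF eventually_ge_at_top[of 0]], simp)
qed

lemma w0_tail: "w0 \<rho>0 u = exp (beta * tail u)"
 by (simp add: w0_def tail_def)

sublocale heat: heat_data beta "w0 \<rho>0 0" "w0 \<rho>0"
proof
 show "0 < beta" by (rule beta_pos)
 have "continuous_on {0..} tail"
 proof (rule continuous_onI)
  fix u e :: real assume u: "u \<in> {0..}" and e: "0 < e"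
  show "EX d>0. ALL v:{0..}. dist v u < d --> dist (tail v) (tail u) <= e"
  proof (intro exI[of _ e] conjI ballI impI e)
   fix v assume v: "v \<in> {0..}" "dist v u < e"
   have "u <= v \<or> v <= u" by linarith
   thus "dist (tail v) (tail u) <= e"
   proof
    assume "u <= v"
    thus ?thesis using tail_diff[of u v] u v by (simp add: dist_real_def)
   next
    assume "v <= u"
    thus ?thesis using tail_diff[of v u] u v by (simp add: dist_real_def)
   qed
  qed
 qed
 thus "continuous_on {0..} (w0 \<rho>0)" unfolding w0_tail[abs_def] by (intro continuous_intros)
 show "\<bar>w0 \<rho>0 u\<bar> <= w0 \<rho>0 0" if "0 <= u" for u
  unfolding w0_tail using tail_diff[of 0 u] that beta_pos by simp
 have "((%u. exp (beta * tail u)) \<longlongrightarrow> exp (beta*0)) at_top" by (intro tendsto_intros tail_lim)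
 thus "(w0 \<rho>0 \<longlongrightarrow> 1) at_top" unfolding w0_tail[abs_def] by simp
qed

lemma tail_clamp:
 assumes u: "0 <= u" and d: "0 < d"
 shows "\<bar>tail u-(LBINT v:{0..}. clamp01 ((v-u)/d) * \<rho>0 v)\<bar> <= d"
proof -
 let ?a = "%v. indicator {u..} v *\<^sub>R \<rho>0 v" and ?b = "%v. indicator {0..} v *\<^sub>R (clamp01 ((v-u)/d) * \<rho>0 v)"
 have ia: "integrable lborel ?a" using rho_sub[of "{u..}"] u by (simp add: set_integrable_def)
 have i0: "integrable lborel (%v. indicator {0..} v *\<^sub>R \<rho>0 v)" using rho_int by (simp add: set_integrable_def)
 have [measurable]: "(%v. clamp01 ((v-u)/d)) \<in> borel_measurable borel" unfolding clamp01_def by measurable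
 have cb: "0 <= clamp01 z" "clamp01 z <= 1" for z by (simp_all add: clamp01_def)
 have ib: "integrable lborel ?b"
 proof (rule Bochner_Integration.integrable_bound[OF i0])
  have "(%v. clamp01 ((v-u)/d)*(indicator {0..} v *\<^sub>R \<rho>0 v)) \<in> borel_measurable lborel"
   using borel_measurable_integrable[OF i0] by measurable
  thus "?b \<in> borel_measurable lborel" by (simp add: mult_ac)
  show "AE v in lborel. norm (?b v) <= norm (indicator {0..} v *\<^sub>R \<rho>0 v)"
  proof (rule AE_I2)
   fix v
   have "\<bar>clamp01 ((v-u)/d)\<bar> * \<bar>\<rho>0 v\<bar> <= 1 * \<bar>\<rho>0 v\<bar>" using cb by (intro mult_right_mono) simp_all
   thus "norm (?b v) <= norm (indicator {0..} v *\<^sub>R \<rho>0 v)" by (simp add: indicator_def abs_mult)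
  qed
 qed
 have "\<bar>?a v-?b v\<bar> <= indicator {u..u+d} v" for v
 proof -
  consider "v < u" | "u <= v" "v <= u+d" | "v > u+d" by linarith
  thus ?thesis
  proof cases
   case 1
   hence "clamp01 ((v-u)/d) = 0" using d by (simp add: clamp01_def divide_le_0_iff)
   thus ?thesis using 1 by simp
  next
   case 2
   hence v: "0 <= v" using u by simp
   have "?a v-?b v = (1-clamp01 ((v-u)/d)) * \<rho>0 v" using 2 v by (simp add: algebra_simps)
   moreover have "\<bar>(1-clamp01 ((v-u)/d)) * \<rho>0 v\<bar> <= 1*1"
    unfolding abs_mult by (rule mult_mono) (use cb[of "(v-u)/d"] rho_range[OF v] in auto)
   ultimately show ?thesis using 2 by simp
  next
   case 3
   hence "1 <= (v-u)/d" using d by (simp add: pos_le_divide_eq)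
   hence "clamp01 ((v-u)/d) = 1" by (simp add: clamp01_def)
   thus ?thesis using 3 u d by simp
  qed
 qed
 hence "norm (LBINT v. ?a v-?b v) <= (LBINT v. indicator {u..u+d} v)"
  by (intro order_trans[OF integral_norm_bound integral_mono[OF integrable_norm[OF Bochner_Integration.integrable_diff[OF ia ib]] integrable_indicator_Icc]]) simp
 thus ?thesis using d unfolding Bochner_Integration.integral_diff[OF ia ib] by (simp add: tail_def set_lebesgue_integral_def)
qed

text \<open>The exponent is the product of - N ln eps, which tends to \<open>beta\<close>, and
  \<open>zexp\<close> / N, which is close to a ramp statistic of the empirical measure and so to
  \<open>tail u\<close>.\<close>

lemma initial_zeta:
 assumes u: "0 <= u" and e: "0 < e"
 shows "prob_event M (%N xi. \<bar>zeta N (epsN N) (X N 0 xi) u-w0 \<rho>0 u\<bar> <= e)"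
proof -
 have "isCont (%p::real \<times> real. exp (fst p * snd p)) (beta, tail u)" by (intro continuous_intros)
 then obtain d0 where d0: "d0 > 0" "ALL p. dist p (beta, tail u) < d0 --> dist (exp (fst p * snd p)) (exp (beta * tail u)) < e"
  using e unfolding continuous_at_eps_delta by (metis fst_conv snd_conv)
 \<comment> \<open>The first factor is off by at most d, the second by at most 4 d: ramp width, 2/N,
   law of large numbers and \<open>tail_clamp\<close>.\<close>
 define d where "d = d0/16"
 have d: "0 < d" using d0 by (simp add: d_def)
 have close: "\<bar>exp (a * b)-exp (beta * tail u)\<bar> <= e" if "\<bar>a-beta\<bar> <= d" "\<bar>b-tail u\<bar> <= 4 * d" for a b
 proof -
  have "dist (a, b) (beta, tail u) <= \<bar>a-beta\<bar>+\<bar>b-tail u\<bar>"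
   using sqrt_sum_squares_le_sum_abs[of "a-beta" "b-tail u"] by (simp add: dist_prod_def dist_real_def)
  also have "... < d0" using that d unfolding d_def by linarith
  finally have "dist (exp (fst (a, b) * snd (a, b))) (exp (beta * tail u)) < e" using d0(2) by blast
  thus ?thesis by (simp add: dist_real_def)
 qed
 define g where "g = (%v. clamp01 ((v-u)/d))"
 define Q where "Q = (LBINT v:{0..}. g v * \<rho>0 v)"
 have lim: "(%N. measure_pmf.prob (\<nu> N) {eta. \<bar>emp N eta g-Q\<bar> > d}) \<longlonglongrightarrow> 0"
  unfolding Q_def
 proof (rule profile[OF d])
  show "continuous_on {0..} g" unfolding g_def clamp01_def using d by (intro continuous_intros) simp
  show "bounded (g ` {0..})" by (rule boundedI[of _ 1]) (auto simp: g_def clamp01_def)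
  show "u+d > 0" using u d by simp
  have "g v = 1" if "v >= u+d" for v
  proof -
   have "1 <= (v-u)/d" using that d by (simp add: pos_le_divide_eq)
   thus ?thesis by (simp add: g_def clamp01_def)
  qed
  thus "ALL v>=u+d. g v = g (u+d)" by simp
 qed
 have ev1: "\<forall>\<^sub>F N in sequentially. dist (- real N * ln (epsN N)) beta < d" using epsN_log_asymp d by (rule tendstoD)
 have "(%N. 2*(1/real N)) \<longlonglongrightarrow> 2*0" by (intro tendsto_intros lim_1_over_n)
 hence "(%N. 2*(1/real N)) \<longlonglongrightarrow> 0" by simp
 hence ev2: "\<forall>\<^sub>F N in sequentially. 2*(1/real N) < d" by (rule order_tendstoD(2)[OF _ d])
 have det: "\<bar>zeta N (epsN N) eta u-w0 \<rho>0 u\<bar> <= e"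
  if N: "N >= 1" "dist (- real N * ln (epsN N)) beta < d" "2*(1/real N) < d" and eta: "eta \<in> chiR" and em: "\<not> \<bar>emp N eta g-Q\<bar> > d" for N eta
 proof -
  have "2 < d * real N" using N(1,3) by (simp add: pos_divide_less_eq)
  hence "1 <= real N * d" by (simp add: mult.commute)
  hence "\<bar>zexp N eta u/real N-emp N eta g\<bar> <= d+2/real N" unfolding g_def by (rule zexp_emp[OF eta N(1) d])
  moreover have "2/real N < d" using N(3) by simp
  moreover have "\<bar>tail u-Q\<bar> <= d" unfolding Q_def g_def by (rule tail_clamp[OF u d])
  ultimately have "\<bar>zexp N eta u/real N-tail u\<bar> <= 4 * d" using em by linarith
  moreover have "\<bar>- real N * ln (epsN N)-beta\<bar> <= d" using N(2) by (simp add: dist_real_def)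
  ultimately have "\<bar>exp ((- real N * ln (epsN N))*(zexp N eta u/real N))-exp (beta * tail u)\<bar> <= e" by (intro close)
  moreover have "(- real N * ln (epsN N))*(zexp N eta u/real N) = - ln (epsN N) * zexp N eta u" using N(1) by simp
  ultimately show ?thesis unfolding zeta_eq[OF eta N(1) u] w0_tail by (simp only:)
 qed
 show ?thesis unfolding prob_event_def
 proof (intro allI impI)
  fix p :: real assume p: "p > 0"
  have ev3: "\<forall>\<^sub>F N in sequentially. measure_pmf.prob (\<nu> N) {eta. \<bar>emp N eta g-Q\<bar> > d} < p" by (rule order_tendstoD(2)[OF lim p])
  have "\<forall>\<^sub>F N in sequentially. measure_pmf.prob (\<nu> N) {eta. \<bar>emp N eta g-Q\<bar> > d} < p
   & dist (- real N * ln (epsN N)) beta < d & 2*(1/real N) < d" by (intro eventually_conj ev1 ev2 ev3)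
  then obtain N0 where N0: "N0 >= 1" "ALL N>=N0. measure_pmf.prob (\<nu> N) {eta. \<bar>emp N eta g-Q\<bar> > d} < p
   & dist (- real N * ln (epsN N)) beta < d & 2*(1/real N) < d" using eventually_sequentiallyI1 by blast
  show "EX N0>=1. ALL N>=N0. EX E:sets (M N). measure (M N) E <= p & (ALL xi:space (M N)-E. \<bar>zeta N (epsN N) (X N 0 xi) u-w0 \<rho>0 u\<bar> <= e)"
  proof (intro exI[of _ N0] conjI allI impI, rule N0(1))
   fix N assume N: "N >= N0"
   hence N1: "N >= 1" using N0(1) by simp
   have mp: "solves_MP (M N) (X N) (%f eta. (real N)^2 * genR (epsN N) f eta) (\<nu> N)" using process N1 by blast
   have NN: "measure_pmf.prob (\<nu> N) {eta. \<bar>emp N eta g-Q\<bar> > d} < p"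
    "dist (- real N * ln (epsN N)) beta < d" "2*(1/real N) < d" using N0(2) N by blast+
   let ?A = "{eta. \<bar>emp N eta g-Q\<bar> > d}"
   let ?E = "{xi\<in>space (M N). X N 0 xi \<in> ?A}"
   have "X N 0 \<in> measurable (M N) (count_space UNIV)" using mp unfolding solves_MP_def by simp
   hence "X N 0 -` ?A \<inter> space (M N) \<in> sets (M N)" by (rule measurable_sets) simp
   moreover have "X N 0 -` ?A \<inter> space (M N) = ?E" by auto
   ultimately have E: "?E \<in> sets (M N)" by (simp only:)
   have "measure (M N) ?E = measure_pmf.prob (\<nu> N) ?A" using mp unfolding solves_MP_def by blast
   hence Ep: "measure (M N) ?E <= p" using NN(1) by linarith
   have "\<bar>zeta N (epsN N) (X N 0 xi) u-w0 \<rho>0 u\<bar> <= e" if "xi \<in> space (M N)-?E" for xi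
    by (rule det[OF N1 NN(2,3) chi_path[OF N1]]) (use that in auto)
   thus "EX E:sets (M N). measure (M N) E <= p & (ALL xi:space (M N)-E. \<bar>zeta N (epsN N) (X N 0 xi) u-w0 \<rho>0 u\<bar> <= e)"
    using E Ep by blast
  qed
 qed
qed

lemma initial_bounded: "prob_event M (%N xi. hz (epsN N) (X N 0 xi) 1 <= w0 \<rho>0 0+1)"
proof (rule prob_event_mono[OF initial_zeta[of 0 1]])
 show "\<forall>\<^sub>F N in sequentially. ALL xi:space (M N). \<bar>zeta N (epsN N) (X N 0 xi) 0-w0 \<rho>0 0\<bar> <= 1 --> hz (epsN N) (X N 0 xi) 1 <= w0 \<rho>0 0+1"
  using eventually_ge_at_top[of 1]
 proof eventually_elim
  case (elim N)
  show ?case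
  proof (rule ballI, rule impI)
   fix xi assume "xi \<in> space (M N)" and z: "\<bar>zeta N (epsN N) (X N 0 xi) 0-w0 \<rho>0 0\<bar> <= 1"
   hence "zeta N (epsN N) (X N 0 xi) 0 = hz (epsN N) (X N 0 xi) 1"
    by (intro zeta_zero chi_path[OF elim] elim epsN_pos) simp_all
   thus "hz (epsN N) (X N 0 xi) 1 <= w0 \<rho>0 0+1" using z by linarith
  qed
 qed
qed simp_all

abbreviation om :: "real => real => real" where "om \<equiv> heat.omega"

definition dev :: "nat => 'w => real => real => real" where
 "dev N xi t u = zeta N (epsN N) (X N t xi) u-om t u"

lemma om_weak_sol: "weak_sol beta (w0 \<rho>0) om"
 by (rule heat.omega_weak_sol) simp

lemma om_admissible: "admissible om T (2 * w0 \<rho>0 0)"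
 by (rule admissible_of_measurable) (use om_weak_sol heat.omega_bound in \<open>simp_all add: weak_sol_def\<close>)

lemma zeta_admissible:
 assumes N: "N >= 1" and xi: "xi \<in> space (M N)" and B: "!!t. t \<in> {0..T} ==> hz (epsN N) (X N t xi) 1 <= B"
 shows "admissible (%t. zeta N (epsN N) (X N t xi)) T B"
proof -
 have e: "0 < epsN N" "epsN N < 1" using epsN_pos[OF N] epsN_lt_1[OF N] by auto
 have chi: "X N t xi \<in> chiR" if "t \<in> {0..T}" for t by (rule chi_path[OF N]) (use that xi in auto)
 have m: "hmeas (zeta N (epsN N) eta)" if "eta \<in> chiR" for eta
  using borel_measurable_continuous_on_indicator[OF _ zeta_continuous[OF that N], of "epsN N"] by (simp add: hmeas_def)
 have zb: "\<bar>zeta N (epsN N) (X N t xi) u\<bar> <= B" if "t \<in> {0..T}" "0 <= u" for t u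
  using zeta_harnack[OF chi[OF that(1)] N order_refl that(2) e(1) less_imp_le[OF e(2)]]
   zeta_zero[OF chi[OF that(1)] N e(1)] B[OF that(1)] by simp
 show ?thesis unfolding admissible_def
 proof (intro conjI ballI allI impI)
  fix f assume f: "csupp f"
  interpret ex: exclusion_MP "M N" "X N" "(real N)^2" "epsN N" "\<nu> N"
   by standard (use process N e in auto)
  show "set_integrable lborel {0..T} (%t. wpair f (zeta N (epsN N) (X N t xi)))"
  proof (cases "0 <= T")
   case True
   have B0: "0 <= B" using order_trans[OF abs_ge_zero zb[of 0 0]] True by simp
   have Xc: "ex.Xc T t xi = X N t xi" if "t \<in> {0..T}" for t using that by (simp add: ex.Xc_eq)
   have "set_integrable lborel {0..T} (%t. wpair f (zeta N (epsN N) (ex.Xc T t xi)))"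
   proof (rule set_integrable_Icc_bounded)
    show "(%t. wpair f (zeta N (epsN N) (ex.Xc T t xi))) \<in> borel_measurable borel"
     by (rule ex.path_measurable[OF True xi])
    fix t assume t: "t \<in> {0..T}"
    show "\<bar>wpair f (zeta N (epsN N) (ex.Xc T t xi))\<bar> <= B*(LBINT u. \<bar>exp (beta * u/2) * f u\<bar>)"
     unfolding Xc[OF t] by (rule wpair_bound[OF f B0]) (rule zb[OF t])
   qed
   thus ?thesis by (subst set_integrable_cong[OF refl refl]) (simp_all add: Xc)
  qed (simp add: set_integrable_def)
 qed (use m chi zb in auto)
qed

lemma oscillation:
 assumes T: "0 < T" and d: "0 < d" and B: "0 < B"
 shows "EX dl>0. dl < 1 & (exp (Lam * dl)-1) * B <= d &
  (ALL t:{0..T}. ALL u:{0..K}. ALL v:{0..K}. \<bar>u-v\<bar> <= dl --> \<bar>om t u-om t v\<bar> <= d)"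
proof -
 have "uniformly_continuous_on ({0..T} \<times> {0..K}) (%(t, u). om t u)"
  by (rule compact_uniformly_continuous[OF continuous_on_subset[OF heat.omega_cont]]) (auto intro: compact_Times)
 then obtain dl1 where dl1: "dl1 > 0" "ALL x:{0..T} \<times> {0..K}. ALL y:{0..T} \<times> {0..K}. dist y x < dl1 -->
   dist ((%(t, u). om t u) y) ((%(t, u). om t u) x) < d"
  using d unfolding uniformly_continuous_on_def by blast
 have "((%dl. (exp (Lam * dl)-1) * B) \<longlongrightarrow> (exp (Lam*0)-1) * B) (at_right 0)" by (intro tendsto_intros)
 hence "((%dl. (exp (Lam * dl)-1) * B) \<longlongrightarrow> 0) (at_right 0)" by simp
 hence "\<forall>\<^sub>F dl in at_right 0. (exp (Lam * dl)-1) * B < d" by (rule order_tendstoD(2)[OF _ d])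
 moreover have "\<forall>\<^sub>F dl in at_right 0. dl \<in> {0<..<min 1 dl1}" by (rule eventually_at_right_real) (use dl1 in simp)
 ultimately have "\<forall>\<^sub>F dl in at_right 0. (exp (Lam * dl)-1) * B < d & dl \<in> {0<..<min 1 dl1}" by (rule eventually_conj)
 then obtain dl where dl: "(exp (Lam * dl)-1) * B < d" "dl \<in> {0<..<min 1 dl1}"
  using eventually_happens'[OF trivial_limit_at_right_real] by blast
 have "\<bar>om t u-om t v\<bar> <= d" if "t \<in> {0..T}" "u \<in> {0..K}" "v \<in> {0..K}" "\<bar>u-v\<bar> <= dl" for t u v
 proof -
  have "dist (t, u) (t, v) < dl1" using that(4) dl(2) by (simp add: dist_prod_def dist_real_def)
  hence "dist ((%(t, u). om t u) (t, u)) ((%(t, u). om t u) (t, v)) < d"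
   using dl1(2)[rule_format, of "(t, v)" "(t, u)"] that by simp
  thus ?thesis by (simp add: dist_real_def)
 qed
 thus ?thesis using dl by (intro exI[of _ dl]) auto
qed

text \<open>The Harnack inequality gives an equicontinuity of \<open>zeta\<close> in space that is
  uniform in N, with no probabilistic input beyond the bound on \<open>hz\<close>.\<close>

lemma dev_oscillation:
 assumes N: "N >= 1" "- real N * ln (epsN N) <= Lam" and xi: "xi \<in> space (M N)" and t: "0 <= t"
  and B: "hz (epsN N) (X N t xi) 1 <= B" and uv: "0 <= u" "0 <= v" "\<bar>u-v\<bar> <= dl"
  and d: "(exp (Lam * dl)-1) * B <= d" "\<bar>om t u-om t v\<bar> <= d"
 shows "\<bar>dev N xi t u-dev N xi t v\<bar> <= 2 * d"
proof -
 have e: "0 < epsN N" "epsN N <= 1" using epsN_pos[OF N(1)] epsN_lt_1[OF N(1)] by auto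
 have chi: "X N t xi \<in> chiR" by (rule chi_path[OF N(1) t xi])
 have dl: "0 <= dl" using uv by linarith
 have z0: "zeta N (epsN N) (X N t xi) 0 = hz (epsN N) (X N t xi) 1" by (rule zeta_zero[OF chi N(1) e(1)])
 have "1 <= zeta N (epsN N) (X N t xi) 0" by (rule zeta_harnack(1)[OF chi N(1) order_refl order_refl e])
 hence B0: "0 <= B" using B unfolding z0 by linarith
 have "- real N * ln (epsN N) * dl <= Lam * dl" by (rule mult_right_mono[OF N(2) dl])
 hence ex: "exp (- real N * ln (epsN N) * dl)-1 <= exp (Lam * dl)-1" by simp
 have L0: "0 <= exp (Lam * dl)-1" using dl beta_pos by simp
 have "\<bar>zeta N (epsN N) (X N t xi) u-zeta N (epsN N) (X N t xi) v\<bar> <= (exp (- real N * ln (epsN N) * dl)-1) * zeta N (epsN N) (X N t xi) 0"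
  by (rule zeta_diff_bound[OF chi N(1) uv e])
 also have "... <= (exp (Lam * dl)-1) * B"
  by (rule mult_mono[OF ex _ L0]) (use B z0 hz_ge_1[of "epsN N"] \<open>1 <= zeta N (epsN N) (X N t xi) 0\<close> in simp_all)
 finally have "\<bar>zeta N (epsN N) (X N t xi) u-zeta N (epsN N) (X N t xi) v\<bar> <= d" using d(1) by linarith
 thus ?thesis using d(2) unfolding dev_def by linarith
qed

lemma eventually_Lam: "\<forall>\<^sub>F N in sequentially. N >= 1 &-real N * ln (epsN N) <= Lam"
proof -
 obtain N0 where N0: "N0 >= 1" "ALL N>=N0.-real N * ln (epsN N) <= Lam & real N*(1/epsN N-1) <= Lam & 1/epsN N <= 2"
  using epsN_bounds by (elim exE conjE) (rule that)
 show ?thesis by (rule eventually_sequentiallyI[of N0]) (use N0 in auto)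
qed

lemma initial_pairing:
 assumes f: "csupp f" and e: "0 < e"
 shows "prob_event M (%N xi. \<bar>wpair f (dev N xi 0)\<bar> <= e)"
proof -
 obtain K where K: "ALL u. \<bar>u\<bar> >= K --> f u = 0" using f by (auto simp: csupp_def)
 define L where "L = (LBINT u. \<bar>exp (beta * u/2) * f u\<bar>)"
 have L: "0 <= L" unfolding L_def by (rule Bochner_Integration.integral_nonneg) simp
 define d where "d = e/(3*(L+1))"
 have d: "0 < d" using e L by (simp add: d_def add_nonneg_pos)
 have d3: "3 * d * L <= e"
 proof -
  have "3*(L+1) ~= 0" using L by simp
  moreover have "e/q * q = e" if "q ~= 0" for q using that by simp
  ultimately have "d*(3*(L+1)) = e" unfolding d_def by blast
  hence "3 * d*(L+1) = e" by (simp only: mult_ac)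
  moreover have "3 * d * L <= 3 * d*(L+1)" using d by (intro mult_left_mono) simp_all
  ultimately show ?thesis by linarith
 qed
 define B where "B = w0 \<rho>0 0+1"
 have B: "0 < B" by (simp add: B_def w0_def add_pos_pos)
 obtain dl where dl: "dl > 0" "(exp (Lam * dl)-1) * B <= d"
  "ALL t:{0..1}. ALL u:{0..K}. ALL v:{0..K}. \<bar>u-v\<bar> <= dl --> \<bar>om t u-om t v\<bar> <= d"
  \<comment> \<open>The time horizon 1 is arbitrary; only time 0 is of interest here.\<close>
  using oscillation[OF zero_less_one d B, of K] by (elim exE conjE) (rule that)
 let ?J = "{..nat \<lceil>K/dl\<rceil>}"
 have ev: "prob_event M (%N xi. (ALL j:?J. \<bar>zeta N (epsN N) (X N 0 xi) (real j * dl)-w0 \<rho>0 (real j * dl)\<bar> <= d) & hz (epsN N) (X N 0 xi) 1 <= B)"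
  unfolding B_def by (intro prob_event_conj prob_event_finite_ball initial_zeta initial_bounded d) (use dl(1) in simp_all)
 show ?thesis
 proof (rule prob_event_mono[OF ev])
  show "\<forall>\<^sub>F N in sequentially. ALL xi:space (M N). (ALL j:?J. \<bar>zeta N (epsN N) (X N 0 xi) (real j * dl)-w0 \<rho>0 (real j * dl)\<bar> <= d) & hz (epsN N) (X N 0 xi) 1 <= B
   --> \<bar>wpair f (dev N xi 0)\<bar> <= e"
   using eventually_Lam
  proof eventually_elim
   case (elim N)
   show ?case
   proof (rule ballI, rule impI, elim conjE)
    fix xi assume xi: "xi \<in> space (M N)" and net: "ALL j:?J. \<bar>zeta N (epsN N) (X N 0 xi) (real j * dl)-w0 \<rho>0 (real j * dl)\<bar> <= d"
     and h: "hz (epsN N) (X N 0 xi) 1 <= B"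
    have "\<bar>dev N xi 0 u\<bar> <= 3 * d" if u: "0 <= u" "f u ~= 0" for u
    proof -
     have uK: "u <= K" using K[rule_format, of u] u by force
     obtain j where j: "j <= nat \<lceil>K/dl\<rceil>" "real j * dl <= u" "u-real j * dl <= dl" by (rule grid_point[OF dl(1) u(1) uK])
     have j0: "0 <= real j * dl" using dl(1) by simp
     have "\<bar>om 0 u-om 0 (real j * dl)\<bar> <= d" using dl(3)[rule_format, of 0 u "real j * dl"] u uK j j0 by simp
     hence "\<bar>dev N xi 0 u-dev N xi 0 (real j * dl)\<bar> <= 2 * d"
      by (intro dev_oscillation[OF conjunct1[OF elim] conjunct2[OF elim] xi order_refl h u(1) j0 _ dl(2)]) (use j in simp_all)
     moreover have "\<bar>dev N xi 0 (real j * dl)\<bar> <= d" using net j(1) heat.omega_init[OF j0] by (simp add: dev_def)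
     ultimately show ?thesis by linarith
    qed
    hence "\<bar>wpair f (dev N xi 0)\<bar> <= 3 * d * L" unfolding L_def by (intro wpair_bound[OF f]) (use d in simp_all)
    thus "\<bar>wpair f (dev N xi 0)\<bar> <= e" using d3 by linarith
   qed
  qed
 qed
qed

lemma defect_event:
 assumes g: "evt g g''" and T: "0 < T" and dl: "0 < dl" and bd: "prob_event M (%N xi. ALL t:{0..T}. hz (epsN N) (X N t xi) 1 <= B)"
 shows "prob_event M (%N xi. ALL t:{0..T}. \<bar>defect g g'' (dev N xi) t\<bar> <= dl)"
proof -
 obtain k' k'' where k: "test_fun beta (%u. exp (beta * u/2) * g u) k' k''"
  "!!u. k'' u-beta * k' u = exp (beta * u/2)*(- cB * g u+g'' u)" by (rule evt_test_fun[OF g]) blast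
 have cs: "csupp g" "csupp g''" using g by (simp_all add: evt_def)
 note ev = prob_event_conj[OF bd weak_form_event[OF process initial_bounded k(1) T dl]]
 show ?thesis
 proof (rule prob_event_mono[OF ev], use eventually_ge_at_top[of 1] in eventually_elim)
  case (elim N)
  show ?case
  proof (rule ballI, rule impI, rule ballI, elim conjE)
   fix xi t assume xi: "xi \<in> space (M N)" and t: "t \<in> {0..T}" and h: "ALL t:{0..T}. hz (epsN N) (X N t xi) 1 <= B"
    and wf: "ALL t:{0..T}. \<bar>pairing N (%u. exp (beta * u/2) * g u) (X N t xi)-pairing N (%u. exp (beta * u/2) * g u) (X N 0 xi)
    -(LBINT s:{0..t}. pairing N (%u. k'' u-beta * k' u) (X N s xi))\<bar> <= dl"
   have "defect g g'' (dev N xi) t = defect g g'' (%t. zeta N (epsN N) (X N t xi)) t-defect g g'' om t"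
    unfolding dev_def[abs_def]
    by (rule defect_diff[OF zeta_admissible[OF elim xi] om_admissible cs t]) (use h in blast)
   also have "defect g g'' om t = 0" by (rule weak_sol_defect[OF om_weak_sol g]) (use t in simp)
   finally have "defect g g'' (dev N xi) t = defect g g'' (%t. zeta N (epsN N) (X N t xi)) t" by simp
   moreover have "\<bar>defect g g'' (%t. zeta N (epsN N) (X N t xi)) t\<bar> <= dl"
    using bspec[OF wf t] unfolding defect_def wpair_def pairing_def k(2) .
   ultimately show "\<bar>defect g g'' (dev N xi) t\<bar> <= dl" by (simp only:)
  qed
 qed
qed

text \<open>The stability estimate asks for finitely many initial pairings and defects to be small;
  each is an event of probability tending to one.\<close>

lemma pairing_event:
 assumes f: "jet f" and T: "0 < T" and e: "0 < e" and B: "0 < B"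
  and bd: "prob_event M (%N xi. ALL t:{0..T}. hz (epsN N) (X N t xi) 1 <= B)"
 shows "prob_event M (%N xi. ALL t:{0..T}. \<bar>wpair (f 0) (dev N xi t)\<bar> <= e)"
proof -
 define C where "C = B+2 * w0 \<rho>0 0"
 have C: "0 <= C" using B by (simp add: C_def w0_def add_nonneg_nonneg)
 obtain S dl where S: "finite S" "ALL (g, g''):S. evt g g''" and dl: "dl > 0" and est: "ALL W. admissible W T C -->
  (ALL (g, g''):S. \<bar>wpair g (W 0)\<bar> <= dl & (ALL t:{0..T}. \<bar>defect g g'' W t\<bar> <= dl)) --> (ALL t:{0..T}. \<bar>wpair (f 0) (W t)\<bar> <= e)"
  using duality_estimate[OF f T C e] by (elim exE conjE) (rule that)
 have "prob_event M (%N xi. ALL p:S. \<bar>wpair (fst p) (dev N xi 0)\<bar> <= dl & (ALL t:{0..T}. \<bar>defect (fst p) (snd p) (dev N xi) t\<bar> <= dl))"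
 proof (rule prob_event_finite_ball[OF S(1)])
  fix p assume "p \<in> S"
  hence e: "evt (fst p) (snd p)" using S(2) by (auto simp: case_prod_beta)
  hence c: "csupp (fst p)" by (simp add: evt_def)
  show "prob_event M (%N xi. \<bar>wpair (fst p) (dev N xi 0)\<bar> <= dl & (ALL t:{0..T}. \<bar>defect (fst p) (snd p) (dev N xi) t\<bar> <= dl))"
   by (rule prob_event_conj[OF initial_pairing[OF c dl] defect_event[OF e T dl bd]])
 qed
 from prob_event_conj[OF bd this] show ?thesis
 proof (rule prob_event_mono, use eventually_ge_at_top[of 1] in eventually_elim)
  case (elim N)
  show ?case
  proof (rule ballI, rule impI, elim conjE)
   fix xi assume xi: "xi \<in> space (M N)" and h: "ALL t:{0..T}. hz (epsN N) (X N t xi) 1 <= B"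
    and s: "ALL p:S. \<bar>wpair (fst p) (dev N xi 0)\<bar> <= dl & (ALL t:{0..T}. \<bar>defect (fst p) (snd p) (dev N xi) t\<bar> <= dl)"
   have "admissible (dev N xi) T C" unfolding C_def dev_def[abs_def]
    by (rule admissible_diff[OF zeta_admissible[OF elim xi] om_admissible]) (use h in blast)
   moreover have "ALL (g, g''):S. \<bar>wpair g (dev N xi 0)\<bar> <= dl & (ALL t:{0..T}. \<bar>defect g g'' (dev N xi) t\<bar> <= dl)"
    using s unfolding case_prod_beta .
   ultimately show "ALL t:{0..T}. \<bar>wpair (f 0) (dev N xi t)\<bar> <= e" using spec[OF est, of "dev N xi"] by blast
  qed
 qed
qed

text \<open>Uniformity in time comes from the pairings, uniformity in space from finitely many bumps
  and the oscillation bound.\<close>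

lemma uniform_event:
 assumes T: "0 < T" and e: "0 < e"
 shows "prob_event M (%N xi. ALL t:{0..T}. ALL u:{0..K}. \<bar>dev N xi t u\<bar> <= e)"
proof -
 obtain B where B: "0 < B" and bd: "prob_event M (%N xi. ALL t:{0..T}. hz (epsN N) (X N t xi) 1 <= B)"
  using zeta_bounded_event[OF process initial_bounded T] by (elim exE conjE) (rule that)
 \<comment> \<open>d from the pairing, 2 d for the oscillation across the bump, 2 d from the grid
   point to u.\<close>
 define d where "d = e/5"
 have d: "0 < d" using e by (simp add: d_def)
 \<comment> \<open>dl < 1 keeps bumps centred in {0..K} inside {0..K+1}, where the modulus of the
   solution is taken.\<close>
 obtain dl where dl: "dl > 0" "dl < 1" "(exp (Lam * dl)-1) * B <= d"
  "ALL t:{0..T}. ALL u:{0..K+1}. ALL v:{0..K+1}. \<bar>u-v\<bar> <= dl --> \<bar>om t u-om t v\<bar> <= d"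
  using oscillation[OF T d B, of "K+1"] by (elim exE conjE) (rule that)
 let ?J = "{..nat \<lceil>K/dl\<rceil>}"
 define f where "f = (%c u. bump c dl 1 u+bump c dl 1 (- u))"
 define I where "I = (%c. LBINT u. indicator {0..} u*(exp (beta * u/2) * f c u))"
 have I: "0 < I c" if "0 <= c" for c unfolding I_def f_def by (rule bump_mass(1)[OF dl(1) that])
 have "prob_event M (%N xi. ALL j:?J. ALL t:{0..T}. \<bar>wpair (f (real j * dl)) (dev N xi t)\<bar> <= d * I (real j * dl))"
 proof (rule prob_event_finite_ball)
  fix j assume "j \<in> ?J"
  obtain F where F: "jet F" "F 0 = f (real j * dl)" using bump_jet[OF dl(1), of 1 "real j * dl"] unfolding f_def by auto
  have "0 < d * I (real j * dl)" using d I[of "real j * dl"] dl(1) by simp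
  from pairing_event[OF F(1) T this B bd]
  show "prob_event M (%N xi. ALL t:{0..T}. \<bar>wpair (f (real j * dl)) (dev N xi t)\<bar> <= d * I (real j * dl))" unfolding F(2) .
 qed simp
 from prob_event_conj[OF bd this] show ?thesis
 proof (rule prob_event_mono, use eventually_Lam in eventually_elim)
  case (elim N)
  show ?case
  proof (rule ballI, rule impI, intro ballI, elim conjE)
   fix xi t u assume xi: "xi \<in> space (M N)" and t: "t \<in> {0..T}" and u: "u \<in> {0..K}"
    and h: "ALL t:{0..T}. hz (epsN N) (X N t xi) 1 <= B"
    and net: "ALL j:?J. ALL t:{0..T}. \<bar>wpair (f (real j * dl)) (dev N xi t)\<bar> <= d * I (real j * dl)"
   have u01: "0 <= u" "u <= K" using u by simp_all
   have t0: "0 <= t" using t by simp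
   obtain j where j: "j <= nat \<lceil>K/dl\<rceil>" "real j * dl <= u" "u-real j * dl <= dl" by (rule grid_point[OF dl(1) u01])
   define c where "c = real j * dl"
   have c: "0 <= c" "c <= u" "u-c <= dl" using j dl(1) by (simp_all add: c_def)
   have osc: "\<bar>dev N xi t v-dev N xi t c\<bar> <= 2 * d" if v: "0 <= v" "\<bar>v-c\<bar> <= dl" for v
   proof (rule dev_oscillation[OF conjunct1[OF elim] conjunct2[OF elim] xi t0 bspec[OF h t] v(1) c(1) v(2) dl(3)])
    have "v \<in> {0..K+1}" "c \<in> {0..K+1}" using v c u01 dl(2) by auto
    thus "\<bar>om t v-om t c\<bar> <= d" using dl(4) t v(2) by blast
   qed
   have ad: "admissible (dev N xi) T (B+2 * w0 \<rho>0 0)" unfolding dev_def[abs_def]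
    by (rule admissible_diff[OF zeta_admissible[OF conjunct1[OF elim] xi] om_admissible]) (use h in blast)
   have m: "hmeas (dev N xi t)" "!!u. 0 <= u ==> \<bar>dev N xi t u\<bar> <= B+2 * w0 \<rho>0 0"
    using ad t unfolding admissible_def by blast+
   have "\<bar>wpair (f c) (dev N xi t)\<bar> <= d * I c" using net j(1) t unfolding c_def by blast
   hence "\<bar>dev N xi t c\<bar> <= d+2 * d" unfolding f_def I_def
    by (intro value_from_bump[OF dl(1) c(1) m osc])
   moreover have "\<bar>dev N xi t u-dev N xi t c\<bar> <= 2 * d" by (rule osc) (use u01 c in simp_all)
   ultimately have "\<bar>dev N xi t u\<bar> <= 5 * d" by linarith
   thus "\<bar>dev N xi t u\<bar> <= e" by (simp add: d_def)
  qed
 qed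
qed

end

theorem theorem5p2:
  fixes \<nu> :: "nat \<Rightarrow> nat set pmf" and \<rho>0 :: "real \<Rightarrow> real"
    and M :: "nat \<Rightarrow> 'w measure" and X :: "nat \<Rightarrow> real \<Rightarrow> 'w \<Rightarrow> nat set"
  assumes nu_supp: "\<forall>N. set_pmf (\<nu> N) \<subseteq> chiR"
    and rho_cont: "continuous_on {0..} \<rho>0"
    and rho_range: "\<forall>v\<ge>0. 0 \<le> \<rho>0 v \<and> \<rho>0 v \<le> 1"
    and rho_int: "set_integrable lborel {0..} \<rho>0"
    and profile: "\<forall>\<delta>>0. \<forall>g K. continuous_on {0..} g \<and> bounded (g ` {0..}) \<and> K > 0
                      \<and> (\<forall>v\<ge>K. g v = g K) \<longrightarrow>
        (\<lambda>N. measure_pmf.prob (\<nu> N)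
               {\<eta>. \<bar>emp N \<eta> g - (LBINT v:{0..}. g v * \<rho>0 v)\<bar> > \<delta>}) \<longlonglongrightarrow> 0"
    and process: "\<forall>N\<ge>1. solves_MP (M N) (X N)
                      (\<lambda>f \<eta>. (real N)^2 * genR (epsN N) f \<eta>) (\<nu> N)"
  shows "\<exists>\<omega>. weak_sol beta (w0 \<rho>0) \<omega> \<and>
           (\<forall>\<omega>'. weak_sol beta (w0 \<rho>0) \<omega>' \<longrightarrow>
              (\<forall>t\<ge>0. AE u in lborel. u \<ge> 0 \<longrightarrow> \<omega>' t u = \<omega> t u)) \<and>
           (\<forall>T>0. \<forall>K>0. \<forall>\<delta>>0.
              (\<lambda>N. outer_prob (M N)
                 {\<xi>\<in>space (M N). \<exists>t\<in>{0..T}. \<exists>u\<in>{0..K}.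
                     \<bar>zeta N (epsN N) (X N t \<xi>) u - \<omega> t u\<bar> > \<delta>}) \<longlonglongrightarrow> 0)"
proof -
 interpret profile_limit \<nu> \<rho>0 M X
 proof
  show "!!v. 0 <= v ==> 0 <= \<rho>0 v & \<rho>0 v <= 1" using rho_range by blast
  show "(%N. measure_pmf.prob (\<nu> N) {eta. \<bar>emp N eta g-(LBINT v:{0..}. g v * \<rho>0 v)\<bar> > dl}) \<longlonglongrightarrow> 0"
   if "dl > 0" "continuous_on {0..} g" "bounded (g ` {0..})" "K > 0" "ALL v>=K. g v = g K" for dl g K
   using profile that by blast
 qed (rule rho_int, rule process)
 show ?thesis
 proof (intro exI[of _ om] conjI allI impI, rule om_weak_sol)
  show "AE u in lborel. u >= 0 --> w t u = om t u" if "weak_sol beta (w0 \<rho>0) w" "0 <= t" for w t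
   by (rule weak_sol_unique[OF that(1) om_weak_sol that(2)])
  fix T K dl :: real assume "0 < T" "0 < K" "0 < dl"
  hence "(%N. outer_prob (M N) {xi\<in>space (M N). \<not> (ALL t:{0..T}. ALL u:{0..K}. \<bar>dev N xi t u\<bar> <= dl)}) \<longlonglongrightarrow> 0"
   by (intro prob_event_outer uniform_event)
  thus "(%N. outer_prob (M N) {xi\<in>space (M N). EX t:{0..T}. EX u:{0..K}. \<bar>zeta N (epsN N) (X N t xi) u-om t u\<bar> > dl}) \<longlonglongrightarrow> 0"
   by (simp add: dev_def not_le)
 qed
qed

end
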